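(* Let $\omega>0$. Each of the following conditions is equivalent to the statement that $\Theta_\omega(z)$ is a meromorphic inner function in $\mathbb{C}^+$: (1) $\widehat{\Theta}_\omega f=h_\omega\ast f$ for every $f\in L^2((1,\infty),dx)$, where $(h_\omega\ast f)(x)=\int_0^\infty h_\omega(x/y)f(y)\,\frac{dy}{y}$; (2) $\widehat{\Theta}_\omega f$ vanishes (almost everywhere) on $(0,1)$ for every $f\in L^2((1,\infty),dx)$; (3) $h_\omega\ast f$ belongs to $L^2((0,\infty),dx)$ for every $f\in L^2((1,\infty),dx)$.
   Context: $\xi(s)=\frac12 s(s-1)\pi^{-s/2}\Gamma(s/2)\zeta(s)$ is the Riemann xi-function, and for $\omega>0$, $\Theta_\omega(z)=\xi(\tfrac12-\omega-iz)/\xi(\tfrac12+\omega-iz)$; it is meromorphic on $\mathbb{C}$ and satisfies $|\Theta_\omega(u)|=1$ for $u\in\mathbb{R}$. $\mathbb{C}^+=\{\Im z>0\}$; a meromorphic inner function in $\mathbb{C}^+$ is a function meromorphic on $\mathbb{C}$ which is bounded and analytic in $\mathbb{C}^+$ with $\lim_{v\to0^+}|\Theta(u+iv)|=1$ for a.e. real $u$. The shifted Fourier (Mellin) transform $\mathsf{F}_{1/2}:L^2((0,\infty),dx)\to L^2(\mathbb{R})$, $(\mathsf{F}_{1/2}f)(z)=\int_0^\infty f(x)x^{\frac12+iz}\frac{dx}{x}$ (in the $L^2$ sense), is an isometry up to a constant factor with inverse $(\mathsf{F}_{1/2}^{-1}g)(x)=\frac1{2\pi}\int_{-\infty}^\infty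 g(u)x^{-\frac12-iu}du$. Let $\widehat{\Theta}_\omega=\mathsf{F}_{1/2}^{-1}\Theta_\omega\mathsf{F}_{1/2}$ on $L^2((0,\infty),dx)$, where $\Theta_\omega$ acts by multiplication by $\Theta_\omega(u)$ on $L^2(\mathbb{R})$. For $n\in\mathbb{N}$, $c_\omega(n)=n^{\omega}\sum_{d\mid n}\mu(d)d^{-2\omega}$; $g_\omega(x)=\frac{2\pi^\omega}{\Gamma(\omega)}\big(x^{2-\omega}(1-x^2)^{\omega-1}-\omega x^{\omega-1}\int_{x^2}^1 t^{\frac12-\omega}(1-t)^{\omega-1}dt\big)$ for $0<x<1$, $g_\omega(x)=0$ for $x>1$; and $h_\omega(x)=\frac1x\sum_{n=1}^{\lfloor x\rfloor}c_\omega(n)g_\omega(n/x)$ for $x>1$, $h_\omega(x)=0$ for $0<x<1$. *)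

theory Defs
  imports "HOL-Analysis.Analysis" "HOL-Complex_Analysis.Complex_Analysis"
    "HOL-Computational_Algebra.Computational_Algebra"
begin

(* Riemann xi function: the entire function which for Re s > 1 equals
   1/2 s (s-1) pi^(-s/2) Gamma(s/2) zeta(s), zeta(s) = sum_{n>=1} n^(-s).
   (Its existence is the classical analytic continuation; by the identity
   theorem it is unique.) *)
definition riemann_xi :: "complex \<Rightarrow> complex" where
  "riemann_xi = (SOME F. F holomorphic_on UNIV \<and>
     (\<forall>s. 1 < Re s \<longrightarrow>
        F s = 1/2 * s * (s - 1) * (of_real pi) powr (- s / 2) * Gamma (s / 2)
              * (\<Sum>n. 1 / (of_nat (Suc n)) powr s)))"

definition Theta :: "real \<Rightarrow> complex \<Rightarrow> complex" where
  "Theta \<omega> z = riemann_xi (1/2 - of_real \<omega> - \<i> * z) / riemann_xi (1/2 + of_real \<omega> - \<i> * z)"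

definition meromorphic_inner :: "(complex \<Rightarrow> complex) \<Rightarrow> bool" where
  "meromorphic_inner \<Theta> \<longleftrightarrow>
     \<Theta> meromorphic_on UNIV \<and>
     remove_sings \<Theta> analytic_on {z. 0 < Im z} \<and>
     bounded (remove_sings \<Theta> ` {z. 0 < Im z}) \<and>
     (AE u in lborel. ((\<lambda>v. cmod (remove_sings \<Theta> (complex_of_real u + \<i> * complex_of_real v)))
                         \<longlongrightarrow> 1) (at_right 0))"

definition L2_on :: "real set \<Rightarrow> (real \<Rightarrow> complex) \<Rightarrow> bool" where
  "L2_on A f \<longleftrightarrow> set_borel_measurable lborel A f \<and>
                   set_integrable lborel A (\<lambda>x. (cmod (f x))\<^sup>2)"

definition mellin_L2 :: "(real \<Rightarrow> complex) \<Rightarrow> (real \<Rightarrow> complex) \<Rightarrow> bool" where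
  "mellin_L2 f g \<longleftrightarrow> L2_on {0<..} f \<and> L2_on UNIV g \<and>
     ((\<lambda>R. \<integral>u. (cmod (g u - (\<integral>x\<in>{1/R..R}. f x * (of_real x) powr (1/2 + \<i> * of_real u) / of_real x \<partial>lborel)))\<^sup>2 \<partial>lborel)
        \<longlongrightarrow> 0) at_top"

definition mellin_inv_L2 :: "(real \<Rightarrow> complex) \<Rightarrow> (real \<Rightarrow> complex) \<Rightarrow> bool" where
  "mellin_inv_L2 g f \<longleftrightarrow> L2_on UNIV g \<and> L2_on {0<..} f \<and>
     ((\<lambda>R. \<integral>x\<in>{0<..}. (cmod (f x - 1 / (2 * of_real pi) *
            (\<integral>u\<in>{-R..R}. g u * (of_real x) powr (- 1/2 - \<i> * of_real u) \<partial>lborel)))\<^sup>2 \<partial>lborel)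
        \<longlongrightarrow> 0) at_top"

definition mellin :: "(real \<Rightarrow> complex) \<Rightarrow> real \<Rightarrow> complex" where
  "mellin f = (SOME g. mellin_L2 f g)"

definition mellin_inv :: "(real \<Rightarrow> complex) \<Rightarrow> real \<Rightarrow> complex" where
  "mellin_inv g = (SOME f. mellin_inv_L2 g f)"

definition Theta_hat :: "real \<Rightarrow> (real \<Rightarrow> complex) \<Rightarrow> real \<Rightarrow> complex" where
  "Theta_hat \<omega> f = mellin_inv (\<lambda>u. Theta \<omega> (of_real u) * mellin f u)"

definition mu :: "nat \<Rightarrow> int" where
  "mu d = (if squarefree d then (-1) ^ card (prime_factors d) else 0)"

definition c_coef :: "real \<Rightarrow> nat \<Rightarrow> real" where
  "c_coef \<omega> n = real n powr \<omega> * (\<Sum>d | d dvd n. real_of_int (mu d) * real d powr (- 2 * \<omega>))"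

definition g_fun :: "real \<Rightarrow> real \<Rightarrow> real" where
  "g_fun \<omega> x = (if 0 < x \<and> x < 1 then
      2 * pi powr \<omega> / Gamma \<omega> *
        (x powr (2 - \<omega>) * (1 - x\<^sup>2) powr (\<omega> - 1)
         - \<omega> * x powr (\<omega> - 1) *
             (\<integral>t\<in>{x\<^sup>2..1}. t powr (1/2 - \<omega>) * (1 - t) powr (\<omega> - 1) \<partial>lborel))
     else 0)"

definition h_fun :: "real \<Rightarrow> real \<Rightarrow> real" where
  "h_fun \<omega> x = (if 1 < x then (1 / x) * (\<Sum>n = 1..nat \<lfloor>x\<rfloor>. c_coef \<omega> n * g_fun \<omega> (real n / x)) else 0)"

definition mconv :: "(real \<Rightarrow> real) \<Rightarrow> (real \<Rightarrow> complex) \<Rightarrow> real \<Rightarrow> complex" where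
  "mconv h f x = (\<integral>y\<in>{0<..}. of_real (h (x / y)) * f y / of_real y \<partial>lborel)"

end

(* Under x = e^t the Mellin transform becomes the Fourier transform on the real line, and h_omega
   becomes a function e supported on t > 0 whose Fourier-Laplace transform equals Theta_omega high up
   in the upper half plane: the coefficients c_omega give zeta(s - omega) / zeta(s + omega), and g_omega
   gives the quotient of the gamma factors. The functional equation makes Theta_omega unimodular on the
   real line. If Theta_omega is inner, shifting the contour from the real line upwards identifies
   multiplication by Theta_omega with convolution by e; since e is supported on t > 0, this gives (1),
   and (1) implies (2) and (3).
   Conversely, each of (2) and (3) is applied to the single function f(x) = x^(-3/2) on (1, oo), which
   corresponds to e^(-t) on t > 0 with transform 1 / (1 - i z). It yields a square-integrable k supported
   on t > 0 with Theta_omega(z) = (1 - i z) * (Laplace transform of k), first high up or on the real line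
   and then in the whole half plane. So Theta_omega is analytic there with growth at most polynomial in
   |z| and 1 / Im z, and Phragmen-Lindeloef with the unimodular boundary values gives |Theta_omega| <= 1. *)
theory Submission
  imports Defs "HOL-Probability.Probability"
begin

section \<open>Square-integrable functions\<close>

text \<open>\<open>riemann_xi\<close> is a choice, so nothing is known about it before
  \<open>xi_rep\<close>, built from Riemann's theta integral, exhibits an entire function with the
  required property. This rests on the inversion of \<open>psi\<close>, that is, on Poisson
  summation for the Gaussian. Three obstacles shape the rest. The zeros of \<open>xi_den\<close> are
  unknown, so identities for the quotient are stated as products A = B * S and only then moved to
  \<open>remove_sings\<close>. \<open>mellin\<close> and \<open>mellin_inv\<close> are choices too,
  fixed only up to null sets, so the work is done with the relation \<open>is_FT\<close>. Condition
  (2) speaks of the real line only in mean square, without pointwise boundary values of the Laplace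
  transform; a primitive that is continuous up to the line replaces them. The transform 1 / (1 - i
  z) of the test function has neither zero nor pole in the upper half plane, so it can be divided
  out everywhere. Towards (1), \<open>h_fun\<close> is integrable only after exponential damping, so
  the convolution is recognised high up and compared with the real line by pairing with indicators
  of intervals.\<close>

definition L2 :: "(real \<Rightarrow> complex) \<Rightarrow> bool" where
  "L2 f \<longleftrightarrow> f \<in> borel_measurable borel \<and> integrable lborel (\<lambda>x. (cmod (f x))\<^sup>2)"

definition nsq :: "(real \<Rightarrow> complex) \<Rightarrow> real" where
  "nsq f = (\<integral>x. (cmod (f x))\<^sup>2 \<partial>lborel)"

definition ip :: "(real \<Rightarrow> complex) \<Rightarrow> (real \<Rightarrow> complex) \<Rightarrow> complex" where
  "ip f g = (\<integral>x. f x * cnj (g x) \<partial>lborel)"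

lemma L2_measurable: "L2 f \<Longrightarrow> f \<in> borel_measurable borel"
  and L2_integrable: "L2 f \<Longrightarrow> integrable lborel (\<lambda>x. (cmod (f x))\<^sup>2)"
  by (auto simp: L2_def)

lemma L2_bound:
  assumes "L2 g" "f \<in> borel_measurable borel" "AE x in lborel. cmod (f x) \<le> C * cmod (g x)"
  shows "L2 f"
proof -
  have "integrable lborel (\<lambda>x. C\<^sup>2 * (cmod (g x))\<^sup>2)"
    using assms(1) by (auto simp: L2_def)
  moreover have "AE x in lborel. norm ((cmod (f x))\<^sup>2) \<le> norm (C\<^sup>2 * (cmod (g x))\<^sup>2)"
    using assms(3)
  proof eventually_elim
    case (elim x)
    have "(cmod (f x))\<^sup>2 \<le> (C * cmod (g x))\<^sup>2" using elim by (intro power_mono) auto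
    then show ?case by (simp add: power_mult_distrib)
  qed
  ultimately have "integrable lborel (\<lambda>x. (cmod (f x))\<^sup>2)"
    using assms(2) by (elim Bochner_Integration.integrable_bound) auto
  then show ?thesis using assms(2) by (simp add: L2_def)
qed

lemma L2_add:
  assumes "L2 f" "L2 g" shows "L2 (\<lambda>x. f x + g x)"
proof -
  have [measurable]: "f \<in> borel_measurable borel" "g \<in> borel_measurable borel"
    using assms by (auto simp: L2_def)
  have "integrable lborel (\<lambda>x. 2 * (cmod (f x))\<^sup>2 + 2 * (cmod (g x))\<^sup>2)"
    using assms by (auto simp: L2_def)
  moreover have "norm ((cmod (f x + g x))\<^sup>2) \<le> norm (2 * (cmod (f x))\<^sup>2 + 2 * (cmod (g x))\<^sup>2)" for x
  proof -
    have "(cmod (f x + g x))\<^sup>2 \<le> (cmod (f x) + cmod (g x))\<^sup>2"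
      by (intro power_mono norm_triangle_ineq) auto
    also have "\<dots> \<le> 2 * (cmod (f x))\<^sup>2 + 2 * (cmod (g x))\<^sup>2"
      using sum_squares_bound[of "cmod (f x)" "cmod (g x)"] by (simp add: power2_sum)
    finally show ?thesis by simp
  qed
  ultimately have "integrable lborel (\<lambda>x. (cmod (f x + g x))\<^sup>2)"
    by (elim Bochner_Integration.integrable_bound) auto
  then show ?thesis by (simp add: L2_def)
qed

lemma L2_cmult: "L2 f \<Longrightarrow> L2 (\<lambda>x. c * f x)"
  by (auto simp: L2_def norm_mult power_mult_distrib)

lemma L2_minus: "L2 f \<Longrightarrow> L2 (\<lambda>x. - f x)"
  by (auto simp: L2_def)

lemma L2_diff: "L2 f \<Longrightarrow> L2 g \<Longrightarrow> L2 (\<lambda>x. f x - g x)"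
  using L2_add[of f "\<lambda>x. - g x"] L2_minus[of g] by simp

lemma borel_measurable_cnj [measurable]:
  "f \<in> borel_measurable M \<Longrightarrow> (\<lambda>x. cnj (f x)) \<in> borel_measurable M"
  by (rule borel_measurable_continuous_on) (auto intro: continuous_intros)

lemma L2_cnj: "L2 f \<Longrightarrow> L2 (\<lambda>x. cnj (f x))"
  by (auto simp: L2_def)

lemma L2_indicator: "L2 f \<Longrightarrow> A \<in> sets borel \<Longrightarrow> L2 (\<lambda>x. indicator A x * f x)"
  by (rule L2_bound[where C=1 and g=f]) (auto simp: L2_def indicator_def)

lemma nsq_nonneg: "0 \<le> nsq f"
  by (simp add: nsq_def)

lemma nsq_mono:
  assumes "L2 g" "f \<in> borel_measurable borel" "AE x in lborel. cmod (f x) \<le> cmod (g x)"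
  shows "nsq f \<le> nsq g"
proof -
  have "L2 f" by (rule L2_bound[OF assms(1,2), where C=1]) (use assms(3) in simp)
  moreover have "AE x in lborel. (cmod (f x))\<^sup>2 \<le> (cmod (g x))\<^sup>2"
    using assms(3) by eventually_elim (intro power_mono, auto)
  ultimately show ?thesis
    unfolding nsq_def using assms(1) by (intro integral_mono_AE) (auto simp: L2_def)
qed

lemma nsq_cmult: "nsq (\<lambda>x. c * f x) = (cmod c)\<^sup>2 * nsq f"
  by (simp add: nsq_def norm_mult power_mult_distrib)

lemma nsq_minus_commute: "nsq (\<lambda>x. f x - g x) = nsq (\<lambda>x. g x - f x)"
  by (simp add: nsq_def norm_minus_commute)

lemma nn_nsq: "L2 f \<Longrightarrow> (\<integral>\<^sup>+x. ennreal ((cmod (f x))\<^sup>2) \<partial>lborel) = ennreal (nsq f)"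
  unfolding nsq_def by (rule nn_integral_eq_integral) (auto simp: L2_def)

lemma L2_iff_nn:
  assumes "f \<in> borel_measurable borel"
  shows "L2 f \<longleftrightarrow> (\<integral>\<^sup>+x. ennreal ((cmod (f x))\<^sup>2) \<partial>lborel) < \<infinity>"
  using assms by (simp add: L2_def integrable_iff_bounded)

lemma L2_prod_norm_integrable:
  assumes "L2 f" "L2 g" shows "integrable lborel (\<lambda>x. cmod (f x) * cmod (g x))"
proof -
  have [measurable]: "f \<in> borel_measurable borel" "g \<in> borel_measurable borel"
    using assms by (auto simp: L2_def)
  have "integrable lborel (\<lambda>x. (cmod (f x))\<^sup>2 + (cmod (g x))\<^sup>2)"
    using assms by (auto simp: L2_def)
  moreover have "norm (cmod (f x) * cmod (g x)) \<le> norm ((cmod (f x))\<^sup>2 + (cmod (g x))\<^sup>2)" for x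
  proof -
    have "0 \<le> cmod (f x) * cmod (g x)" by simp
    moreover have "2 * (cmod (f x) * cmod (g x)) \<le> (cmod (f x))\<^sup>2 + (cmod (g x))\<^sup>2"
      using sum_squares_bound[of "cmod (f x)" "cmod (g x)"] by (simp add: mult.assoc)
    ultimately show ?thesis by (simp only: real_norm_def)
  qed
  ultimately show ?thesis
    by (elim Bochner_Integration.integrable_bound) auto
qed

lemma L2_prod_integrable:
  assumes "L2 f" "L2 g" shows "integrable lborel (\<lambda>x. f x * g x)"
  by (rule Bochner_Integration.integrable_bound[OF L2_prod_norm_integrable[OF assms]])
     (use assms in \<open>auto simp: L2_def norm_mult\<close>)

lemma L2_prod_cnj_integrable:
  assumes "L2 f" "L2 g" shows "integrable lborel (\<lambda>x. f x * cnj (g x))"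
  using L2_prod_integrable[OF assms(1) L2_cnj[OF assms(2)]] .

lemma L2_Cauchy_Schwarz:
  assumes "L2 f" "L2 g"
  shows "(\<integral>x. cmod (f x) * cmod (g x) \<partial>lborel) \<le> sqrt (nsq f) * sqrt (nsq g)"
proof -
  have [measurable]: "f \<in> borel_measurable borel" "g \<in> borel_measurable borel"
    using assms by (auto simp: L2_def)
  let ?I = "\<integral>x. cmod (f x) * cmod (g x) \<partial>lborel"
  have "(\<integral>\<^sup>+x. ennreal (cmod (f x)) * ennreal (cmod (g x)) \<partial>lborel)\<^sup>2
     \<le> (\<integral>\<^sup>+x. (ennreal (cmod (f x)))\<^sup>2 \<partial>lborel) * (\<integral>\<^sup>+x. (ennreal (cmod (g x)))\<^sup>2 \<partial>lborel)"
    by (rule Cauchy_Schwarz_nn_integral) auto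
  also have "(\<integral>\<^sup>+x. (ennreal (cmod (f x)))\<^sup>2 \<partial>lborel) = ennreal (nsq f)"
    using nn_nsq[OF assms(1)] by (simp add: ennreal_power)
  also have "(\<integral>\<^sup>+x. (ennreal (cmod (g x)))\<^sup>2 \<partial>lborel) = ennreal (nsq g)"
    using nn_nsq[OF assms(2)] by (simp add: ennreal_power)
  also have "(\<integral>\<^sup>+x. ennreal (cmod (f x)) * ennreal (cmod (g x)) \<partial>lborel) = ennreal ?I"
    by (simp flip: ennreal_mult) (intro nn_integral_eq_integral L2_prod_norm_integrable assms; simp)
  finally have "?I\<^sup>2 \<le> nsq f * nsq g"
    by (simp add: ennreal_power nsq_nonneg flip: ennreal_mult)
  then show ?thesis
    by (metis real_le_rsqrt real_sqrt_mult)
qed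

lemma ip_bound:
  assumes "L2 f" "L2 g" shows "cmod (ip f g) \<le> sqrt (nsq f) * sqrt (nsq g)"
proof -
  have "cmod (ip f g) \<le> (\<integral>x. cmod (f x * cnj (g x)) \<partial>lborel)"
    unfolding ip_def by (rule integral_norm_bound)
  also have "\<dots> = (\<integral>x. cmod (f x) * cmod (g x) \<partial>lborel)" by (simp add: norm_mult)
  finally show ?thesis using L2_Cauchy_Schwarz[OF assms] by linarith
qed

lemma ip_self: "ip f f = of_real (nsq f)"
  unfolding ip_def nsq_def
  by (simp add: complex_norm_square[symmetric] flip: integral_complex_of_real of_real_power)

lemma ip_add_left: "L2 f \<Longrightarrow> L2 g \<Longrightarrow> L2 h \<Longrightarrow> ip (\<lambda>x. f x + g x) h = ip f h + ip g h"
  by (simp add: ip_def ring_distribs L2_prod_cnj_integrable)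
lemma ip_diff_left: "L2 f \<Longrightarrow> L2 g \<Longrightarrow> L2 h \<Longrightarrow> ip (\<lambda>x. f x - g x) h = ip f h - ip g h"
  by (simp add: ip_def ring_distribs L2_prod_cnj_integrable)
lemma ip_add_right: "L2 f \<Longrightarrow> L2 g \<Longrightarrow> L2 h \<Longrightarrow> ip h (\<lambda>x. f x + g x) = ip h f + ip h g"
  by (simp add: ip_def ring_distribs L2_prod_cnj_integrable)
lemma ip_diff_right: "L2 f \<Longrightarrow> L2 g \<Longrightarrow> L2 h \<Longrightarrow> ip h (\<lambda>x. f x - g x) = ip h f - ip h g"
  by (simp add: ip_def ring_distribs L2_prod_cnj_integrable)
lemma ip_cmult_left: "ip (\<lambda>x. c * f x) g = c * ip f g"
  by (simp add: ip_def mult.assoc)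
lemma ip_cmult_right: "ip g (\<lambda>x. c * f x) = cnj c * ip g f"
  by (simp add: ip_def mult.left_commute)
lemma ip_commute: "ip f g = cnj (ip g f)"
  unfolding ip_def by (subst Bochner_Integration.integral_cnj[symmetric]) (simp add: mult.commute)

lemma nsq_triangle:
  assumes "L2 f" "L2 g"
  shows "sqrt (nsq (\<lambda>x. f x + g x)) \<le> sqrt (nsq f) + sqrt (nsq g)"
proof -
  have "of_real (nsq (\<lambda>x. f x + g x)) = ip (\<lambda>x. f x + g x) (\<lambda>x. f x + g x)"
    by (simp add: ip_self)
  also have "\<dots> = ip f f + ip g g + (ip f g + ip g f)"
    using assms by (simp add: ip_add_left ip_add_right L2_add)
  finally have "Re (of_real (nsq (\<lambda>x. f x + g x))) = Re (ip f f + ip g g + (ip f g + ip g f))"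
    by simp
  then have "nsq (\<lambda>x. f x + g x) \<le> nsq f + nsq g + 2 * (sqrt (nsq f) * sqrt (nsq g))"
    using ip_bound[OF assms] ip_commute[of g f] complex_Re_le_cmod[of "ip f g"]
    by (simp add: ip_self)
  also have "\<dots> = (sqrt (nsq f) + sqrt (nsq g))\<^sup>2"
    by (simp add: power2_sum nsq_nonneg)
  finally show ?thesis
    by (simp add: real_le_lsqrt nsq_nonneg)
qed

lemma nsq_triangle_diff:
  assumes "L2 f" "L2 g" "L2 h"
  shows "sqrt (nsq (\<lambda>x. f x - h x)) \<le> sqrt (nsq (\<lambda>x. f x - g x)) + sqrt (nsq (\<lambda>x. g x - h x))"
  using nsq_triangle[of "\<lambda>x. f x - g x" "\<lambda>x. g x - h x"] assms by (simp add: L2_diff)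

lemma nsq_tendsto_AE0:
  assumes "L2 f" "nsq f = 0" shows "AE x in lborel. f x = 0"
proof -
  have "AE x in lborel. (cmod (f x))\<^sup>2 = 0"
    using assms by (subst integral_nonneg_eq_0_iff_AE[symmetric]) (auto simp: L2_def nsq_def)
  then show ?thesis by simp
qed

lemma nsq_AE_cong:
  assumes "AE x in lborel. f x = g x" "f \<in> borel_measurable borel" "g \<in> borel_measurable borel"
  shows "nsq f = nsq g"
proof -
  have "AE x in lborel. (cmod (f x))\<^sup>2 = (cmod (g x))\<^sup>2"
    using assms(1) by eventually_elim simp
  then show ?thesis unfolding nsq_def using assms(2,3) by (intro integral_cong_AE) auto
qed

lemma L2_AE_cong:
  assumes "L2 f" "AE x in lborel. f x = g x" "g \<in> borel_measurable borel"
  shows "L2 g"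
proof (rule L2_bound[where C=1 and g=f])
  show "AE x in lborel. cmod (g x) \<le> 1 * cmod (f x)"
    using assms(2) by eventually_elim simp
qed (use assms in auto)

lemma ip_tendsto:
  assumes "\<And>n. L2 (F n)" "L2 f" "L2 g" "((\<lambda>n. nsq (\<lambda>x. f x - F n x)) \<longlongrightarrow> 0) G"
  shows "((\<lambda>n. ip (F n) g) \<longlongrightarrow> ip f g) G"
proof -
  have "((\<lambda>n. sqrt (nsq (\<lambda>x. f x - F n x)) * sqrt (nsq g)) \<longlongrightarrow> sqrt 0 * sqrt (nsq g)) G"
    by (intro tendsto_intros assms)
  then have "((\<lambda>n. sqrt (nsq (\<lambda>x. f x - F n x)) * sqrt (nsq g)) \<longlongrightarrow> 0) G" by simp
  moreover have "norm (ip f g - ip (F n) g) \<le> sqrt (nsq (\<lambda>x. f x - F n x)) * sqrt (nsq g)" for n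
    using ip_bound[of "\<lambda>x. f x - F n x" g] assms(1)[of n] assms(2,3)
    by (simp add: ip_diff_left L2_diff)
  ultimately have "((\<lambda>n. ip f g - ip (F n) g) \<longlongrightarrow> 0) G"
    by (rule Lim_null_comparison[OF always_eventually[OF allI], rotated])
  then have "((\<lambda>n. ip f g - (ip f g - ip (F n) g)) \<longlongrightarrow> ip f g - 0) G"
    by (intro tendsto_intros)
  then show ?thesis by simp
qed

lemma nsq_tendsto:
  assumes "\<And>n. L2 (F n)" "L2 f" "((\<lambda>n. nsq (\<lambda>x. f x - F n x)) \<longlongrightarrow> 0) G"
  shows "((\<lambda>n. nsq (F n)) \<longlongrightarrow> nsq f) G"
proof -
  have *: "((\<lambda>n. sqrt (nsq (\<lambda>x. f x - F n x))) \<longlongrightarrow> 0) G"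
    using tendsto_real_sqrt[OF assms(3)] by simp
  have "norm (sqrt (nsq f) - sqrt (nsq (F n))) \<le> sqrt (nsq (\<lambda>x. f x - F n x))" for n
    using nsq_triangle[of "\<lambda>x. f x - F n x" "F n"] nsq_triangle[of "\<lambda>x. F n x - f x" f]
      assms(1)[of n] assms(2) nsq_minus_commute[of "F n" f] by (simp add: L2_diff)
  then have "((\<lambda>n. sqrt (nsq f) - sqrt (nsq (F n))) \<longlongrightarrow> 0) G"
    using * by (elim Lim_null_comparison[rotated]) simp
  then have "((\<lambda>n. (sqrt (nsq f) - (sqrt (nsq f) - sqrt (nsq (F n))))\<^sup>2) \<longlongrightarrow> (sqrt (nsq f) - 0)\<^sup>2) G"
    by (intro tendsto_intros)
  then show ?thesis by (simp add: nsq_nonneg)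
qed

text \<open>Riesz--Fischer: along a subsequence the increments are so small that
  \<open>\<Sum>k. 2^k |F (r (k+1)) - F (r k)|\<^sup>2\<close> is integrable, hence finite almost everywhere.\<close>
lemma L2_complete:
  fixes F :: "nat \<Rightarrow> real \<Rightarrow> complex"
  assumes L: "\<And>n. L2 (F n)"
    and C: "\<And>e. e > 0 \<Longrightarrow> \<exists>N. \<forall>m\<ge>N. \<forall>n\<ge>N. nsq (\<lambda>x. F m x - F n x) < e"
  shows "\<exists>g. L2 g \<and> (\<lambda>n. nsq (\<lambda>x. g x - F n x)) \<longlonglongrightarrow> 0"
proof -
  have [measurable]: "F n \<in> borel_measurable borel" for n using L by (auto simp: L2_def)
  have "\<exists>N. \<forall>k. \<forall>m\<ge>N k. \<forall>n\<ge>N k. nsq (\<lambda>x. F m x - F n x) < (1/4)^k"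
    by (rule choice) (use C in simp)
  then obtain N where N: "\<And>k m n. m \<ge> N k \<Longrightarrow> n \<ge> N k \<Longrightarrow> nsq (\<lambda>x. F m x - F n x) < (1/4)^k"
    by blast
  \<comment> \<open>The sum makes \<open>r\<close> monotone and at least N k at every k; the summand
    k makes it unbounded even when all N k are 0.\<close>
  define r where "r k = k + (\<Sum>i\<le>k. N i)" for k
  have r_N: "r k \<ge> N k" for k
    unfolding r_def using member_le_sum[of k "{..k}" N] by (simp add: trans_le_add2)
  have r_mono: "r (Suc k) \<ge> r k" for k by (simp add: r_def)
  have r_ge: "r k \<ge> k" for k by (simp add: r_def)
  define D where "D k x = F (r (Suc k)) x - F (r k) x" for k x
  have [measurable]: "D k \<in> borel_measurable borel" for k unfolding D_def by measurable
  have LD: "L2 (D k)" for k unfolding D_def using L by (intro L2_diff)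
  have nD: "nsq (D k) < (1/4)^k" for k
    unfolding D_def using N[of k "r (Suc k)" "r k"] r_N[of k] r_mono[of k] by simp
  have "(\<integral>\<^sup>+x. (\<Sum>k. ennreal (2^k * (cmod (D k x))\<^sup>2)) \<partial>lborel)
      = (\<Sum>k. \<integral>\<^sup>+x. ennreal (2^k * (cmod (D k x))\<^sup>2) \<partial>lborel)"
    by (rule nn_integral_suminf) simp
  also have "\<dots> = (\<Sum>k. ennreal (2^k * nsq (D k)))"
    by (simp add: ennreal_mult nn_integral_cmult nn_nsq[OF LD] nsq_nonneg)
  also have "\<dots> \<le> (\<Sum>k. ennreal ((1/2)^k))"
  proof (intro suminf_le summableI ennreal_leI)
    fix k show "2^k * nsq (D k) \<le> (1/2)^k"
      using mult_left_mono[OF less_imp_le[OF nD[of k]], of "2^k"]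
      by (simp flip: power_mult_distrib)
  qed
  also have "\<dots> < \<infinity>"
    by (subst suminf_ennreal2) (auto intro: summable_geometric)
  finally have fin: "(\<integral>\<^sup>+x. (\<Sum>k. ennreal (2^k * (cmod (D k x))\<^sup>2)) \<partial>lborel) \<noteq> \<infinity>" by simp
  have "AE x in lborel. (\<Sum>k. ennreal (2^k * (cmod (D k x))\<^sup>2)) \<noteq> \<infinity>"
    by (rule nn_integral_PInf_AE[OF _ fin]) measurable
  then have AEc: "AE x in lborel. convergent (\<lambda>k. F (r k) x)"
  proof eventually_elim
    case (elim x)
    have s: "summable (\<lambda>k. 2^k * (cmod (D k x))\<^sup>2)"
      using elim by (intro summable_suminf_not_top) auto
    have "summable (\<lambda>k. (1/2)^k + 2^k * (cmod (D k x))\<^sup>2)"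
      by (intro summable_add s summable_geometric) simp
    moreover have "norm (D k x) \<le> (1/2)^k + 2^k * (cmod (D k x))\<^sup>2" for k
    proof -
      \<comment> \<open>Arithmetic-geometric mean with weights 2^(-k) and 2^k: a geometric term plus
        the summable weighted square dominates the increment itself.\<close>
      have "2 * (sqrt ((1/2)^k) * (sqrt (2^k) * cmod (D k x)))
          \<le> (sqrt ((1/2)^k))\<^sup>2 + (sqrt (2^k) * cmod (D k x))\<^sup>2"
        using sum_squares_bound[of "sqrt ((1/2)^k)" "sqrt (2^k) * cmod (D k x)"] by (simp add: mult.assoc)
      also have "sqrt ((1/2)^k) * (sqrt (2^k) * cmod (D k x)) = cmod (D k x)"
        by (simp add: real_sqrt_divide flip: mult.assoc real_sqrt_mult power_mult_distrib)
      finally show ?thesis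
        by (simp add: power_mult_distrib) (smt (verit) norm_ge_zero)
    qed
    ultimately have "summable (\<lambda>k. D k x)"
      by (rule summable_comparison_test'[where N=0])
    then have "convergent (\<lambda>n. \<Sum>k<n. D k x)" by (simp add: summable_iff_convergent)
    moreover have "(\<Sum>k<n. D k x) = F (r n) x - F (r 0) x" for n
      unfolding D_def by (rule sum_lessThan_telescope)
    ultimately have "convergent (\<lambda>n. F (r n) x - F (r 0) x)" by simp
    then show ?case using convergent_add_const_iff[of "- F (r 0) x" "\<lambda>n. F (r n) x"] by simp
  qed
  define g where "g x = lim (\<lambda>k. F (r k) x)" for x
  have [measurable]: "g \<in> borel_measurable borel"
    unfolding g_def by (intro borel_measurable_lim_metric) auto
  have lim: "AE x in lborel. (\<lambda>k. F (r k) x) \<longlonglongrightarrow> g x"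
    using AEc by eventually_elim (simp add: g_def convergent_LIMSEQ_iff)
  \<comment> \<open>Fatou's lemma along the subsequence: a bound on all late F n - F m passes to g -
    F m. It serves both for g being square-integrable and for the convergence of the full
    sequence.\<close>
  have fat: "(\<integral>\<^sup>+x. ennreal ((cmod (g x - F m x))\<^sup>2) \<partial>lborel) \<le> ennreal e"
    if "e > 0" "\<And>n. n \<ge> M \<Longrightarrow> nsq (\<lambda>x. F n x - F m x) \<le> e" for e m M
  proof -
    have "(\<integral>\<^sup>+x. ennreal ((cmod (g x - F m x))\<^sup>2) \<partial>lborel)
        = (\<integral>\<^sup>+x. liminf (\<lambda>k. ennreal ((cmod (F (r k) x - F m x))\<^sup>2)) \<partial>lborel)"
    proof (rule nn_integral_cong_AE, use lim in eventually_elim)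
      case (elim x)
      have "(\<lambda>k. ennreal ((cmod (F (r k) x - F m x))\<^sup>2)) \<longlonglongrightarrow> ennreal ((cmod (g x - F m x))\<^sup>2)"
        by (intro tendsto_ennrealI tendsto_intros elim)
      then show ?case by (metis lim_imp_Liminf trivial_limit_sequentially)
    qed
    also have "\<dots> \<le> liminf (\<lambda>k. \<integral>\<^sup>+x. ennreal ((cmod (F (r k) x - F m x))\<^sup>2) \<partial>lborel)"
      by (rule nn_integral_liminf) simp
    also have "\<dots> = liminf (\<lambda>k. ennreal (nsq (\<lambda>x. F (r k) x - F m x)))"
      by (subst nn_nsq) (auto intro: L2_diff L)
    also have "\<dots> \<le> ennreal e"
    proof (rule Liminf_le)
      show "eventually (\<lambda>k. ennreal (nsq (\<lambda>x. F (r k) x - F m x)) \<le> ennreal e) sequentially"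
        using eventually_ge_at_top[of M]
      proof eventually_elim
        case (elim k)
        then have "M \<le> r k" using r_ge[of k] by linarith
        then show ?case by (intro ennreal_leI that(2))
      qed
    qed simp
    finally show ?thesis .
  qed
  have Lg: "L2 (\<lambda>x. g x - F m x)" if "m \<ge> N 0" for m
  proof -
    have "(\<integral>\<^sup>+x. ennreal ((cmod (g x - F m x))\<^sup>2) \<partial>lborel) \<le> ennreal 1"
    proof (rule fat)
      fix n assume "n \<ge> N 0"
      then show "nsq (\<lambda>x. F n x - F m x) \<le> 1" using N[of 0 n m] that by simp
    qed simp
    also have "\<dots> < \<infinity>" by simp
    finally show ?thesis by (subst L2_iff_nn) auto
  qed
  have Lg': "L2 g" using L2_add[OF Lg[of "N 0"] L[of "N 0"]] by simp
  moreover have "(\<lambda>n. nsq (\<lambda>x. g x - F n x)) \<longlonglongrightarrow> 0"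
  proof (rule LIMSEQ_I)
    fix e :: real assume e: "e > 0"
    obtain M where M: "\<forall>m\<ge>M. \<forall>n\<ge>M. nsq (\<lambda>x. F m x - F n x) < e/2" using C[of "e/2"] e by auto
    show "\<exists>no. \<forall>n\<ge>no. norm (nsq (\<lambda>x. g x - F n x) - 0) < e"
    proof (intro exI allI impI)
      fix n assume n: "n \<ge> M"
      have "ennreal (nsq (\<lambda>x. g x - F n x)) \<le> ennreal (e/2)"
        using fat[of "e/2" M n] e M n by (subst nn_nsq[symmetric]) (auto intro: L2_diff Lg' L less_imp_le)
      then show "norm (nsq (\<lambda>x. g x - F n x) - 0) < e" using e by (simp add: nsq_nonneg)
    qed
  qed
  ultimately show ?thesis by blast
qed

section \<open>The Fourier transform on the real line\<close>

definition trunc :: "real \<Rightarrow> (real \<Rightarrow> complex) \<Rightarrow> real \<Rightarrow> complex" where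
  "trunc R f = (\<lambda>t. indicator {-R..R} t * f t)"

lemma trunc_L2: "L2 f \<Longrightarrow> L2 (trunc R f)"
  unfolding trunc_def by (rule L2_indicator) auto

lemma L2_indicator_Icc: "L2 (indicator {a..b::real})"
proof -
  have "integrable lborel (\<lambda>x. indicator {a..b} x :: real)"
    by (simp add: integrable_indicator_iff emeasure_lborel_Icc_eq)
  moreover have "(\<lambda>x. (cmod (indicator {a..b} x))\<^sup>2) = (\<lambda>x. indicator {a..b} x :: real)"
    by (auto simp: indicator_def)
  ultimately show ?thesis unfolding L2_def by simp
qed

lemma trunc_integrable: "L2 f \<Longrightarrow> integrable lborel (trunc R f)"
  unfolding trunc_def by (rule L2_prod_integrable[OF L2_indicator_Icc])

lemma nsq_trunc_tendsto:
  assumes "L2 f" shows "((\<lambda>R. nsq (\<lambda>t. f t - trunc R f t)) \<longlongrightarrow> 0) at_top"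
proof -
  have [measurable]: "f \<in> borel_measurable borel" using assms by (simp add: L2_def)
  have "((\<lambda>R. nsq (\<lambda>t. f t - trunc R f t)) \<longlongrightarrow> (\<integral>t. 0 \<partial>(lborel::real measure))) at_top"
    unfolding nsq_def
  proof (rule integral_dominated_convergence_at_top)
    show "integrable lborel (\<lambda>t. (cmod (f t))\<^sup>2)" using assms by (simp add: L2_def)
    show "AE t in lborel. ((\<lambda>R. (cmod (f t - trunc R f t))\<^sup>2) \<longlongrightarrow> 0) at_top"
    proof (rule AE_I2)
      fix t :: real
      show "((\<lambda>R. (cmod (f t - trunc R f t))\<^sup>2) \<longlongrightarrow> 0) at_top"
      proof (rule tendsto_eventually)
        show "\<forall>\<^sub>F R in at_top. (cmod (f t - trunc R f t))\<^sup>2 = 0"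
          using eventually_ge_at_top[of "\<bar>t\<bar>"]
          by eventually_elim (auto simp: trunc_def indicator_def)
      qed
    qed
    show "\<forall>\<^sub>F R in at_top. AE t in lborel. norm ((cmod (f t - trunc R f t))\<^sup>2) \<le> (cmod (f t))\<^sup>2"
      by (intro always_eventually allI AE_I2) (auto simp: trunc_def indicator_def)
  qed (auto simp: trunc_def)
  then show ?thesis by simp
qed

lemma L2_dense_bounded:
  assumes "L2 f" "e > 0"
  shows "\<exists>M g. M > 0 \<and> L2 g \<and> (\<forall>t. cmod (g t) \<le> M) \<and> (\<forall>t. \<bar>t\<bar> > M \<longrightarrow> g t = 0) \<and> nsq (\<lambda>t. f t - g t) < e"
proof -
  have [measurable]: "f \<in> borel_measurable borel" using assms by (simp add: L2_def)
  define F where "F n t = (if \<bar>t\<bar> \<le> real n \<and> cmod (f t) \<le> real n then f t else 0)" for n t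
  have [measurable]: "F n \<in> borel_measurable borel" for n unfolding F_def by measurable
  have "(\<lambda>n. nsq (\<lambda>t. f t - F n t)) \<longlonglongrightarrow> (\<integral>t. 0 \<partial>(lborel::real measure))"
    unfolding nsq_def
  proof (rule integral_dominated_convergence)
    show "integrable lborel (\<lambda>t. (cmod (f t))\<^sup>2)" using assms by (simp add: L2_def)
    show "AE t in lborel. (\<lambda>n. (cmod (f t - F n t))\<^sup>2) \<longlonglongrightarrow> 0"
    proof (rule AE_I2)
      fix t :: real
      show "(\<lambda>n. (cmod (f t - F n t))\<^sup>2) \<longlonglongrightarrow> 0"
      proof (rule tendsto_eventually)
        show "\<forall>\<^sub>F n in sequentially. (cmod (f t - F n t))\<^sup>2 = 0"
          using eventually_ge_at_top[of "nat \<lceil>max \<bar>t\<bar> (cmod (f t))\<rceil>"]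
          by eventually_elim (auto simp: F_def nat_le_iff ceiling_le_iff)
      qed
    qed
    show "AE t in lborel. norm ((cmod (f t - F n t))\<^sup>2) \<le> (cmod (f t))\<^sup>2" for n
      by (intro AE_I2) (auto simp: F_def)
  qed auto
  then have "\<forall>\<^sub>F n in sequentially. nsq (\<lambda>t. f t - F n t) < e"
    using assms(2) by (intro order_tendstoD) auto
  then obtain n where n: "nsq (\<lambda>t. f t - F n t) < e" by (auto simp: eventually_sequentially)
  have "L2 (F n)"
    by (rule L2_bound[OF assms(1), where C=1]) (auto simp: F_def)
  then show ?thesis using n
    by (intro exI[of _ "real n + 1"] exI[of _ "F n"]) (auto simp: F_def)
qed

text \<open>After \<open>L2_dense_bounded\<close> the function is bounded with bounded support. It
  is an almost everywhere limit of continuous functions; clipping their values keeps continuity and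
  supplies the majorant for dominated convergence. The final cut-off is sharp, so \<open>k\<close>
  is continuous but \<open>trunc a k\<close> may jump at the two end points.\<close>

lemma L2_dense_continuous:
  assumes "L2 f" "e > 0"
  shows "\<exists>K a k. continuous_on UNIV k \<and> (\<forall>t. cmod (k t) \<le> K) \<and> nsq (\<lambda>t. f t - trunc a k t) < e"
proof -
  obtain M g where M: "M > 0" and Lg: "L2 g" and gM: "\<And>t. cmod (g t) \<le> M"
    and g0: "\<And>t. \<bar>t\<bar> > M \<Longrightarrow> g t = 0" and fg: "nsq (\<lambda>t. f t - g t) < e/4"
    using L2_dense_bounded[OF assms(1), of "e/4"] assms(2) by auto
  have [measurable]: "g \<in> borel_measurable borel" using Lg by (simp add: L2_def)
  have "g measurable_on UNIV"
    by (rule lebesgue_measurable_imp_measurable_on) (simp_all add: measurable_completion)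
  then obtain N k where N: "negligible N" and k: "\<And>n. continuous_on UNIV (k n)"
    and lim: "\<And>x. x \<notin> N \<Longrightarrow> (\<lambda>n. k n x) \<longlonglongrightarrow> g x"
    unfolding measurable_on_def by auto
  \<comment> \<open>Radial retraction onto the disc of radius M: the identity inside, and z scaled
    back to modulus M outside.\<close>
  define cl where "cl z = z /\<^sub>R max 1 (cmod z / M)" for z :: complex
  have cl_cont: "continuous_on UNIV cl"
    unfolding cl_def using M by (intro continuous_intros) auto
  have cl_bd: "cmod (cl z) \<le> M" for z
  proof -
    have "cmod z \<le> M * max 1 (cmod z / M)"
      using M by (auto simp: max_def field_simps)
    then show ?thesis by (simp add: cl_def divide_simps mult.commute split: if_splits)
  qed
  have cl_id: "cl z = z" if "cmod z \<le> M" for z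
    using that M by (auto simp: cl_def max_def divide_simps)
  define h where "h n t = cl (k n t)" for n t
  have hc: "continuous_on UNIV (h n)" for n
    unfolding h_def by (rule continuous_on_compose2[OF cl_cont k]) auto
  have [measurable]: "h n \<in> borel_measurable borel" for n
    by (rule borel_measurable_continuous_onI[OF hc])
  have [measurable]: "trunc M (h n) \<in> borel_measurable borel" for n unfolding trunc_def by measurable
  have AEN: "AE x in lborel. x \<notin> N"
    using N by (metis AE_not_in AE_completion negligible_iff_null_sets AE_completion_iff)
  have "(\<lambda>n. nsq (\<lambda>t. g t - trunc M (h n) t)) \<longlonglongrightarrow> (\<integral>t. 0 \<partial>(lborel::real measure))"
    unfolding nsq_def
  proof (rule integral_dominated_convergence)
    have "integrable lborel (\<lambda>t. indicator {-M..M} t :: real)" by (simp add: integrable_indicator_iff emeasure_lborel_Icc_eq)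
    then show "integrable lborel (\<lambda>t. (2*M)\<^sup>2 * indicator {-M..M} t)" by (rule integrable_mult_right)
    show "AE t in lborel. (\<lambda>n. (cmod (g t - trunc M (h n) t))\<^sup>2) \<longlonglongrightarrow> 0"
      using AEN
    proof eventually_elim
      case (elim t)
      have "(\<lambda>n. h n t) \<longlonglongrightarrow> cl (g t)"
        unfolding h_def
        by (rule isCont_tendsto_compose[OF _ lim[OF elim]]) (use cl_cont in \<open>simp add: continuous_on_eq_continuous_at\<close>)
      then have "(\<lambda>n. (cmod (g t - indicator {-M..M} t * h n t))\<^sup>2) \<longlonglongrightarrow> (cmod (g t - indicator {-M..M} t * cl (g t)))\<^sup>2"
        by (intro tendsto_intros)
      moreover have "g t - indicator {-M..M} t * cl (g t) = 0"
        using g0[of t] cl_id[OF gM[of t]] by (cases "\<bar>t\<bar> \<le> M") (auto simp: indicator_def abs_le_iff)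
      ultimately show ?case by (simp add: trunc_def)
    qed
    show "AE t in lborel. norm ((cmod (g t - trunc M (h n) t))\<^sup>2) \<le> (2*M)\<^sup>2 * indicator {-M..M} t" for n
    proof (rule AE_I2)
      fix t
      show "norm ((cmod (g t - trunc M (h n) t))\<^sup>2) \<le> (2*M)\<^sup>2 * indicator {-M..M} t"
      proof (cases "\<bar>t\<bar> \<le> M")
        case True
        have "cmod (g t - h n t) \<le> 2 * M"
          using norm_triangle_ineq4[of "g t" "h n t"] gM[of t] cl_bd[of "k n t"] by (simp add: h_def)
        then have "(cmod (g t - h n t))\<^sup>2 \<le> (2*M)\<^sup>2" by (intro power_mono) auto
        then show ?thesis using True by (simp add: trunc_def indicator_def abs_le_iff)
      next
        case False
        then have "g t = 0" "t \<notin> {-M..M}" using g0[of t] by auto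
        then show ?thesis by (simp add: trunc_def)
      qed
    qed
  qed auto
  then have "\<forall>\<^sub>F n in sequentially. nsq (\<lambda>t. g t - trunc M (h n) t) < e/4"
    using assms(2) by (intro order_tendstoD) auto
  then obtain n where n: "nsq (\<lambda>t. g t - trunc M (h n) t) < e/4" by (auto simp: eventually_sequentially)
  have L: "L2 (trunc M (h n))"
    unfolding trunc_def
  proof (rule L2_bound[OF L2_indicator_Icc])
    show "AE t in lborel. cmod (indicator {-M..M} t * h n t) \<le> M * cmod (indicator {-M..M} t)"
      using cl_bd by (intro AE_I2) (auto simp: h_def indicator_def)
  qed auto
  have "sqrt (nsq (\<lambda>t. f t - trunc M (h n) t)) \<le> sqrt (nsq (\<lambda>t. f t - g t)) + sqrt (nsq (\<lambda>t. g t - trunc M (h n) t))"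
    by (intro nsq_triangle_diff assms Lg L)
  also have "\<dots> < sqrt (e/4) + sqrt (e/4)"
    using n fg by (intro add_strict_mono real_sqrt_less_mono)
  also have "\<dots> = sqrt e" by (simp add: real_sqrt_divide)
  finally have "nsq (\<lambda>t. f t - trunc M (h n) t) < e" by simp
  then show ?thesis using hc cl_bd by (intro exI[of _ M] exI[of _ "h n"]) (auto simp: h_def)
qed

lemma nsq_shift: "nsq (\<lambda>t. f (t - r)) = nsq f"
  unfolding nsq_def using lborel_integral_real_affine[of 1 "\<lambda>t. (cmod (f (t - r)))\<^sup>2" r] by simp

lemma L2_shift: "L2 f \<Longrightarrow> L2 (\<lambda>t. f (t - r))"
  unfolding L2_def using lborel_integrable_real_affine[of "\<lambda>t. (cmod (f t))\<^sup>2" 1 "-r"]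
    measurable_compose[of "\<lambda>t. t - r" borel borel f borel]
  by (simp add: add.commute)

text \<open>Continuity of translation, tested against f alone. For the approximant
  \<open>trunc a k\<close> it follows by dominated convergence: it is bounded, f is integrable, and
  its jumps lie at two points. Cauchy-Schwarz and translation invariance of the norm transfer this
  to f.\<close>

lemma autocorrelation_tendsto:
  assumes L: "L2 f" and I: "integrable lborel f" and r: "r \<longlonglongrightarrow> (0::real)"
  shows "(\<lambda>n. ip f (\<lambda>t. f (t - r n))) \<longlonglongrightarrow> ip f f"
proof (rule metric_LIMSEQ_I)
  fix e :: real assume e: "e > 0"
  have [measurable]: "f \<in> borel_measurable borel" using L by (simp add: L2_def)
  define q where "q = sqrt (nsq f) + 1"
  have q: "q > 0" "sqrt (nsq f) \<le> q" by (auto simp: q_def nsq_nonneg add_nonneg_pos)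
  \<comment> \<open>Squared because \<open>nsq\<close> is a squared norm. By Cauchy-Schwarz, each
    replacement of f by its approximant then costs at most e / 4.\<close>
  define d where "d = (e / (4 * q))\<^sup>2"
  have d: "d > 0" using e q by (simp add: d_def)
  obtain K a k where kc: "continuous_on UNIV k" and kK: "\<And>t. cmod (k t) \<le> K"
    and fk: "nsq (\<lambda>t. f t - trunc a k t) < d"
    using L2_dense_continuous[OF L d] by blast
  have [measurable]: "k \<in> borel_measurable borel" by (rule borel_measurable_continuous_onI[OF kc])
  have K: "K \<ge> 0" using kK[of 0] norm_ge_zero order_trans by blast
  let ?p = "trunc a k"
  have [measurable]: "?p \<in> borel_measurable borel" unfolding trunc_def by measurable
  have pK: "cmod (?p t) \<le> K" for t using kK[of t] K by (auto simp: trunc_def indicator_def)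
  have Lp: "L2 ?p"
    unfolding trunc_def
  proof (rule L2_bound[OF L2_indicator_Icc])
    show "AE t in lborel. cmod (indicator {-a..a} t * k t) \<le> K * cmod (indicator {-a..a} t)"
      using kK by (intro AE_I2) (auto simp: indicator_def)
  qed auto
  have "(\<lambda>n. ip f (\<lambda>t. ?p (t - r n))) \<longlonglongrightarrow> ip f ?p"
    unfolding ip_def
  proof (rule integral_dominated_convergence)
    show "integrable lborel (\<lambda>t. K * cmod (f t))" using I by auto
    have ae: "AE t in lborel. t \<noteq> a \<and> t \<noteq> -a"
      by (intro AE_conjI AE_lborel_singleton)
    show "AE t in lborel. (\<lambda>n. f t * cnj (?p (t - r n))) \<longlonglongrightarrow> f t * cnj (?p t)"
      using ae
    proof eventually_elim
      case (elim t)
      have tr: "(\<lambda>n. t - r n) \<longlonglongrightarrow> t" using tendsto_diff[OF tendsto_const r, of t] by simp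
      have "(\<lambda>n. k (t - r n)) \<longlonglongrightarrow> k t"
        by (rule isCont_tendsto_compose[OF _ tr]) (use kc in \<open>simp add: continuous_on_eq_continuous_at\<close>)
      moreover have "(\<lambda>n. indicator {-a..a} (t - r n) :: complex) \<longlonglongrightarrow> indicator {-a..a} t"
      proof (rule tendsto_eventually)
        consider "t < -a" | "-a < t" "t < a" | "a < t" using elim by fastforce
        then show "\<forall>\<^sub>F n in sequentially. indicator {-a..a} (t - r n) = (indicator {-a..a} t :: complex)"
        proof cases
          case 1
          show ?thesis using order_tendstoD(2)[OF tr 1] by eventually_elim (use 1 in auto)
        next
          case 2
          show ?thesis using order_tendstoD(1)[OF tr 2(1)] order_tendstoD(2)[OF tr 2(2)]
            by eventually_elim (use 2 in \<open>auto simp: indicator_def\<close>)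
        next
          case 3
          show ?thesis using order_tendstoD(1)[OF tr 3] by eventually_elim (use 3 in \<open>auto simp: indicator_def\<close>)
        qed
      qed
      ultimately show ?case unfolding trunc_def by (intro tendsto_intros)
    qed
    show "AE t in lborel. norm (f t * cnj (?p (t - r n))) \<le> K * cmod (f t)" for n
      using mult_left_mono[OF pK norm_ge_zero] by (intro AE_I2) (simp add: norm_mult mult.commute[of K])
  qed auto
  then obtain N where N: "\<And>n. n \<ge> N \<Longrightarrow> dist (ip f (\<lambda>t. ?p (t - r n))) (ip f ?p) < e/2"
    using e by (metis metric_LIMSEQ_D half_gt_zero)
  show "\<exists>N. \<forall>n\<ge>N. dist (ip f (\<lambda>t. f (t - r n))) (ip f f) < e"
  proof (intro exI allI impI)
    fix n assume n: "n \<ge> N"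
    have sd: "sqrt (nsq (\<lambda>t. f t - ?p t)) < e / (4 * q)"
      using real_sqrt_less_mono[OF fk] e q by (simp add: d_def)
    have b: "cmod (ip f (\<lambda>t. f (t - s) - ?p (t - s))) \<le> e/4" for s
    proof -
      have "cmod (ip f (\<lambda>t. f (t - s) - ?p (t - s))) \<le> sqrt (nsq f) * sqrt (nsq (\<lambda>t. f (t-s) - ?p (t-s)))"
        by (intro ip_bound L L2_shift[of "\<lambda>t. f t - ?p t", simplified] L2_diff Lp)
      also have "\<dots> \<le> q * (e / (4*q))"
        using nsq_shift[of "\<lambda>t. f t - ?p t" s] sd q by (intro mult_mono) (auto simp: nsq_nonneg)
      finally show ?thesis using q by simp
    qed
    let ?A = "ip f (\<lambda>t. f (t - r n) - ?p (t - r n))" and ?B = "ip f (\<lambda>t. ?p (t - r n)) - ip f ?p"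
      and ?C = "ip f (\<lambda>t. f (t - 0) - ?p (t - 0))"
    have "ip f (\<lambda>t. f (t - r n)) - ip f f = ?A + ?B - ?C"
      using L Lp L2_shift[OF L] L2_shift[OF Lp] by (simp add: ip_diff_right)
    moreover have "cmod (A + B - C) \<le> cmod A + cmod B + cmod C" for A B C :: complex
      using norm_triangle_ineq4[of "A + B" C] norm_triangle_ineq[of A B] by linarith
    ultimately have "cmod (ip f (\<lambda>t. f (t - r n)) - ip f f) \<le> cmod ?A + cmod ?B + cmod ?C"
      by presburger
    also have "\<dots> < e/4 + e/2 + e/4"
      using b[of "r n"] b[of 0] N[OF n] by (simp add: dist_norm)
    finally show "dist (ip f (\<lambda>t. f (t - r n))) (ip f f) < e" by (simp add: dist_norm)
  qed
qed

text \<open>The sign c is always subject to c^2 = 1, so that one development covers the transform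
  and its inverse.\<close>

definition FT :: "real \<Rightarrow> (real \<Rightarrow> complex) \<Rightarrow> real \<Rightarrow> complex" where
  "FT c f u = (\<integral>t. f t * cis (c * u * t) \<partial>lborel)"

lemma borel_measurable_cis [measurable]:
  "f \<in> borel_measurable M \<Longrightarrow> (\<lambda>x. cis (f x)) \<in> borel_measurable M"
  by (rule borel_measurable_continuous_on) (auto intro: continuous_intros)

lemma FT_measurable [measurable]:
  assumes [measurable]: "f \<in> borel_measurable borel"
  shows "FT c f \<in> borel_measurable borel"
  unfolding FT_def by measurable

lemma FT_bound:
  shows "cmod (FT c f u) \<le> (\<integral>t. cmod (f t) \<partial>lborel)"
proof -
  have "cmod (FT c f u) \<le> (\<integral>t. cmod (f t * cis (c * u * t)) \<partial>lborel)"
    unfolding FT_def by (rule integral_norm_bound)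
  then show ?thesis by (simp add: norm_mult)
qed

lemma integrable_mult_cis:
  assumes "integrable lborel f" "g \<in> borel_measurable borel"
  shows "integrable lborel (\<lambda>t. f t * cis (g t))"
  by (rule Bochner_Integration.integrable_bound[OF assms(1)])
     (use assms borel_measurable_integrable[OF assms(1)] in \<open>auto simp: norm_mult\<close>)

lemma FT_diff: "integrable lborel f \<Longrightarrow> integrable lborel g \<Longrightarrow> FT c (\<lambda>t. f t - g t) u = FT c f u - FT c g u"
  unfolding FT_def by (simp add: left_diff_distrib integrable_mult_cis)

lemma FT_cmult: "FT c (\<lambda>t. k * f t) u = k * FT c f u"
  unfolding FT_def by (simp add: mult.assoc)

text \<open>For exchanging oscillatory integrals: the two integrable factors carry the convergence,
  and the kernel enters only through its bound C.\<close>

lemma fubini_prod: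
  fixes a b :: "real \<Rightarrow> complex" and k :: "real \<Rightarrow> real \<Rightarrow> complex"
  assumes a: "integrable lborel a" and b: "integrable lborel b"
    and [measurable]: "case_prod k \<in> borel_measurable (borel \<Otimes>\<^sub>M borel)"
    and k: "\<And>x y. cmod (k x y) \<le> C"
  shows "(\<integral>x. a x * (\<integral>y. b y * k x y \<partial>lborel) \<partial>lborel) = (\<integral>y. b y * (\<integral>x. a x * k x y \<partial>lborel) \<partial>lborel)"
proof -
  have [measurable]: "a \<in> borel_measurable borel" "b \<in> borel_measurable borel"
    using borel_measurable_integrable[OF a] borel_measurable_integrable[OF b] by auto
  have C: "C \<ge> 0" using k[of 0 0] norm_ge_zero order_trans by blast
  have ab: "integrable (lborel \<Otimes>\<^sub>M lborel) (\<lambda>(x,y). C * (cmod (a x) * cmod (b y)))"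
  proof (rule lborel_pair.Fubini_integrable)
    show "integrable lborel (\<lambda>x. \<integral>y. norm (case (x,y) of (x,y) \<Rightarrow> C * (cmod (a x) * cmod (b y))) \<partial>lborel)"
      using a C by (simp add: abs_mult)
    show "AE x in lborel. integrable lborel (\<lambda>y. case (x,y) of (x,y) \<Rightarrow> C * (cmod (a x) * cmod (b y)))"
      using b by simp
  qed simp
  have "integrable (lborel \<Otimes>\<^sub>M lborel) (\<lambda>(x,y). a x * (b y * k x y))"
  proof (rule Bochner_Integration.integrable_bound[OF ab])
    have "cmod (a x) * cmod (b y) * cmod (k x y) \<le> cmod (a x) * cmod (b y) * C" for x y
      using k by (intro mult_left_mono) auto
    then show "AE p in lborel \<Otimes>\<^sub>M lborel. norm (case p of (x,y) \<Rightarrow> a x * (b y * k x y))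
          \<le> norm (case p of (x,y) \<Rightarrow> C * (cmod (a x) * cmod (b y)))"
      using C by (intro AE_I2) (auto simp: norm_mult abs_mult mult_ac)
  qed simp
  from lborel_pair.Fubini_integral[OF this]
  have "(\<integral>y. (\<integral>x. a x * (b y * k x y) \<partial>lborel) \<partial>lborel) = (\<integral>x. (\<integral>y. a x * (b y * k x y) \<partial>lborel) \<partial>lborel)" .
  moreover have "(\<integral>x. a x * (b y * k x y) \<partial>lborel) = b y * (\<integral>x. a x * k x y \<partial>lborel)" for y
    by (subst integral_mult_right_zero[symmetric]) (simp only: mult.left_commute)
  ultimately show ?thesis by simp
qed

text \<open>After rescaling by n this is the characteristic function of the standard normal
  distribution; c^2 = 1 makes the sign disappear.\<close>

lemma gaussian_FT:
  assumes c: "c\<^sup>2 = 1" and n: "n > 0"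
  shows "(\<integral>u. of_real (exp (- (u/n)\<^sup>2 / 2)) * cis (c * u * r) \<partial>lborel)
    = of_real (n * sqrt (2 * pi) * exp (- (n * r)\<^sup>2 / 2))"
proof -
  have "(\<integral>u. of_real (exp (- (u/n)\<^sup>2 / 2)) * cis (c * u * r) \<partial>lborel)
      = n *\<^sub>R (\<integral>x. of_real (exp (- x\<^sup>2 / 2)) * cis (c * (n * x) * r) \<partial>lborel)"
    using n by (subst lborel_integral_real_affine[of n _ 0]) auto
  also have "(\<integral>x. of_real (exp (- x\<^sup>2 / 2)) * cis (c * (n * x) * r) \<partial>lborel)
      = (\<integral>x. of_real (sqrt (2*pi)) * (std_normal_density x *\<^sub>R iexp ((c * n * r) * x)) \<partial>lborel)"
    by (rule Bochner_Integration.integral_cong)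
       (auto simp: std_normal_density_def cis_conv_exp scaleR_conv_of_real mult_ac)
  also have "\<dots> = of_real (sqrt (2*pi)) * char std_normal_distribution (c * n * r)"
    unfolding char_def integral_mult_right_zero
    by (subst integral_density) (auto simp: normal_density_nonneg)
  also have "\<dots> = of_real (sqrt (2*pi) * exp (- (n * r)\<^sup>2 / 2))"
    using c by (simp add: char_std_normal_distribution power_mult_distrib)
  finally show ?thesis by (simp add: scaleR_conv_of_real mult_ac)
qed

lemma integrable_gaussian:
  fixes n :: real
  assumes "n > 0" shows "integrable lborel (\<lambda>u. exp (- (u/n)\<^sup>2 / 2))"
proof -
  have "integrable lborel (\<lambda>u::real. std_normal_density (0 + (1/n) * u))"
    by (rule lborel_integrable_real_affine) (use assms in auto)
  then have "integrable lborel (\<lambda>u::real. sqrt (2 * pi) * std_normal_density (0 + (1/n) * u))"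
    by (rule integrable_mult_right)
  then show ?thesis by (simp add: std_normal_density_def)
qed

text \<open>The Gaussian weight makes the triple integral over u, t, s absolutely convergent.
  Integrating over u first leaves a Gaussian of width 1 / n in t - s, so the weighted norm of the
  transform is an average of autocorrelations of f at shifts y / n, with y normally
  distributed.\<close>

lemma FT_gaussian_mean:
  assumes c: "c\<^sup>2 = 1" and n: "n > 0" and L: "L2 f" and I: "integrable lborel f"
  shows "(\<integral>u. (cmod (FT c f u))\<^sup>2 * exp (- (u/n)\<^sup>2 / 2) \<partial>lborel)
    = 2 * pi * Re (\<integral>y. std_normal_density y * ip f (\<lambda>t. f (t - y / n)) \<partial>lborel)"
proof -
  have [measurable]: "f \<in> borel_measurable borel" using L by (simp add: L2_def)
  have Ic: "integrable lborel (\<lambda>s. cnj (f s))" using I by simp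
  define w where "w u = complex_of_real (exp (- (u/n)\<^sup>2 / 2))" for u
  have wI: "integrable lborel w" unfolding w_def using integrable_gaussian[OF n] by simp
  have [measurable]: "w \<in> borel_measurable borel" using borel_measurable_integrable[OF wI] by simp
  have aI: "integrable lborel (\<lambda>u. cnj (FT c f u) * w u)"
  proof (rule Bochner_Integration.integrable_bound)
    show "integrable lborel (\<lambda>u. of_real (\<integral>t. cmod (f t) \<partial>lborel) * w u)" using wI by simp
    show "AE u in lborel. norm (cnj (FT c f u) * w u) \<le> norm (of_real (\<integral>t. cmod (f t) \<partial>lborel) * w u)"
      using FT_bound[of c f] by (intro AE_I2) (simp add: norm_mult mult_right_mono)
  qed simp
  have cnjFT: "cnj (FT c f u) = (\<integral>s. cnj (f s) * cis (- (c * u * s)) \<partial>lborel)" for u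
    unfolding FT_def by (subst Bochner_Integration.integral_cnj[symmetric]) (simp add: cis_cnj)
  have "complex_of_real (\<integral>u. (cmod (FT c f u))\<^sup>2 * exp (- (u/n)\<^sup>2 / 2) \<partial>lborel)
      = (\<integral>u. (cnj (FT c f u) * w u) * FT c f u \<partial>lborel)"
    unfolding w_def by (subst integral_complex_of_real[symmetric])
      (auto simp: complex_norm_square mult_ac simp del: of_real_power intro!: Bochner_Integration.integral_cong)
  also have "\<dots> = (\<integral>t. f t * (\<integral>u. (cnj (FT c f u) * w u) * cis (c * u * t) \<partial>lborel) \<partial>lborel)"
    unfolding FT_def[of c f] by (rule fubini_prod[where C=1]) (use aI I in \<open>auto simp: FT_def[symmetric]\<close>)
  also have "\<dots> = (\<integral>t. f t * (\<integral>s. cnj (f s) * of_real (n * sqrt (2 * pi) * exp (- (n * (t - s))\<^sup>2 / 2)) \<partial>lborel) \<partial>lborel)"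
  proof (rule Bochner_Integration.integral_cong[OF refl])
    fix t
    have "(\<integral>u. (cnj (FT c f u) * w u) * cis (c * u * t) \<partial>lborel)
        = (\<integral>u. w u * (\<integral>s. cnj (f s) * cis (c * u * (t - s)) \<partial>lborel) \<partial>lborel)"
    proof (rule Bochner_Integration.integral_cong[OF refl])
      fix u
      have "cnj (FT c f u) * cis (c * u * t) = (\<integral>s. cnj (f s) * cis (c * u * (t - s)) \<partial>lborel)"
        unfolding cnjFT by (subst integral_mult_left_zero[symmetric])
           (auto intro!: Bochner_Integration.integral_cong simp: mult.assoc cis_mult right_diff_distrib)
      then show "(cnj (FT c f u) * w u) * cis (c * u * t) = w u * (\<integral>s. cnj (f s) * cis (c * u * (t - s)) \<partial>lborel)"
        by (simp add: mult_ac)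
    qed
    also have "\<dots> = (\<integral>s. cnj (f s) * (\<integral>u. w u * cis (c * u * (t - s)) \<partial>lborel) \<partial>lborel)"
      by (rule fubini_prod[OF wI Ic, where C=1]) auto
    also have "\<dots> = (\<integral>s. cnj (f s) * of_real (n * sqrt (2 * pi) * exp (- (n * (t - s))\<^sup>2 / 2)) \<partial>lborel)"
      unfolding w_def gaussian_FT[OF c n] ..
    finally show "f t * (\<integral>u. (cnj (FT c f u) * w u) * cis (c * u * t) \<partial>lborel) =
      f t * (\<integral>s. cnj (f s) * of_real (n * sqrt (2 * pi) * exp (- (n * (t - s))\<^sup>2 / 2)) \<partial>lborel)" by simp
  qed
  also have "\<dots> = (\<integral>t. (\<integral>y. of_real (2 * pi * std_normal_density y) * (f t * cnj (f (t - y / n))) \<partial>lborel) \<partial>lborel)"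
  proof (rule Bochner_Integration.integral_cong[OF refl])
    fix t
    have "(\<integral>s. cnj (f s) * of_real (n * sqrt (2 * pi) * exp (- (n * (t - s))\<^sup>2 / 2)) \<partial>lborel)
       = (1/n) *\<^sub>R (\<integral>y. cnj (f (t - y / n)) * of_real (n * sqrt (2 * pi) * exp (- y\<^sup>2 / 2)) \<partial>lborel)"
      using n by (subst lborel_integral_real_affine[of "-1/n" _ t]) auto
    also have "\<dots> = (\<integral>y. of_real (2 * pi * std_normal_density y) * cnj (f (t - y / n)) \<partial>lborel)"
    proof (subst integral_scaleR_right[symmetric], rule Bochner_Integration.integral_cong[OF refl])
      fix y
      have "2 * pi * std_normal_density y = (2 * pi / sqrt (2 * pi)) * exp (- y\<^sup>2 / 2)"
        by (simp add: std_normal_density_def)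
      also have "2 * pi / sqrt (2 * pi) = sqrt (2 * pi)"
        by (rule real_div_sqrt) simp
      finally show "(1/n) *\<^sub>R (cnj (f (t - y / n)) * of_real (n * sqrt (2 * pi) * exp (- y\<^sup>2 / 2)))
          = of_real (2 * pi * std_normal_density y) * cnj (f (t - y / n))"
        using n by (simp add: scaleR_conv_of_real)
    qed
    finally show "f t * (\<integral>s. cnj (f s) * of_real (n * sqrt (2 * pi) * exp (- (n * (t - s))\<^sup>2 / 2)) \<partial>lborel)
      = (\<integral>y. of_real (2 * pi * std_normal_density y) * (f t * cnj (f (t - y / n))) \<partial>lborel)"
      by (subst integral_mult_right_zero[symmetric]) (simp add: mult.left_commute)
  qed
  also have "\<dots> = (\<integral>y. (\<integral>t. of_real (2 * pi * std_normal_density y) * (f t * cnj (f (t - y / n))) \<partial>lborel) \<partial>lborel)"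
  proof (rule lborel_pair.Fubini_integral)
    have bd: "(\<integral>t. cmod (f t) * cmod (f (t - y / n)) \<partial>lborel) \<le> nsq f" for y
      using L2_Cauchy_Schwarz[OF L L2_shift[OF L]] nsq_shift[of f] by (simp add: nsq_nonneg)
    show "integrable (lborel \<Otimes>\<^sub>M lborel) (\<lambda>(y, t). of_real (2 * pi * std_normal_density y) * (f t * cnj (f (t - y / n))))"
    proof (rule lborel_pair.Fubini_integrable)
      show "integrable lborel (\<lambda>y. \<integral>t. norm (case (y, t) of (y, t) \<Rightarrow>
         complex_of_real (2 * pi * std_normal_density y) * (f t * cnj (f (t - y / n)))) \<partial>lborel)"
      proof (rule Bochner_Integration.integrable_bound)
        show "integrable lborel (\<lambda>y. (2 * pi * nsq f) * std_normal_density y)" by simp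
        show "AE y in lborel. norm (\<integral>t. norm (case (y, t) of (y, t) \<Rightarrow>
           complex_of_real (2 * pi * std_normal_density y) * (f t * cnj (f (t - y / n)))) \<partial>lborel)
           \<le> norm ((2 * pi * nsq f) * std_normal_density y)"
        proof (rule AE_I2)
          fix y
          have "(\<integral>t. norm (complex_of_real (2 * pi * std_normal_density y) * (f t * cnj (f (t - y / n)))) \<partial>lborel)
            = 2 * pi * std_normal_density y * (\<integral>t. cmod (f t) * cmod (f (t - y / n)) \<partial>lborel)"
            by (subst integral_mult_right_zero[symmetric])
               (simp add: norm_mult normal_density_nonneg)
          also have "\<dots> \<le> 2 * pi * std_normal_density y * nsq f"
            by (intro mult_left_mono bd) (simp add: normal_density_nonneg)
          finally show "norm (\<integral>t. norm (case (y, t) of (y, t) \<Rightarrow>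
             complex_of_real (2 * pi * std_normal_density y) * (f t * cnj (f (t - y / n)))) \<partial>lborel)
             \<le> norm ((2 * pi * nsq f) * std_normal_density y)"
            by (simp add: normal_density_nonneg nsq_nonneg mult_ac abs_mult)
        qed
      qed simp
      show "AE y in lborel. integrable lborel (\<lambda>t. case (y, t) of (y, t) \<Rightarrow>
         complex_of_real (2 * pi * std_normal_density y) * (f t * cnj (f (t - y / n))))"
        using L2_prod_cnj_integrable[OF L L2_shift[OF L]] by simp
    qed simp
  qed
  also have "\<dots> = of_real (2 * pi) * (\<integral>y. of_real (std_normal_density y) * ip f (\<lambda>t. f (t - y / n)) \<partial>lborel)"
    unfolding ip_def by (simp flip: integral_mult_right_zero add: mult.assoc)
  finally have "complex_of_real (\<integral>u. (cmod (FT c f u))\<^sup>2 * exp (- (u/n)\<^sup>2 / 2) \<partial>lborel)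
    = of_real (2 * pi) * (\<integral>y. of_real (std_normal_density y) * ip f (\<lambda>t. f (t - y / n)) \<partial>lborel)" .
  from arg_cong[OF this, of Re] show ?thesis by simp
qed

text \<open>Let n grow in \<open>FT_gaussian_mean\<close>. The right side converges by continuity of
  the autocorrelation at 0; on the left the weights increase to 1, so monotone convergence gives the
  value and also the square-integrability of the transform.\<close>

lemma Plancherel_integrable:
  assumes c: "c\<^sup>2 = 1" and L: "L2 f" and I: "integrable lborel f"
  shows "L2 (FT c f)" "nsq (FT c f) = 2 * pi * nsq f"
proof -
  have [measurable]: "f \<in> borel_measurable borel" using L by (simp add: L2_def)
  have "(\<lambda>n. \<integral>y. std_normal_density y * ip f (\<lambda>t. f (t - y / real (Suc n))) \<partial>lborel)
      \<longlonglongrightarrow> (\<integral>y. std_normal_density y * ip f f \<partial>lborel)"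
  proof (rule integral_dominated_convergence)
    show "(\<lambda>y. std_normal_density y * ip f (\<lambda>t. f (t - y / real (Suc n)))) \<in> borel_measurable lborel" for n
      unfolding ip_def by measurable
    show "integrable lborel (\<lambda>y. std_normal_density y * nsq f)" by simp
    show "AE y in lborel. (\<lambda>n. std_normal_density y * ip f (\<lambda>t. f (t - y / real (Suc n))))
        \<longlonglongrightarrow> std_normal_density y * ip f f"
    proof (intro AE_I2 tendsto_intros autocorrelation_tendsto L I)
      fix y :: real
      show "(\<lambda>n. y / real (Suc n)) \<longlonglongrightarrow> 0"
        using LIMSEQ_Suc[OF lim_const_over_n[of y]] .
    qed
    show "AE y in lborel. norm (std_normal_density y * ip f (\<lambda>t. f (t - y / real (Suc n)))) \<le> std_normal_density y * nsq f" for n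
    proof (rule AE_I2)
      fix y
      have "cmod (ip f (\<lambda>t. f (t - y / real (Suc n)))) \<le> nsq f"
        using ip_bound[OF L L2_shift[OF L]] nsq_shift[of f] by (simp add: nsq_nonneg)
      then show "norm (std_normal_density y * ip f (\<lambda>t. f (t - y / real (Suc n)))) \<le> std_normal_density y * nsq f"
        by (simp add: norm_mult normal_density_nonneg mult_left_mono)
    qed
  qed auto
  then have "(\<lambda>n. 2 * pi * Re (\<integral>y. std_normal_density y * ip f (\<lambda>t. f (t - y / real (Suc n))) \<partial>lborel))
      \<longlonglongrightarrow> 2 * pi * Re (\<integral>y. std_normal_density y * ip f f \<partial>lborel)"
    by (intro tendsto_intros)
  also have "(\<integral>y. std_normal_density y * ip f f \<partial>lborel) = nsq f"
    by (simp add: ip_self)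
  finally have lim: "(\<lambda>n. \<integral>u. (cmod (FT c f u))\<^sup>2 * exp (- (u/real (Suc n))\<^sup>2 / 2) \<partial>lborel) \<longlonglongrightarrow> 2 * pi * nsq f"
    by (subst FT_gaussian_mean[OF c _ L I]) auto
  have ii: "integrable lborel (\<lambda>u. (cmod (FT c f u))\<^sup>2 * exp (- (u/real (Suc n))\<^sup>2 / 2))" for n
  proof (rule Bochner_Integration.integrable_bound)
    show "integrable lborel (\<lambda>u. (\<integral>t. cmod (f t) \<partial>lborel)\<^sup>2 * exp (- (u/real (Suc n))\<^sup>2 / 2))"
      by (intro integrable_mult_right integrable_gaussian) simp
    show "AE u in lborel. norm ((cmod (FT c f u))\<^sup>2 * exp (- (u/real (Suc n))\<^sup>2 / 2))
       \<le> norm ((\<integral>t. cmod (f t) \<partial>lborel)\<^sup>2 * exp (- (u/real (Suc n))\<^sup>2 / 2))"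
      using FT_bound[of c f] by (intro AE_I2) (auto simp: abs_mult intro!: mult_right_mono power_mono)
  qed simp
  have mono: "mono (\<lambda>n. (cmod (FT c f u))\<^sup>2 * exp (- (u/real (Suc n))\<^sup>2 / 2))" for u
  proof (rule monoI)
    fix m n :: nat assume "m \<le> n"
    then have "(u / real (Suc n))\<^sup>2 \<le> (u / real (Suc m))\<^sup>2"
      unfolding power_divide by (intro divide_left_mono power_mono) auto
    then show "(cmod (FT c f u))\<^sup>2 * exp (- (u/real (Suc m))\<^sup>2 / 2) \<le> (cmod (FT c f u))\<^sup>2 * exp (- (u/real (Suc n))\<^sup>2 / 2)"
      by (intro mult_left_mono) auto
  qed
  have pt: "(\<lambda>n. (cmod (FT c f u))\<^sup>2 * exp (- (u/real (Suc n))\<^sup>2 / 2)) \<longlonglongrightarrow> (cmod (FT c f u))\<^sup>2" for u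
  proof -
    have "(\<lambda>n. (cmod (FT c f u))\<^sup>2 * exp (- (u/real (Suc n))\<^sup>2 / 2)) \<longlonglongrightarrow> (cmod (FT c f u))\<^sup>2 * exp (- 0\<^sup>2/2)"
      using LIMSEQ_Suc[OF lim_const_over_n[of u]] by (intro tendsto_intros) auto
    then show ?thesis by simp
  qed
  have "integrable lborel (\<lambda>u. (cmod (FT c f u))\<^sup>2)"
    by (rule integral_monotone_convergence_nonneg(1)[OF ii _ _ _ lim]) (use mono pt in auto)
  then show "L2 (FT c f)" by (simp add: L2_def)
  show "nsq (FT c f) = 2 * pi * nsq f"
    unfolding nsq_def[of "FT c f"]
    by (rule integral_monotone_convergence_nonneg(2)[OF ii _ _ _ lim]) (use mono pt in auto)
qed

text \<open>A relation rather than a function: a limit in mean is determined only up to null sets,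
  and \<open>mellin\<close> picks an arbitrary representative.\<close>

definition is_FT :: "real \<Rightarrow> (real \<Rightarrow> complex) \<Rightarrow> (real \<Rightarrow> complex) \<Rightarrow> bool" where
  "is_FT c f g \<longleftrightarrow> L2 f \<and> L2 g \<and> ((\<lambda>R. nsq (\<lambda>u. g u - FT c (trunc R f) u)) \<longlongrightarrow> 0) at_top"

lemma L2_FT_trunc: "c\<^sup>2 = 1 \<Longrightarrow> L2 f \<Longrightarrow> L2 (FT c (trunc R f))"
  by (rule Plancherel_integrable) (auto intro: trunc_L2 trunc_integrable)

lemma nsq_FT_trunc_diff:
  assumes "c\<^sup>2 = 1" "L2 f"
  shows "nsq (\<lambda>u. FT c (trunc R f) u - FT c (trunc S f) u) = 2 * pi * nsq (\<lambda>t. trunc R f t - trunc S f t)"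
proof -
  have "nsq (FT c (\<lambda>t. trunc R f t - trunc S f t)) = 2 * pi * nsq (\<lambda>t. trunc R f t - trunc S f t)"
    by (intro Plancherel_integrable assms L2_diff trunc_L2 Bochner_Integration.integrable_diff trunc_integrable)
  moreover have "FT c (\<lambda>t. trunc R f t - trunc S f t) = (\<lambda>u. FT c (trunc R f) u - FT c (trunc S f) u)"
    by (rule ext) (intro FT_diff trunc_integrable assms)
  ultimately show ?thesis by simp
qed

text \<open>By the isometry the transforms of the truncations are Cauchy in mean square. The limit
  is obtained along integer R, as completeness is about sequences; the Cauchy estimate for real R
  and S then upgrades the convergence.\<close>

lemma FT_exists:
  assumes c: "c\<^sup>2 = 1" and L: "L2 f"
  shows "\<exists>g. is_FT c f g"
proof -
  let ?A = "\<lambda>R. FT c (trunc R f)"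
  have small: "\<exists>N. \<forall>R\<ge>N. \<forall>S\<ge>N. nsq (\<lambda>u. ?A R u - ?A S u) < e" if e: "e > 0" for e
  proof -
    \<comment> \<open>The threshold e / (8 pi) allows for a factor 4 from the triangle inequality
      and a factor 2 pi from Plancherel.\<close>
    have "\<forall>\<^sub>F R in at_top. nsq (\<lambda>t. f t - trunc R f t) < e / (8 * pi)"
      using e by (intro order_tendstoD[OF nsq_trunc_tendsto[OF L]]) auto
    then obtain N where N: "\<And>R. R \<ge> N \<Longrightarrow> nsq (\<lambda>t. f t - trunc R f t) < e / (8 * pi)"
      by (auto simp: eventually_at_top_linorder)
    have "nsq (\<lambda>u. ?A R u - ?A S u) < e" if "R \<ge> N" "S \<ge> N" for R S
    proof -
      have "sqrt (nsq (\<lambda>t. trunc R f t - trunc S f t))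
          \<le> sqrt (nsq (\<lambda>t. trunc R f t - f t)) + sqrt (nsq (\<lambda>t. f t - trunc S f t))"
        by (intro nsq_triangle_diff trunc_L2 L)
      also have "\<dots> < sqrt (e / (8 * pi)) + sqrt (e / (8 * pi))"
        using N[OF that(1)] N[OF that(2)] nsq_minus_commute[of f "trunc R f"]
        by (intro add_strict_mono real_sqrt_less_mono) auto
      also have "\<dots> = sqrt (4 * (e / (8 * pi)))" by (simp only: real_sqrt_mult real_sqrt_four)
      finally show ?thesis
        by (simp add: nsq_FT_trunc_diff[OF c L] field_simps)
    qed
    then show ?thesis by blast
  qed
  have "\<exists>g. L2 g \<and> (\<lambda>n. nsq (\<lambda>x. g x - ?A (real n) x)) \<longlonglongrightarrow> 0"
  proof (rule L2_complete)
    show "L2 (?A (real n))" for n by (rule L2_FT_trunc[OF c L])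
    fix e :: real assume "e > 0"
    from small[OF this] obtain N where N: "\<And>R S. R \<ge> N \<Longrightarrow> S \<ge> N \<Longrightarrow> nsq (\<lambda>u. ?A R u - ?A S u) < e" by blast
    show "\<exists>N. \<forall>m\<ge>N. \<forall>n\<ge>N. nsq (\<lambda>x. ?A (real m) x - ?A (real n) x) < e"
      by (rule exI[of _ "nat \<lceil>N\<rceil>"]) (intro allI impI N; linarith)
  qed
  then obtain g where g: "L2 g" and lim: "(\<lambda>n. nsq (\<lambda>x. g x - ?A (real n) x)) \<longlonglongrightarrow> 0" by blast
  have "((\<lambda>R. nsq (\<lambda>u. g u - ?A R u)) \<longlongrightarrow> 0) at_top"
  proof (rule tendstoI)
    fix e :: real assume e: "e > 0"
    then obtain N where N: "\<And>R S. R \<ge> N \<Longrightarrow> S \<ge> N \<Longrightarrow> nsq (\<lambda>u. ?A R u - ?A S u) < e/4"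
      using small[of "e/4"] by auto
    have "\<forall>\<^sub>F n in sequentially. nsq (\<lambda>x. g x - ?A (real n) x) < e/4 \<and> nat \<lceil>N\<rceil> \<le> n"
      using e by (intro eventually_conj order_tendstoD[OF lim] eventually_ge_at_top) auto
    then obtain n where n: "n \<ge> nat \<lceil>N\<rceil>" "nsq (\<lambda>x. g x - ?A (real n) x) < e/4"
      by (auto dest: eventually_happens)
    show "\<forall>\<^sub>F R in at_top. dist (nsq (\<lambda>u. g u - ?A R u)) 0 < e"
      using eventually_ge_at_top[of N]
    proof eventually_elim
      case (elim R)
      have "sqrt (nsq (\<lambda>u. g u - ?A R u)) \<le> sqrt (nsq (\<lambda>u. g u - ?A (real n) u)) + sqrt (nsq (\<lambda>u. ?A (real n) u - ?A R u))"
        by (intro nsq_triangle_diff g L2_FT_trunc c L)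
      also have "\<dots> < sqrt (e/4) + sqrt (e/4)"
        using n elim by (intro add_strict_mono real_sqrt_less_mono N) linarith+
      also have "\<dots> = sqrt e" by (simp add: real_sqrt_divide)
      finally show ?case by (simp add: nsq_nonneg)
    qed
  qed
  then show ?thesis using g L unfolding is_FT_def by blast
qed

lemma is_FT_L2: "is_FT c f g \<Longrightarrow> L2 f" "is_FT c f g \<Longrightarrow> L2 g"
  by (auto simp: is_FT_def)

lemma is_FT_nsq:
  assumes c: "c\<^sup>2 = 1" and F: "is_FT c f g"
  shows "nsq g = 2 * pi * nsq f"
proof -
  have L: "L2 f" "L2 g" and lim: "((\<lambda>R. nsq (\<lambda>u. g u - FT c (trunc R f) u)) \<longlongrightarrow> 0) at_top"
    using F by (auto simp: is_FT_def)
  have "((\<lambda>R. nsq (FT c (trunc R f))) \<longlongrightarrow> nsq g) at_top"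
    by (rule nsq_tendsto[OF L2_FT_trunc[OF c L(1)] L(2) lim])
  moreover have "nsq (FT c (trunc R f)) = 2 * pi * nsq (trunc R f)" for R
    by (rule Plancherel_integrable[OF c trunc_L2 trunc_integrable]) (rule L)+
  ultimately have "((\<lambda>R. 2 * pi * nsq (trunc R f)) \<longlongrightarrow> nsq g) at_top" by simp
  moreover have "((\<lambda>R. 2 * pi * nsq (trunc R f)) \<longlongrightarrow> 2 * pi * nsq f) at_top"
    by (intro tendsto_mult[OF tendsto_const] nsq_tendsto[OF trunc_L2[OF L(1)] L(1)] nsq_trunc_tendsto[OF L(1)])
  ultimately show ?thesis by (rule tendsto_unique[OF trivial_limit_at_top_linorder])
qed

lemma is_FT_diff:
  assumes c: "c\<^sup>2 = 1" and F: "is_FT c f g" and G: "is_FT c f' g'"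
  shows "is_FT c (\<lambda>t. f t - f' t) (\<lambda>u. g u - g' u)"
proof -
  have L: "L2 f" "L2 g" "L2 f'" "L2 g'" using F G by (auto simp: is_FT_def)
  have eq: "FT c (trunc R (\<lambda>t. f t - f' t)) u = FT c (trunc R f) u - FT c (trunc R f') u" for R u
    using FT_diff[OF trunc_integrable[OF L(1), of R] trunc_integrable[OF L(3), of R]]
    by (simp add: trunc_def right_diff_distrib)
  have "((\<lambda>R. sqrt (nsq (\<lambda>u. g u - FT c (trunc R f) u)) + sqrt (nsq (\<lambda>u. g' u - FT c (trunc R f') u))) \<longlongrightarrow> sqrt 0 + sqrt 0) at_top"
    using F G unfolding is_FT_def by (intro tendsto_add tendsto_real_sqrt) auto
  then have "((\<lambda>R. sqrt (nsq (\<lambda>u. g u - FT c (trunc R f) u)) + sqrt (nsq (\<lambda>u. g' u - FT c (trunc R f') u))) \<longlongrightarrow> 0) at_top"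
    by simp
  moreover have "norm (sqrt (nsq (\<lambda>u. g u - g' u - FT c (trunc R (\<lambda>t. f t - f' t)) u)))
     \<le> sqrt (nsq (\<lambda>u. g u - FT c (trunc R f) u)) + sqrt (nsq (\<lambda>u. g' u - FT c (trunc R f') u))" for R
    using nsq_triangle[of "\<lambda>u. g u - FT c (trunc R f) u" "\<lambda>u. FT c (trunc R f') u - g' u"]
      L2_FT_trunc[OF c L(1)] L2_FT_trunc[OF c L(3)] L nsq_minus_commute[of g' "FT c (trunc R f')"]
    by (simp add: L2_diff eq nsq_nonneg algebra_simps)
  ultimately have "((\<lambda>R. sqrt (nsq (\<lambda>u. g u - g' u - FT c (trunc R (\<lambda>t. f t - f' t)) u))) \<longlongrightarrow> 0) at_top"
    by (rule Lim_null_comparison[OF always_eventually[OF allI], rotated])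
  then have "((\<lambda>R. (sqrt (nsq (\<lambda>u. g u - g' u - FT c (trunc R (\<lambda>t. f t - f' t)) u)))\<^sup>2) \<longlongrightarrow> 0\<^sup>2) at_top"
    by (intro tendsto_power)
  then show ?thesis using L by (simp add: is_FT_def L2_diff nsq_nonneg)
qed

lemma is_FT_cmult:
  assumes F: "is_FT c f g" shows "is_FT c (\<lambda>t. k * f t) (\<lambda>u. k * g u)"
proof -
  have L: "L2 f" "L2 g" using F by (auto simp: is_FT_def)
  have eq: "k * g u - FT c (trunc R (\<lambda>t. k * f t)) u = k * (g u - FT c (trunc R f) u)" for R u
    using FT_cmult[of c k "trunc R f" u] by (simp add: trunc_def right_diff_distrib mult.left_commute)
  have "((\<lambda>R. (cmod k)\<^sup>2 * nsq (\<lambda>u. g u - FT c (trunc R f) u)) \<longlongrightarrow> (cmod k)\<^sup>2 * 0) at_top"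
    using F unfolding is_FT_def by (intro tendsto_mult tendsto_const) auto
  then show ?thesis using L by (simp add: is_FT_def eq nsq_cmult L2_cmult)
qed

lemma is_FT_add:
  assumes c: "c\<^sup>2 = 1" and F: "is_FT c f g" and G: "is_FT c f' g'"
  shows "is_FT c (\<lambda>t. f t + f' t) (\<lambda>u. g u + g' u)"
  using is_FT_diff[OF c F is_FT_cmult[OF G, of "-1"]] by simp

lemma is_FT_AE_cong:
  assumes F: "is_FT c f g" and "AE u in lborel. g u = g' u" "g' \<in> borel_measurable borel"
  shows "is_FT c f g'"
proof -
  have L: "L2 f" "L2 g" using F by (auto simp: is_FT_def)
  have [measurable]: "f \<in> borel_measurable borel" "g \<in> borel_measurable borel" "g' \<in> borel_measurable borel"
    using L assms(3) by (auto simp: L2_def)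
  have "nsq (\<lambda>u. g' u - FT c (trunc R f) u) = nsq (\<lambda>u. g u - FT c (trunc R f) u)" for R
  proof (rule nsq_AE_cong)
    show "AE u in lborel. g' u - FT c (trunc R f) u = g u - FT c (trunc R f) u"
      using assms(2) by eventually_elim simp
    have [measurable]: "trunc R f \<in> borel_measurable borel" unfolding trunc_def by measurable
    show "(\<lambda>u. g' u - FT c (trunc R f) u) \<in> borel_measurable borel"
      "(\<lambda>u. g u - FT c (trunc R f) u) \<in> borel_measurable borel" by measurable
  qed
  then show ?thesis using F L2_AE_cong[OF L(2) assms(2,3)] by (simp add: is_FT_def)
qed

lemma is_FT_unique:
  assumes c: "c\<^sup>2 = 1" and F: "is_FT c f g" and G: "is_FT c f g'"
  shows "AE u in lborel. g u = g' u"
proof -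
  have "nsq (\<lambda>u. g u - g' u) = 2 * pi * nsq (\<lambda>t. f t - f t)"
    by (rule is_FT_nsq[OF c is_FT_diff[OF c F G]])
  then have "AE u in lborel. g u - g' u = 0"
    using F G by (intro nsq_tendsto_AE0 L2_diff) (auto simp: is_FT_def nsq_def)
  then show ?thesis by simp
qed

text \<open>Polarization: the real part of the inner product is determined by the norms, the
  imaginary part by replacing the second function by \<open>\<i>\<close> times it.\<close>
lemma is_FT_ip:
  assumes c: "c\<^sup>2 = 1" and F: "is_FT c f g" and G: "is_FT c f' g'"
  shows "ip g g' = 2 * pi * ip f f'"
proof -
  have exp: "nsq (\<lambda>x. p x + q x) = nsq p + nsq q + 2 * Re (ip p q)" if "L2 p" "L2 q" for p q
  proof -
    have "of_real (nsq (\<lambda>x. p x + q x)) = ip (\<lambda>x. p x + q x) (\<lambda>x. p x + q x)" by (simp add: ip_self)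
    also have "\<dots> = (ip p p + ip p q) + (ip q p + ip q q)"
      using that by (simp add: ip_add_left ip_add_right L2_add)
    also have "\<dots> = of_real (nsq p) + of_real (nsq q) + (ip p q + cnj (ip p q))"
      using ip_commute[of q p] by (simp add: ip_self)
    finally have "Re (of_real (nsq (\<lambda>x. p x + q x))) = Re (of_real (nsq p) + of_real (nsq q) + (ip p q + cnj (ip p q)))"
      by simp
    then show ?thesis by simp
  qed
  have re: "Re (ip p p') = 2 * pi * Re (ip q q')" if "is_FT c q p" "is_FT c q' p'" for p q p' q'
    using exp[OF is_FT_L2(2)[OF that(1)] is_FT_L2(2)[OF that(2)]]
      exp[OF is_FT_L2(1)[OF that(1)] is_FT_L2(1)[OF that(2)]]
      is_FT_nsq[OF c that(1)] is_FT_nsq[OF c that(2)] is_FT_nsq[OF c is_FT_add[OF c that]]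
    by (simp add: algebra_simps)
  show ?thesis
  proof (rule complex_eqI)
    show "Re (ip g g') = Re (2 * pi * ip f f')" using re[OF F G] by simp
    show "Im (ip g g') = Im (2 * pi * ip f f')"
      using re[OF F is_FT_cmult[OF G, of \<i>]] by (simp add: ip_cmult_right)
  qed
qed

lemma is_FT_integrable:
  assumes c: "c\<^sup>2 = 1" and L: "L2 f" and I: "integrable lborel f"
  shows "is_FT c f (FT c f)"
proof -
  have "nsq (\<lambda>u. FT c f u - FT c (trunc R f) u) = 2 * pi * nsq (\<lambda>t. f t - trunc R f t)" for R
  proof -
    have "nsq (FT c (\<lambda>t. f t - trunc R f t)) = 2 * pi * nsq (\<lambda>t. f t - trunc R f t)"
      by (intro Plancherel_integrable c L2_diff L trunc_L2 Bochner_Integration.integrable_diff I trunc_integrable)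
    moreover have "FT c (\<lambda>t. f t - trunc R f t) = (\<lambda>u. FT c f u - FT c (trunc R f) u)"
      by (rule ext) (intro FT_diff I trunc_integrable L)
    ultimately show ?thesis by simp
  qed
  moreover have "((\<lambda>R. 2 * pi * nsq (\<lambda>t. f t - trunc R f t)) \<longlongrightarrow> 2 * pi * 0) at_top"
    by (intro tendsto_intros nsq_trunc_tendsto L)
  ultimately show ?thesis using L Plancherel_integrable(1)[OF c L I] by (simp add: is_FT_def)
qed

text \<open>For functions truncated on both sides this is Fubini. The truncation of b is removed
  first with R fixed, then that of f, each time by continuity of the inner product.\<close>

lemma is_FT_adjoint:
  assumes c: "c\<^sup>2 = 1" and F: "is_FT c f g" and G: "is_FT (-c) b a"
  shows "ip g b = ip f a"
proof -
  have c': "(-c)\<^sup>2 = 1" using c by simp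
  have L: "L2 f" "L2 g" "L2 a" "L2 b" using F G by (auto simp: is_FT_def)
  have swap: "ip (FT c (trunc R f)) (trunc S b) = ip (trunc R f) (FT (-c) (trunc S b))" for R S
  proof -
    have "ip (FT c (trunc R f)) (trunc S b)
      = (\<integral>u. cnj (trunc S b u) * (\<integral>t. trunc R f t * cis (c * u * t) \<partial>lborel) \<partial>lborel)"
      unfolding ip_def FT_def by (simp add: mult.commute)
    also have "\<dots> = (\<integral>t. trunc R f t * (\<integral>u. cnj (trunc S b u) * cis (c * u * t) \<partial>lborel) \<partial>lborel)"
      by (rule fubini_prod[where a="\<lambda>u. cnj (trunc S b u)" and b="trunc R f" and k="\<lambda>u t. cis (c * u * t)" and C=1])
         (use trunc_integrable[OF L(1)] trunc_integrable[OF L(4)] in auto)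
    also have "\<dots> = ip (trunc R f) (FT (-c) (trunc S b))"
    proof -
      have "(\<integral>u. cnj (trunc S b u) * cis (c * u * t) \<partial>lborel) = cnj (FT (-c) (trunc S b) t)" for t
        unfolding FT_def by (subst Bochner_Integration.integral_cnj[symmetric]) (simp add: cis_cnj mult_ac)
      then show ?thesis by (simp add: ip_def)
    qed
    finally show ?thesis .
  qed
  have "((\<lambda>S. ip (trunc S b) (FT c (trunc R f))) \<longlongrightarrow> ip b (FT c (trunc R f))) at_top" for R
    by (rule ip_tendsto[OF trunc_L2 L(4) L2_FT_trunc[OF c L(1)] nsq_trunc_tendsto[OF L(4)]]) (rule L)
  moreover have "((\<lambda>S. ip (FT (-c) (trunc S b)) (trunc R f)) \<longlongrightarrow> ip a (trunc R f)) at_top" for R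
    using G by (intro ip_tendsto L2_FT_trunc[OF c'] L trunc_L2) (auto simp: is_FT_def)
  moreover have "ip (trunc S b) (FT c (trunc R f)) = ip (FT (-c) (trunc S b)) (trunc R f)" for R S
    using swap[of R S] ip_commute[of "trunc S b"] ip_commute[of "FT (-c) (trunc S b)"] by simp
  ultimately have lims: "((\<lambda>S. ip (FT (-c) (trunc S b)) (trunc R f)) \<longlongrightarrow> ip b (FT c (trunc R f))) at_top"
    "((\<lambda>S. ip (FT (-c) (trunc S b)) (trunc R f)) \<longlongrightarrow> ip a (trunc R f)) at_top" for R
    by simp_all
  have 1: "ip b (FT c (trunc R f)) = ip a (trunc R f)" for R
    by (rule tendsto_unique[OF trivial_limit_at_top_linorder lims])
  have "((\<lambda>R. ip (FT c (trunc R f)) b) \<longlongrightarrow> ip g b) at_top"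
    using F by (intro ip_tendsto L2_FT_trunc[OF c] L) (auto simp: is_FT_def)
  moreover have "ip (FT c (trunc R f)) b = ip (trunc R f) a" for R
    using 1[of R] ip_commute[of "FT c (trunc R f)"] ip_commute[of "trunc R f"] by simp
  ultimately have "((\<lambda>R. ip (trunc R f) a) \<longlongrightarrow> ip g b) at_top" by simp
  moreover have "((\<lambda>R. ip (trunc R f) a) \<longlongrightarrow> ip f a) at_top"
    by (rule ip_tendsto[OF trunc_L2 L(1) L(3) nsq_trunc_tendsto[OF L(1)]]) (rule L)
  ultimately show ?thesis by (rule tendsto_unique[OF trivial_limit_at_top_linorder])
qed

text \<open>Fourier inversion from the isometry and the adjoint relation alone: expanding
  \<open>\<parallel>F\<^sup>*g - 2\<pi>f\<parallel>\<^sup>2\<close> gives \<open>4\<pi>\<^sup>2 - 8\<pi>\<^sup>2 + 4\<pi>\<^sup>2 = 0\<close> times \<open>\<parallel>f\<parallel>\<^sup>2\<close>.\<close>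
lemma is_FT_inverse:
  assumes c: "c\<^sup>2 = 1" and F: "is_FT c f g"
  shows "is_FT (-c) g (\<lambda>t. of_real (2 * pi) * f t)"
proof -
  have c': "(-c)\<^sup>2 = 1" using c by simp
  have L: "L2 f" "L2 g" using F by (auto simp: is_FT_def)
  obtain b where b: "is_FT (-c) g b" using FT_exists[OF c' L(2)] by blast
  have Lb: "L2 b" using b by (auto simp: is_FT_def)
  have 1: "ip f b = of_real (2 * pi * nsq f)"
    using is_FT_adjoint[OF c F b] is_FT_nsq[OF c F] by (simp add: ip_self)
  then have 2: "ip b f = of_real (2 * pi * nsq f)" using ip_commute[of b f] by simp
  have 3: "ip b b = of_real (2 * pi * (2 * pi * nsq f))"
    using is_FT_nsq[OF c' b] is_FT_nsq[OF c F] by (simp add: ip_self)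
  have "of_real (nsq (\<lambda>t. b t - of_real (2 * pi) * f t)) = ip (\<lambda>t. b t - of_real (2 * pi) * f t) (\<lambda>t. b t - of_real (2 * pi) * f t)"
    by (simp add: ip_self)
  also have "\<dots> = ip b b - of_real (2 * pi) * ip b f - of_real (2 * pi) * ip f b + of_real (2 * pi) * of_real (2 * pi) * ip f f"
    using L Lb L2_cmult[OF L(1), of "of_real (2 * pi)"]
    by (simp add: ip_diff_left ip_diff_right L2_diff ip_cmult_left[of "2 * of_real pi" f] ip_cmult_right[of _ "2 * of_real pi" f] ring_distribs)
  also have "\<dots> = 0" unfolding 1 2 3 ip_self[of f] by (simp add: algebra_simps)
  finally have "nsq (\<lambda>t. b t - of_real (2 * pi) * f t) = 0" by simp
  then have "AE t in lborel. b t - of_real (2 * pi) * f t = 0"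
    by (intro nsq_tendsto_AE0 L2_diff Lb L2_cmult L)
  then have "AE t in lborel. b t = of_real (2 * pi) * f t" by simp
  then show ?thesis
    by (rule is_FT_AE_cong[OF b]) (use L in \<open>auto simp: L2_def\<close>)
qed

section \<open>Differentiation and holomorphy of parameter integrals\<close>

text \<open>Cauchy's inequality turns the domination of \<open>f x\<close> into a domination of its difference
  quotients, so that dominated convergence applies to them.\<close>
lemma has_field_derivative_integral:
  fixes f :: "'a \<Rightarrow> complex \<Rightarrow> complex"
  assumes S: "open S"
    and meas: "\<And>z. z \<in> S \<Longrightarrow> (\<lambda>x. f x z) \<in> borel_measurable M"
    and hol: "\<And>x. x \<in> space M \<Longrightarrow> f x holomorphic_on S"
    and dom: "\<And>z. z \<in> S \<Longrightarrow> \<exists>r>0. \<exists>B. cball z r \<subseteq> S \<and> integrable M B \<and>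
                (\<forall>x\<in>space M. \<forall>w\<in>cball z r. cmod (f x w) \<le> B x)"
    and z: "z \<in> S"
  shows "((\<lambda>z. \<integral>x. f x z \<partial>M) has_field_derivative (\<integral>x. deriv (f x) z \<partial>M)) (at z)"
proof -
  obtain r B where r: "r > 0" and sub: "cball z r \<subseteq> S" and B: "integrable M B"
    and bd: "\<And>x w. x \<in> space M \<Longrightarrow> w \<in> cball z r \<Longrightarrow> cmod (f x w) \<le> B x"
    using dom[OF z] by blast
  have int: "integrable M (\<lambda>x. f x w)" if "w \<in> cball z r" for w
    by (rule Bochner_Integration.integrable_bound[OF B])
       (use that sub meas bd in \<open>auto intro!: AE_I2 intro: order_trans[OF bd abs_ge_self]\<close>)
  \<comment> \<open>Around a point v of the half-size disc, the disc of radius r / 2 still lies in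
    \<open>cball z r\<close>, so Cauchy's inequality bounds the derivative at v by 2 B x /
    r.\<close>
  have lip: "cmod (f x w - f x z) \<le> (2 * B x / r) * cmod (w - z)"
    if x: "x \<in> space M" and w: "w \<in> ball z (r/2)" for x w
  proof (rule field_differentiable_bound[where S="ball z (r/2)" and f'="deriv (f x)"])
    have "cball z r \<subseteq> S" by fact
    then have hb: "f x holomorphic_on cball z r" using hol[OF x] holomorphic_on_subset by blast
    show "(f x has_field_derivative deriv (f x) v) (at v within ball z (r/2))" if "v \<in> ball z (r/2)" for v
      using that sub r holomorphic_derivI[OF hol[OF x] S, of v]
      by (auto intro!: has_field_derivative_at_within simp: subset_eq)
    show "norm (deriv (f x) v) \<le> 2 * B x / r" if v: "v \<in> ball z (r/2)" for v
    proof -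
      have vs: "cball v (r/2) \<subseteq> cball z r"
      proof
        fix y assume "y \<in> cball v (r/2)"
        then show "y \<in> cball z r" using v dist_triangle[of z y v] by auto
      qed
      have "norm ((deriv ^^ 1) (f x) v) \<le> fact 1 * B x / (r/2) ^ 1"
      proof (rule Cauchy_inequality)
        show "f x holomorphic_on ball v (r/2)"
          using hb vs by (meson ball_subset_cball holomorphic_on_subset order_trans)
        show "continuous_on (cball v (r/2)) (f x)"
          using holomorphic_on_imp_continuous_on[OF holomorphic_on_subset[OF hb vs]] .
        show "norm (f x y) \<le> B x" if "norm (v - y) = r/2" for y
          using that vs by (intro bd x) (auto simp: dist_norm)
      qed (use r in auto)
      then show ?thesis by (simp add: mult.commute)
    qed
  qed (use w r in auto)
  let ?D = "\<lambda>x. deriv (f x) z"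
  have "((\<lambda>w. ((\<integral>x. f x w \<partial>M) - (\<integral>x. f x z \<partial>M)) / (w - z)) \<longlongrightarrow> (\<integral>x. ?D x \<partial>M)) (at z)"
  proof (rule tendsto_at_iff_sequentially[THEN iffD2], intro allI impI)
    fix X :: "nat \<Rightarrow> complex" assume X: "\<forall>i. X i \<in> UNIV - {z}" and Xlim: "X \<longlonglongrightarrow> z"
    have "\<forall>\<^sub>F i in sequentially. X i \<in> ball z (r/2)"
      using Xlim r by (intro topological_tendstoD) auto
    then obtain N where N: "\<And>i. i \<ge> N \<Longrightarrow> X i \<in> ball z (r/2)" by (auto simp: eventually_sequentially)
    define Y where "Y i = X (i + N)" for i
    have Y: "Y i \<noteq> z" "Y i \<in> ball z (r/2)" for i using X N by (auto simp: Y_def)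
    have Yc: "Y i \<in> cball z r" for i using Y(2)[of i] r by auto
    have Ylim: "Y \<longlonglongrightarrow> z" unfolding Y_def using LIMSEQ_ignore_initial_segment[OF Xlim] .
    have Yat: "filterlim Y (at z) sequentially"
      using Ylim Y(1) by (simp add: filterlim_at)
    have lim: "(\<lambda>i. (f x (Y i) - f x z) / (Y i - z)) \<longlonglongrightarrow> ?D x" if x: "x \<in> space M" for x
    proof -
      have "(f x has_field_derivative ?D x) (at z)" by (rule holomorphic_derivI[OF hol[OF x] S z])
      then have "((\<lambda>w. (f x w - f x z) / (w - z)) \<longlongrightarrow> ?D x) (at z)"
        by (simp add: has_field_derivative_iff)
      then show ?thesis by (rule filterlim_compose[OF _ Yat])
    qed
    have mq: "(\<lambda>x. (f x (Y i) - f x z) / (Y i - z)) \<in> borel_measurable M" for i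
    proof -
      have "Y i \<in> S" using Yc[of i] sub by blast
      from meas[OF this] meas[OF z] show ?thesis by measurable
    qed
    have lm: "(\<lambda>i. \<integral>x. (f x (Y i) - f x z) / (Y i - z) \<partial>M) \<longlonglongrightarrow> (\<integral>x. ?D x \<partial>M)"
    proof (rule integral_dominated_convergence)
      show "?D \<in> borel_measurable M" by (rule borel_measurable_LIMSEQ_metric[OF mq lim])
      show "integrable M (\<lambda>x. 2 * B x / r)" using B by simp
      show "AE x in M. (\<lambda>i. (f x (Y i) - f x z) / (Y i - z)) \<longlonglongrightarrow> ?D x" using lim by auto
      show "AE x in M. norm ((f x (Y i) - f x z) / (Y i - z)) \<le> 2 * B x / r" for i
        using lip[OF _ Y(2)[of i]] Y(1)[of i] by (auto simp: norm_divide pos_divide_le_eq)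
    qed (rule mq)
    have eq: "(\<integral>x. (f x (Y i) - f x z) / (Y i - z) \<partial>M) = ((\<integral>x. f x (Y i) \<partial>M) - (\<integral>x. f x z \<partial>M)) / (Y i - z)" for i
      using int[OF Yc[of i]] int[of z] r by simp
    have "(\<lambda>i. ((\<integral>x. f x (X (i + N)) \<partial>M) - (\<integral>x. f x z \<partial>M)) / (X (i + N) - z)) \<longlonglongrightarrow> (\<integral>x. ?D x \<partial>M)"
      by (rule lm[unfolded eq, unfolded Y_def])
    then show "((\<lambda>w. ((\<integral>x. f x w \<partial>M) - (\<integral>x. f x z \<partial>M)) / (w - z)) \<circ> X) \<longlonglongrightarrow> (\<integral>x. ?D x \<partial>M)"
      unfolding o_def by (rule LIMSEQ_offset)
  qed
  then show ?thesis by (simp add: has_field_derivative_iff)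
qed

lemma holomorphic_on_integral:
  fixes f :: "'a \<Rightarrow> complex \<Rightarrow> complex"
  assumes "open S"
    and "\<And>z. z \<in> S \<Longrightarrow> (\<lambda>x. f x z) \<in> borel_measurable M"
    and "\<And>x. x \<in> space M \<Longrightarrow> f x holomorphic_on S"
    and "\<And>z. z \<in> S \<Longrightarrow> \<exists>r>0. \<exists>B. cball z r \<subseteq> S \<and> integrable M B \<and>
                (\<forall>x\<in>space M. \<forall>w\<in>cball z r. cmod (f x w) \<le> B x)"
  shows "(\<lambda>z. \<integral>x. f x z \<partial>M) holomorphic_on S"
  unfolding holomorphic_on_def field_differentiable_def
  using has_field_derivative_integral[OF assms] has_field_derivative_at_within by blast

section \<open>The substitution x = e^r\<close>

text \<open>Substitution on the compact intervals [e^(-n), e^n], followed by monotone convergence on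
  both sides.\<close>

lemma nn_integral_exp_subst:
  fixes f :: "real \<Rightarrow> ennreal"
  assumes [measurable]: "f \<in> borel_measurable borel"
  shows "(\<integral>\<^sup>+x. f x * indicator {0<..} x \<partial>lborel) = (\<integral>\<^sup>+r. f (exp r) * ennreal (exp r) \<partial>lborel)"
proof -
  have "(\<lambda>n. \<integral>\<^sup>+x. f x * indicator {exp (- real (Suc n))..exp (real (Suc n))} x \<partial>lborel)
      \<longlonglongrightarrow> (\<integral>\<^sup>+x. f x * indicator {0<..} x \<partial>lborel)"
  proof (rule nn_integral_LIMSEQ)
    show "incseq (\<lambda>n x. f x * indicator {exp (- real (Suc n))..exp (real (Suc n))} x)"
    proof (intro incseq_SucI le_funI mult_left_mono)
      fix n :: nat and x :: real
      have "{exp (- real (Suc n))..exp (real (Suc n))} \<subseteq> {exp (- real (Suc (Suc n)))..exp (real (Suc (Suc n)))}"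
        by (intro atLeastatMost_subset_iff[THEN iffD2]) auto
      then show "indicator {exp (- real (Suc n))..exp (real (Suc n))} x \<le>
         (indicator {exp (- real (Suc (Suc n)))..exp (real (Suc (Suc n)))} x :: ennreal)"
        by (intro indicator_leI) (rule subsetD)
    qed simp
    show "(\<lambda>n. f x * indicator {exp (- real (Suc n))..exp (real (Suc n))} x) \<longlonglongrightarrow> f x * indicator {0<..} x" for x
    proof (rule tendsto_eventually)
      show "\<forall>\<^sub>F n in sequentially. f x * indicator {exp (- real (Suc n))..exp (real (Suc n))} x = f x * indicator {0<..} x"
      proof (cases "x > 0")
        case True
        show ?thesis
          using eventually_ge_at_top[of "nat \<lceil>\<bar>ln x\<bar>\<rceil>"]
        proof eventually_elim
          case (elim n)
          then have "\<bar>ln x\<bar> \<le> real (Suc n)" by linarith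
          then have "exp (- real (Suc n)) \<le> exp (ln x)" "exp (ln x) \<le> exp (real (Suc n))" by auto
          then show ?case using True by simp
        qed
      next
        case False
        then have "x \<notin> {exp (- real (Suc n))..exp (real (Suc n))}" for n
          using exp_gt_zero[of "- real (Suc n)"] by (auto simp del: exp_gt_zero)
        then show ?thesis using False by simp
      qed
    qed
  qed simp
  moreover have "(\<lambda>n. \<integral>\<^sup>+r. f (exp r) * ennreal (exp r) * indicator {- real (Suc n)..real (Suc n)} r \<partial>lborel)
      \<longlonglongrightarrow> (\<integral>\<^sup>+r. f (exp r) * ennreal (exp r) \<partial>lborel)"
  proof (rule nn_integral_LIMSEQ)
    show "incseq (\<lambda>n r. f (exp r) * ennreal (exp r) * indicator {- real (Suc n)..real (Suc n)} r)"
      by (intro incseq_SucI le_funI mult_left_mono) (auto split: split_indicator)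
    show "(\<lambda>n. f (exp r) * ennreal (exp r) * indicator {- real (Suc n)..real (Suc n)} r) \<longlonglongrightarrow> f (exp r) * ennreal (exp r)" for r
    proof (rule tendsto_eventually)
      show "\<forall>\<^sub>F n in sequentially. f (exp r) * ennreal (exp r) * indicator {- real (Suc n)..real (Suc n)} r = f (exp r) * ennreal (exp r)"
        using eventually_ge_at_top[of "nat \<lceil>\<bar>r\<bar>\<rceil>"]
      proof eventually_elim
        case (elim n)
        then have "\<bar>r\<bar> \<le> real (Suc n)" by linarith
        then show ?case by (simp add: abs_le_iff)
      qed
    qed
  qed simp
  moreover have "(\<integral>\<^sup>+x. f x * indicator {exp (- real (Suc n))..exp (real (Suc n))} x \<partial>lborel)
     = (\<integral>\<^sup>+r. f (exp r) * ennreal (exp r) * indicator {- real (Suc n)..real (Suc n)} r \<partial>lborel)" for n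
    by (rule nn_integral_substitution_aux) (auto intro!: continuous_intros derivative_eq_intros)
  ultimately show ?thesis using LIMSEQ_unique by simp
qed

lemma integrable_exp_subst:
  fixes f :: "real \<Rightarrow> 'b::{banach, second_countable_topology}"
  assumes [measurable]: "f \<in> borel_measurable borel"
  shows "integrable lborel (\<lambda>x. indicator {0<..} x *\<^sub>R f x) \<longleftrightarrow> integrable lborel (\<lambda>r. exp r *\<^sub>R f (exp r))"
proof -
  have "(\<integral>\<^sup>+x. ennreal (norm (indicator {0<..} x *\<^sub>R f x)) \<partial>lborel) = (\<integral>\<^sup>+x. ennreal (norm (f x)) * indicator {0<..} x \<partial>lborel)"
    by (rule nn_integral_cong) (auto simp: indicator_def)
  also have "\<dots> = (\<integral>\<^sup>+r. ennreal (norm (exp r *\<^sub>R f (exp r))) \<partial>lborel)"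
    by (subst nn_integral_exp_subst) (auto intro!: nn_integral_cong simp: ennreal_mult mult.commute)
  finally show ?thesis by (simp add: integrable_iff_bounded)
qed

text \<open>With the substitution expressed as an identity of measures, its versions for Bochner
  integrals and for almost everywhere statements follow from the rules on \<open>density\<close> and
  \<open>distr\<close>.\<close>

lemma exp_lborel_measure:
  "density lborel (\<lambda>x. indicator {0<..} x) = distr (density lborel (\<lambda>r. ennreal (exp r))) borel exp"
proof (rule measure_eqI)
  fix A assume "A \<in> sets (density lborel (\<lambda>x::real. indicator {0<..} x))"
  then have [measurable]: "A \<in> sets borel" by simp
  have eA: "(exp -` A :: real set) \<in> sets borel"
    using measurable_sets[of exp borel borel A] by simp
  have "emeasure (density lborel (\<lambda>x. indicator {0<..} x)) A = (\<integral>\<^sup>+x. indicator A x * indicator {0<..} x \<partial>lborel)"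
    by (subst emeasure_density) (auto simp: mult.commute)
  also have "\<dots> = (\<integral>\<^sup>+r. indicator A (exp r) * ennreal (exp r) \<partial>lborel)"
    by (rule nn_integral_exp_subst) simp
  also have "\<dots> = emeasure (distr (density lborel (\<lambda>r. ennreal (exp r))) borel exp) A"
    by (subst emeasure_distr, simp, simp, subst emeasure_density)
       (use eA in \<open>auto intro!: nn_integral_cong simp: mult.commute indicator_def\<close>)
  finally show "emeasure (density lborel (\<lambda>x. indicator {0<..} x)) A
     = emeasure (distr (density lborel (\<lambda>r. ennreal (exp r))) borel exp) A" .
qed simp

lemma integral_exp_subst:
  fixes f :: "real \<Rightarrow> 'b::{banach, second_countable_topology}"
  assumes [measurable]: "f \<in> borel_measurable borel"
  shows "(\<integral>x. indicator {0<..} x *\<^sub>R f x \<partial>lborel) = (\<integral>r. exp r *\<^sub>R f (exp r) \<partial>lborel)"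
proof -
  have "(\<integral>x. indicator {0<..} x *\<^sub>R f x \<partial>lborel) = (\<integral>x. f x \<partial>density lborel (\<lambda>x. ennreal (indicator {0<..} x)))"
    by (subst integral_density) auto
  also have "(\<lambda>x. ennreal (indicator {0<..} x)) = (\<lambda>x::real. indicator {0<..} x)"
    by (auto simp: indicator_def)
  also have "(\<integral>x. f x \<partial>density lborel (\<lambda>x. indicator {0<..} x)) = (\<integral>r. exp r *\<^sub>R f (exp r) \<partial>lborel)"
    unfolding exp_lborel_measure by (simp add: integral_distr integral_density)
  finally show ?thesis .
qed

lemma AE_exp_subst:
  fixes P :: "real \<Rightarrow> bool"
  assumes [measurable]: "Measurable.pred borel P"
  shows "(AE x in lborel. 0 < x \<longrightarrow> P x) \<longleftrightarrow> (AE r in lborel. P (exp r))"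
proof -
  have "(AE x in lborel. 0 < x \<longrightarrow> P x) \<longleftrightarrow> (AE x in density lborel (\<lambda>x. indicator {0<..} x). P x)"
    by (subst AE_density) (auto simp: indicator_def)
  also have "\<dots> \<longleftrightarrow> (AE r in density lborel (\<lambda>r. ennreal (exp r)). P (exp r))"
    unfolding exp_lborel_measure by (subst AE_distr_iff) auto
  also have "\<dots> \<longleftrightarrow> (AE r in lborel. P (exp r))"
    by (subst AE_density) auto
  finally show ?thesis .
qed

section \<open>The Riemann-Lebesgue lemma and pointwise convergence of Fourier sums\<close>

lemma integrable_complex_indicator_Icc: "integrable lborel (\<lambda>x. indicator {a..b::real} x :: complex)"
  using L2_prod_integrable[OF L2_indicator_Icc[of a b] L2_indicator_Icc[of a b]]
  by (simp flip: indicator_inter_arith)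

text \<open>Translation by half a period pi / u reverses the sign of the transform, so twice the
  transform is the transform of g minus its translate. As pi / u <= 1, that difference lives on
  [-1, 2], whose length gives the constant sqrt 3 in Cauchy-Schwarz.\<close>

lemma Riemann_Lebesgue_aux:
  assumes L: "L2 g" and I: "integrable lborel g" and supp: "\<And>t. t \<notin> {0..1} \<Longrightarrow> g t = 0"
    and c: "c\<^sup>2 = 1" and u: "u \<ge> pi"
  shows "2 * cmod (FT c g u) \<le> sqrt (nsq (\<lambda>t. g t - g (t - pi / u))) * sqrt 3"
proof -
  have u0: "u > 0" using u pi_gt_zero by linarith
  let ?r = "pi / u"
  have r: "0 \<le> ?r" "?r \<le> 1" using u u0 by auto
  have c1: "c = 1 \<or> c = -1" using c by (simp add: power2_eq_1_iff)
  have Ls: "L2 (\<lambda>t. g (t - ?r))" by (rule L2_shift[OF L])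
  have Is: "integrable lborel (\<lambda>t. g (t - ?r))"
    using lborel_integrable_real_affine[OF I, of 1 "- ?r"] by (simp add: add.commute)
  have "FT c (\<lambda>t. g (t - ?r)) u = (\<integral>t. g t * cis (c * u * (t + ?r)) \<partial>lborel)"
    unfolding FT_def by (subst lborel_integral_real_affine[of 1 _ ?r]) (auto simp: add.commute)
  also have "\<dots> = (\<integral>t. - (g t * cis (c * u * t)) \<partial>lborel)"
  proof (rule Bochner_Integration.integral_cong[OF refl])
    fix t
    have "c * u * (t + ?r) = c * u * t + c * pi" using u0 by (simp add: distrib_left)
    moreover have "cis (c * pi) = -1" using c1 by (auto simp: complex_eq_iff)
    ultimately show "g t * cis (c * u * (t + ?r)) = - (g t * cis (c * u * t))"
      by (simp flip: cis_mult)
  qed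
  also have "\<dots> = - FT c g u" by (simp add: FT_def)
  finally have "FT c (\<lambda>t. g t - g (t - ?r)) u = 2 * FT c g u"
    using FT_diff[OF I Is, of c u] by simp
  then have "2 * cmod (FT c g u) = cmod (FT c (\<lambda>t. g t - g (t - ?r)) u)"
    by (simp add: norm_mult)
  also have "\<dots> \<le> (\<integral>t. cmod (g t - g (t - ?r)) \<partial>lborel)" by (rule FT_bound)
  also have "\<dots> = (\<integral>t. cmod (g t - g (t - ?r)) * cmod (indicator {-1..2} t) \<partial>lborel)"
  proof (rule Bochner_Integration.integral_cong[OF refl])
    fix t
    show "cmod (g t - g (t - ?r)) = cmod (g t - g (t - ?r)) * cmod (indicator {-1..2} t)"
    proof (cases "t \<in> {-1..2}")
      case False
      then have "t \<notin> {0..1}" "t - ?r \<notin> {0..1}" using r by auto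
      then show ?thesis using supp by simp
    qed simp
  qed
  also have "\<dots> \<le> sqrt (nsq (\<lambda>t. g t - g (t - ?r))) * sqrt (nsq (indicator {-1..2}))"
    by (intro L2_Cauchy_Schwarz L2_diff L Ls L2_indicator_Icc)
  also have "nsq (indicator {-1..2}) = 3"
  proof -
    have "nsq (indicator {-1..2}) = (\<integral>x. indicator {-1..2} x \<partial>(lborel::real measure))"
      unfolding nsq_def by (rule Bochner_Integration.integral_cong) (auto simp: indicator_def)
    then show ?thesis by simp
  qed
  finally show ?thesis .
qed

text \<open>Expanding the squared norm of g minus its translate through \<open>ip\<close> reduces
  the claim to \<open>autocorrelation_tendsto\<close>.\<close>

lemma Riemann_Lebesgue:
  assumes L: "L2 g" and I: "integrable lborel g" and supp: "\<And>t. t \<notin> {0..1} \<Longrightarrow> g t = 0"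
    and c: "c\<^sup>2 = 1" and u: "filterlim u at_top sequentially"
  shows "(\<lambda>n. FT c g (u n)) \<longlonglongrightarrow> 0"
proof -
  let ?r = "\<lambda>n. pi / u n"
  have r: "?r \<longlonglongrightarrow> 0" by (rule real_tendsto_divide_at_top[OF tendsto_const u])
  have nsq_eq: "nsq (\<lambda>t. g t - g (t - s)) = 2 * nsq g - 2 * Re (ip g (\<lambda>t. g (t - s)))" for s
  proof -
    have "of_real (nsq (\<lambda>t. g t - g (t - s))) = ip (\<lambda>t. g t - g (t - s)) (\<lambda>t. g t - g (t - s))"
      by (simp add: ip_self)
    also have "\<dots> = ip g g - ip g (\<lambda>t. g (t - s)) - (ip (\<lambda>t. g (t - s)) g - ip (\<lambda>t. g (t - s)) (\<lambda>t. g (t - s)))"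
      using L L2_shift[OF L] by (simp add: ip_diff_left ip_diff_right L2_diff)
    also have "\<dots> = of_real (2 * nsq g) - (ip g (\<lambda>t. g (t - s)) + cnj (ip g (\<lambda>t. g (t - s))))"
      using ip_commute[of "\<lambda>t. g (t - s)" g] nsq_shift[of g s] by (simp add: ip_self)
    finally have "Re (of_real (nsq (\<lambda>t. g t - g (t - s)))) = Re (of_real (2 * nsq g) - (ip g (\<lambda>t. g (t - s)) + cnj (ip g (\<lambda>t. g (t - s)))))"
      by simp
    then show ?thesis by simp
  qed
  have "(\<lambda>n. 2 * nsq g - 2 * Re (ip g (\<lambda>t. g (t - ?r n)))) \<longlonglongrightarrow> 2 * nsq g - 2 * Re (ip g g)"
    by (intro tendsto_intros autocorrelation_tendsto[OF L I r])
  then have "(\<lambda>n. nsq (\<lambda>t. g t - g (t - ?r n))) \<longlonglongrightarrow> 0"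
    unfolding nsq_eq by (simp add: ip_self)
  then have "(\<lambda>n. sqrt (nsq (\<lambda>t. g t - g (t - ?r n))) * sqrt 3) \<longlonglongrightarrow> sqrt 0 * sqrt 3"
    by (intro tendsto_mult tendsto_const tendsto_real_sqrt)
  then have "(\<lambda>n. sqrt (nsq (\<lambda>t. g t - g (t - ?r n))) * sqrt 3) \<longlonglongrightarrow> 0" by simp
  moreover have "\<forall>\<^sub>F n in sequentially. norm (FT c g (u n)) \<le> sqrt (nsq (\<lambda>t. g t - g (t - ?r n))) * sqrt 3"
    using filterlim_at_top[THEN iffD1, OF u, rule_format, of pi]
  proof eventually_elim
    case (elim n)
    then show ?case using Riemann_Lebesgue_aux[OF L I supp c elim] norm_ge_zero[of "FT c g (u n)"] by linarith
  qed
  ultimately show ?thesis by (rule Lim_null_comparison[rotated])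
qed

text \<open>Chernoff's proof: dividing \<open>f - f 0\<close> by \<open>e\<^sup>2\<^sup>\<pi>\<^sup>i\<^sup>x - 1\<close> makes the partial Fourier sums telescope.\<close>
lemma Fourier_sum_at_0:
  fixes f :: "real \<Rightarrow> complex"
  assumes [measurable]: "f \<in> borel_measurable borel"
    and lip: "\<And>x. x \<in> {0..1} \<Longrightarrow> cmod (f x - f 0) \<le> K * x"
    and lip1: "\<And>x. x \<in> {0..1} \<Longrightarrow> cmod (f x - f 0) \<le> K * (1 - x)"
    and K: "K \<ge> 0"
  shows "(\<lambda>N. \<Sum>k\<in>{- int N..int N}. \<integral>x. indicator {0..1} x * f x * cis (- 2 * pi * of_int k * x) \<partial>lborel) \<longlonglongrightarrow> f 0"
proof -
  define g where "g x = indicator {0<..<1} x * ((f x - f 0) / (cis (2 * pi * x) - 1))" for x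
  have [measurable]: "g \<in> borel_measurable borel" unfolding g_def by measurable
  \<comment> \<open>Jordan's inequality: sine is concave on [0, pi], hence above its chord from 0 to
    pi / 2.\<close>
  have sin_ge: "2 * x \<le> sin (pi * x)" if "0 \<le> x" "x \<le> 1/2" for x
  proof -
    have "concave_on {0..pi} sin"
      unfolding concave_on_def
      by (rule f''_ge0_imp_convex[where f'="\<lambda>x. - cos x" and f''="\<lambda>x. sin x"])
         (auto intro!: derivative_eq_intros sin_ge_zero)
    then have "sin ((1 - 2*x) *\<^sub>R 0 + (2*x) *\<^sub>R (pi/2)) \<ge> (1 - 2*x) * sin 0 + (2*x) * sin (pi/2)"
      using that by (intro concave_onD) auto
    then show ?thesis by (simp add: mult.commute)
  qed
  have cis_ge: "cmod (cis (2 * pi * x) - 1) \<ge> 4 * min x (1 - x)" if "x \<in> {0<..<1}" for x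
  proof -
    have "cis (2 * pi * x) - 1 = cis (pi * x) * (cis (pi * x) - cis (- (pi * x)))"
      by (simp add: right_diff_distrib cis_mult mult.assoc)
    also have "cis (pi * x) - cis (- (pi * x)) = of_real (2 * sin (pi * x)) * \<i>"
      by (simp add: complex_eq_iff)
    finally have "cmod (cis (2 * pi * x) - 1) = 2 * \<bar>sin (pi * x)\<bar>"
      by (simp add: norm_mult)
    moreover have "sin (pi * x) \<ge> 2 * min x (1 - x)"
    proof (cases "x \<le> 1/2")
      case True then show ?thesis using sin_ge[of x] that by auto
    next
      case False
      have "sin (pi * (1 - x)) = sin (pi * x)" by (simp add: right_diff_distrib sin_diff)
      then show ?thesis using sin_ge[of "1 - x"] that False by auto
    qed
    ultimately show ?thesis by linarith
  qed
  \<comment> \<open>The denominator vanishes at both ends of the interval; \<open>lip\<close>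
    compensates at 0 and \<open>lip1\<close> at 1.\<close>
  have gb: "cmod (g x) \<le> K * cmod (indicator {0..1} x)" for x
  proof (cases "x \<in> {0<..<1}")
    case True
    have "cmod (f x - f 0) \<le> K * min x (1 - x)" using lip[of x] lip1[of x] True by (auto simp: min_def)
    also have "\<dots> \<le> K * cmod (cis (2 * pi * x) - 1)"
      using cis_ge[OF True] True K by (intro mult_left_mono) (auto simp: min_def split: if_splits)
    finally have "cmod (f x - f 0) / cmod (cis (2 * pi * x) - 1) \<le> K"
      using K by (simp add: divide_le_eq)
    then show ?thesis using True by (simp add: g_def norm_divide)
  qed (use K in \<open>auto simp: g_def\<close>)
  have Lg: "L2 g" by (rule L2_bound[OF L2_indicator_Icc, of _ K]) (use gb in auto)
  have supp: "g t = 0" if "t \<notin> {0..1}" for t using that by (auto simp: g_def)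
  have Ig: "integrable lborel g"
    using L2_prod_integrable[OF Lg L2_indicator_Icc[of 0 1]]
    by (rule Bochner_Integration.integrable_cong[THEN iffD1, rotated 2]) (use supp in \<open>auto simp: indicator_def\<close>)
  define a where "a k = (\<integral>x. g x * cis (- 2 * pi * of_int k * x) \<partial>lborel)" for k
  have ig: "integrable lborel (\<lambda>x. g x * cis (- 2 * pi * of_int k * x))" for k
    by (rule integrable_mult_cis[OF Ig]) measurable
  have fb: "cmod (f x) \<le> cmod (f 0) + K" if "x \<in> {0..1}" for x
  proof -
    have "K * x \<le> K" using that K by (simp add: mult_left_le)
    then show ?thesis using lip[OF that] norm_triangle_ineq[of "f x - f 0" "f 0"] by simp
  qed
  have if0: "integrable lborel (\<lambda>x. indicator {0..1} x * f x)"
  proof (rule Bochner_Integration.integrable_bound)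
    show "integrable lborel (\<lambda>x. (cmod (f 0) + K) * indicator {0..1::real} x)" by simp
    show "AE x in lborel. norm (indicator {0..1} x * f x) \<le> norm ((cmod (f 0) + K) * indicator {0..1} x)"
      using fb K by (intro AE_I2) (auto simp: indicator_def)
  qed simp
  have if1: "integrable lborel (\<lambda>x. indicator {0..1} x * f x * cis (- 2 * pi * of_int k * x))" for k
    by (rule integrable_mult_cis[OF if0]) measurable
  have ic: "integrable lborel (\<lambda>x. indicator {0..1} x * f 0 * cis (- 2 * pi * of_int k * x))" for k
    by (rule integrable_mult_cis) (auto intro: integrable_complex_indicator_Icc)
  have cint: "(\<integral>x. indicator {0..1} x * f 0 * cis (- 2 * pi * of_int k * x) \<partial>lborel) = (if k = 0 then f 0 else 0)" for k
  proof (cases "k = 0")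
    case True
    have "(\<integral>x. indicator {0..1::real} x * f 0 \<partial>lborel) = (\<integral>x. indicator {0..1::real} x *\<^sub>R f 0 \<partial>lborel)"
      by (rule Bochner_Integration.integral_cong) (auto simp: indicator_def)
    also have "\<dots> = f 0" by simp
    finally show ?thesis using True by simp
  next
    case False
    let ?F = "\<lambda>x. f 0 * cis (- 2 * pi * of_int k * x) / (- 2 * pi * of_int k * \<i>)"
    have "(\<integral>x. indicator {0..1} x *\<^sub>R (f 0 * cis (- 2 * pi * of_int k * x)) \<partial>lborel) = ?F 1 - ?F 0"
    proof (rule integral_FTC_Icc)
      fix x :: real
      show "(?F has_vector_derivative f 0 * cis (- 2 * pi * of_int k * x)) (at x within {0..1})"
        using False unfolding cis_conv_exp
        by (auto intro!: derivative_eq_intros has_vector_derivative_real_field simp: field_simps)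
    qed (auto intro!: continuous_intros)
    also have "cis (- 2 * pi * of_int k * 1) = 1"
      using cis_multiple_2pi[of "- of_int k"] by (simp add: mult.commute mult.left_commute)
    then have "?F 1 - ?F 0 = 0" by simp
    also have "(\<integral>x. indicator {0..1} x *\<^sub>R (f 0 * cis (- 2 * pi * of_int k * x)) \<partial>lborel)
        = (\<integral>x. indicator {0..1} x * f 0 * cis (- 2 * pi * of_int k * x) \<partial>lborel)"
      by (rule Bochner_Integration.integral_cong) (auto simp: indicator_def)
    finally show ?thesis using False by simp
  qed
  \<comment> \<open>Multiplication by cis (2 pi x) lowers the index by one, so the k-th coefficient
    of f - f 0 = g * (cis (2 pi x) - 1) is a difference of neighbouring coefficients of g. The
    constant f 0 contributes only at k = 0.\<close>
  have step: "(\<integral>x. indicator {0..1} x * f x * cis (- 2 * pi * of_int k * x) \<partial>lborel) - (if k = 0 then f 0 else 0) = a (k - 1) - a k" for k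
  proof -
    have "(\<integral>x. indicator {0..1} x * f x * cis (- 2 * pi * of_int k * x) \<partial>lborel) - (if k = 0 then f 0 else 0)
      = (\<integral>x. indicator {0..1} x * f x * cis (- 2 * pi * of_int k * x) - indicator {0..1} x * f 0 * cis (- 2 * pi * of_int k * x) \<partial>lborel)"
      unfolding cint[of k, symmetric] by (rule Bochner_Integration.integral_diff[OF if1 ic, symmetric])
    also have "\<dots> = (\<integral>x. g x * cis (- 2 * pi * of_int (k - 1) * x) - g x * cis (- 2 * pi * of_int k * x) \<partial>lborel)"
    proof (rule integral_cong_AE)
      have "AE x in lborel. x \<noteq> 0 \<and> x \<noteq> (1::real)" by (intro AE_conjI AE_lborel_singleton)
      then show "AE x in lborel. indicator {0..1} x * f x * cis (- 2 * pi * of_int k * x) - indicator {0..1} x * f 0 * cis (- 2 * pi * of_int k * x)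
         = g x * cis (- 2 * pi * of_int (k - 1) * x) - g x * cis (- 2 * pi * of_int k * x)"
      proof eventually_elim
        case (elim x)
        show ?case
        proof (cases "x \<in> {0<..<1}")
          case True
          have "cis (2 * pi * x) \<noteq> 1" using cis_ge[OF True] True by (auto simp: min_def split: if_splits)
          moreover have "cis (- 2 * pi * of_int (k - 1) * x) = cis (- 2 * pi * of_int k * x) * cis (2 * pi * x)"
            unfolding cis_mult by (rule arg_cong[where f=cis]) (simp add: algebra_simps)
          moreover have "g x * (cis (2 * pi * x) - 1) = f x - f 0"
            using True \<open>cis (2 * pi * x) \<noteq> 1\<close> by (simp add: g_def)
          moreover have "p * (d * e) - p * d = (p * (e - 1)) * d" for p d e :: complex
            by (simp add: algebra_simps)
          ultimately have "g x * cis (- 2 * pi * of_int (k - 1) * x) - g x * cis (- 2 * pi * of_int k * x)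
              = (f x - f 0) * cis (- 2 * pi * of_int k * x)"
            by (simp only:)
          then show ?thesis using True by (simp add: left_diff_distrib)
        next
          case False
          then have "x \<notin> {0..1}" using elim by auto
          then show ?thesis using supp by simp
        qed
      qed
    qed measurable
    also have "\<dots> = a (k - 1) - a k" unfolding a_def by (rule Bochner_Integration.integral_diff[OF ig ig])
    finally show ?thesis .
  qed
  define b where "b k = (\<integral>x. indicator {0..1} x * f x * cis (- 2 * pi * of_int k * x) \<partial>lborel)" for k :: int
  have b0: "b 0 = f 0 + (a (-1) - a 0)" using step[of 0] by (simp add: b_def algebra_simps)
  have bk: "b k = a (k - 1) - a k" if "k \<noteq> 0" for k using step[of k] that by (simp add: b_def)
  have part: "(\<Sum>k\<in>{- int N..int N}. b k) = f 0 + (a (- int N - 1) - a (int N))" for N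
  proof (induction N)
    case 0
    show ?case using b0 by simp
  next
    case (Suc N)
    have "{- int (Suc N)..int (Suc N)} = insert (int N + 1) (insert (- int N - 1) {- int N..int N})" by auto
    then have "(\<Sum>k\<in>{- int (Suc N)..int (Suc N)}. b k) = b (int N + 1) + (b (- int N - 1) + (\<Sum>k\<in>{- int N..int N}. b k))"
      by simp
    also have "b (int N + 1) = a (int N) - a (int (Suc N))" using bk[of "int N + 1"] by (simp add: add.commute)
    also have "b (- int N - 1) = a (- int (Suc N) - 1) - a (- int N - 1)" using bk[of "- int N - 1"] by simp
    finally show ?case using Suc.IH by simp
  qed
  have afT: "a (int N) = FT (-1) g (2 * pi * real N)" for N unfolding a_def FT_def by (simp add: mult.commute)
  have afT': "a (- int N - 1) = FT 1 g (2 * pi * real (Suc N))" for N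
  proof -
    have "- 2 * pi * of_int (- int N - 1) * x = 1 * (2 * pi * real (Suc N)) * x" for x
      by (simp add: algebra_simps)
    then show ?thesis unfolding a_def FT_def by (simp only:)
  qed
  have fl: "filterlim (\<lambda>N. 2 * pi * real N) at_top sequentially"
    by (rule filterlim_tendsto_pos_mult_at_top[OF tendsto_const _ filterlim_real_sequentially]) simp
  have "(\<lambda>N. a (int N)) \<longlonglongrightarrow> 0" unfolding afT by (rule Riemann_Lebesgue[OF Lg Ig supp _ fl]) auto
  moreover have "(\<lambda>N. a (- int N - 1)) \<longlonglongrightarrow> 0" unfolding afT'
    by (rule Riemann_Lebesgue[OF Lg Ig supp _ filterlim_compose[OF fl filterlim_Suc]]) auto
  ultimately have "(\<lambda>N. f 0 + (a (- int N - 1) - a (int N))) \<longlonglongrightarrow> f 0 + (0 - 0)" by (intro tendsto_intros)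
  then show ?thesis unfolding part[symmetric] b_def by simp
qed

section \<open>The theta function and the xi function\<close>

text \<open>Half of theta(t) - 1, where theta(t) is the sum of exp (- pi n^2 t) over all integers
  n.\<close>

definition psi :: "real \<Rightarrow> real" where
  "psi t = (\<Sum>n. exp (- pi * (real (Suc n))\<^sup>2 * t))"

section \<open>Poisson summation for the Gaussian\<close>

context
  fixes t :: real
  assumes t: "t > 0"
begin

definition gauss :: "real \<Rightarrow> real" where "gauss y = exp (- pi * t * y\<^sup>2)"
text \<open>Pairing the translates by n and by -(n + 1) turns the two-sided periodization into a
  series over the natural numbers in which every integer translate occurs exactly once.\<close>

definition per :: "nat \<Rightarrow> real \<Rightarrow> real" where "per n x = gauss (x + real n) + gauss (x - real (Suc n))"

lemma gauss_measurable [measurable]: "gauss \<in> borel_measurable borel"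
  unfolding gauss_def by measurable

lemma per_measurable [measurable]: "per n \<in> borel_measurable borel"
  unfolding per_def by measurable

text \<open>A geometric bound suffices for all the series below; it uses n <= n^2 for natural
  n.\<close>

lemma gauss_le: "\<bar>y\<bar> \<ge> real n \<Longrightarrow> gauss y \<le> exp (- pi * t) ^ n"
proof -
  assume "\<bar>y\<bar> \<ge> real n"
  then have "(real n)\<^sup>2 \<le> y\<^sup>2" by (simp add: abs_le_square_iff[symmetric])
  moreover have "real n \<le> (real n)\<^sup>2" by (simp add: power2_eq_square flip: of_nat_mult)
  ultimately have "real n \<le> y\<^sup>2" by (rule order_trans[rotated])
  then have "pi * t * real n \<le> pi * t * y\<^sup>2" using t by (intro mult_left_mono) auto
  then show ?thesis by (simp add: gauss_def mult_ac flip: exp_of_nat_mult)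
qed

lemma gauss_minus: "gauss (- y) = gauss y"
  by (simp add: gauss_def)

lemma q_less_1: "exp (- pi * t) < 1" using t by simp

lemma summable_gauss: "summable (\<lambda>n. gauss (real n))"
  by (rule summable_comparison_test'[OF summable_geometric[of "exp (- pi * t)"], of 0])
     (use q_less_1 gauss_le in \<open>auto simp: gauss_def\<close>)

lemma gauss_lipschitz:
  assumes "convex S" "\<And>z. z \<in> S \<Longrightarrow> real n \<le> \<bar>z\<bar> \<and> \<bar>z\<bar> \<le> real (Suc n)" "x \<in> S" "y \<in> S"
  shows "\<bar>gauss x - gauss y\<bar> \<le> 2 * pi * t * (real (Suc n) * exp (- pi * t) ^ n) * \<bar>x - y\<bar>"
proof -
  have "norm (gauss x - gauss y) \<le> 2 * pi * t * (real (Suc n) * exp (- pi * t) ^ n) * norm (x - y)"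
  proof (rule field_differentiable_bound[OF assms(1), where f'="\<lambda>z. - 2 * pi * t * z * gauss z"])
    fix z assume z: "z \<in> S"
    show "(gauss has_field_derivative - 2 * pi * t * z * gauss z) (at z within S)"
      unfolding gauss_def by (auto intro!: derivative_eq_intros simp: algebra_simps)
    have "\<bar>z\<bar> * gauss z \<le> real (Suc n) * exp (- pi * t) ^ n"
      using assms(2)[OF z] gauss_le[of n z] by (intro mult_mono) (auto simp: gauss_def)
    then have "2 * pi * t * (\<bar>z\<bar> * gauss z) \<le> 2 * pi * t * (real (Suc n) * exp (- pi * t) ^ n)"
      using t by (intro mult_left_mono) auto
    then show "norm (- 2 * pi * t * z * gauss z) \<le> 2 * pi * t * (real (Suc n) * exp (- pi * t) ^ n)"
      using t by (simp add: abs_mult gauss_def mult.assoc)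
  qed (use assms in auto)
  then show ?thesis by simp
qed

lemma per_bounds:
  assumes "x \<in> {0..1}"
  shows "0 \<le> per n x" "per n x \<le> 2 * exp (- pi * t) ^ n"
  using gauss_le[of n "x + real n"] gauss_le[of n "x - real (Suc n)"] assms
  by (auto simp: per_def gauss_def add_nonneg_nonneg)

lemma summable_per: "x \<in> {0..1} \<Longrightarrow> summable (\<lambda>n. per n x)"
  by (rule summable_comparison_test'[OF summable_mult[OF summable_geometric[of "exp (- pi * t)"]], of 0 _ 2])
     (use q_less_1 per_bounds in auto)

lemma per_lipschitz:
  assumes "x \<in> {0..1}" "y \<in> {0..1}"
  shows "\<bar>per n x - per n y\<bar> \<le> 4 * pi * t * (real (Suc n) * exp (- pi * t) ^ n) * \<bar>x - y\<bar>"
proof -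
  have "\<bar>gauss (x + real n) - gauss (y + real n)\<bar> \<le> 2 * pi * t * (real (Suc n) * exp (- pi * t) ^ n) * \<bar>(x + real n) - (y + real n)\<bar>"
    by (rule gauss_lipschitz[of "{real n..real (Suc n)}"]) (use assms in auto)
  moreover have "\<bar>gauss (x - real (Suc n)) - gauss (y - real (Suc n))\<bar> \<le> 2 * pi * t * (real (Suc n) * exp (- pi * t) ^ n) * \<bar>(x - real (Suc n)) - (y - real (Suc n))\<bar>"
    by (rule gauss_lipschitz[of "{- real (Suc n)..- real n}"]) (use assms in auto)
  ultimately show ?thesis unfolding per_def by (simp add: algebra_simps)
qed

definition persum :: "real \<Rightarrow> real" where "persum x = (\<Sum>n. per n x)"

lemma persum_measurable [measurable]: "persum \<in> borel_measurable borel"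
  unfolding persum_def by measurable

text \<open>Supplies the Lipschitz hypotheses of \<open>Fourier_sum_at_0\<close>. The constants of
  the summands are multiples of (n + 1) q^n, the differentiated geometric series.\<close>

lemma persum_lipschitz:
  "\<exists>K\<ge>0. \<forall>x\<in>{0..1}. \<forall>y\<in>{0..1}. \<bar>persum x - persum y\<bar> \<le> K * \<bar>x - y\<bar>"
proof -
  let ?b = "\<lambda>n. 4 * pi * t * (real (Suc n) * exp (- pi * t) ^ n)"
  have "summable (\<lambda>n. real (Suc n) * exp (- pi * t) ^ n)"
    using geometric_deriv_sums[of "exp (- pi * t)"] q_less_1 by (auto simp: sums_iff)
  then have sb: "summable ?b" by (rule summable_mult)
  have "\<bar>persum x - persum y\<bar> \<le> suminf ?b * \<bar>x - y\<bar>" if "x \<in> {0..1}" "y \<in> {0..1}" for x y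
  proof -
    have s: "summable (\<lambda>n. ?b n * \<bar>x - y\<bar>)" by (rule summable_mult2[OF sb])
    have sd: "summable (\<lambda>n. \<bar>per n x - per n y\<bar>)"
      by (rule summable_comparison_test'[OF s, of 0]) (use per_lipschitz[OF that] in simp)
    have "persum x - persum y = (\<Sum>n. per n x - per n y)"
      unfolding persum_def by (rule suminf_diff[OF summable_per summable_per]) (use that in auto)
    also have "\<bar>\<dots>\<bar> \<le> (\<Sum>n. \<bar>per n x - per n y\<bar>)" by (rule summable_rabs[OF sd])
    also have "\<dots> \<le> (\<Sum>n. ?b n * \<bar>x - y\<bar>)"
      by (rule suminf_le[OF _ sd s]) (use per_lipschitz[OF that] in simp)
    also have "\<dots> = suminf ?b * \<bar>x - y\<bar>" by (rule suminf_mult2[OF sb, symmetric])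
    finally show ?thesis .
  qed
  moreover have "suminf ?b \<ge> 0" using t by (intro suminf_nonneg sb) auto
  ultimately show ?thesis by blast
qed

lemma persum_0: "persum 0 = 1 + 2 * psi t"
proof -
  have s1: "summable (\<lambda>n. gauss (real (Suc n)))" using summable_gauss by (subst summable_Suc_iff)
  have "persum 0 = (\<Sum>n. gauss (real n) + gauss (real (Suc n)))"
    unfolding persum_def per_def by (simp only: diff_0 gauss_minus add_0)
  also have "\<dots> = (\<Sum>n. gauss (real n)) + (\<Sum>n. gauss (real (Suc n)))"
    by (rule suminf_add[OF summable_gauss s1, symmetric])
  also have "(\<Sum>n. gauss (real n)) = 1 + (\<Sum>n. gauss (real (Suc n)))"
    using suminf_split_head[OF summable_gauss] by (simp add: gauss_def)
  also have "(\<Sum>n. gauss (real (Suc n))) = psi t"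
    unfolding psi_def gauss_def by (simp add: mult_ac)
  finally show ?thesis by simp
qed

lemma persum_1: "persum 1 = persum 0"
proof -
  have "per n 1 = per n 0" for n
  proof -
    have "1 + real n = real (Suc n)" "1 - real (Suc n) = - real n" "0 - real (Suc n) = - real (Suc n)" "0 + real n = real n" by simp_all
    then show ?thesis unfolding per_def by (simp only: gauss_minus add.commute)
  qed
  then show ?thesis by (simp add: persum_def)
qed

lemma integrable_gauss: "integrable lborel gauss"
proof -
  have "integrable lborel (\<lambda>u. exp (- (u / (1 / sqrt (2 * pi * t)))\<^sup>2 / 2))"
    by (rule integrable_gaussian) (use t in simp)
  then show ?thesis using t unfolding gauss_def by (simp add: power_mult_distrib mult_ac)
qed

lemma FT_gauss:
  "(\<integral>x. gauss x * cis (- 2 * pi * real_of_int k * x) \<partial>lborel) = of_real (exp (- pi * (of_int k)\<^sup>2 / t) / sqrt t)"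
proof -
  \<comment> \<open>This is the width n for which exp (- (u / n)^2 / 2) equals exp (- pi t
    u^2).\<close>
  have n: "1 / sqrt (2 * pi * t) > 0" using t by simp
  have "(\<integral>u. of_real (exp (- (u/(1 / sqrt (2 * pi * t)))\<^sup>2 / 2)) * cis (-1 * u * (2 * pi * k)) \<partial>lborel)
    = of_real (1 / sqrt (2 * pi * t) * sqrt (2 * pi) * exp (- (1 / sqrt (2 * pi * t) * (2 * pi * k))\<^sup>2 / 2))"
    by (rule gaussian_FT[OF _ n]) simp
  also have "1 / sqrt (2 * pi * t) * sqrt (2 * pi) = 1 / sqrt t"
    using t by (simp add: real_sqrt_mult)
  also have "- (1 / sqrt (2 * pi * t) * (2 * pi * k))\<^sup>2 / 2 = - pi * (of_int k)\<^sup>2 / t"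
    using t by (simp add: power_divide power_mult_distrib power2_eq_square[of pi] power2_eq_square[of 2])
  also have "(\<integral>u. of_real (exp (- (u/(1 / sqrt (2 * pi * t)))\<^sup>2 / 2)) * cis (-1 * u * (2 * pi * k)) \<partial>lborel)
      = (\<integral>x. gauss x * cis (- 2 * pi * real_of_int k * x) \<partial>lborel)"
  proof (rule Bochner_Integration.integral_cong[OF refl])
    fix u
    have "(u/(1 / sqrt (2 * pi * t)))\<^sup>2 / 2 = pi * t * u\<^sup>2" using t by (simp add: power_mult_distrib)
    then show "of_real (exp (- (u/(1 / sqrt (2 * pi * t)))\<^sup>2 / 2)) * cis (-1 * u * (2 * pi * k)) = gauss u * cis (- 2 * pi * real_of_int k * u)"
      unfolding gauss_def by (simp add: mult_ac)
  qed
  finally show ?thesis by simp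
qed

text \<open>Passing from N to N + 1 adds the pieces [N, N + 1] and [-N - 1, -N]. Moved to [0, 1]
  they are the two terms of \<open>per\<close> at N, while the factor \<open>cis\<close> is
  unchanged because integer translations are periods of it.\<close>

lemma unfold_partial:
  "(\<integral>x. indicator {- real N..real N} x * (gauss x * cis (- 2 * pi * real_of_int k * x)) \<partial>lborel)
   = (\<integral>x. indicator {0..1} x * ((\<Sum>n<N. per n x) * cis (- 2 * pi * real_of_int k * x)) \<partial>lborel)"
proof (induction N)
  case 0
  have "AE x in lborel. indicator {- real 0..real 0} x * (gauss x * cis (- 2 * pi * real_of_int k * x)) = 0"
    using AE_lborel_singleton[of 0] by eventually_elim simp
  then have "(\<integral>x. indicator {- real 0..real 0} x * (gauss x * cis (- 2 * pi * real_of_int k * x)) \<partial>lborel) = (\<integral>x. 0 \<partial>(lborel::real measure))"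
    by (intro integral_cong_AE) auto
  then show ?case by simp
next
  case (Suc N)
  let ?E = "\<lambda>x. gauss x * cis (- 2 * pi * real_of_int k * x)"
  have [measurable]: "?E \<in> borel_measurable borel" by measurable
  have IE: "integrable lborel ?E"
    by (rule integrable_mult_cis) (use integrable_gauss in auto)
  have IA: "integrable lborel (\<lambda>x. indicator A x * ?E x)" if [measurable]: "A \<in> sets borel" for A
    by (rule Bochner_Integration.integrable_bound[OF IE]) (auto simp: indicator_def)
  have per_cis: "cis (- 2 * pi * real_of_int k * (x + real_of_int m)) = cis (- 2 * pi * real_of_int k * x)" for x m
  proof -
    have "- 2 * pi * real_of_int k * (x + real_of_int m) = - 2 * pi * real_of_int k * x + 2 * pi * real_of_int (- k * m)"
      by (simp add: algebra_simps)
    moreover have "cis (2 * pi * real_of_int (- k * m)) = 1" by (rule cis_multiple_2pi) (rule Ints_of_int)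
    ultimately show ?thesis by (simp only: cis_mult[symmetric] mult_1_right)
  qed
  have "(\<integral>x. indicator {- real (Suc N)..real (Suc N)} x * ?E x \<partial>lborel)
    = (\<integral>x. (indicator {- real N..real N} x * ?E x + indicator {real N..real (Suc N)} x * ?E x) + indicator {- real (Suc N)..- real N} x * ?E x \<partial>lborel)"
  proof (rule integral_cong_AE)
    have "AE x in lborel. x \<noteq> real N \<and> x \<noteq> - real N" by (intro AE_conjI AE_lborel_singleton)
    then show "AE x in lborel. indicator {- real (Suc N)..real (Suc N)} x * ?E x
      = (indicator {- real N..real N} x * ?E x + indicator {real N..real (Suc N)} x * ?E x) + indicator {- real (Suc N)..- real N} x * ?E x"
      by eventually_elim (auto simp: indicator_def)
  qed measurable
  also have "\<dots> = (\<integral>x. indicator {- real N..real N} x * ?E x \<partial>lborel) + (\<integral>x. indicator {real N..real (Suc N)} x * ?E x \<partial>lborel)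
      + (\<integral>x. indicator {- real (Suc N)..- real N} x * ?E x \<partial>lborel)"
    by (simp only: Bochner_Integration.integral_add IA Bochner_Integration.integrable_add atLeastAtMost_borel)
  also have "(\<integral>x. indicator {real N..real (Suc N)} x * ?E x \<partial>lborel)
      = (\<integral>x. indicator {0..1} x * (gauss (x + real N) * cis (- 2 * pi * real_of_int k * x)) \<partial>lborel)"
    using per_cis[of _ "int N"]
    by (subst lborel_integral_real_affine[of 1 _ "real N"])
       (auto intro!: Bochner_Integration.integral_cong simp: indicator_def add.commute)
  also have "(\<integral>x. indicator {- real (Suc N)..- real N} x * ?E x \<partial>lborel)
      = (\<integral>x. indicator {0..1} x * (gauss (x - real (Suc N)) * cis (- 2 * pi * real_of_int k * x)) \<partial>lborel)"
  proof (subst lborel_integral_real_affine[of 1 _ "- real (Suc N)"], simp, unfold abs_one scaleR_one, rule Bochner_Integration.integral_cong[OF refl])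
    fix x
    have 1: "- real (Suc N) + 1 * x = x + real_of_int (- int (Suc N))" by simp
    have 2: "x + real_of_int (- int (Suc N)) = x - real (Suc N)" by simp
    have "indicator {- real (Suc N)..- real N} (x - real (Suc N)) = (indicator {0..1} x :: complex)"
      by (auto simp: indicator_def)
    then show "indicator {- real (Suc N)..- real N} (- real (Suc N) + 1 * x) * ?E (- real (Suc N) + 1 * x)
       = indicator {0..1} x * (gauss (x - real (Suc N)) * cis (- 2 * pi * real_of_int k * x))"
      unfolding 1 per_cis unfolding 2 by (simp only:)
  qed
  also have "(\<integral>x. indicator {- real N..real N} x * ?E x \<partial>lborel) = (\<integral>x. indicator {0..1} x * ((\<Sum>n<N. per n x) * cis (- 2 * pi * real_of_int k * x)) \<partial>lborel)"
    by (rule Suc.IH)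
  finally have *: "(\<integral>x. indicator {- real (Suc N)..real (Suc N)} x * ?E x \<partial>lborel)
     = (\<integral>x. indicator {0..1} x * ((\<Sum>n<N. per n x) * cis (- 2 * pi * real_of_int k * x)) \<partial>lborel)
     + (\<integral>x. indicator {0..1} x * (gauss (x + real N) * cis (- 2 * pi * real_of_int k * x)) \<partial>lborel)
     + (\<integral>x. indicator {0..1} x * (gauss (x - real (Suc N)) * cis (- 2 * pi * real_of_int k * x)) \<partial>lborel)" .
  have Ib: "integrable lborel (\<lambda>x. indicator {0..1} x * (of_real (b x) * cis (- 2 * pi * real_of_int k * x)))"
    if [measurable]: "b \<in> borel_measurable borel" and "\<And>x. x \<in> {0..1} \<Longrightarrow> \<bar>b x\<bar> \<le> B" for b :: "real \<Rightarrow> real" and B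
  proof (rule Bochner_Integration.integrable_bound)
    show "integrable lborel (\<lambda>x. B * indicator {0..1::real} x)" by simp
    show "AE x in lborel. norm (indicator {0..1} x * (complex_of_real (b x) * cis (- 2 * pi * real_of_int k * x))) \<le> norm (B * indicator {0..1} x)"
      using that(2) by (intro AE_I2) (fastforce simp: indicator_def norm_mult)
  qed measurable
  have g1: "\<bar>gauss y\<bar> \<le> 1" for y using t by (simp add: gauss_def)
  have "integrable lborel (\<lambda>x. indicator {0..1} x * (complex_of_real (\<Sum>n<N. per n x) * cis (- 2 * pi * real_of_int k * x)))"
  proof (rule Ib[where B="real N * 2"])
    fix x :: real
    have "\<bar>per n x\<bar> \<le> 2" for n using g1[of "x + real n"] g1[of "x - real (Suc n)"] by (simp add: per_def)
    then have "(\<Sum>n<N. \<bar>per n x\<bar>) \<le> real (card {..<N}) * 2" by (intro sum_bounded_above) auto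
    then show "\<bar>\<Sum>n<N. per n x\<bar> \<le> real N * 2"
      by (intro order_trans[OF sum_abs]) simp
  qed measurable
  moreover have "integrable lborel (\<lambda>x. indicator {0..1} x * (complex_of_real (gauss (x + real N)) * cis (- 2 * pi * real_of_int k * x)))"
    by (rule Ib[where B=1]) (use g1 in auto)
  moreover have "integrable lborel (\<lambda>x. indicator {0..1} x * (complex_of_real (gauss (x - real (Suc N))) * cis (- 2 * pi * real_of_int k * x)))"
    by (rule Ib[where B=1]) (use g1 in auto)
  ultimately show ?case unfolding *
    by (simp only: Bochner_Integration.integral_add[symmetric] Bochner_Integration.integrable_add)
       (rule Bochner_Integration.integral_cong, auto simp: per_def algebra_simps)
qed

text \<open>The coefficient form of Poisson summation: dominated convergence on both sides of
  \<open>unfold_partial\<close> equates the Fourier coefficient of the periodization with the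
  Fourier transform of the Gaussian at the integer k.\<close>

lemma Fourier_coeff_persum:
  "(\<integral>x. indicator {0..1} x * complex_of_real (persum x) * cis (- 2 * pi * of_int k * x) \<partial>lborel) = of_real (exp (- pi * (of_int k)\<^sup>2 / t) / sqrt t)"
proof -
  let ?E = "\<lambda>x. gauss x * cis (- 2 * pi * real_of_int k * x)"
  have IE: "integrable lborel (\<lambda>x. norm (?E x))"
    by (intro integrable_norm integrable_mult_cis) (use integrable_gauss in auto)
  have "(\<lambda>N. \<integral>x. indicator {- real N..real N} x * ?E x \<partial>lborel) \<longlonglongrightarrow> (\<integral>x. ?E x \<partial>lborel)"
  proof (rule integral_dominated_convergence[OF _ _ IE])
    show "AE x in lborel. (\<lambda>N. indicator {- real N..real N} x * ?E x) \<longlonglongrightarrow> ?E x"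
    proof (intro AE_I2 tendsto_eventually)
      fix x :: real
      show "\<forall>\<^sub>F N in sequentially. indicator {- real N..real N} x * ?E x = ?E x"
        using eventually_ge_at_top[of "nat \<lceil>\<bar>x\<bar>\<rceil>"]
      proof eventually_elim
        case (elim N)
        then have "\<bar>x\<bar> \<le> real N" by linarith
        then show ?case by (simp add: abs_le_iff)
      qed
    qed
    show "AE x in lborel. norm (indicator {- real N..real N} x * ?E x) \<le> norm (?E x)" for N
      by (intro AE_I2) (auto simp: indicator_def)
  qed measurable
  then have 1: "(\<lambda>N. \<integral>x. indicator {0..1} x * ((\<Sum>n<N. per n x) * cis (- 2 * pi * real_of_int k * x)) \<partial>lborel) \<longlonglongrightarrow> (\<integral>x. ?E x \<partial>lborel)"
    unfolding unfold_partial .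
  define C where "C = (\<Sum>n. 2 * exp (- pi * t) ^ n)"
  have sC: "summable (\<lambda>n. 2 * exp (- pi * t) ^ n)" by (intro summable_mult summable_geometric) (use q_less_1 in simp)
  have bC: "(\<Sum>n<N. per n x) \<le> C" "0 \<le> (\<Sum>n<N. per n x)" if "x \<in> {0..1}" for x N
  proof -
    have "(\<Sum>n<N. per n x) \<le> (\<Sum>n<N. 2 * exp (- pi * t) ^ n)" by (intro sum_mono per_bounds that)
    also have "\<dots> \<le> C" unfolding C_def by (intro sum_le_suminf sC) auto
    finally show "(\<Sum>n<N. per n x) \<le> C" .
    show "0 \<le> (\<Sum>n<N. per n x)" by (intro sum_nonneg per_bounds that)
  qed
  have 2: "(\<lambda>N. \<integral>x. indicator {0..1} x * ((\<Sum>n<N. per n x) * cis (- 2 * pi * real_of_int k * x)) \<partial>lborel)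
     \<longlonglongrightarrow> (\<integral>x. indicator {0..1} x * complex_of_real (persum x) * cis (- 2 * pi * of_int k * x) \<partial>lborel)"
  proof (rule integral_dominated_convergence)
    show "integrable lborel (\<lambda>x. C * indicator {0..1::real} x)" by simp
    show "AE x in lborel. (\<lambda>N. indicator {0..1} x * (complex_of_real (\<Sum>n<N. per n x) * cis (- 2 * pi * real_of_int k * x)))
      \<longlonglongrightarrow> indicator {0..1} x * complex_of_real (persum x) * cis (- 2 * pi * of_int k * x)"
    proof (rule AE_I2)
      fix x :: real
      show "(\<lambda>N. indicator {0..1} x * (complex_of_real (\<Sum>n<N. per n x) * cis (- 2 * pi * real_of_int k * x)))
      \<longlonglongrightarrow> indicator {0..1} x * complex_of_real (persum x) * cis (- 2 * pi * of_int k * x)"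
      proof (cases "x \<in> {0..1}")
        case True
        have "(\<lambda>N. \<Sum>n<N. per n x) \<longlonglongrightarrow> persum x"
          unfolding persum_def by (rule summable_LIMSEQ[OF summable_per[OF True]])
        then show ?thesis unfolding mult.assoc by (intro tendsto_intros)
      qed simp
    qed
    show "AE x in lborel. norm (indicator {0..1} x * (complex_of_real (\<Sum>n<N. per n x) * cis (- 2 * pi * real_of_int k * x))) \<le> C * indicator {0..1} x" for N
      using bC by (intro AE_I2) (auto simp: indicator_def norm_mult simp del: of_real_sum)
  qed measurable
  have "(\<integral>x. ?E x \<partial>lborel) = (\<integral>x. indicator {0..1} x * complex_of_real (persum x) * cis (- 2 * pi * of_int k * x) \<partial>lborel)"
    by (rule LIMSEQ_unique[OF 1 2])
  then show ?thesis using FT_gauss[of k] by simp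
qed

end

lemma summable_psi: "t > 0 \<Longrightarrow> summable (\<lambda>n. exp (- pi * (real (Suc n))\<^sup>2 * t))"
  using summable_gauss[of t, THEN summable_Suc_iff[THEN iffD2]]
  by (simp add: gauss_def mult_ac)

text \<open>The periodization at 0 is 1 + 2 psi t. Its Fourier sums converge there and have Gaussian
  coefficients of parameter 1 / t, which are even in k, so the symmetric partial sums fold into 1 +
  2 psi (1 / t).\<close>

theorem psi_inversion:
  assumes t: "t > 0"
  shows "1 + 2 * psi t = (1 + 2 * psi (1 / t)) / sqrt t"
proof -
  obtain K where K: "K \<ge> 0" and lip: "\<And>x y. x \<in> {0..1} \<Longrightarrow> y \<in> {0..1} \<Longrightarrow> \<bar>persum t x - persum t y\<bar> \<le> K * \<bar>x - y\<bar>"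
    using persum_lipschitz[OF t] by blast
  have "(\<lambda>N. \<Sum>k\<in>{- int N..int N}. \<integral>x. indicator {0..1} x * complex_of_real (persum t x) * cis (- 2 * pi * of_int k * x) \<partial>lborel)
     \<longlonglongrightarrow> complex_of_real (persum t 0)"
  proof (rule Fourier_sum_at_0[OF _ _ _ K])
    show "(\<lambda>x. complex_of_real (persum t x)) \<in> borel_measurable borel"
      using persum_measurable[OF t] by measurable
    show "cmod (of_real (persum t x) - of_real (persum t 0)) \<le> K * x" if "x \<in> {0..1}" for x
      using lip[OF that, of 0] that by (simp flip: of_real_diff)
    show "cmod (of_real (persum t x) - of_real (persum t 0)) \<le> K * (1 - x)" if "x \<in> {0..1}" for x
      using lip[OF that, of 1] that persum_1[OF t] by (simp flip: of_real_diff)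
  qed
  then have "(\<lambda>N. complex_of_real (\<Sum>k\<in>{- int N..int N}. exp (- pi * (of_int k)\<^sup>2 / t) / sqrt t)) \<longlonglongrightarrow> complex_of_real (persum t 0)"
    unfolding Fourier_coeff_persum[OF t] of_real_sum .
  then have 1: "(\<lambda>N. \<Sum>k\<in>{- int N..int N}. exp (- pi * (of_int k)\<^sup>2 / t) / sqrt t) \<longlonglongrightarrow> 1 + 2 * psi t"
    unfolding persum_0[OF t] tendsto_of_real_iff .
  have part: "(\<Sum>k\<in>{- int N..int N}. exp (- pi * (of_int k)\<^sup>2 / t) / sqrt t)
      = (1 + 2 * (\<Sum>n<N. exp (- pi * (real (Suc n))\<^sup>2 * (1 / t)))) / sqrt t" for N
  proof (induction N)
    case (Suc N)
    have "{- int (Suc N)..int (Suc N)} = insert (int N + 1) (insert (- int N - 1) {- int N..int N})" by auto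
    moreover have "(- real N - 1)\<^sup>2 = (real N + 1)\<^sup>2" by (simp add: power2_eq_square algebra_simps)
    ultimately show ?case using Suc.IH by (simp add: add_divide_distrib add.commute)
  qed simp
  have "(\<lambda>N. (1 + 2 * (\<Sum>n<N. exp (- pi * (real (Suc n))\<^sup>2 * (1 / t)))) / sqrt t) \<longlonglongrightarrow> (1 + 2 * psi (1 / t)) / sqrt t"
    unfolding psi_def using t by (intro tendsto_intros summable_LIMSEQ summable_psi) auto
  then show ?thesis using 1 unfolding part by (rule LIMSEQ_unique[rotated])
qed

section \<open>The Mellin transform of psi and the entire function xi\<close>

text \<open>The points a + 1 + 1 / (n + 1) on the ray accumulate at a + 1, so the identity theorem
  applies. Used with d = 1 in the variable s of xi and with d = i in the upper half plane
  variable.\<close>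

lemma identity_on_ray:
  fixes f g :: "complex \<Rightarrow> complex"
  assumes "f holomorphic_on S" "g holomorphic_on S" "open S" "connected S" "d \<noteq> 0"
    and ray: "\<And>x::real. x > a \<Longrightarrow> of_real x * d \<in> S \<and> f (of_real x * d) = g (of_real x * d)"
    and "w \<in> S"
  shows "f w = g w"
proof -
  let ?U = "(\<lambda>x::real. of_real x * d) ` {a<..}"
  have "(of_real (a + 1) * d) islimpt ?U"
    unfolding islimpt_sequential
  proof (intro exI conjI allI)
    let ?X = "\<lambda>n. complex_of_real (a + 1 + inverse (real (Suc n))) * d"
    fix n
    have *: "inverse (real (Suc n)) > 0" by simp
    have "a + 1 + inverse (real (Suc n)) \<in> {a<..}" using * unfolding greaterThan_iff by linarith
    moreover have "complex_of_real (a + 1 + inverse (real (Suc n))) \<noteq> of_real (a + 1)"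
      unfolding of_real_eq_iff using * by linarith
    ultimately show "?X n \<in> ?U - {of_real (a + 1) * d}"
      using assms(5) by (intro DiffI imageI) (simp_all only: mult_cancel_right singleton_iff simp_thms)
    have "(\<lambda>n. a + 1 + inverse (real (Suc n))) \<longlonglongrightarrow> a + 1 + 0"
      by (intro tendsto_intros LIMSEQ_inverse_real_of_nat)
    then show "?X \<longlonglongrightarrow> of_real (a + 1) * d"
      by (intro tendsto_mult tendsto_const tendsto_of_real) simp
  qed
  have "f w - g w = 0"
  proof (rule analytic_continuation[of "\<lambda>z. f z - g z" S ?U "of_real (a + 1) * d"])
    show "(\<lambda>z. f z - g z) holomorphic_on S" by (intro holomorphic_on_diff assms)
    show "?U \<subseteq> S" "of_real (a + 1) * d \<in> S" using ray ray[of "a + 1"] by auto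
    show "f z - g z = 0" if "z \<in> ?U" for z using that ray by auto
  qed fact+
  then show ?thesis by simp
qed

text \<open>Euler's integral for Gamma under t = a e^r. The nonnegative integral is used so that
  summation over n in \<open>psi_Mellin\<close> can be exchanged freely.\<close>

lemma nn_integral_Gamma_exp:
  fixes a s :: real
  assumes "a > 0" "s > 0"
  shows "(\<integral>\<^sup>+r. ennreal (exp (- a * exp r) * exp (r * s)) \<partial>lborel) = ennreal (Gamma s / a powr s)"
proof -
  have "ennreal (Gamma s) = (\<integral>\<^sup>+t. ennreal (t powr (s - 1) / exp t) * indicator {0<..} t \<partial>lborel)"
    unfolding Gamma_conv_nn_integral_real[OF assms(2)]
  proof (rule nn_integral_cong_AE)
    show "AE t in lborel. ennreal (indicator {0..} t * t powr (s - 1) / exp t) = ennreal (t powr (s - 1) / exp t) * indicator {0<..} t"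
      using AE_lborel_singleton[of 0] by eventually_elim (auto simp: indicator_def)
  qed
  also have "\<dots> = (\<integral>\<^sup>+r. ennreal (exp r powr (s - 1) / exp (exp r)) * ennreal (exp r) \<partial>lborel)"
    by (rule nn_integral_exp_subst) measurable
  also have "\<dots> = (\<integral>\<^sup>+r. ennreal (exp (- exp r) * exp (r * s)) \<partial>lborel)"
    by (rule nn_integral_cong)
       (simp add: powr_def exp_minus divide_inverse right_diff_distrib exp_diff mult.commute flip: ennreal_mult)
  also have "\<dots> = (\<integral>\<^sup>+r. ennreal (exp (- exp (ln a + 1 * r)) * exp ((ln a + 1 * r) * s)) \<partial>lborel)"
    by (subst nn_integral_real_affine[of _ 1 "ln a"]) auto
  also have "\<dots> = (\<integral>\<^sup>+r. ennreal (a powr s) * ennreal (exp (- a * exp r) * exp (r * s)) \<partial>lborel)"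
  proof (rule nn_integral_cong)
    fix r
    have "exp (- exp (ln a + 1 * r)) = exp (- a * exp r)" using assms by (simp add: exp_add)
    moreover have "exp ((ln a + 1 * r) * s) = a powr s * exp (r * s)"
      using assms by (simp add: powr_def flip: exp_add) (simp add: algebra_simps)
    ultimately show "ennreal (exp (- exp (ln a + 1 * r)) * exp ((ln a + 1 * r) * s)) = ennreal (a powr s) * ennreal (exp (- a * exp r) * exp (r * s))"
      by (simp only: ennreal_mult[symmetric] exp_ge_zero powr_ge_zero mult_nonneg_nonneg mult.left_commute)
  qed
  also have "\<dots> = ennreal (a powr s) * (\<integral>\<^sup>+r. ennreal (exp (- a * exp r) * exp (r * s)) \<partial>lborel)"
    by (rule nn_integral_cmult) measurable
  finally have eq: "ennreal (Gamma s) = ennreal (a powr s) * (\<integral>\<^sup>+r. ennreal (exp (- a * exp r) * exp (r * s)) \<partial>lborel)" .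
  have "ennreal (Gamma s / a powr s) = ennreal (1 / a powr s) * ennreal (Gamma s)"
    using assms Gamma_real_pos[of s] by (simp flip: ennreal_mult)
  also have "\<dots> = (ennreal (1 / a powr s) * ennreal (a powr s)) * (\<integral>\<^sup>+r. ennreal (exp (- a * exp r) * exp (r * s)) \<partial>lborel)"
    unfolding eq by (simp add: mult.assoc)
  also have "ennreal (1 / a powr s) * ennreal (a powr s) = 1"
    using assms by (simp flip: ennreal_mult)
  finally show ?thesis by simp
qed

definition zeta_real :: "real \<Rightarrow> real" where
  "zeta_real s = (\<Sum>n. real (Suc n) powr (- s))"

lemma summable_zeta_real: "s > 1 \<Longrightarrow> summable (\<lambda>n. real (Suc n) powr (- s))"
  using summable_real_powr_iff[of "-s"] summable_Suc_iff[of "\<lambda>n. real n powr (- s)"] by simp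

lemma psi_measurable [measurable]: "psi \<in> borel_measurable borel"
  unfolding psi_def by measurable

lemma psi_nonneg: "t > 0 \<Longrightarrow> psi t \<ge> 0"
  unfolding psi_def by (intro suminf_nonneg summable_psi) auto

text \<open>Termwise integration of the positive series: the n-th term gives the power (pi
  n^2)^(-s/2) = pi^(-s/2) n^(-s). Finiteness of the sum yields integrability along with the
  value.\<close>

lemma psi_Mellin:
  assumes s: "s > 1"
  shows "has_bochner_integral lborel (\<lambda>r. psi (exp r) * exp (r * (s / 2))) (Gamma (s/2) * pi powr (- s / 2) * zeta_real s)"
proof (rule has_bochner_integral_nn_integral)
  show "0 \<le> Gamma (s/2) * pi powr (- s / 2) * zeta_real s"
    unfolding zeta_real_def using s
    by (intro mult_nonneg_nonneg suminf_nonneg summable_zeta_real) (auto intro: less_imp_le Gamma_real_pos)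
  have "(\<integral>\<^sup>+r. ennreal (psi (exp r) * exp (r * (s/2))) \<partial>lborel)
    = (\<integral>\<^sup>+r. (\<Sum>n. ennreal (exp (- (pi * (real (Suc n))\<^sup>2) * exp r) * exp (r * (s/2)))) \<partial>lborel)"
  proof (rule nn_integral_cong)
    fix r :: real
    have sm: "summable (\<lambda>n. exp (- (pi * (real (Suc n))\<^sup>2) * exp r) * exp (r * (s/2)))"
      using summable_mult2[OF summable_psi[of "exp r"], of "exp (r * (s/2))"] by simp
    have eq: "psi (exp r) * exp (r * (s/2)) = (\<Sum>n. exp (- (pi * (real (Suc n))\<^sup>2) * exp r) * exp (r * (s/2)))"
      unfolding psi_def by (subst suminf_mult2[OF summable_psi]) auto
    show "ennreal (psi (exp r) * exp (r * (s/2))) = (\<Sum>n. ennreal (exp (- (pi * (real (Suc n))\<^sup>2) * exp r) * exp (r * (s/2))))"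
      unfolding eq by (rule suminf_ennreal2[OF _ sm, symmetric]) (intro mult_nonneg_nonneg exp_ge_zero)
  qed
  also have "\<dots> = (\<Sum>n. \<integral>\<^sup>+r. ennreal (exp (- (pi * (real (Suc n))\<^sup>2) * exp r) * exp (r * (s/2))) \<partial>lborel)"
    by (rule nn_integral_suminf) measurable
  also have "\<dots> = (\<Sum>n. ennreal (Gamma (s/2) * pi powr (- s / 2) * real (Suc n) powr (- s)))"
  proof (rule suminf_cong)
    fix n
    have "(real (Suc n))\<^sup>2 powr (s/2) = real (Suc n) powr s"
    proof -
      have "(real (Suc n))\<^sup>2 = real (Suc n) powr 2" by simp
      then show ?thesis by (simp only: powr_powr) simp
    qed
    moreover have "(pi * (real (Suc n))\<^sup>2) powr (s/2) = pi powr (s/2) * (real (Suc n))\<^sup>2 powr (s/2)"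
      by (rule powr_mult)
    moreover have "pi powr (- s / 2) = inverse (pi powr (s/2))" "real (Suc n) powr (- s) = inverse (real (Suc n) powr s)"
      using powr_minus[of pi "s/2"] powr_minus[of "real (Suc n)" s] by simp_all
    ultimately have "Gamma (s/2) / (pi * (real (Suc n))\<^sup>2) powr (s/2) = Gamma (s/2) * pi powr (- s / 2) * real (Suc n) powr (- s)"
      by (simp only: divide_inverse inverse_mult_distrib mult.assoc)
    moreover have "(\<integral>\<^sup>+r. ennreal (exp (- (pi * (real (Suc n))\<^sup>2) * exp r) * exp (r * (s/2))) \<partial>lborel)
        = ennreal (Gamma (s/2) / (pi * (real (Suc n))\<^sup>2) powr (s/2))"
      by (rule nn_integral_Gamma_exp) (use s in auto)
    ultimately show "(\<integral>\<^sup>+r. ennreal (exp (- (pi * (real (Suc n))\<^sup>2) * exp r) * exp (r * (s/2))) \<partial>lborel)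
        = ennreal (Gamma (s/2) * pi powr (- s / 2) * real (Suc n) powr (- s))" by (simp only:)
  qed
  also have "\<dots> = ennreal (Gamma (s/2) * pi powr (- s / 2) * zeta_real s)"
  proof -
    have C: "0 \<le> Gamma (s/2) * pi powr (- s / 2)" using s Gamma_real_pos[of "s/2"] by simp
    have "(\<Sum>n. ennreal (Gamma (s/2) * pi powr (- s / 2) * real (Suc n) powr (- s)))
        = ennreal (\<Sum>n. Gamma (s/2) * pi powr (- s / 2) * real (Suc n) powr (- s))"
      by (rule suminf_ennreal2[OF mult_nonneg_nonneg[OF C powr_ge_zero] summable_mult[OF summable_zeta_real[OF s]]])
    also have "(\<Sum>n. Gamma (s/2) * pi powr (- s / 2) * real (Suc n) powr (- s)) = Gamma (s/2) * pi powr (- s / 2) * zeta_real s"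
      unfolding zeta_real_def by (rule suminf_mult[OF summable_zeta_real[OF s]])
    finally show ?thesis .
  qed
  finally show "(\<integral>\<^sup>+r. ennreal (psi (exp r) * exp (r * (s / 2))) \<partial>lborel) = ennreal (Gamma (s/2) * pi powr (- s / 2) * zeta_real s)" .
qed (auto intro!: mult_nonneg_nonneg psi_nonneg)

text \<open>For r > 0 a larger exponent dominates, so every real a is reduced to an exponent s / 2
  with s > 1, where \<open>psi_Mellin\<close> applies.\<close>

lemma psi_half_integrable: "integrable lborel (\<lambda>r. indicator {0<..} r * (psi (exp r) * exp (r * a)))"
proof (rule Bochner_Integration.integrable_bound)
  let ?s = "2 * max a 1"
  show "integrable lborel (\<lambda>r. psi (exp r) * exp (r * (?s / 2)))"
    using psi_Mellin[of ?s] by (auto simp: has_bochner_integral_iff)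
  show "AE r in lborel. norm (indicator {0<..} r * (psi (exp r) * exp (r * a))) \<le> norm (psi (exp r) * exp (r * (?s / 2)))"
    by (intro AE_I2) (auto simp: indicator_def abs_mult intro!: mult_left_mono)
qed measurable

lemma exp_half_line:
  fixes a :: real
  assumes "a > 0"
  shows "has_bochner_integral lborel (\<lambda>r. indicator {0<..} r * exp (- a * r)) (1 / a)"
proof (rule has_bochner_integral_nn_integral)
  have "(\<integral>\<^sup>+r. ennreal (indicator {0<..} r * exp (- a * r)) \<partial>lborel) = (\<integral>\<^sup>+r. ennreal (exp (- a * r)) * indicator {0..} r \<partial>lborel)"
  proof (rule nn_integral_cong_AE)
    show "AE r in lborel. ennreal (indicator {0<..} r * exp (- a * r)) = ennreal (exp (- a * r)) * indicator {0..} r"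
      using AE_lborel_singleton[of 0] by eventually_elim (auto simp: indicator_def)
  qed
  also have "\<dots> = ennreal (0 - (- exp (- a * 0) / a))"
  proof (rule nn_integral_FTC_atLeast[where F="\<lambda>r. - exp (- a * r) / a"])
    show "((\<lambda>r. - exp (- a * r) / a) has_real_derivative exp (- a * x)) (at x)" for x
      using assms by (auto intro!: derivative_eq_intros)
    show "((\<lambda>r. - exp (- a * r) / a) \<longlongrightarrow> 0) at_top" using assms by real_asymp
  qed auto
  finally show "(\<integral>\<^sup>+r. ennreal (indicator {0<..} r * exp (- a * r)) \<partial>lborel) = ennreal (1 / a)" by simp
qed (use assms in auto)

text \<open>Riemann's integral of psi(t) (t^(z/2) + t^((1-z)/2)) dt / t over t > 1, written with t =
  e^r. The rapid decay of psi makes it converge for every z.\<close>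

definition xi_int :: "complex \<Rightarrow> complex" where
  "xi_int z = (\<integral>r. of_real (indicator {0<..} r * psi (exp r)) * (exp (of_real r * (z / 2)) + exp (of_real r * ((1 - z) / 2))) \<partial>lborel)"

text \<open>The summand 1/2 is z (z - 1) / 2 times 1 / (z - 1) - 1 / z, the polar part of the
  completed zeta function.\<close>

definition xi_rep :: "complex \<Rightarrow> complex" where
  "xi_rep z = 1/2 + z * (z - 1) / 2 * xi_int z"

lemma xi_int_holomorphic: "xi_int holomorphic_on UNIV"
  unfolding xi_int_def
proof (rule holomorphic_on_integral)
  fix z :: complex
  \<comment> \<open>For |w - z| <= 1 both Re w and 1 - Re w are at most 2 + |z|.\<close>
  let ?B = "\<lambda>r. 2 * (indicator {0<..} r * (psi (exp r) * exp (r * ((2 + cmod z) / 2))))"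
  show "\<exists>d>0. \<exists>B. cball z d \<subseteq> UNIV \<and> integrable lborel B \<and> (\<forall>r\<in>space lborel. \<forall>w\<in>cball z d.
      cmod (of_real (indicator {0<..} r * psi (exp r)) * (exp (of_real r * (w / 2)) + exp (of_real r * ((1 - w) / 2)))) \<le> B r)"
  proof (intro exI[of _ 1] exI[of _ ?B] conjI ballI)
    show "integrable lborel ?B" by (intro integrable_mult_right psi_half_integrable)
    fix r :: real and w :: complex assume w: "w \<in> cball z 1"
    show "cmod (of_real (indicator {0<..} r * psi (exp r)) * (exp (of_real r * (w / 2)) + exp (of_real r * ((1 - w) / 2)))) \<le> ?B r"
    proof (cases "r > 0")
      case True
      have wz: "cmod w \<le> cmod z + 1" using w norm_triangle_ineq[of z "w - z"] by (simp add: dist_norm norm_minus_commute)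
      have "cmod (exp (of_real r * (w / 2)) + exp (of_real r * ((1 - w) / 2))) \<le> exp (r * (Re w / 2)) + exp (r * ((1 - Re w) / 2))"
        by (rule order_trans[OF norm_triangle_ineq]) simp
      also have "\<dots> \<le> exp (r * ((2 + cmod z) / 2)) + exp (r * ((2 + cmod z) / 2))"
        using wz complex_Re_le_cmod[of w] abs_Re_le_cmod[of w] True
        by (intro add_mono) (auto intro!: mult_left_mono)
      finally have "psi (exp r) * cmod (exp (of_real r * (w / 2)) + exp (of_real r * ((1 - w) / 2))) \<le> psi (exp r) * (2 * exp (r * ((2 + cmod z) / 2)))"
        by (intro mult_left_mono psi_nonneg) auto
      then show ?thesis using True psi_nonneg[of "exp r"] by (simp add: norm_mult mult_ac)
    qed simp
  qed auto
qed (auto intro!: holomorphic_intros)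

lemma xi_rep_holomorphic: "xi_rep holomorphic_on UNIV"
  unfolding xi_rep_def by (auto intro!: holomorphic_intros xi_int_holomorphic)

lemma xi_rep_reflect: "xi_rep (1 - z) = xi_rep z"
proof -
  have "xi_int (1 - z) = xi_int z" unfolding xi_int_def by (simp add: add.commute)
  then show ?thesis by (simp add: xi_rep_def algebra_simps)
qed

lemma xi_rep_cnj: "xi_rep (cnj z) = cnj (xi_rep z)"
proof -
  have "xi_int (cnj z) = cnj (xi_int z)" unfolding xi_int_def
    by (subst Bochner_Integration.integral_cnj[symmetric]) (simp add: exp_cnj)
  then show ?thesis by (simp add: xi_rep_def)
qed

text \<open>Split the Mellin integral of psi at r = 0. On the negative half, the reflection r -> -r
  and \<open>psi_inversion\<close> produce the exponent (1 - s) / 2 and two explicit exponentials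
  with total integral 1 / (s - 1) - 1 / s.\<close>

lemma xi_rep_real:
  assumes s: "s > 1"
  shows "xi_rep (of_real s) = of_real (s * (s - 1) / 2 * (Gamma (s/2) * pi powr (- s / 2) * zeta_real s))"
proof -
  let ?p = "\<lambda>r. psi (exp r) * exp (r * (s / 2))"
  let ?q = "\<lambda>r. indicator {0<..} r * (psi (exp r) * exp (r * ((1 - s) / 2)))"
  have ip: "integrable lborel ?p" and vp: "(\<integral>r. ?p r \<partial>lborel) = Gamma (s/2) * pi powr (- s / 2) * zeta_real s"
    using psi_Mellin[OF s] by (auto simp: has_bochner_integral_iff)
  have ipA: "integrable lborel (\<lambda>r. indicator A r * ?p r)" if [measurable]: "A \<in> sets borel" for A
    by (rule Bochner_Integration.integrable_bound[OF ip]) (auto simp: indicator_def)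
  have e1: "has_bochner_integral lborel (\<lambda>r. indicator {0<..} r * exp (- ((s - 1) / 2) * r)) (1 / ((s - 1) / 2))"
    by (rule exp_half_line) (use s in simp)
  have e2: "has_bochner_integral lborel (\<lambda>r. indicator {0<..} r * exp (- (s / 2) * r)) (1 / (s / 2))"
    by (rule exp_half_line) (use s in simp)
  have "(\<integral>r. ?p r \<partial>lborel) = (\<integral>r. indicator {0<..} r * ?p r + indicator {..<0} r * ?p r \<partial>lborel)"
  proof (rule integral_cong_AE)
    show "AE r in lborel. ?p r = indicator {0<..} r * ?p r + indicator {..<0} r * ?p r"
      using AE_lborel_singleton[of 0] by eventually_elim (auto simp: indicator_def)
  qed measurable
  also have "\<dots> = (\<integral>r. indicator {0<..} r * ?p r \<partial>lborel) + (\<integral>r. indicator {..<0} r * ?p r \<partial>lborel)"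
    by (intro Bochner_Integration.integral_add ipA) auto
  also have "(\<integral>r. indicator {..<0} r * ?p r \<partial>lborel) = (\<integral>r. indicator {..<0} (- r) * ?p (- r) \<partial>lborel)"
    using lborel_integral_real_affine[of "-1" "\<lambda>r. indicator {..<0} r * ?p r" 0] by simp
  also have "\<dots> = (\<integral>r. ?q r + (1/2) * (indicator {0<..} r * exp (- ((s - 1) / 2) * r)) - (1/2) * (indicator {0<..} r * exp (- (s / 2) * r)) \<partial>lborel)"
  proof (rule Bochner_Integration.integral_cong[OF refl])
    fix r :: real
    have "sqrt (exp r) = exp (r / 2)" by (rule real_sqrt_unique) (auto simp flip: exp_of_nat_mult)
    then have "1 + 2 * psi (exp r) = (1 + 2 * psi (exp (-r))) / exp (r / 2)"
      using psi_inversion[of "exp r"] by (simp add: exp_minus inverse_eq_divide)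
    then have "psi (exp (-r)) = (exp (r/2) * (1 + 2 * psi (exp r)) - 1) / 2" by (simp add: field_simps)
    then have "?p (- r) = (exp (r/2) * (1 + 2 * psi (exp r)) - 1) / 2 * exp (- r * (s/2))" by simp
    also have "\<dots> = psi (exp r) * (exp (r/2) * exp (- r * (s/2))) + (1/2) * (exp (r/2) * exp (- r * (s/2))) - (1/2) * exp (- r * (s/2))"
      by (simp add: field_simps)
    also have "exp (r/2) * exp (- r * (s/2)) = exp (r * ((1 - s) / 2))"
      by (simp add: field_simps flip: exp_add)
    finally have "?p (- r) = psi (exp r) * exp (r * ((1 - s) / 2)) + (1/2) * exp (r * ((1 - s) / 2)) - (1/2) * exp (- r * (s/2))" .
    moreover have "- ((s - 1) / 2) * r = r * ((1 - s) / 2)" "- (s / 2) * r = - r * (s/2)"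
      by (simp_all add: field_simps)
    ultimately have "?p (- r) = psi (exp r) * exp (r * ((1 - s) / 2)) + (1/2) * exp (- ((s - 1) / 2) * r) - (1/2) * exp (- (s / 2) * r)"
      by (simp only:)
    then show "indicator {..<0} (- r) * ?p (- r) = ?q r + (1/2) * (indicator {0<..} r * exp (- ((s - 1) / 2) * r)) - (1/2) * (indicator {0<..} r * exp (- (s / 2) * r))"
      by (auto simp: indicator_def)
  qed
  also have "\<dots> = (\<integral>r. ?q r \<partial>lborel) + (1/2) * (1 / ((s - 1) / 2)) - (1/2) * (1 / (s / 2))"
    using e1 e2 psi_half_integrable[of "(1 - s) / 2"]
    by (simp only: has_bochner_integral_iff Bochner_Integration.integral_add Bochner_Integration.integral_diff
        Bochner_Integration.integrable_add integrable_mult_right integral_mult_right_zero)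
  finally have L: "Gamma (s/2) * pi powr (- s / 2) * zeta_real s
     = (\<integral>r. indicator {0<..} r * ?p r \<partial>lborel) + (\<integral>r. ?q r \<partial>lborel) + (1 / (s - 1) - 1 / s)"
    unfolding vp by simp
  have "xi_int (of_real s) = (\<integral>r. of_real (indicator {0<..} r * ?p r + ?q r) \<partial>lborel)"
    unfolding xi_int_def
  proof (rule Bochner_Integration.integral_cong[OF refl])
    fix r :: real
    have "exp (of_real r * (of_real s / 2)) = complex_of_real (exp (r * (s / 2)))"
      "exp (of_real r * ((1 - of_real s) / 2)) = complex_of_real (exp (r * ((1 - s) / 2)))"
      by (simp_all add: exp_of_real[symmetric])
    then show "of_real (indicator {0<..} r * psi (exp r)) * (exp (of_real r * (of_real s / 2)) + exp (of_real r * ((1 - of_real s) / 2)))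
        = complex_of_real (indicator {0<..} r * ?p r + ?q r)"
      by (simp only: of_real_mult of_real_add distrib_left mult.assoc)
  qed
  also have "\<dots> = of_real (\<integral>r. indicator {0<..} r * ?p r + ?q r \<partial>lborel)" by (rule integral_complex_of_real)
  also have "(\<integral>r. indicator {0<..} r * ?p r + ?q r \<partial>lborel) = Gamma (s/2) * pi powr (- s / 2) * zeta_real s - (1 / (s - 1) - 1 / s)"
    unfolding L using Bochner_Integration.integral_add[OF ipA[of "{0<..}"] psi_half_integrable[of "(1 - s) / 2"]] by simp
  finally have "xi_rep (of_real s) = of_real (1/2 + s * (s - 1) / 2 * (Gamma (s/2) * pi powr (- s / 2) * zeta_real s - (1 / (s - 1) - 1 / s)))"
    by (simp add: xi_rep_def)
  also have "s * (s - 1) / 2 * (Gamma (s/2) * pi powr (- s / 2) * zeta_real s - (1 / (s - 1) - 1 / s)) =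
     s * (s - 1) / 2 * (Gamma (s/2) * pi powr (- s / 2) * zeta_real s) - 1/2"
    using s by (simp add: right_diff_distrib) (simp add: field_simps)
  finally show ?thesis by simp
qed

text \<open>The series is read as an integral over the counting measure, so that
  \<open>holomorphic_on_integral\<close> applies. The majorant uses the exponent halfway between 1
  and Re z.\<close>

lemma zeta_holomorphic: "(\<lambda>s. \<Sum>n. 1 / (of_nat (Suc n)) powr s) holomorphic_on {s::complex. 1 < Re s}"
proof -
  have norm: "norm (1 / (of_nat (Suc n)) powr w) = real (Suc n) powr (- Re w)" for n and w :: complex
    by (simp add: norm_divide norm_powr_real_powr powr_minus inverse_eq_divide del: of_nat_Suc)
  have int: "integrable (count_space UNIV) (\<lambda>n. 1 / (of_nat (Suc n)) powr w)" if "1 < Re w" for w :: complex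
    unfolding integrable_count_space_nat_iff norm using summable_zeta_real[OF that] .
  have "(\<lambda>s. \<integral>n. 1 / (of_nat (Suc n)) powr s \<partial>count_space UNIV) holomorphic_on {s::complex. 1 < Re s}"
  proof (rule holomorphic_on_integral)
    show "open {s::complex. 1 < Re s}" by (rule open_halfspace_Re_gt)
    fix z :: complex assume "z \<in> {s. 1 < Re s}"
    then have z: "1 < Re z" by simp
    let ?d = "(Re z - 1) / 2" and ?B = "\<lambda>n. real (Suc n) powr (- ((Re z + 1) / 2))"
    show "\<exists>d>0. \<exists>B. cball z d \<subseteq> {s. 1 < Re s} \<and> integrable (count_space UNIV) B \<and>
       (\<forall>n\<in>space (count_space UNIV). \<forall>w\<in>cball z d. cmod (1 / (of_nat (Suc n)) powr w) \<le> B n)"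
    proof (intro exI[of _ ?d] exI[of _ ?B] conjI ballI)
      have re: "Re w \<ge> (Re z + 1) / 2" if "w \<in> cball z ?d" for w
        using that abs_Re_le_cmod[of "z - w"] by (simp add: dist_norm)
      show "cball z ?d \<subseteq> {s. 1 < Re s}" using re z by fastforce
      show "integrable (count_space UNIV) ?B"
        unfolding integrable_count_space_nat_iff using summable_zeta_real[of "(Re z + 1) / 2"] z by simp
      show "cmod (1 / (of_nat (Suc n)) powr w) \<le> ?B n" if "w \<in> cball z ?d" for n w
        unfolding norm using re[OF that] by (intro powr_mono) auto
    qed (use z in simp)
  qed (auto intro!: holomorphic_intros simp del: of_nat_Suc)
  then show ?thesis
  proof (rule holomorphic_transform)
    fix s :: complex assume "s \<in> {s. 1 < Re s}"
    then have "1 < Re s" by simp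
    from integral_count_space_nat[OF int[OF this]]
    show "(\<integral>n. 1 / (of_nat (Suc n)) powr s \<partial>count_space UNIV) = (\<Sum>n. 1 / (of_nat (Suc n)) powr s)" .
  qed
qed

text \<open>Both sides are holomorphic for Re s > 1 and agree on the real ray by
  \<open>xi_rep_real\<close>.\<close>

lemma xi_rep_eq:
  assumes "1 < Re s"
  shows "xi_rep s = 1/2 * s * (s - 1) * (of_real pi) powr (- s / 2) * Gamma (s / 2) * (\<Sum>n. 1 / (of_nat (Suc n)) powr s)"
proof (rule identity_on_ray[where f=xi_rep and S="{s. 1 < Re s}" and d=1 and a=1 and
    g="\<lambda>s. 1/2 * s * (s - 1) * (of_real pi) powr (- s / 2) * Gamma (s / 2) * (\<Sum>n. 1 / (of_nat (Suc n)) powr s)"])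
  show "xi_rep holomorphic_on {s. 1 < Re s}" using xi_rep_holomorphic holomorphic_on_subset by blast
  show "(\<lambda>s. 1/2 * s * (s - 1) * (of_real pi) powr (- s / 2) * Gamma (s / 2) * (\<Sum>n. 1 / (of_nat (Suc n)) powr s)) holomorphic_on {s::complex. 1 < Re s}"
    by (intro holomorphic_intros zeta_holomorphic) (auto elim!: nonpos_Ints_cases simp: complex_eq_iff)
  show "open {s::complex. 1 < Re s}" by (rule open_halfspace_Re_gt)
  show "connected {s::complex. 1 < Re s}" by (rule convex_connected[OF convex_halfspace_Re_gt])
  show "s \<in> {s. 1 < Re s}" using assms by simp
  fix x :: real assume x: "x > 1"
  have t: "1 / (complex_of_nat (Suc n)) powr (of_real x) = of_real (real (Suc n) powr (- x))" for n
    using powr_of_real[of "real (Suc n)" x] by (simp add: powr_minus inverse_eq_divide del: of_nat_Suc)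
  have z: "(\<Sum>n. 1 / (complex_of_nat (Suc n)) powr (of_real x)) = of_real (zeta_real x)"
    unfolding t zeta_real_def by (rule suminf_of_real[symmetric, OF summable_zeta_real[OF x]])
  have p: "(complex_of_real pi) powr (- of_real x / 2) = of_real (pi powr (- x / 2))"
    using powr_of_real[of pi "- x / 2"] by simp
  have g: "Gamma (complex_of_real x / 2) = of_real (Gamma (x / 2))"
    using Gamma_complex_of_real[of "x / 2"] by simp
  show "of_real x * 1 \<in> {s. 1 < Re s} \<and> xi_rep (of_real x * 1) =
     1/2 * (of_real x * 1) * (of_real x * 1 - 1) * (of_real pi) powr (- (of_real x * 1) / 2) * Gamma (of_real x * 1 / 2)
      * (\<Sum>n. 1 / (of_nat (Suc n)) powr (of_real x * 1))"
    unfolding mult_1_right z p g using x xi_rep_real[OF x] by simp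
qed simp

text \<open>\<open>xi_rep\<close> shows that the choice is not vacuous, and the identity theorem
  shows that it is unique.\<close>

lemma riemann_xi_eq: "riemann_xi = xi_rep"
proof -
  define F where "F = riemann_xi"
  have "F holomorphic_on UNIV \<and> (\<forall>s. 1 < Re s \<longrightarrow>
        F s = 1/2 * s * (s - 1) * (of_real pi) powr (- s / 2) * Gamma (s / 2) * (\<Sum>n. 1 / (of_nat (Suc n)) powr s))"
    unfolding F_def riemann_xi_def by (rule someI[of _ xi_rep]) (use xi_rep_holomorphic xi_rep_eq in blast)
  then have F: "F holomorphic_on UNIV"
    and Fs: "\<And>s. 1 < Re s \<Longrightarrow> F s = 1/2 * s * (s - 1) * (of_real pi) powr (- s / 2) * Gamma (s / 2) * (\<Sum>n. 1 / (of_nat (Suc n)) powr s)"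
    by blast+
  have F': "F s = xi_rep s" if "1 < Re s" for s
    unfolding Fs[OF that] by (rule xi_rep_eq[OF that, symmetric])
  have "F z = xi_rep z" for z
    by (rule identity_on_ray[where S=UNIV and d=1 and a=1 and f=F and g=xi_rep])
       (use F F' xi_rep_holomorphic in auto)
  then show ?thesis by (auto simp: F_def)
qed

section \<open>The Dirichlet series of the coefficients c\<close>

text \<open>For a prime \<open>p\<close> dividing \<open>n\<close>, the squarefree divisors of \<open>n\<close> pair up as \<open>d\<close> and \<open>p d\<close> with
  \<open>p\<close> not dividing \<open>d\<close>.\<close>
lemma sum_mu_divisors:
  assumes "n > 0"
  shows "(\<Sum>d | d dvd n. mu d) = (if n = 1 then 1 else 0)"
proof (cases "n = 1")
  case True
  then show ?thesis by (simp add: mu_def)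
next
  case False
  then obtain p where p: "prime p" "p dvd n" using prime_factor_nat by blast
  define D where "D = {d. d dvd n \<and> squarefree d \<and> \<not> p dvd d}"
  have fin: "finite {d. d dvd n}" using assms by simp
  have finD: "finite D" unfolding D_def by (rule finite_subset[OF _ fin]) auto
  have p0: "p > 0" using p prime_gt_0_nat by blast
  have cop: "coprime p d" if "d \<in> D" for d using that p by (auto simp: D_def prime_imp_coprime)
  have sf: "{d. d dvd n \<and> squarefree d} = D \<union> (\<lambda>d. p * d) ` D"
  proof (intro equalityI subsetI)
    fix d assume d: "d \<in> {d. d dvd n \<and> squarefree d}"
    show "d \<in> D \<union> (\<lambda>d. p * d) ` D"
    proof (cases "p dvd d")
      case True
      then obtain e where e: "d = p * e" by (auto simp: dvd_def)
      have "squarefree e" using d e squarefree_multD by blast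
      moreover have "\<not> p dvd e"
      proof
        assume "p dvd e"
        then have "p\<^sup>2 dvd d" using e by (auto simp: power2_eq_square)
        then show False using d p squarefreeD[of d p] by auto
      qed
      moreover have "e dvd n" using d e dvd_mult_right by blast
      ultimately show ?thesis using e by (auto simp: D_def)
    qed (use d in \<open>auto simp: D_def\<close>)
  next
    fix d assume "d \<in> D \<union> (\<lambda>d. p * d) ` D"
    then show "d \<in> {d. d dvd n \<and> squarefree d}"
    proof
      assume "d \<in> (\<lambda>d. p * d) ` D"
      then obtain e where e: "d = p * e" "e \<in> D" by auto
      then have "p * e dvd n" using p cop by (intro divides_mult) (auto simp: D_def)
      moreover have "squarefree (p * e)"
        using e cop p by (intro squarefree_mult_coprime) (auto simp: D_def squarefree_prime)
      ultimately show ?thesis using e by auto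
    qed (auto simp: D_def)
  qed
  have mup: "mu (p * d) = - mu d" if d: "d \<in> D" for d
  proof -
    have "squarefree (p * d)" using sf d by blast
    moreover have "prime_factors (p * d) = insert p (prime_factors d)"
      using d p p0 assms by (subst prime_factors_product) (auto simp: D_def prime_prime_factors)
    moreover have "p \<notin> prime_factors d" using d by (auto simp: D_def)
    ultimately show ?thesis using d by (auto simp: mu_def D_def)
  qed
  have "(\<Sum>d | d dvd n. mu d) = (\<Sum>d | d dvd n \<and> squarefree d. mu d)"
    by (rule sum.mono_neutral_right) (use fin in \<open>auto simp: mu_def\<close>)
  also have "\<dots> = (\<Sum>d\<in>D. mu d) + (\<Sum>d\<in>(\<lambda>d. p * d) ` D. mu d)"
    unfolding sf by (rule sum.union_disjoint) (use finD in \<open>auto simp: D_def\<close>)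
  also have "(\<Sum>d\<in>(\<lambda>d. p * d) ` D. mu d) = (\<Sum>d\<in>D. - mu d)"
    by (subst sum.reindex) (use p0 mup in \<open>auto simp: inj_on_def\<close>)
  finally show ?thesis using False by (simp add: sum_negf)
qed

lemma has_sum_Suc: "(f has_sum S) {0<..} \<longleftrightarrow> ((\<lambda>n. f (Suc n)) has_sum S) UNIV"
proof -
  have "{0<..} = range Suc" by (auto simp: image_iff gr0_conv_Suc)
  then show ?thesis by (simp add: has_sum_reindex o_def)
qed

text \<open>Absolute convergence allows the double series over pairs (d, m) to be regrouped along n
  = d m. Unordered sums over the positive integers do the regrouping and are converted to
  \<open>sums\<close>, shifted by \<open>Suc\<close>, only at the end.\<close>

lemma sums_Dirichlet_product:
  fixes F G :: "nat \<Rightarrow> real"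
  assumes F: "summable (\<lambda>n. \<bar>F (Suc n)\<bar>)" and G: "summable (\<lambda>n. \<bar>G (Suc n)\<bar>)"
  shows "(\<lambda>n. \<Sum>d | d dvd Suc n. F d * G (Suc n div d)) sums ((\<Sum>n. F (Suc n)) * (\<Sum>n. G (Suc n)))"
proof -
  let ?P = "{0<..} :: nat set" and ?FS = "\<Sum>n. F (Suc n)" and ?GS = "\<Sum>n. G (Suc n)"
  have hs: "(H has_sum (\<Sum>n. H (Suc n))) ?P" if "summable (\<lambda>n. \<bar>H (Suc n)\<bar>)" for H :: "nat \<Rightarrow> real"
    unfolding has_sum_Suc by (rule norm_summable_imp_has_sum) (use that summable_rabs_cancel in auto)
  have Fs: "(F has_sum ?FS) ?P" and Gs: "(G has_sum ?GS) ?P" by (rule hs, fact)+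
  have Fa: "((\<lambda>n. \<bar>F n\<bar>) has_sum (\<Sum>n. \<bar>F (Suc n)\<bar>)) ?P" by (rule hs) (use F in simp)
  have Ga: "((\<lambda>n. \<bar>G n\<bar>) has_sum (\<Sum>n. \<bar>G (Suc n)\<bar>)) ?P" by (rule hs) (use G in simp)
  let ?f = "\<lambda>(d, m). F d * G m"
  have inner: "((\<lambda>m. \<bar>F d\<bar> * \<bar>G m\<bar>) has_sum (\<bar>F d\<bar> * (\<Sum>n. \<bar>G (Suc n)\<bar>))) ?P" for d
    by (rule has_sum_cmult_right[OF Ga])
  have "(\<lambda>p. norm (?f p)) summable_on (Sigma ?P (\<lambda>_. ?P))"
    unfolding Infinite_Sum.abs_summable_on_Sigma_iff
  proof (intro conjI ballI)
    fix d show "(\<lambda>m. norm (?f (d, m))) summable_on ?P"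
      using inner[of d] by (simp add: abs_mult has_sum_imp_summable)
  next
    have "(\<Sum>\<^sub>\<infinity>m\<in>?P. norm (?f (d, m))) = \<bar>F d\<bar> * (\<Sum>n. \<bar>G (Suc n)\<bar>)" for d
      using infsumI[OF inner[of d]] by (simp add: abs_mult)
    moreover have "(\<lambda>d. \<bar>F d\<bar> * (\<Sum>n. \<bar>G (Suc n)\<bar>)) summable_on ?P"
      using has_sum_cmult_left[OF Fa] by (rule has_sum_imp_summable)
    ultimately show "(\<lambda>d. norm (\<Sum>\<^sub>\<infinity>m\<in>?P. norm (?f (d, m)))) summable_on ?P"
      using suminf_nonneg[OF G] by (simp add: abs_mult)
  qed
  then obtain S where S: "(?f has_sum S) (Sigma ?P (\<lambda>_. ?P))"
    using Infinite_Sum.abs_summable_summable has_sum_infsum by blast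
  have "((\<lambda>d. F d * ?GS) has_sum S) ?P"
    by (rule has_sum_SigmaD[OF S]) (use has_sum_cmult_right[OF Gs] in simp)
  then have S_eq: "S = ?FS * ?GS"
    using has_sum_cmult_left[OF Fs] has_sum_unique by blast
  have "((\<lambda>(n, d). F d * G (n div d)) has_sum S) (Sigma ?P (\<lambda>n. {d. d dvd n})) = (?f has_sum S) (Sigma ?P (\<lambda>_. ?P))"
    by (rule has_sum_reindex_bij_witness[where i = "\<lambda>(d, m). (d * m, d)" and j = "\<lambda>(n, d). (d, n div d)"])
       (auto intro: Nat.gr0I simp: dvd_pos_nat)
  with S have "((\<lambda>(n, d). F d * G (n div d)) has_sum S) (Sigma ?P (\<lambda>n. {d. d dvd n}))" by blast
  then have "((\<lambda>n. \<Sum>d | d dvd n. F d * G (n div d)) has_sum S) ?P"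
    by (rule has_sum_SigmaD) (auto intro!: has_sum_finite)
  then show ?thesis
    unfolding has_sum_Suc S_eq by (rule has_sum_imp_sums)
qed

lemma abs_mu_le: "\<bar>mu d\<bar> \<le> 1"
  by (auto simp: mu_def power_abs)

context
  fixes \<omega> s :: real
  assumes \<omega>: "\<omega> > 0" and s: "s > 1 + \<omega>"
begin

text \<open>For n = d m the power n^(\<omega> - s) splits into powers of d and m, and the factor
  d^(-2 \<omega>) changes the exponent of d to -(s + \<omega>). This makes the terms a Dirichlet
  convolution.\<close>

lemma c_coef_Dirichlet:
  assumes "n > 0"
  shows "c_coef \<omega> n * real n powr (- s)
    = (\<Sum>d | d dvd n. (real_of_int (mu d) * real d powr (- (s + \<omega>))) * (real (n div d) powr (- (s - \<omega>))))"
proof -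
  have "real n powr \<omega> * (real_of_int (mu d) * real d powr (- 2 * \<omega>)) * real n powr (- s)
     = (real_of_int (mu d) * real d powr (- (s + \<omega>))) * (real (n div d) powr (- (s - \<omega>)))" if d: "d dvd n" for d
  proof -
    obtain m where m: "n = d * m" using d by (auto simp: dvd_def)
    then have pos: "d > 0" "m > 0" using assms by auto
    have "real n powr \<omega> * real n powr (- s) = real n powr (\<omega> - s)" by (simp flip: powr_add)
    also have "\<dots> = real d powr (\<omega> - s) * real m powr (\<omega> - s)" by (simp add: m powr_mult)
    finally have "real n powr \<omega> * real n powr (- s) * real d powr (- 2 * \<omega>) = real m powr (\<omega> - s) * (real d powr (\<omega> - s) * real d powr (- 2 * \<omega>))"
      by simp
    also have "real d powr (\<omega> - s) * real d powr (- 2 * \<omega>) = real d powr (- (s + \<omega>))"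
      unfolding powr_add[symmetric] by (simp add: algebra_simps)
    finally show ?thesis using m pos by (simp add: mult_ac)
  qed
  then show ?thesis unfolding c_coef_def sum_distrib_left sum_distrib_right by (intro sum.cong) auto
qed

lemma summable_mu: "summable (\<lambda>n. \<bar>real_of_int (mu (Suc n)) * real (Suc n) powr (- (s + \<omega>))\<bar>)"
proof (rule summable_comparison_test'[OF summable_zeta_real[of "s + \<omega>"], of 0])
  fix n :: nat
  have "\<bar>real_of_int (mu (Suc n))\<bar> \<le> 1" using abs_mu_le[of "Suc n"] by linarith
  then have "\<bar>real_of_int (mu (Suc n))\<bar> * real (Suc n) powr (- (s + \<omega>)) \<le> 1 * real (Suc n) powr (- (s + \<omega>))"
    by (intro mult_right_mono) auto
  then show "norm \<bar>real_of_int (mu (Suc n)) * real (Suc n) powr (- (s + \<omega>))\<bar> \<le> real (Suc n) powr (- (s + \<omega>))"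
    by (simp add: abs_mult del: of_nat_Suc)
qed (use \<omega> s in simp)

lemma summable_c_coef: "summable (\<lambda>n. \<bar>c_coef \<omega> (Suc n) * real (Suc n) powr (- s)\<bar>)"
proof (rule summable_comparison_test')
  let ?F = "\<lambda>d. \<bar>real_of_int (mu d) * real d powr (- (s + \<omega>))\<bar>" and ?G = "\<lambda>m. real m powr (- (s - \<omega>))"
  show "summable (\<lambda>n. \<Sum>d | d dvd Suc n. ?F d * ?G (Suc n div d))"
    using sums_Dirichlet_product[of ?F ?G] summable_mu summable_zeta_real[of "s - \<omega>"] s
    by (simp add: sums_iff del: of_nat_Suc)
  show "norm \<bar>c_coef \<omega> (Suc n) * real (Suc n) powr (- s)\<bar> \<le> (\<Sum>d | d dvd Suc n. ?F d * ?G (Suc n div d))" if "n \<ge> 0" for n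
    unfolding c_coef_Dirichlet[OF zero_less_Suc] real_norm_def abs_idempotent
    by (rule order_trans[OF sum_abs]) (simp add: abs_mult)
qed

text \<open>The series equals zeta(s - \<omega>) / zeta(s + \<omega>). In product form it needs no
  separate nonvanishing argument: the series of \<open>mu\<close> times zeta(s + \<omega>) is 1 by
  \<open>sum_mu_divisors\<close>.\<close>

lemma suminf_c_coef:
  "(\<Sum>n. c_coef \<omega> (Suc n) * real (Suc n) powr (- s)) * zeta_real (s + \<omega>) = zeta_real (s - \<omega>)"
proof -
  let ?F = "\<lambda>d. real_of_int (mu d) * real d powr (- (s + \<omega>))"
  have z: "summable (\<lambda>n. \<bar>real (Suc n) powr (- x)\<bar>)" if "x > 1" for x
    using summable_zeta_real[OF that] by simp
  have "(\<lambda>n. \<Sum>d | d dvd Suc n. ?F d * real (Suc n div d) powr (- (s - \<omega>))) sums ((\<Sum>n. ?F (Suc n)) * zeta_real (s - \<omega>))"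
    unfolding zeta_real_def by (rule sums_Dirichlet_product[OF summable_mu z]) (use s in simp)
  then have 1: "(\<Sum>n. c_coef \<omega> (Suc n) * real (Suc n) powr (- s)) = (\<Sum>n. ?F (Suc n)) * zeta_real (s - \<omega>)"
    unfolding c_coef_Dirichlet[OF zero_less_Suc] by (rule sums_unique[symmetric])
  have "(\<lambda>n. \<Sum>d | d dvd Suc n. ?F d * real (Suc n div d) powr (- (s + \<omega>))) sums ((\<Sum>n. ?F (Suc n)) * zeta_real (s + \<omega>))"
    unfolding zeta_real_def by (rule sums_Dirichlet_product[OF summable_mu z]) (use s \<omega> in simp)
  moreover have "(\<Sum>d | d dvd Suc n. ?F d * real (Suc n div d) powr (- (s + \<omega>))) = (if n = 0 then 1 else 0)" for n
  proof -
    have "?F d * real (Suc n div d) powr (- (s + \<omega>)) = real_of_int (mu d) * real (Suc n) powr (- (s + \<omega>))" if "d dvd Suc n" for d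
    proof -
      have "real (Suc n) = real d * real (Suc n div d)" using that by (simp flip: of_nat_mult del: of_nat_Suc)
      then have "real (Suc n) powr (- (s + \<omega>)) = real d powr (- (s + \<omega>)) * real (Suc n div d) powr (- (s + \<omega>))"
        by (simp only: powr_mult)
      then show ?thesis by (simp only: mult.assoc)
    qed
    then have "(\<Sum>d | d dvd Suc n. ?F d * real (Suc n div d) powr (- (s + \<omega>))) = real_of_int (\<Sum>d | d dvd Suc n. mu d) * real (Suc n) powr (- (s + \<omega>))"
      unfolding of_int_sum sum_distrib_right by (intro sum.cong) auto
    then show ?thesis by (simp add: sum_mu_divisors)
  qed
  ultimately have "(\<lambda>n. if n = 0 then 1 else 0) sums ((\<Sum>n. ?F (Suc n)) * zeta_real (s + \<omega>))" by simp
  moreover have "(\<lambda>n::nat. if n = 0 then 1 else 0) sums (1::real)" using sums_single[of 0 "\<lambda>_. 1::real"] by simp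
  ultimately have 2: "(\<Sum>n. ?F (Suc n)) * zeta_real (s + \<omega>) = 1" using sums_unique2 by blast
  show ?thesis unfolding 1 using 2 by (simp add: mult.commute mult.left_commute)
qed

end

section \<open>The gamma factors and the Mellin transform of h\<close>

text \<open>Euler's Beta integral under t = e^(-2 q). The 2 matches the squares in
  \<open>g_fun\<close> when x = e^(-q), and its Jacobian halves the value.\<close>

lemma Beta_exp:
  fixes a b :: real
  assumes "a > 0" "b > 0"
  shows "(\<integral>\<^sup>+q. ennreal (indicator {0<..} q * (exp (- 2 * a * q) * (1 - exp (- 2 * q)) powr (b - 1))) \<partial>lborel) = ennreal (Beta a b / 2)"
proof -
  let ?f = "\<lambda>t. t powr (a - 1) * (1 - t) powr (b - 1)"
  have "ennreal (Beta a b) = (\<integral>\<^sup>+t. ennreal (indicator {0..1} t * ?f t) \<partial>lborel)"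
    by (rule nn_integral_has_integral_lebesgue[symmetric, OF _ has_integral_Beta_real]) (use assms in auto)
  also have "\<dots> = (\<integral>\<^sup>+t. ennreal (indicator {..<1} t * ?f t) * indicator {0<..} t \<partial>lborel)"
  proof (rule nn_integral_cong_AE)
    have "AE t in lborel. t \<noteq> 0 \<and> t \<noteq> (1::real)" by (intro AE_conjI AE_lborel_singleton)
    then show "AE t in lborel. ennreal (indicator {0..1} t * ?f t) = ennreal (indicator {..<1} t * ?f t) * indicator {0<..} t"
      by eventually_elim (auto simp: indicator_def)
  qed
  also have "\<dots> = (\<integral>\<^sup>+r. ennreal (indicator {..<1} (exp r) * ?f (exp r)) * ennreal (exp r) \<partial>lborel)"
    by (rule nn_integral_exp_subst) measurable
  also have "\<dots> = ennreal 2 * (\<integral>\<^sup>+q. ennreal (indicator {..<1} (exp (0 + - 2 * q)) * ?f (exp (0 + - 2 * q))) * ennreal (exp (0 + - 2 * q)) \<partial>lborel)"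
    by (subst nn_integral_real_affine[of _ "-2" 0]) auto
  also have "(\<integral>\<^sup>+q. ennreal (indicator {..<1} (exp (0 + - 2 * q)) * ?f (exp (0 + - 2 * q))) * ennreal (exp (0 + - 2 * q)) \<partial>lborel)
     = (\<integral>\<^sup>+q. ennreal (indicator {0<..} q * (exp (- 2 * a * q) * (1 - exp (- 2 * q)) powr (b - 1))) \<partial>lborel)"
  proof (rule nn_integral_cong)
    fix q :: real
    have "exp (- 2 * q) powr (a - 1) * exp (- 2 * q) = exp (- 2 * a * q)"
      by (simp add: powr_def flip: exp_add) (simp add: field_simps)
    moreover have "?f (exp (- 2 * q)) * exp (- 2 * q) = (exp (- 2 * q) powr (a - 1) * exp (- 2 * q)) * (1 - exp (- 2 * q)) powr (b - 1)"
      by (simp only: mult_ac)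
    ultimately have "?f (exp (- 2 * q)) * exp (- 2 * q) = exp (- 2 * a * q) * (1 - exp (- 2 * q)) powr (b - 1)"
      by (simp only:)
    moreover have "indicator {..<1} (exp (- 2 * q)) = (indicator {0<..} q :: real)" by (auto simp: indicator_def)
    ultimately show "ennreal (indicator {..<1} (exp (0 + - 2 * q)) * ?f (exp (0 + - 2 * q))) * ennreal (exp (0 + - 2 * q))
       = ennreal (indicator {0<..} q * (exp (- 2 * a * q) * (1 - exp (- 2 * q)) powr (b - 1)))"
      by (simp only: add_0 ennreal_mult'[symmetric] exp_ge_zero ennreal_mult''[symmetric] mult.assoc)
  qed
  finally have eq: "ennreal (Beta a b) = ennreal 2 * (\<integral>\<^sup>+q. ennreal (indicator {0<..} q * (exp (- 2 * a * q) * (1 - exp (- 2 * q)) powr (b - 1))) \<partial>lborel)" .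
  have "ennreal (Beta a b / 2) = ennreal (1/2) * ennreal (Beta a b)"
    by (subst ennreal_mult'[symmetric]) simp_all
  also have "\<dots> = (ennreal (1/2) * ennreal 2) * (\<integral>\<^sup>+q. ennreal (indicator {0<..} q * (exp (- 2 * a * q) * (1 - exp (- 2 * q)) powr (b - 1))) \<partial>lborel)"
    unfolding eq by (simp only: mult.assoc)
  also have "ennreal (1/2) * ennreal 2 = 1"
    by (subst ennreal_mult'[symmetric]) simp_all
  finally show ?thesis by simp
qed

text \<open>The incomplete Beta integral inside \<open>g_fun\<close>, with y in place of
  x^2.\<close>

definition J_fun :: "real \<Rightarrow> real \<Rightarrow> real" where
  "J_fun \<omega> y = (\<integral>t\<in>{y..1}. t powr (1/2 - \<omega>) * (1 - t) powr (\<omega> - 1) \<partial>lborel)"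

lemma J_fun_measurable [measurable]: "J_fun \<omega> \<in> borel_measurable borel"
proof -
  have "J_fun \<omega> = (\<lambda>y. \<integral>t. (if y \<le> t \<and> t \<le> 1 then t powr (1/2 - \<omega>) * (1 - t) powr (\<omega> - 1) else 0) \<partial>lborel)"
    unfolding J_fun_def set_lebesgue_integral_def
    by (intro ext Bochner_Integration.integral_cong refl) (auto simp: indicator_def)
  also have "\<dots> \<in> borel_measurable borel" by measurable
  finally show ?thesis .
qed

lemma g_fun_alt: "g_fun \<omega> x = (if 0 < x \<and> x < 1 then
      2 * pi powr \<omega> / Gamma \<omega> * (x powr (2 - \<omega>) * (1 - x\<^sup>2) powr (\<omega> - 1) - \<omega> * x powr (\<omega> - 1) * J_fun \<omega> (x\<^sup>2)) else 0)"
  by (simp add: g_fun_def J_fun_def)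

lemma g_fun_measurable [measurable]: "g_fun \<omega> \<in> borel_measurable borel"
  unfolding g_fun_alt[abs_def] by measurable

lemma h_fun_measurable [measurable]: "h_fun \<omega> \<in> borel_measurable borel"
proof -
  \<comment> \<open>The number of summands depends on x; written as a full series with a condition
    in each term, the sum is measurable term by term.\<close>
  have "h_fun \<omega> = (\<lambda>x. if 1 < x then (1 / x) * (\<Sum>n. if 1 \<le> n \<and> real n \<le> x then c_coef \<omega> n * g_fun \<omega> (real n / x) else 0) else 0)"
  proof
    fix x
    have "(\<Sum>n. if 1 \<le> n \<and> real n \<le> x then c_coef \<omega> n * g_fun \<omega> (real n / x) else 0)
        = (\<Sum>n = 1..nat \<lfloor>x\<rfloor>. c_coef \<omega> n * g_fun \<omega> (real n / x))" if "1 < x"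
      using that by (subst suminf_finite[of "{1..nat \<lfloor>x\<rfloor>}"]) (auto simp: le_nat_floor le_nat_iff le_floor_iff intro!: sum.cong)
    then show "h_fun \<omega> x = (if 1 < x then (1 / x) * (\<Sum>n. if 1 \<le> n \<and> real n \<le> x then c_coef \<omega> n * g_fun \<omega> (real n / x) else 0) else 0)"
      by (simp add: h_fun_def)
  qed
  also have "\<dots> \<in> borel_measurable borel" by measurable
  finally show ?thesis .
qed

context
  fixes \<omega> s :: real
  assumes \<omega>: "\<omega> > 0" and s: "s > 1 + \<omega>"
begin

text \<open>The Beta value to which both summands of \<open>g_fun\<close> lead; its quotient of
  Gamma values becomes that of the xi factors.\<close>

definition Bw :: real where "Bw = Beta ((s - \<omega>) / 2 + 1) \<omega>"

lemma half_pos: "(s - \<omega>) / 2 + 1 > 0"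
proof -
  have "(s - \<omega>) / 2 > 0" using s by simp
  then show ?thesis by linarith
qed

lemma Bw_pos: "Bw > 0"
  unfolding Bw_def Beta_def using \<omega> half_pos
  by (intro divide_pos_pos mult_pos_pos Gamma_real_pos) linarith+

text \<open>\<open>J_fun\<close> at e^(-2 r) is an integral over 0 < q < r. Exchanging the
  integrations, the inner one is the tail of an exponential, e^(-k q) / k with k = s + \<omega> - 1,
  and what remains is again the integral of \<open>Beta_exp\<close>.\<close>

lemma J_part_integral:
  "has_bochner_integral lborel (\<lambda>r. indicator {0<..} r * (exp (- (s + \<omega> - 1) * r) * J_fun \<omega> (exp (- 2 * r)))) (Bw / (s + \<omega> - 1))"
proof -
  \<comment> \<open>The integrand of \<open>J_fun\<close> after t = e^(-2 q), including the
    Jacobian.\<close>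
  define w where "w q = 2 * exp (- 2 * (3/2 - \<omega>) * q) * (1 - exp (- 2 * q)) powr (\<omega> - 1)" for q :: real
  have [measurable]: "w \<in> borel_measurable borel" unfolding w_def by measurable
  have w0: "w q \<ge> 0" for q by (simp add: w_def)
  let ?W = "\<lambda>r. \<integral>\<^sup>+q. ennreal (if 0 < q \<and> q < r then w q else 0) \<partial>lborel"
  let ?k = "s + \<omega> - 1"
  have k: "?k > 0" using s \<omega> by simp
  let ?f = "\<lambda>t. t powr (1/2 - \<omega>) * (1 - t) powr (\<omega> - 1)"
  have JW: "(\<integral>\<^sup>+t. ennreal (indicator {exp (- 2 * r)..1} t * ?f t) \<partial>lborel) = ?W r" if r: "r > 0" for r
  proof -
    have "(\<integral>\<^sup>+t. ennreal (indicator {exp (- 2 * r)..1} t * ?f t) \<partial>lborel) = (\<integral>\<^sup>+t. ennreal (indicator {exp (- 2 * r)<..<1} t * ?f t) * indicator {0<..} t \<partial>lborel)"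
    proof (rule nn_integral_cong_AE)
      have "AE t in lborel. t \<noteq> exp (- 2 * r) \<and> t \<noteq> (1::real)" by (intro AE_conjI AE_lborel_singleton)
      then show "AE t in lborel. ennreal (indicator {exp (- 2 * r)..1} t * ?f t) = ennreal (indicator {exp (- 2 * r)<..<1} t * ?f t) * indicator {0<..} t"
      proof eventually_elim
        case (elim t)
        show ?case using elim exp_gt_zero[of "- 2 * r"]
          by (cases "t > 0") (auto simp: indicator_def simp del: exp_gt_zero)
      qed
    qed
    also have "\<dots> = (\<integral>\<^sup>+p. ennreal (indicator {exp (- 2 * r)<..<1} (exp p) * ?f (exp p)) * ennreal (exp p) \<partial>lborel)"
      by (rule nn_integral_exp_subst) measurable
    also have "\<dots> = ennreal 2 * (\<integral>\<^sup>+q. ennreal (indicator {exp (- 2 * r)<..<1} (exp (0 + - 2 * q)) * ?f (exp (0 + - 2 * q))) * ennreal (exp (0 + - 2 * q)) \<partial>lborel)"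
      by (subst nn_integral_real_affine[of _ "-2" 0]) auto
    also have "\<dots> = (\<integral>\<^sup>+q. ennreal 2 * (ennreal (indicator {exp (- 2 * r)<..<1} (exp (0 + - 2 * q)) * ?f (exp (0 + - 2 * q))) * ennreal (exp (0 + - 2 * q))) \<partial>lborel)"
      by (rule nn_integral_cmult[symmetric]) measurable
    also have "\<dots> = ?W r"
    proof (rule nn_integral_cong)
      fix q :: real
      have "exp (- 2 * q) powr (1/2 - \<omega>) * exp (- 2 * q) = exp (- 2 * (3/2 - \<omega>) * q)"
        by (simp add: powr_def flip: exp_add) (simp add: field_simps)
      moreover have "2 * (?f (exp (- 2 * q)) * exp (- 2 * q)) = 2 * (exp (- 2 * q) powr (1/2 - \<omega>) * exp (- 2 * q)) * (1 - exp (- 2 * q)) powr (\<omega> - 1)"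
        by (simp only: mult_ac)
      ultimately have "2 * (?f (exp (- 2 * q)) * exp (- 2 * q)) = w q"
        unfolding w_def by (simp only:)
      moreover have "indicator {exp (- 2 * r)<..<1} (exp (- 2 * q)) = (if 0 < q \<and> q < r then 1 else 0 :: real)"
        by (auto simp: indicator_def)
      ultimately show "ennreal 2 * (ennreal (indicator {exp (- 2 * r)<..<1} (exp (0 + - 2 * q)) * ?f (exp (0 + - 2 * q))) * ennreal (exp (0 + - 2 * q)))
         = ennreal (if 0 < q \<and> q < r then w q else 0)"
        by (cases "0 < q \<and> q < r")
           (simp_all only: simp_thms add_0 if_True if_False mult_1 mult_zero_left mult_zero_right ennreal_0
             ennreal_mult'[symmetric] ennreal_mult''[symmetric] exp_ge_zero zero_le_numeral)
    qed
    finally show ?thesis .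
  qed
  have "(\<integral>\<^sup>+r. ennreal (indicator {0<..} r * exp (- ?k * r)) * ?W r \<partial>lborel)
      = (\<integral>\<^sup>+r. \<integral>\<^sup>+q. ennreal (indicator {0<..} r * exp (- ?k * r)) * ennreal (if 0 < q \<and> q < r then w q else 0) \<partial>lborel \<partial>lborel)"
    by (intro nn_integral_cong nn_integral_cmult[symmetric]) measurable
  also have "\<dots> = (\<integral>\<^sup>+q. \<integral>\<^sup>+r. ennreal (indicator {0<..} r * exp (- ?k * r)) * ennreal (if 0 < q \<and> q < r then w q else 0) \<partial>lborel \<partial>lborel)"
    by (rule lborel_pair.Fubini'[symmetric]) measurable
  also have "\<dots> = (\<integral>\<^sup>+q. ennreal (1 / ?k) * (ennreal 2 * ennreal (indicator {0<..} q * (exp (- 2 * ((s - \<omega>) / 2 + 1) * q) * (1 - exp (- 2 * q)) powr (\<omega> - 1)))) \<partial>lborel)"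
  proof (rule nn_integral_cong)
    fix q :: real
    show "(\<integral>\<^sup>+r. ennreal (indicator {0<..} r * exp (- ?k * r)) * ennreal (if 0 < q \<and> q < r then w q else 0) \<partial>lborel)
      = ennreal (1 / ?k) * (ennreal 2 * ennreal (indicator {0<..} q * (exp (- 2 * ((s - \<omega>) / 2 + 1) * q) * (1 - exp (- 2 * q)) powr (\<omega> - 1))))"
    proof (cases "q > 0")
      case True
      have "(\<integral>\<^sup>+r. ennreal (indicator {0<..} r * exp (- ?k * r)) * ennreal (if 0 < q \<and> q < r then w q else 0) \<partial>lborel)
         = (\<integral>\<^sup>+r. ennreal (w q) * ennreal (indicator {q<..} r * exp (- ?k * r)) \<partial>lborel)"
        using True by (intro nn_integral_cong) (auto simp: indicator_def mult.commute)
      also have "\<dots> = ennreal (w q) * (\<integral>\<^sup>+r. ennreal (indicator {q<..} r * exp (- ?k * r)) \<partial>lborel)"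
        by (rule nn_integral_cmult) measurable
      also have "(\<integral>\<^sup>+r. ennreal (indicator {q<..} r * exp (- ?k * r)) \<partial>lborel) = (\<integral>\<^sup>+r. ennreal (indicator {q<..} (q + 1 * r) * exp (- ?k * (q + 1 * r))) \<partial>lborel)"
        by (subst nn_integral_real_affine[of _ 1 q]) auto
      also have "\<dots> = (\<integral>\<^sup>+r. ennreal (exp (- ?k * q)) * ennreal (indicator {0<..} r * exp (- ?k * r)) \<partial>lborel)"
      proof (rule nn_integral_cong)
        fix r
        have "exp (- ?k * (q + 1 * r)) = exp (- ?k * q) * exp (- ?k * r)" by (simp add: algebra_simps flip: exp_add)
        then show "ennreal (indicator {q<..} (q + 1 * r) * exp (- ?k * (q + 1 * r))) = ennreal (exp (- ?k * q)) * ennreal (indicator {0<..} r * exp (- ?k * r))"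
          by (simp only: ennreal_mult'[symmetric] exp_ge_zero) (auto simp: indicator_def)
      qed
      also have "\<dots> = ennreal (exp (- ?k * q)) * (\<integral>\<^sup>+r. ennreal (indicator {0<..} r * exp (- ?k * r)) \<partial>lborel)"
        by (rule nn_integral_cmult) measurable
      also have "(\<integral>\<^sup>+r. ennreal (indicator {0<..} r * exp (- ?k * r)) \<partial>lborel) = ennreal (1 / ?k)"
        using exp_half_line[OF k] by (subst nn_integral_eq_integral) (auto simp: has_bochner_integral_iff)
      finally have "(\<integral>\<^sup>+r. ennreal (indicator {0<..} r * exp (- ?k * r)) * ennreal (if 0 < q \<and> q < r then w q else 0) \<partial>lborel)
        = ennreal (w q) * (ennreal (exp (- ?k * q)) * ennreal (1 / ?k))" .
      also have "\<dots> = ennreal (1 / ?k * (w q * exp (- ?k * q)))"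
        using w0[of q] k by (simp add: ennreal_mult'[symmetric] ennreal_mult''[symmetric] mult_ac)
      also have "w q * exp (- ?k * q) = 2 * (exp (- 2 * ((s - \<omega>) / 2 + 1) * q) * (1 - exp (- 2 * q)) powr (\<omega> - 1))"
      proof -
        have "exp (- 2 * (3/2 - \<omega>) * q) * exp (- ?k * q) = exp (- 2 * ((s - \<omega>) / 2 + 1) * q)"
          by (simp flip: exp_add) (simp add: field_simps)
        moreover have "w q * exp (- ?k * q) = 2 * ((exp (- 2 * (3/2 - \<omega>) * q) * exp (- ?k * q)) * (1 - exp (- 2 * q)) powr (\<omega> - 1))"
          unfolding w_def by (simp only: mult_ac)
        ultimately show ?thesis by (simp only:)
      qed
      finally have fin: "(\<integral>\<^sup>+r. ennreal (indicator {0<..} r * exp (- ?k * r)) * ennreal (if 0 < q \<and> q < r then w q else 0) \<partial>lborel)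
        = ennreal (1 / ?k * (2 * (exp (- 2 * ((s - \<omega>) / 2 + 1) * q) * (1 - exp (- 2 * q)) powr (\<omega> - 1))))" .
      have k1: "0 \<le> 1 / ?k" using k by simp
      have ind: "indicator {0<..} q = (1::real)" using True by simp
      show ?thesis unfolding fin ind mult_1 ennreal_mult'[OF k1] ennreal_mult'[OF zero_le_numeral] ..
    next
      case False
      then show ?thesis by simp
    qed
  qed
  also have "\<dots> = ennreal (1 / ?k) * (ennreal 2 * ennreal (Bw / 2))"
    unfolding Bw_def Beta_exp[OF half_pos \<omega>, symmetric] by (simp add: nn_integral_cmult)
  also have "\<dots> = ennreal (Bw / ?k)"
  proof -
    have k1: "0 \<le> 1 / ?k" using k by simp
    have "1 / ?k * (2 * (Bw / 2)) = Bw / ?k" by simp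
    then show ?thesis
      by (simp only: ennreal_mult'[OF k1, symmetric] ennreal_mult'[OF zero_le_numeral, symmetric])
  qed
  finally have tot: "(\<integral>\<^sup>+r. ennreal (indicator {0<..} r * exp (- ?k * r)) * ?W r \<partial>lborel) = ennreal (Bw / ?k)" .
  \<comment> \<open>An infinite inner integral would be turned into 0 by \<open>enn2real\<close>,
    the value of the Bochner integral. The finite total excludes this for almost every r.\<close>
  have "AE r in lborel. ennreal (indicator {0<..} r * exp (- ?k * r)) * ?W r \<noteq> \<infinity>"
    by (rule nn_integral_PInf_AE) (use tot in auto)
  then have ae: "AE r in lborel. ennreal (indicator {0<..} r * (exp (- ?k * r) * J_fun \<omega> (exp (- 2 * r)))) = ennreal (indicator {0<..} r * exp (- ?k * r)) * ?W r"
  proof eventually_elim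
    case (elim r)
    show ?case
    proof (cases "r > 0")
      case True
      have fin: "?W r \<noteq> \<infinity>" using elim True by (auto simp: ennreal_mult_eq_top_iff)
      have "J_fun \<omega> (exp (- 2 * r)) = enn2real (\<integral>\<^sup>+t. ennreal (indicator {exp (- 2 * r)..1} t * ?f t) \<partial>lborel)"
        unfolding J_fun_def set_lebesgue_integral_def real_scaleR_def
        by (rule integral_eq_nn_integral) auto
      also have "\<dots> = enn2real (?W r)" unfolding JW[OF True] ..
      finally have "ennreal (J_fun \<omega> (exp (- 2 * r))) = ?W r" using fin by (simp add: ennreal_enn2real_if)
      then show ?thesis using True by (simp add: ennreal_mult')
    qed simp
  qed
  show ?thesis
  proof (rule has_bochner_integral_nn_integral)
    show "AE r in lborel. 0 \<le> indicator {0<..} r * (exp (- ?k * r) * J_fun \<omega> (exp (- 2 * r)))"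
      unfolding J_fun_def set_lebesgue_integral_def by (intro AE_I2 mult_nonneg_nonneg Bochner_Integration.integral_nonneg) auto
    show "(\<integral>\<^sup>+r. ennreal (indicator {0<..} r * (exp (- ?k * r) * J_fun \<omega> (exp (- 2 * r)))) \<partial>lborel) = ennreal (Bw / ?k)"
      unfolding tot[symmetric] by (rule nn_integral_cong_AE[OF ae])
  qed (use Bw_pos k in auto)
qed

text \<open>The Mellin integrand of \<open>g_fun\<close> at s, under x = e^(-r).\<close>

definition Pg :: "real \<Rightarrow> real" where "Pg r = g_fun \<omega> (exp (- r)) * exp (- s * r)"

lemma Pg_measurable [measurable]: "Pg \<in> borel_measurable borel"
  unfolding Pg_def by measurable

text \<open>The two parts of \<open>g_fun\<close> contribute Bw / 2 and \<omega> Bw / (s + \<omega>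
  - 1). This shows the purpose of the second part: the difference carries the factor (s - \<omega> -
  1) / (s + \<omega> - 1), the quotient of the factors s - 1 in xi at the two shifted
  arguments.\<close>

lemma Pg_integral:
  "has_bochner_integral lborel Pg (pi powr \<omega> / Gamma \<omega> * Bw * (s - \<omega> - 1) / (s + \<omega> - 1))"
proof -
  let ?A = "\<lambda>r. indicator {0<..} r * (exp (- 2 * ((s - \<omega>) / 2 + 1) * r) * (1 - exp (- 2 * r)) powr (\<omega> - 1))"
  let ?J = "\<lambda>r. indicator {0<..} r * (exp (- (s + \<omega> - 1) * r) * J_fun \<omega> (exp (- 2 * r)))"
  have A: "has_bochner_integral lborel ?A (Bw / 2)"
  proof (rule has_bochner_integral_nn_integral)
    show "(\<integral>\<^sup>+r. ennreal (?A r) \<partial>lborel) = ennreal (Bw / 2)"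
      unfolding Bw_def by (rule Beta_exp) (use half_pos \<omega> in auto)
  qed (use Bw_pos in auto)
  have "has_bochner_integral lborel (\<lambda>r. 2 * pi powr \<omega> / Gamma \<omega> * (?A r - \<omega> * ?J r)) (2 * pi powr \<omega> / Gamma \<omega> * (Bw / 2 - \<omega> * (Bw / (s + \<omega> - 1))))"
    by (intro has_bochner_integral_mult_right has_bochner_integral_diff A J_part_integral)
  moreover have "2 * pi powr \<omega> / Gamma \<omega> * (?A r - \<omega> * ?J r) = Pg r" for r
  proof (cases "r > 0")
    case True
    have sq: "(exp (- r))\<^sup>2 = exp (- 2 * r)" by (simp flip: exp_of_nat_mult)
    have 1: "exp (- r) powr (2 - \<omega>) * exp (- s * r) = exp (- 2 * ((s - \<omega>) / 2 + 1) * r)"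
      by (simp add: powr_def flip: exp_add) (simp add: field_simps)
    have 2: "exp (- r) powr (\<omega> - 1) * exp (- s * r) = exp (- (s + \<omega> - 1) * r)"
      by (simp add: powr_def flip: exp_add) (simp add: field_simps)
    have "Pg r = 2 * pi powr \<omega> / Gamma \<omega> * ((exp (- r) powr (2 - \<omega>) * exp (- s * r)) * (1 - exp (- 2 * r)) powr (\<omega> - 1)
       - \<omega> * ((exp (- r) powr (\<omega> - 1) * exp (- s * r)) * J_fun \<omega> (exp (- 2 * r))))"
      unfolding Pg_def g_fun_alt sq using True by (simp add: algebra_simps)
    then show ?thesis using True unfolding 1 2 by simp
  qed (simp add: Pg_def g_fun_def)
  moreover have "2 * pi powr \<omega> / Gamma \<omega> * (Bw / 2 - \<omega> * (Bw / (s + \<omega> - 1))) = pi powr \<omega> / Gamma \<omega> * Bw * (s - \<omega> - 1) / (s + \<omega> - 1)"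
  proof -
    have "2 * (Bw / 2 - \<omega> * (Bw / (s + \<omega> - 1))) = Bw * (s - \<omega> - 1) / (s + \<omega> - 1)"
      using s \<omega> by (simp add: field_simps)
    moreover have "2 * p / G * X = p / G * (2 * X)" for p G X :: real by simp
    ultimately show ?thesis by (simp only: times_divide_eq_right mult.assoc)
  qed
  ultimately show ?thesis by simp
qed

text \<open>In the logarithmic variable the dilations by n in \<open>h_fun\<close> become
  translations of \<open>Pg\<close> by ln n. Since \<open>g_fun\<close> vanishes from 1 on, only n <
  e^t contribute, so the finite sum may be written as a series.\<close>

lemma h_fun_series:
  "(\<lambda>n. c_coef \<omega> (Suc n) * real (Suc n) powr (- s) * Pg (t - ln (real (Suc n)))) sums (h_fun \<omega> (exp t) * exp (t * (1 - s)))"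
  "finite {n. Pg (t - ln (real (Suc n))) \<noteq> 0}"
proof -
  have T: "real (Suc n) powr (- s) * Pg (t - ln (real (Suc n))) = g_fun \<omega> (real (Suc n) / exp t) * exp (- s * t)" for n
  proof -
    have e: "exp (- (t - ln (real (Suc n)))) = real (Suc n) / exp t" by (simp add: exp_diff del: of_nat_Suc)
    have "real (Suc n) powr (- s) * exp (- s * (t - ln (real (Suc n)))) = exp (- s * t)"
      by (simp add: powr_def del: of_nat_Suc flip: exp_add) (simp add: algebra_simps)
    then show ?thesis unfolding Pg_def e by (metis mult.left_commute)
  qed
  have z: "g_fun \<omega> (real (Suc n) / exp t) = 0" if "n \<notin> {..<nat \<lfloor>exp t\<rfloor>}" for n
  proof -
    have "exp t < real (Suc n)" using that by (simp add: not_less) linarith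
    then show ?thesis by (simp add: g_fun_def divide_less_eq del: of_nat_Suc)
  qed
  have "{n. Pg (t - ln (real (Suc n))) \<noteq> 0} \<subseteq> {..<nat \<lfloor>exp t\<rfloor>}"
  proof
    fix n assume n: "n \<in> {n. Pg (t - ln (real (Suc n))) \<noteq> 0}"
    show "n \<in> {..<nat \<lfloor>exp t\<rfloor>}"
    proof (rule ccontr)
      assume "n \<notin> {..<nat \<lfloor>exp t\<rfloor>}"
      then have "real (Suc n) powr (- s) * Pg (t - ln (real (Suc n))) = 0" using T[of n] z[of n] by simp
      then show False using n by simp
    qed
  qed
  then show "finite {n. Pg (t - ln (real (Suc n))) \<noteq> 0}" by (rule finite_subset) simp
  have "(\<lambda>n. c_coef \<omega> (Suc n) * (g_fun \<omega> (real (Suc n) / exp t) * exp (- s * t))) sums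
      (\<Sum>n<nat \<lfloor>exp t\<rfloor>. c_coef \<omega> (Suc n) * (g_fun \<omega> (real (Suc n) / exp t) * exp (- s * t)))"
    by (rule sums_finite) (use z in auto)
  moreover have "(\<Sum>n<nat \<lfloor>exp t\<rfloor>. c_coef \<omega> (Suc n) * (g_fun \<omega> (real (Suc n) / exp t) * exp (- s * t))) = h_fun \<omega> (exp t) * exp (t * (1 - s))"
  proof -
    have "(\<Sum>n<nat \<lfloor>exp t\<rfloor>. c_coef \<omega> (Suc n) * (g_fun \<omega> (real (Suc n) / exp t) * exp (- s * t)))
       = (\<Sum>n=1..nat \<lfloor>exp t\<rfloor>. c_coef \<omega> n * g_fun \<omega> (real n / exp t)) * exp (- s * t)"
      unfolding sum_distrib_right
      by (rule sum.reindex_bij_witness[where i="\<lambda>n. n - 1" and j=Suc]) (auto simp: mult.assoc)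
    also have "\<dots> = h_fun \<omega> (exp t) * exp (t * (1 - s))"
    proof (cases "t > 0")
      case True
      have "exp (- s * t) = (1 / exp t) * exp (t * (1 - s))"
        by (simp add: divide_inverse flip: exp_minus exp_add) (simp add: algebra_simps)
      then show ?thesis using True by (simp add: h_fun_def mult_ac)
    next
      case False
      \<comment> \<open>At t = 0 the sum still contains n = 1, but \<open>g_fun\<close> is 0 at 1,
        in agreement with \<open>h_fun\<close> being 0 at 1.\<close>
      have "g_fun \<omega> (real n / exp t) = 0" if "n \<ge> 1" for n
      proof -
        have "exp t \<le> 1" using False by simp
        then have "exp t \<le> real n" using that by linarith
        then show ?thesis by (simp add: g_fun_def divide_less_eq)
      qed
      then have "(\<Sum>n=1..nat \<lfloor>exp t\<rfloor>. c_coef \<omega> n * g_fun \<omega> (real n / exp t)) = 0" by (intro sum.neutral) auto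
      then show ?thesis using False by (simp add: h_fun_def)
    qed
    finally show ?thesis .
  qed
  ultimately show "(\<lambda>n. c_coef \<omega> (Suc n) * real (Suc n) powr (- s) * Pg (t - ln (real (Suc n)))) sums (h_fun \<omega> (exp t) * exp (t * (1 - s)))"
    by (simp only: mult.assoc T)
qed

text \<open>Termwise integration: every translate of \<open>Pg\<close> has the same integral and the
  same norm, so absolute convergence of the coefficient series is all that is required.\<close>

lemma h_fun_Mellin:
  "integrable lborel (\<lambda>t. h_fun \<omega> (exp t) * exp (t * (1 - s)))"
  "(\<integral>t. h_fun \<omega> (exp t) * exp (t * (1 - s)) \<partial>lborel)
    = (\<Sum>n. c_coef \<omega> (Suc n) * real (Suc n) powr (- s)) * (pi powr \<omega> / Gamma \<omega> * Bw * (s - \<omega> - 1) / (s + \<omega> - 1))"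
proof -
  let ?I = "pi powr \<omega> / Gamma \<omega> * Bw * (s - \<omega> - 1) / (s + \<omega> - 1)"
  let ?c = "\<lambda>n. c_coef \<omega> (Suc n) * real (Suc n) powr (- s)"
  let ?f = "\<lambda>n t. ?c n * Pg (t - ln (real (Suc n)))"
  have PI: "integrable lborel Pg" and PV: "(\<integral>r. Pg r \<partial>lborel) = ?I"
    using Pg_integral by (auto simp: has_bochner_integral_iff)
  have shift: "(\<integral>t. F (t - a) \<partial>lborel) = (\<integral>t. F t \<partial>lborel)" for F :: "real \<Rightarrow> real" and a
    using lborel_integral_real_affine[of 1 "\<lambda>t. F (t - a)" a] by simp
  have fi: "integrable lborel (?f n)" for n
    using lborel_integrable_real_affine[OF PI, of 1 "- ln (real (Suc n))"]
    by (intro integrable_mult_right) (simp add: add.commute del: of_nat_Suc)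
  have fint: "(\<integral>t. ?f n t \<partial>lborel) = ?c n * ?I" for n
    using shift[of Pg "ln (real (Suc n))"] PV by simp
  have fn: "(\<integral>t. norm (?f n t) \<partial>lborel) = \<bar>?c n\<bar> * (\<integral>r. \<bar>Pg r\<bar> \<partial>lborel)" for n
    using shift[of "\<lambda>r. \<bar>Pg r\<bar>" "ln (real (Suc n))"] by (simp add: abs_mult)
  have ae: "AE t in lborel. summable (\<lambda>n. norm (?f n t))"
  proof (rule AE_I2)
    fix t
    show "summable (\<lambda>n. norm (?f n t))"
      by (rule summable_finite[OF h_fun_series(2)[of t]]) auto
  qed
  have sm: "summable (\<lambda>n. \<integral>t. norm (?f n t) \<partial>lborel)"
    unfolding fn by (intro summable_mult2 summable_c_coef \<omega> s)
  have eq: "(\<Sum>n. ?f n t) = h_fun \<omega> (exp t) * exp (t * (1 - s))" for t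
    by (rule sums_unique[symmetric, OF h_fun_series(1)])
  show "integrable lborel (\<lambda>t. h_fun \<omega> (exp t) * exp (t * (1 - s)))"
    using integrable_suminf[OF fi ae sm] unfolding eq .
  have "summable ?c" using summable_rabs_cancel[OF summable_c_coef[OF \<omega> s]] .
  then show "(\<integral>t. h_fun \<omega> (exp t) * exp (t * (1 - s)) \<partial>lborel) = (\<Sum>n. ?c n) * ?I"
    using integral_suminf[OF fi ae sm] unfolding eq fint by (simp only: suminf_mult2)
qed

text \<open>The coefficient series supplies the zeta factors, \<open>Bw\<close> and pi^\<omega> /
  Gamma \<omega> the gamma and pi factors, and Gamma (a + 1) = a Gamma a the linear factors s -
  \<omega> and s + \<omega>. The product form sidesteps the zeros of xi.\<close>

lemma xi_ratio_real:
  "xi_rep (of_real (s - \<omega>)) = xi_rep (of_real (s + \<omega>)) * of_real (\<integral>t. h_fun \<omega> (exp t) * exp (t * (1 - s)) \<partial>lborel)"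
proof -
  let ?C = "\<Sum>n. c_coef \<omega> (Suc n) * real (Suc n) powr (- s)"
  have z: "?C * zeta_real (s + \<omega>) = zeta_real (s - \<omega>)" by (rule suminf_c_coef[OF \<omega> s])
  have G1: "Gamma ((s - \<omega>) / 2 + 1) = (s - \<omega>) / 2 * Gamma ((s - \<omega>) / 2)"
    by (rule Gamma_plus1) (use s \<omega> in \<open>auto elim!: nonpos_Ints_cases\<close>)
  have G2: "Gamma ((s + \<omega>) / 2 + 1) = (s + \<omega>) / 2 * Gamma ((s + \<omega>) / 2)"
    by (rule Gamma_plus1) (use s \<omega> in \<open>auto elim!: nonpos_Ints_cases\<close>)
  have "Gamma ((s + \<omega>) / 2) > 0" "Gamma \<omega> > 0"
    using s \<omega> by (intro Gamma_real_pos; simp)+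
  then have ne: "Gamma ((s + \<omega>) / 2) \<noteq> 0" "Gamma \<omega> \<noteq> 0" "s + \<omega> \<noteq> 0" "s + \<omega> - 1 \<noteq> 0"
    using s \<omega> by linarith+
  have "(s - \<omega>) / 2 + 1 + \<omega> = (s + \<omega>) / 2 + 1" by (simp add: field_simps)
  then have B: "Bw = (s - \<omega>) / 2 * Gamma ((s - \<omega>) / 2) * Gamma \<omega> / ((s + \<omega>) / 2 * Gamma ((s + \<omega>) / 2))"
    unfolding Bw_def Beta_def G1 by (simp only: G2)
  have p: "pi powr (- (s + \<omega>) / 2) * pi powr \<omega> = pi powr (- (s - \<omega>) / 2)"
    unfolding powr_add[symmetric] by (simp add: field_simps)
  have "(s + \<omega>) * (s + \<omega> - 1) / 2 * (Gamma ((s + \<omega>) / 2) * pi powr (- (s + \<omega>) / 2) * zeta_real (s + \<omega>))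
       * (?C * (pi powr \<omega> / Gamma \<omega> * Bw * (s - \<omega> - 1) / (s + \<omega> - 1)))
    = (pi powr (- (s + \<omega>) / 2) * pi powr \<omega>) * (?C * zeta_real (s + \<omega>)) * ((s - \<omega>) * (s - \<omega> - 1) / 2 * Gamma ((s - \<omega>) / 2))"
  proof -
    \<comment> \<open>The algebra is isolated with plain variables in place of the special
      values.\<close>
    have "a * (a - 1) / 2 * (X * P * Z) * (C * (Q / W * (b / 2 * Y * W / (a / 2 * X)) * (b - 1) / (a - 1)))
      = (P * Q) * (C * Z) * (b * (b - 1) / 2 * Y)" if "X \<noteq> 0" "W \<noteq> 0" "a \<noteq> 0" "a - 1 \<noteq> 0" for a b X Y W P Q C Z :: real
      using that by (simp add: divide_simps)
    from this[OF ne] show ?thesis unfolding B .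
  qed
  also have "\<dots> = (s - \<omega>) * (s - \<omega> - 1) / 2 * (Gamma ((s - \<omega>) / 2) * pi powr (- (s - \<omega>) / 2) * zeta_real (s - \<omega>))"
    unfolding p z by (simp only: mult_ac)
  finally show ?thesis
    unfolding h_fun_Mellin(2) using s \<omega> by (simp only: xi_rep_real flip: of_real_mult)
qed

end

section \<open>Laplace transforms in the upper half plane\<close>

definition LT :: "(real \<Rightarrow> complex) \<Rightarrow> complex \<Rightarrow> complex" where
  "LT k z = (\<integral>t. k t * exp (\<i> * z * of_real t) \<partial>lborel)"

lemma norm_exp_ii: "cmod (exp (\<i> * z * of_real t)) = exp (- (Im z * t))"
  by simp

lemma L2_exp_half_line:
  assumes "v > 0"
  shows "L2 (\<lambda>t. of_real (indicator {0<..} t * exp (- v * t)))"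
    "nsq (\<lambda>t. of_real (indicator {0<..} t * exp (- v * t))) = 1 / (2 * v)"
proof -
  have sq: "(cmod (of_real (indicator {0<..} t * exp (- v * t))))\<^sup>2 = indicator {0<..} t * exp (- (2 * v) * t)" for t
    by (simp add: norm_mult power_mult_distrib indicator_def flip: exp_of_nat_mult)
  show "L2 (\<lambda>t. of_real (indicator {0<..} t * exp (- v * t)))"
    "nsq (\<lambda>t. of_real (indicator {0<..} t * exp (- v * t))) = 1 / (2 * v)"
    unfolding L2_def nsq_def sq using exp_half_line[of "2 * v"] assms by (auto simp: has_bochner_integral_iff)
qed

text \<open>Cauchy-Schwarz against e^(-v t) on the half line with v = Im z, whose squared norm is 1
  / (2 v).\<close>

lemma
  assumes L: "L2 k" and supp: "\<And>t. t \<le> 0 \<Longrightarrow> k t = 0" and z: "Im z > 0"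
  shows LT_abs_integrable: "integrable lborel (\<lambda>t. cmod (k t) * exp (- (Im z * t)))"
    and LT_integrable: "integrable lborel (\<lambda>t. k t * exp (\<i> * z * of_real t))"
    and LT_bound: "cmod (LT k z) \<le> sqrt (nsq k) / sqrt (2 * Im z)"
proof -
  have [measurable]: "k \<in> borel_measurable borel" using L by (simp add: L2_def)
  let ?e = "\<lambda>t. complex_of_real (indicator {0<..} t * exp (- Im z * t))"
  have eq: "cmod (k t) * cmod (?e t) = cmod (k t) * exp (- (Im z * t))" for t
    using supp[of t] by (cases "t > 0") (auto simp: norm_mult)
  show i: "integrable lborel (\<lambda>t. cmod (k t) * exp (- (Im z * t)))"
    using L2_prod_norm_integrable[OF L L2_exp_half_line(1)[OF z]] unfolding eq .
  show "integrable lborel (\<lambda>t. k t * exp (\<i> * z * of_real t))"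
    by (rule Bochner_Integration.integrable_bound[OF i]) (auto simp: norm_mult)
  have "cmod (LT k z) \<le> (\<integral>t. cmod (k t * exp (\<i> * z * of_real t)) \<partial>lborel)"
    unfolding LT_def by (rule integral_norm_bound)
  also have "\<dots> = (\<integral>t. cmod (k t) * cmod (?e t) \<partial>lborel)" unfolding eq norm_mult norm_exp_ii ..
  also have "\<dots> \<le> sqrt (nsq k) * sqrt (nsq ?e)" by (rule L2_Cauchy_Schwarz[OF L L2_exp_half_line(1)[OF z]])
  also have "nsq ?e = 1 / (2 * Im z)" by (rule L2_exp_half_line(2)[OF z])
  finally show "cmod (LT k z) \<le> sqrt (nsq k) / sqrt (2 * Im z)" by (simp add: real_sqrt_divide)
qed

text \<open>Near z the integrand is dominated by the one at the height halfway between a and Im z: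
  as k lives on t > 0, raising the imaginary part only improves the decay.\<close>

lemma LT_holomorphic_general:
  assumes [measurable]: "k \<in> borel_measurable borel" and supp: "\<And>t. t \<le> 0 \<Longrightarrow> k t = 0"
    and int: "\<And>v. v > a \<Longrightarrow> integrable lborel (\<lambda>t. cmod (k t) * exp (- (v * t)))"
  shows "LT k holomorphic_on {z. Im z > a}"
  unfolding LT_def
proof (rule holomorphic_on_integral)
  show "open {z. Im z > a}" by (rule open_halfspace_Im_gt)
  fix z assume "z \<in> {z. Im z > a}"
  then have z: "Im z > a" by simp
  let ?d = "(Im z - a) / 2" and ?v = "(Im z + a) / 2"
  show "\<exists>r>0. \<exists>B. cball z r \<subseteq> {z. Im z > a} \<and> integrable lborel B \<and>
      (\<forall>t\<in>space lborel. \<forall>w\<in>cball z r. cmod (k t * exp (\<i> * w * of_real t)) \<le> B t)"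
  proof (intro exI[of _ ?d] exI[of _ "\<lambda>t. cmod (k t) * exp (- (?v * t))"] conjI ballI)
    have im: "Im w \<ge> ?v" if "w \<in> cball z ?d" for w
      using that abs_Im_le_cmod[of "z - w"] by (simp add: dist_norm)
    show "cball z ?d \<subseteq> {z. Im z > a}" using im z by fastforce
    show "integrable lborel (\<lambda>t. cmod (k t) * exp (- (?v * t)))" by (rule int) (use z in simp)
    show "cmod (k t * exp (\<i> * w * of_real t)) \<le> cmod (k t) * exp (- (?v * t))" if "w \<in> cball z ?d" for t w
    proof (cases "t > 0")
      case True
      then have "?v * t \<le> Im w * t" using im[OF that] by (intro mult_right_mono) auto
      then show ?thesis unfolding norm_mult norm_exp_ii by (intro mult_left_mono) auto
    qed (use supp in simp)
  qed (use z in simp)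
qed (auto intro!: holomorphic_intros)

lemma LT_holomorphic:
  assumes L: "L2 k" and supp: "\<And>t. t \<le> 0 \<Longrightarrow> k t = 0"
  shows "LT k holomorphic_on {z. Im z > 0}"
proof (rule LT_holomorphic_general)
  show "integrable lborel (\<lambda>t. cmod (k t) * exp (- (v * t)))" if "v > 0" for v
    using LT_abs_integrable[OF L supp, of "\<i> * of_real v"] that by simp
qed (use L supp in \<open>auto simp: L2_def\<close>)

text \<open>Phragmen--Lindeloef with the boundary growth \<open>|f|\<^sup>2 = O(|z|\<^sup>2 / Im z)\<close>: on \<open>|z| = R\<close> one has
  \<open>|z\<^sup>2 - R\<^sup>2| = 2 R Im z\<close>, which cancels the blow-up at the corners of the half disc.\<close>
lemma half_plane_bound:
  assumes hol: "f holomorphic_on {z. Im z > 0}" and cont: "continuous_on {z. Im z \<ge> 0} f"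
    and real1: "\<And>u::real. cmod (f (of_real u)) \<le> 1"
    and growth: "\<And>z. Im z > 0 \<Longrightarrow> (cmod (f z))\<^sup>2 \<le> M * (1 + cmod z)\<^sup>2 / Im z"
    and z0: "Im z0 > 0"
  shows "cmod (f z0) \<le> 1"
proof -
  have M: "M \<ge> 0"
  proof -
    have "0 \<le> M * (1 + cmod \<i>)\<^sup>2 / Im \<i>" by (rule order_trans[OF zero_le_power2 growth]) simp
    then show ?thesis by (simp add: zero_le_mult_iff)
  qed
  \<comment> \<open>The real part of 1 - i e z is 1 + e Im z >= 1. The modulus also dominates e |z|,
    which is what beats the growth of f on large half circles.\<close>
  have den: "1 \<le> cmod (1 - \<i> * of_real e * z)" "e * cmod z \<le> cmod (1 - \<i> * of_real e * z)" if "e > 0" "Im z \<ge> 0" for e z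
  proof -
    have "1 \<le> Re (1 - \<i> * of_real e * z)" using that by simp
    then show "1 \<le> cmod (1 - \<i> * of_real e * z)" using complex_Re_le_cmod order_trans by blast
    have "(e * cmod z)\<^sup>2 \<le> (1 + e * Im z)\<^sup>2 + (e * Re z)\<^sup>2"
      unfolding power_mult_distrib cmod_power2 using that by (simp add: power2_eq_square algebra_simps)
    also have "\<dots> = (cmod (1 - \<i> * of_real e * z))\<^sup>2" by (simp add: cmod_power2)
    finally show "e * cmod z \<le> cmod (1 - \<i> * of_real e * z)" by (rule power2_le_imp_le) simp
  qed
  \<comment> \<open>First R tends to infinity, then e to 0. The condition R >= 8 M / e^2 makes the
    bound 8 M R^3 on the arc smaller than e^2 R^4, the size of the denominator there.\<close>
  have key: "(cmod (f z0))\<^sup>2 * (1 - (cmod z0)\<^sup>2 / R\<^sup>2) \<le> (cmod (1 - \<i> * of_real e * z0))\<^sup>2"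
    if e: "e > 0" and R: "R \<ge> 1" "R > cmod z0" "R \<ge> 8 * M / e\<^sup>2" for e R
  proof -
    let ?S = "cball 0 R \<inter> {z. Im z \<ge> 0}"
    \<comment> \<open>f is squared because the growth hypothesis is about its square. On the arc the
      numerator over R^2 is of order R, while the squared denominator is of order e^2 R^2.\<close>
    define F where "F z = (f z)\<^sup>2 * (z\<^sup>2 - of_real (R\<^sup>2)) / (of_real (R\<^sup>2) * (1 - \<i> * of_real e * z)\<^sup>2)" for z
    have R0: "R > 0" using R by simp
    have nz: "1 - \<i> * of_real e * z \<noteq> 0" if "Im z \<ge> 0" for z using den(1)[OF e that] by force
    have nF: "norm (F z) = (cmod (f z))\<^sup>2 * cmod (z\<^sup>2 - of_real (R\<^sup>2)) / (R\<^sup>2 * (cmod (1 - \<i> * of_real e * z))\<^sup>2)" for z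
      by (simp add: F_def norm_divide norm_mult norm_power)
    have closed: "closed ?S" by (intro closed_Int closed_cball closed_halfspace_Im_ge)
    have sub: "interior ?S \<subseteq> {z. Im z > 0}"
    proof -
      have "interior ?S \<subseteq> interior {z. Im z \<ge> 0}" by (rule interior_mono) auto
      then show ?thesis using interior_halfspace_ge[of \<i> 0] by simp
    qed
    have cF: "continuous_on ?S F"
      unfolding F_def using nz R0 continuous_on_subset[OF cont, of ?S] by (intro continuous_intros) auto
    have "norm (F z0) \<le> 1"
    proof (rule maximum_modulus_frontier[where f=F and S="?S" and \<xi>=z0])
      show "bounded ?S" using bounded_cball bounded_Int by blast
      show "F holomorphic_on interior ?S"
        unfolding F_def using nz R0 sub holomorphic_on_subset[OF hol sub] by (intro holomorphic_intros) auto
      show "continuous_on (closure ?S) F" using cF closed by (simp add: closure_closed)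
      show "z0 \<in> ?S" using z0 R by simp
      fix z assume z: "z \<in> frontier ?S"
      have zS: "cmod z \<le> R" "Im z \<ge> 0" using z closed by (auto simp: frontier_def closure_closed)
      have "\<not> (cmod z < R \<and> Im z > 0)"
      proof
        assume a: "cmod z < R \<and> Im z > 0"
        have "ball 0 R \<inter> {z. Im z > 0} \<subseteq> interior ?S"
          by (rule interior_maximal) (auto intro!: open_Int open_halfspace_Im_gt)
        then show False using a z by (auto simp: frontier_def)
      qed
      then consider "Im z = 0" | "cmod z = R" "Im z > 0" using zS by linarith
      then show "norm (F z) \<le> 1"
      proof cases
        case 1
        then have zu: "z = of_real (Re z)" by (simp add: complex_eq_iff)
        have f1: "(cmod (f z))\<^sup>2 \<le> 1" using real1[of "Re z"] zu power_mono[of "cmod (f z)" 1 2] by simp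
        have "cmod (z\<^sup>2 - of_real (R\<^sup>2)) = \<bar>(Re z)\<^sup>2 - R\<^sup>2\<bar>"
          by (subst zu) (simp only: of_real_power[symmetric] of_real_diff[symmetric] norm_of_real)
        also have "\<dots> \<le> R\<^sup>2"
        proof -
          have "(Re z)\<^sup>2 \<le> R\<^sup>2" using zS abs_Re_le_cmod[of z] R0 by (intro abs_le_square_iff[THEN iffD1]) simp
          then show ?thesis by (simp add: abs_le_iff)
        qed
        finally have "(cmod (f z))\<^sup>2 * cmod (z\<^sup>2 - of_real (R\<^sup>2)) \<le> 1 * R\<^sup>2" using f1 by (intro mult_mono) auto
        also have "\<dots> \<le> R\<^sup>2 * (cmod (1 - \<i> * of_real e * z))\<^sup>2"
          using den(1)[OF e zS(2)] one_le_power[OF den(1)[OF e zS(2)], of 2] R0 by (simp add: mult_le_cancel_left1)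
        finally show ?thesis using nz[OF zS(2)] R0
          unfolding nF by (simp add: divide_le_eq)
      next
        case 2
        have "z\<^sup>2 - of_real (R\<^sup>2) = z * (z - cnj z)"
          using complex_norm_square[of z] 2 by (simp add: power2_eq_square right_diff_distrib)
        also have "z - cnj z = \<i> * of_real (2 * Im z)" by (simp add: complex_eq_iff)
        finally have zR: "cmod (z\<^sup>2 - of_real (R\<^sup>2)) = R * (2 * Im z)" using 2 by (simp add: norm_mult)
        have "(cmod (f z))\<^sup>2 * (R * (2 * Im z)) \<le> M * (1 + R)\<^sup>2 / Im z * (R * (2 * Im z))"
          using growth[of z] 2 R0 by (intro mult_right_mono) auto
        also have "\<dots> = 2 * M * R * (1 + R)\<^sup>2" using 2 by simp
        also have "\<dots> \<le> 2 * M * R * (2 * R)\<^sup>2" using R M by (intro mult_left_mono power_mono) auto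
        also have "\<dots> = (8 * M) * R ^ 3" by (simp add: power2_eq_square power3_eq_cube)
        also have "\<dots> \<le> (R * e\<^sup>2) * R ^ 3"
          using R(3) e R0 by (intro mult_right_mono) (auto simp: divide_le_eq)
        also have "\<dots> = R\<^sup>2 * (e * cmod z)\<^sup>2" using 2 by (simp add: power2_eq_square power3_eq_cube)
        also have "\<dots> \<le> R\<^sup>2 * (cmod (1 - \<i> * of_real e * z))\<^sup>2"
          using den(2)[OF e zS(2)] e by (intro mult_left_mono power_mono) auto
        finally show ?thesis using nz[OF zS(2)] R0
          unfolding nF zR by (simp add: divide_le_eq)
      qed
    qed
    then have "(cmod (f z0))\<^sup>2 * cmod (z0\<^sup>2 - of_real (R\<^sup>2)) \<le> R\<^sup>2 * (cmod (1 - \<i> * of_real e * z0))\<^sup>2"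
      using nz[of z0] z0 R0 unfolding nF by (simp add: divide_le_eq)
    moreover have "R\<^sup>2 - (cmod z0)\<^sup>2 \<le> cmod (z0\<^sup>2 - of_real (R\<^sup>2))"
      using norm_triangle_ineq2[of "complex_of_real (R\<^sup>2)" "z0\<^sup>2"] by (simp add: norm_power norm_minus_commute)
    ultimately have "(cmod (f z0))\<^sup>2 * (R\<^sup>2 - (cmod z0)\<^sup>2) \<le> R\<^sup>2 * (cmod (1 - \<i> * of_real e * z0))\<^sup>2"
      by (meson mult_left_mono order_trans zero_le_power2)
    then have "(cmod (f z0))\<^sup>2 * (R\<^sup>2 - (cmod z0)\<^sup>2) / R\<^sup>2 \<le> (cmod (1 - \<i> * of_real e * z0))\<^sup>2"
      using R0 by (simp add: divide_le_eq mult.commute)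
    moreover have "(cmod (f z0))\<^sup>2 * (R\<^sup>2 - (cmod z0)\<^sup>2) / R\<^sup>2 = (cmod (f z0))\<^sup>2 * (1 - (cmod z0)\<^sup>2 / R\<^sup>2)"
      using R0 by (simp add: field_simps)
    ultimately show ?thesis by simp
  qed
  have step: "(cmod (f z0))\<^sup>2 \<le> (cmod (1 - \<i> * of_real e * z0))\<^sup>2" if e: "e > 0" for e
  proof (rule tendsto_upperbound[where F=at_top])
    have "((\<lambda>R::real. (cmod (f z0))\<^sup>2 * (1 - (cmod z0)\<^sup>2 / R\<^sup>2)) \<longlongrightarrow> (cmod (f z0))\<^sup>2 * (1 - 0)) at_top"
      by (intro tendsto_intros real_tendsto_divide_at_top filterlim_pow_at_top filterlim_ident) auto
    then show "((\<lambda>R::real. (cmod (f z0))\<^sup>2 * (1 - (cmod z0)\<^sup>2 / R\<^sup>2)) \<longlongrightarrow> (cmod (f z0))\<^sup>2) at_top" by simp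
    show "\<forall>\<^sub>F R in at_top. (cmod (f z0))\<^sup>2 * (1 - (cmod z0)\<^sup>2 / R\<^sup>2) \<le> (cmod (1 - \<i> * of_real e * z0))\<^sup>2"
      using eventually_ge_at_top[of 1] eventually_gt_at_top[of "cmod z0"] eventually_ge_at_top[of "8 * M / e\<^sup>2"]
      by eventually_elim (rule key[OF e])
  qed simp
  have "(cmod (f z0))\<^sup>2 \<le> 1"
  proof (rule tendsto_lowerbound[where F="at_right 0"])
    have "((\<lambda>e. (cmod (1 - \<i> * of_real e * z0))\<^sup>2) \<longlongrightarrow> (cmod (1 - \<i> * of_real 0 * z0))\<^sup>2) (at_right 0)"
      by (intro tendsto_intros)
    then show "((\<lambda>e. (cmod (1 - \<i> * of_real e * z0))\<^sup>2) \<longlongrightarrow> 1) (at_right 0)" by simp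
    show "\<forall>\<^sub>F e in at_right 0. (cmod (f z0))\<^sup>2 \<le> (cmod (1 - \<i> * of_real e * z0))\<^sup>2"
      using eventually_at_right_less[of 0] by eventually_elim (rule step)
  qed simp
  then show ?thesis using power2_le_imp_le[of "cmod (f z0)" 1] by simp
qed

section \<open>Quotients that are unimodular on the real line\<close>

text \<open>What the argument about inner functions uses of the xi quotient: two entire functions of
  equal modulus on the real line. Xi itself enters through the interpretation
  \<open>xi\<close>.\<close>

locale unimodular_quotient =
  fixes A B :: "complex \<Rightarrow> complex" and \<Theta> :: "complex \<Rightarrow> complex"
  assumes A_hol: "A holomorphic_on UNIV" and B_hol: "B holomorphic_on UNIV"
    and B_nz: "\<exists>z. B z \<noteq> 0"
    and AB: "\<And>u::real. cmod (A (of_real u)) = cmod (B (of_real u))"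
    and \<Theta>_eq: "\<And>z. \<Theta> z = A z / B z"
begin

text \<open>At a zero of B the quotient takes the conventional value 0; removing singularities gives
  the function meant analytically.\<close>

definition T :: "complex \<Rightarrow> complex" where "T = remove_sings \<Theta>"

lemma B_eventually_nz: "eventually (\<lambda>w. B w \<noteq> 0) (at z)"
proof -
  obtain \<beta> where "B \<beta> \<noteq> 0" using B_nz by blast
  from non_zero_neighbour_alt[OF B_hol open_UNIV connected_UNIV UNIV_I UNIV_I this, of z]
  show ?thesis by simp
qed

lemma \<Theta>_meromorphic: "\<Theta> meromorphic_on UNIV"
proof -
  have "(\<lambda>z. A z / B z) meromorphic_on UNIV"
    using A_hol B_hol by (intro meromorphic_intros analytic_on_imp_meromorphic_on) (auto simp: analytic_on_open)
  then show ?thesis using \<Theta>_eq by presburger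
qed

lemma \<Theta>_analytic_at: "B z \<noteq> 0 \<Longrightarrow> \<Theta> analytic_on {z}"
proof -
  assume "B z \<noteq> 0"
  then have "(\<lambda>z. A z / B z) analytic_on {z}"
    using holomorphic_on_imp_analytic_at[OF A_hol] holomorphic_on_imp_analytic_at[OF B_hol]
    by (intro analytic_on_divide) auto
  moreover have "\<Theta> = (\<lambda>z. A z / B z)" using \<Theta>_eq by auto
  ultimately show ?thesis by simp
qed

lemma T_eq: "B z \<noteq> 0 \<Longrightarrow> T z = A z / B z"
  using remove_sings_at_analytic[OF \<Theta>_analytic_at] \<Theta>_eq by (simp add: T_def)

lemma isolated: "isolated_singularity_at \<Theta> z"
  by (rule meromorphic_on_isolated_singularity[OF meromorphic_on_subset[OF \<Theta>_meromorphic]]) simp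

text \<open>Real zeros of B do no harm: along real points the modulus is 1 whenever B does not
  vanish, so there is no pole. A meromorphic function without a pole has a finite limit, of modulus
  1 by the same points.\<close>

lemma T_real:
  "T analytic_on {of_real u}" "cmod (T (of_real u)) = 1"
proof -
  let ?u = "complex_of_real u"
  let ?X = "\<lambda>n. complex_of_real (u + inverse (real (Suc n)))"
  have Xlim: "?X \<longlonglongrightarrow> ?u"
  proof -
    have "(\<lambda>n. u + inverse (real (Suc n))) \<longlonglongrightarrow> u + 0" by (intro tendsto_intros LIMSEQ_inverse_real_of_nat)
    then show ?thesis by (intro tendsto_of_real) simp
  qed
  have Xat: "filterlim ?X (at ?u) sequentially"
    using Xlim by (simp add: filterlim_at del: of_real_add of_real_inverse of_nat_Suc)
  have ev: "\<forall>\<^sub>F n in sequentially. cmod (\<Theta> (?X n)) = 1"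
    using filterlim_iff[THEN iffD1, OF Xat, rule_format, OF B_eventually_nz]
    by eventually_elim (simp add: \<Theta>_eq norm_divide AB del: of_real_add of_real_inverse of_nat_Suc)
  have "\<not> is_pole \<Theta> ?u"
  proof
    assume "is_pole \<Theta> ?u"
    then have "filterlim (\<lambda>n. \<Theta> (?X n)) at_infinity sequentially"
      unfolding is_pole_def by (rule filterlim_compose[OF _ Xat])
    then have "filterlim (\<lambda>n. cmod (\<Theta> (?X n))) at_top sequentially"
      by (rule filterlim_at_infinity_imp_norm_at_top)
    then have "\<forall>\<^sub>F n in sequentially. 2 \<le> cmod (\<Theta> (?X n))" by (simp add: filterlim_at_top)
    with ev have "\<forall>\<^sub>F n in sequentially. False" by eventually_elim simp
    then show False by simp
  qed
  moreover have "not_essential \<Theta> ?u"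
    by (rule meromorphic_on_not_essential[OF meromorphic_on_subset[OF \<Theta>_meromorphic]]) simp
  ultimately obtain c where c: "\<Theta> \<midarrow>?u\<rightarrow> c" by (auto simp: not_essential_def)
  show "T analytic_on {?u}" unfolding T_def by (rule remove_sings_analytic_at[OF isolated c])
  have "T ?u = c" unfolding T_def using c by blast
  moreover have "(\<lambda>n. cmod (\<Theta> (?X n))) \<longlonglongrightarrow> cmod c"
    by (intro tendsto_norm filterlim_compose[OF c Xat])
  then have "cmod c = 1" using LIMSEQ_unique tendsto_eventually[OF ev] by blast
  ultimately show "cmod (T ?u) = 1" by simp
qed

lemma T_real_cont: "continuous_on UNIV (\<lambda>u::real. T (of_real u))"
proof -
  have "isCont (\<lambda>u::real. T (of_real u)) u" for u
    by (rule isCont_o2[where f=complex_of_real and g=T, OF _ analytic_at_imp_isCont[OF T_real(1)]]) (intro continuous_intros)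
  then show ?thesis by (simp add: continuous_at_imp_continuous_on)
qed

lemma T_real_measurable [measurable]: "(\<lambda>u::real. T (of_real u)) \<in> borel_measurable borel"
  by (rule borel_measurable_continuous_onI[OF T_real_cont])

lemma countable_zeros_B: "countable {z. B z = 0}"
proof (rule ccontr)
  assume "uncountable {z. B z = 0}"
  then have "B = (\<lambda>_. 0)" by (intro holomorphic_countable_equal_UNIV[OF B_hol]) auto
  then show False using B_nz by auto
qed

lemma AE_T_eq: "AE u in lborel. \<Theta> (of_real u) = T (of_real u)"
proof -
  have "countable {u::real. B (of_real u) = 0}"
    by (rule countable_subset[OF _ countable_image[OF countable_zeros_B, of Re]])
       (auto intro!: image_eqI[where f=Re])
  then have "{u::real. B (of_real u) = 0} \<in> null_sets lborel"
    by (rule countable_imp_null_set_lborel)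
  then have "AE u in lborel. B (of_real u) \<noteq> 0"
    using AE_not_in[of "{u::real. B (of_real u) = 0}" lborel] by simp
  then show ?thesis by eventually_elim (simp add: T_eq \<Theta>_eq)
qed

text \<open>A holomorphic cofactor S gives the value of \<open>T\<close> also at zeros of B, being
  the limit of the quotient there.\<close>

lemma T_eq_on:
  assumes "S holomorphic_on U" "open U" "z \<in> U" and rep: "\<And>w. w \<in> U \<Longrightarrow> A w = B w * S w"
  shows "T z = S z"
proof -
  have "isCont S z" using holomorphic_on_imp_continuous_on[OF assms(1)] assms(2,3) by (simp add: continuous_on_eq_continuous_at)
  then have "S \<midarrow>z\<rightarrow> S z" by (rule isContD)
  moreover have "\<forall>\<^sub>F w in at z. w \<in> U" by (rule eventually_at_in_open'[OF assms(2,3)])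
  then have "\<forall>\<^sub>F w in at z. S w = \<Theta> w"
    using B_eventually_nz[of z] by eventually_elim (simp add: \<Theta>_eq rep)
  ultimately have "\<Theta> \<midarrow>z\<rightarrow> S z" using tendsto_cong by fast
  then show ?thesis unfolding T_def by blast
qed

text \<open>Since the \<open>LT\<close> of an \<open>L\<^sup>2\<close> function grows at most like \<open>(Im z)\<^sup>-\<^sup>1\<^sup>/\<^sup>2\<close>, such a
  representation of the quotient forces it to be inner.\<close>
lemma inner_if_LT:
  assumes L: "L2 k" and supp: "\<And>t. t \<le> 0 \<Longrightarrow> k t = 0"
    and rep: "\<And>z. Im z > 0 \<Longrightarrow> A z = B z * ((1 - \<i> * z) * LT k z)"
  shows "meromorphic_inner \<Theta>"
proof -
  let ?H = "{z. Im z > 0}" and ?S = "\<lambda>z. (1 - \<i> * z) * LT k z"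
  have oH: "open ?H" by (rule open_halfspace_Im_gt)
  have Sh: "?S holomorphic_on ?H" by (intro holomorphic_intros LT_holomorphic[OF L supp])
  have TS: "T z = ?S z" if "Im z > 0" for z
    by (rule T_eq_on[OF Sh oH]) (use that rep in auto)
  have Th: "T holomorphic_on ?H" using Sh by (rule holomorphic_transform) (simp add: TS)
  have Tc: "continuous_on {z. Im z \<ge> 0} T"
  proof (rule continuous_at_imp_continuous_on, rule ballI)
    fix z assume z: "z \<in> {z. Im z \<ge> 0}"
    show "isCont T z"
    proof (cases "Im z = 0")
      case True
      then have "z = of_real (Re z)" by (simp add: complex_eq_iff)
      then show ?thesis using analytic_at_imp_isCont[OF T_real(1)[of "Re z"]] by simp
    next
      case False
      then show ?thesis
        using z holomorphic_on_imp_continuous_on[OF Th] oH by (simp add: continuous_on_eq_continuous_at)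
    qed
  qed
  have T1: "cmod (T z) \<le> 1" if z: "Im z > 0" for z
  \<comment> \<open>The square of the bound in \<open>LT_bound\<close> is nsq k / (2 Im w); the
    factor 1 - i w contributes (1 + |w|)^2.\<close>
  proof (rule half_plane_bound[OF Th Tc _ _ z, where M="nsq k / 2"])
    show "cmod (T (of_real u)) \<le> 1" for u using T_real(2)[of u] by simp
    fix w assume w: "Im w > 0"
    have "cmod (1 - \<i> * w) \<le> 1 + cmod w" using norm_triangle_ineq4[of 1 "\<i> * w"] by (simp add: norm_mult)
    then have "cmod (?S w) \<le> (1 + cmod w) * (sqrt (nsq k) / sqrt (2 * Im w))"
      unfolding norm_mult by (intro mult_mono LT_bound[OF L supp w]) auto
    then have "(cmod (T w))\<^sup>2 \<le> ((1 + cmod w) * (sqrt (nsq k) / sqrt (2 * Im w)))\<^sup>2"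
      unfolding TS[OF w] by (intro power_mono) auto
    also have "\<dots> = nsq k / 2 * (1 + cmod w)\<^sup>2 / Im w"
      using w by (simp add: power_mult_distrib power_divide nsq_nonneg)
    finally show "(cmod (T w))\<^sup>2 \<le> nsq k / 2 * (1 + cmod w)\<^sup>2 / Im w" .
  qed
  have "T analytic_on ?H" using Th oH by (simp add: analytic_on_open)
  moreover have "bounded (T ` ?H)" unfolding bounded_iff using T1 by auto
  moreover have "((\<lambda>v. cmod (T (of_real u + \<i> * of_real v))) \<longlongrightarrow> 1) (at_right 0)" for u :: real
  proof -
    have "((\<lambda>v. of_real u + \<i> * of_real v) \<longlongrightarrow> of_real u + \<i> * of_real 0) (at_right 0)" by (intro tendsto_intros)
    then have "((\<lambda>v. cmod (T (of_real u + \<i> * of_real v))) \<longlongrightarrow> cmod (T (of_real u))) (at_right 0)"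
      by (intro tendsto_norm isCont_tendsto_compose[OF analytic_at_imp_isCont[OF T_real(1)]]) simp
    then show ?thesis by (simp add: T_real(2))
  qed
  ultimately show ?thesis unfolding meromorphic_inner_def using \<Theta>_meromorphic unfolding T_def by simp
qed

end

section \<open>The transform of the test function and a kernel for primitives\<close>

lemma exp_complex_half_line:
  assumes a: "Re a > 0"
  shows "integrable lborel (\<lambda>t. indicator {0<..} t * exp (- a * of_real t))"
    and "(\<integral>t. indicator {0<..} t * exp (- a * of_real t) \<partial>lborel) = 1 / a"
proof -
  let ?f = "\<lambda>t. indicator {0<..} t * exp (- a * of_real t)"
  have "integrable lborel (\<lambda>t. indicator {0<..} t * exp (- Re a * t))"
    using exp_half_line[OF a] by (simp add: has_bochner_integral_iff)
  then show i: "integrable lborel ?f"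
    by (rule Bochner_Integration.integrable_bound) (auto simp: norm_mult indicator_def)
  have "(\<lambda>n. \<integral>t. indicator {0..real n} t *\<^sub>R exp (- a * of_real t) \<partial>lborel) \<longlonglongrightarrow> (\<integral>t. ?f t \<partial>lborel)"
  proof (rule integral_dominated_convergence[OF _ _ integrable_norm[OF i]])
    have ae: "AE t in lborel. t \<noteq> (0::real)" by (rule AE_lborel_singleton)
    then show "AE t in lborel. (\<lambda>n. indicator {0..real n} t *\<^sub>R exp (- a * of_real t)) \<longlonglongrightarrow> ?f t"
    proof eventually_elim
      case (elim t)
      show ?case
      proof (rule tendsto_eventually)
        show "\<forall>\<^sub>F n in sequentially. indicator {0..real n} t *\<^sub>R exp (- a * of_real t) = ?f t"
          using eventually_ge_at_top[of "nat \<lceil>t\<rceil>"]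
        proof eventually_elim
          case (elim n)
          then have "t \<le> real n" by linarith
          then show ?case using \<open>t \<noteq> 0\<close> by (auto simp: indicator_def)
        qed
      qed
    qed
    show "AE t in lborel. norm (indicator {0..real n} t *\<^sub>R exp (- a * of_real t)) \<le> norm (?f t)" for n
      using ae by eventually_elim (auto simp: indicator_def)
  qed measurable
  moreover have "(\<integral>t. indicator {0..real n} t *\<^sub>R exp (- a * of_real t) \<partial>lborel) = - exp (- a * of_real (real n)) / a - - exp (- a * of_real 0) / a" for n
  proof (rule integral_FTC_Icc)
    show "((\<lambda>t. - exp (- a * of_real t) / a) has_vector_derivative exp (- a * of_real t)) (at t within {0..real n})" for t
      using a by (intro has_vector_derivative_real_field) (auto intro!: derivative_eq_intros)
  qed (auto intro!: continuous_intros)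
  moreover have "(\<lambda>n. - exp (- a * of_real (real n)) / a - - exp (- a * of_real 0) / a) \<longlonglongrightarrow> - 0 / a - - exp (- a * of_real 0) / a"
  proof (intro tendsto_intros)
    have "(\<lambda>n. exp (- Re a * real n)) \<longlonglongrightarrow> 0" using a by real_asymp
    then show "(\<lambda>n. exp (- a * of_real (real n))) \<longlonglongrightarrow> 0"
      by (rule Lim_null_comparison[rotated]) simp
  qed (use a in auto)
  ultimately show "(\<integral>t. ?f t \<partial>lborel) = 1 / a"
    using LIMSEQ_unique by fastforce
qed

definition ehalf :: "real \<Rightarrow> complex" where "ehalf t = indicator {0<..} t * exp (- of_real t)"

lemma ehalf_alt: "ehalf = (\<lambda>t. of_real (indicator {0<..} t * exp (- 1 * t)))"
  by (auto simp: ehalf_def indicator_def exp_of_real[symmetric])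

lemma L2_ehalf: "L2 ehalf"
  unfolding ehalf_alt by (rule L2_exp_half_line) simp

lemma integrable_ehalf: "integrable lborel ehalf"
  unfolding ehalf_def using exp_complex_half_line(1)[of 1] by simp

lemma LT_ehalf: "Im z > -1 \<Longrightarrow> LT ehalf z = 1 / (1 - \<i> * z)"
  using exp_complex_half_line(2)[of "1 - \<i> * z"]
  by (simp add: LT_def ehalf_def algebra_simps flip: exp_add)

lemma FT_LT: "FT 1 k u = LT k (of_real u)"
  by (simp add: FT_def LT_def cis_conv_exp mult.assoc)

lemma FT_ehalf: "FT 1 ehalf u = 1 / (1 - \<i> * of_real u)"
  by (simp add: FT_LT LT_ehalf)

text \<open>The function is dominated by |1 / (1 - i t)|, the transform of \<open>ehalf\<close>,
  which is square-integrable by Plancherel.\<close>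

lemma L2_inverse_linear: "L2 (\<lambda>t. of_real (1 / (1 + \<bar>t\<bar>)))"
proof (rule L2_bound[where C=1])
  show "L2 (FT 1 ehalf)" by (rule Plancherel_integrable) (auto intro: L2_ehalf integrable_ehalf)
  have "1 / (1 + \<bar>t\<bar>) \<le> cmod (FT 1 ehalf t)" for t
  proof -
    have "cmod (1 - \<i> * of_real t) \<le> 1 + \<bar>t\<bar>" using norm_triangle_ineq4[of 1 "\<i> * of_real t"] by (simp add: norm_mult)
    moreover have "1 - \<i> * of_real t \<noteq> 0" by (simp add: complex_eq_iff)
    ultimately show ?thesis by (simp add: FT_ehalf norm_divide frac_le)
  qed
  then show "AE t in lborel. cmod (of_real (1 / (1 + \<bar>t\<bar>))) \<le> 1 * cmod (FT 1 ehalf t)"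
    by (intro AE_I2) (simp del: of_real_divide of_real_add)
qed measurable

text \<open>For t nonzero, the primitive in z of exp (i z t) that vanishes at z = 0. The division by
  t supplies the decay that lets it be paired with an L2 function up to the real line.\<close>

definition qk :: "complex \<Rightarrow> real \<Rightarrow> complex" where
  "qk z t = (exp (\<i> * z * of_real t) - 1) / (\<i> * of_real t)"

lemma cmod_exp_minus_1_le:
  assumes "Re w \<le> 0" shows "cmod (exp w - 1) \<le> cmod w"
proof -
  have "norm (exp w - exp 0) \<le> 1 * norm (w - 0)"
  proof (rule field_differentiable_bound[where S="{z. Re z \<le> 0}" and f'=exp])
    show "convex {z. Re z \<le> 0}" by (rule convex_halfspace_Re_le)
    show "(exp has_field_derivative exp z) (at z within {z. Re z \<le> 0})" for z :: complex
      by (rule has_field_derivative_at_within[OF DERIV_exp])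
  qed (use assms in auto)
  then show ?thesis by simp
qed

text \<open>The numerator is at most |z| t, good for small t, and at most 2, good for large t; the
  sum of the two estimates gives the decay 1 / (1 + t).\<close>

lemma qk_bound:
  assumes "Im z \<ge> 0" "t > 0"
  shows "cmod (qk z t) \<le> (cmod z + 2) * (1 / (1 + \<bar>t\<bar>))"
proof -
  have re: "Re (\<i> * z * of_real t) \<le> 0" using assms by simp
  have 1: "cmod (exp (\<i> * z * of_real t) - 1) \<le> cmod z * t"
    using cmod_exp_minus_1_le[OF re] assms by (simp add: norm_mult)
  have 2: "cmod (exp (\<i> * z * of_real t) - 1) \<le> 2"
    using norm_triangle_ineq4[of "exp (\<i> * z * of_real t)" 1] re by (simp add: norm_mult) (smt (verit) one_le_exp_iff exp_le_one_iff)
  have "(1 + t) * cmod (exp (\<i> * z * of_real t) - 1) = cmod (exp (\<i> * z * of_real t) - 1) + t * cmod (exp (\<i> * z * of_real t) - 1)"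
    by (simp add: algebra_simps)
  also have "\<dots> \<le> cmod z * t + t * 2" using 1 2 assms by (intro add_mono mult_left_mono) auto
  finally have "(1 + t) * cmod (exp (\<i> * z * of_real t) - 1) \<le> t * (cmod z + 2)" by (simp add: algebra_simps)
  then show ?thesis using assms unfolding qk_def norm_divide norm_mult
    by (simp add: divide_simps mult.commute)
qed

section \<open>Analytic extension of the relation on the real line\<close>

context unimodular_quotient
begin

text \<open>Integrating \<open>k\<close> against \<open>qk\<close> gives a primitive of \<open>LT k\<close> that is continuous up to the real
  line, where its increments are those of a primitive of \<open>T z / (1 - \<i> z)\<close>; the difference, extended
  by \<open>0\<close> below the line, is analytic and hence vanishes.\<close>
lemma analytic_extension_agrees:
  assumes L: "L2 k" and supp: "\<And>t. t \<le> 0 \<Longrightarrow> k t = 0"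
    and F: "is_FT 1 k (\<lambda>u. T (of_real u) / (1 - \<i> * of_real u))"
    and z: "Im z > 0"
  shows "A z = B z * ((1 - \<i> * z) * LT k z)"
proof -
  let ?H = "{z. Im z > 0}" and ?W = "\<lambda>z. T z / (1 - \<i> * z)"
  have oH: "open ?H" by (rule open_halfspace_Im_gt)
  have [measurable]: "k \<in> borel_measurable borel" using L by (simp add: L2_def)
  have [measurable]: "qk w \<in> borel_measurable borel" for w unfolding qk_def by measurable
  define b where "b t = cmod (k t) * cmod (of_real (1 / (1 + \<bar>t\<bar>)))" for t
  have bI: "integrable lborel b" unfolding b_def by (rule L2_prod_norm_integrable[OF L L2_inverse_linear])
  have kq: "cmod (k t * qk w t) \<le> (cmod w + 2) * b t" if "Im w \<ge> 0" for w t
  proof (cases "t > 0")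
    case True
    have "cmod (k t) * cmod (qk w t) \<le> cmod (k t) * ((cmod w + 2) * (1 / (1 + \<bar>t\<bar>)))"
      by (intro mult_left_mono qk_bound that True) auto
    then show ?thesis by (simp add: norm_mult b_def mult_ac del: of_real_divide of_real_add)
  qed (use supp in \<open>simp add: b_def\<close>)
  define Q where "Q w = (\<integral>t. k t * qk w t \<partial>lborel)" for w
  have Qderiv: "(Q has_field_derivative LT k w) (at w)" if w: "Im w > 0" for w
  proof -
    have d: "((\<lambda>w. k t * qk w t) has_field_derivative k t * exp (\<i> * w * of_real t)) (at w)" for t w
    proof (cases "t = 0")
      case False
      then show ?thesis unfolding qk_def by (auto intro!: derivative_eq_intros)
    qed (use supp in simp)
    have "((\<lambda>w. \<integral>t. k t * qk w t \<partial>lborel) has_field_derivative (\<integral>t. deriv (\<lambda>w. k t * qk w t) w \<partial>lborel)) (at w)"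
    proof (rule has_field_derivative_integral[OF oH])
      show "(\<lambda>w. k t * qk w t) holomorphic_on ?H" for t
        using d[of t] holomorphic_on_open[OF oH] by blast
      fix v assume v: "v \<in> ?H"
      let ?r = "min 1 (Im v / 2)"
      show "\<exists>r>0. \<exists>B. cball v r \<subseteq> ?H \<and> integrable lborel B \<and> (\<forall>t\<in>space lborel. \<forall>w\<in>cball v r. cmod (k t * qk w t) \<le> B t)"
      proof (intro exI[of _ ?r] exI[of _ "\<lambda>t. (cmod v + 3) * b t"] conjI ballI)
        have im: "Im w > 0" if "w \<in> cball v ?r" for w
          using that v abs_Im_le_cmod[of "v - w"] by (simp add: dist_norm) (elim conjE, linarith)
        show "cball v ?r \<subseteq> ?H" using im by auto
        show "integrable lborel (\<lambda>t. (cmod v + 3) * b t)" using bI by simp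
        fix t w assume w: "w \<in> cball v ?r"
        have "cmod w \<le> cmod v + 1" using w norm_triangle_ineq[of v "w - v"] by (simp add: dist_norm norm_minus_commute)
        then have "(cmod w + 2) * b t \<le> (cmod v + 3) * b t" by (intro mult_right_mono) (auto simp: b_def)
        then show "cmod (k t * qk w t) \<le> (cmod v + 3) * b t" using kq[of w t] im[OF w] by simp
      qed (use v in auto)
    qed (use w in auto)
    also have "(\<integral>t. deriv (\<lambda>w. k t * qk w t) w \<partial>lborel) = LT k w"
      unfolding LT_def using DERIV_imp_deriv[OF d] by simp
    finally show ?thesis by (simp add: Q_def[abs_def])
  qed
  have Qcont: "continuous_on {z. Im z \<ge> 0} Q"
    unfolding continuous_on_sequentially
  proof (intro allI ballI impI, elim conjE)
    fix X :: "nat \<Rightarrow> complex" and a assume X: "\<forall>n. X n \<in> {z. Im z \<ge> 0}" and lim: "X \<longlonglongrightarrow> a"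
    obtain C where C: "\<And>n. cmod (X n) \<le> C"
      using convergent_imp_Bseq[OF convergentI[OF lim]] unfolding Bseq_def by blast
    show "(Q \<circ> X) \<longlonglongrightarrow> Q a"
      unfolding o_def Q_def
    proof (rule integral_dominated_convergence)
      show "integrable lborel (\<lambda>t. (C + 2) * b t)" using bI by simp
      show "AE t in lborel. (\<lambda>n. k t * qk (X n) t) \<longlonglongrightarrow> k t * qk a t"
      proof (rule AE_I2)
        fix t
        show "(\<lambda>n. k t * qk (X n) t) \<longlonglongrightarrow> k t * qk a t"
        proof (cases "t = 0")
          case False
          then show ?thesis unfolding qk_def by (intro tendsto_intros lim) auto
        qed (use supp in simp)
      qed
      show "AE t in lborel. norm (k t * qk (X n) t) \<le> (C + 2) * b t" for n
      proof (rule AE_I2)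
        fix t
        have "(cmod (X n) + 2) * b t \<le> (C + 2) * b t" using C by (intro mult_right_mono) (auto simp: b_def)
        then show "norm (k t * qk (X n) t) \<le> (C + 2) * b t" using kq[of "X n" t] X by simp
      qed
    qed measurable
  qed
  \<comment> \<open>Pairing with the indicator of [p, r] uses the transform relation without any
    pointwise boundary value: the conjugated transform of the indicator is a difference of two
    kernels \<open>qk\<close>, so the adjoint relation yields increments of Q.\<close>
  have Qreal: "Q (of_real r) - Q (of_real p) = (\<integral>u. indicator {p..r} u *\<^sub>R ?W (of_real u) \<partial>lborel)" if pr: "p \<le> r" for p r
  proof -
    let ?I = "indicator {p..r} :: real \<Rightarrow> complex"
    have LI: "L2 ?I" by (rule L2_indicator_Icc)
    have "is_FT (- 1) ?I (FT (- 1) ?I)"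
      by (rule is_FT_integrable) (auto intro: LI integrable_complex_indicator_Icc)
    then have "ip (\<lambda>u. ?W (of_real u)) ?I = ip k (FT (- 1) ?I)"
      by (intro is_FT_adjoint[OF _ F]) auto
    moreover have "ip (\<lambda>u. ?W (of_real u)) ?I = (\<integral>u. indicator {p..r} u *\<^sub>R ?W (of_real u) \<partial>lborel)"
      unfolding ip_def by (rule Bochner_Integration.integral_cong) (auto simp: indicator_def)
    moreover have "ip k (FT (- 1) ?I) = (\<integral>t. k t * qk (of_real r) t - k t * qk (of_real p) t \<partial>lborel)"
      unfolding ip_def
    proof (rule Bochner_Integration.integral_cong[OF refl])
      fix t
      show "k t * cnj (FT (- 1) ?I t) = k t * qk (of_real r) t - k t * qk (of_real p) t"
      proof (cases "t = 0")
        case False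
        have "cnj (FT (- 1) ?I t) = (\<integral>u. indicator {p..r} u *\<^sub>R exp (\<i> * of_real u * of_real t) \<partial>lborel)"
          unfolding FT_def
          by (subst Bochner_Integration.integral_cnj[symmetric])
             (auto intro!: Bochner_Integration.integral_cong simp: indicator_def cis_cnj cis_conv_exp exp_cnj mult_ac)
        also have "\<dots> = exp (\<i> * of_real r * of_real t) / (\<i> * of_real t) - exp (\<i> * of_real p * of_real t) / (\<i> * of_real t)"
        proof (rule integral_FTC_Icc[OF pr])
          show "((\<lambda>u. exp (\<i> * of_real u * of_real t) / (\<i> * of_real t)) has_vector_derivative exp (\<i> * of_real u * of_real t)) (at u within {p..r})" for u
            using False by (intro has_vector_derivative_real_field) (auto intro!: derivative_eq_intros)
        qed (intro continuous_intros)
        also have "\<dots> = qk (of_real r) t - qk (of_real p) t" by (simp add: qk_def diff_divide_distrib)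
        finally show ?thesis by (simp add: right_diff_distrib)
      qed (use supp in simp)
    qed
    moreover have "integrable lborel (\<lambda>t. k t * qk (of_real s) t)" for s
      by (rule Bochner_Integration.integrable_bound[where f="\<lambda>t. (cmod (complex_of_real s) + 2) * b t"])
         (use bI kq[of "of_real s"] in \<open>auto intro!: AE_I2 intro: order_trans[OF _ abs_ge_self]\<close>)
    ultimately show ?thesis unfolding Q_def by simp
  qed
  have "T analytic_on {0}" using T_real(1)[of 0] by simp
  then obtain r0 where r0: "r0 > 0" "T holomorphic_on ball 0 r0" by (auto simp: analytic_on_def)
  \<comment> \<open>The bound 1 keeps the disc away from -i, the zero of 1 - i z.\<close>
  define \<rho> where "\<rho> = min r0 1"
  have \<rho>: "\<rho> > 0" "\<rho> \<le> 1" using r0 by (auto simp: \<rho>_def)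
  let ?B = "ball (0::complex) \<rho>"
  have Th: "T holomorphic_on ?B" by (rule holomorphic_on_subset[OF r0(2)]) (auto simp: \<rho>_def)
  have nz: "1 - \<i> * w \<noteq> 0" if "w \<in> ?B" for w
  proof
    assume "1 - \<i> * w = 0"
    then have "cmod (\<i> * w) = 1" by (metis eq_iff_diff_eq_0 norm_one)
    then show False using that \<rho> by (simp add: norm_mult)
  qed
  have Wh: "?W holomorphic_on ?B" using Th nz by (intro holomorphic_intros) auto
  obtain V where V: "\<And>x. x \<in> ?B \<Longrightarrow> (V has_field_derivative ?W x) (at x within ?B)"
    using holomorphic_convex_primitive'[OF convex_ball open_ball Wh] by blast
  then have V: "(V has_field_derivative ?W x) (at x)" if "x \<in> ?B" for x
    using that at_within_open[OF that open_ball] by fastforce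
  have Vreal: "V (of_real r) - V (of_real p) = (\<integral>u. indicator {p..r} u *\<^sub>R ?W (of_real u) \<partial>lborel)"
    if pr: "p \<le> r" "-\<rho> < p" "r < \<rho>" for p r
  proof (rule integral_FTC_Icc[OF pr(1), symmetric])
    have inB: "of_real u \<in> ?B" if "u \<in> {p..r}" for u using that pr by auto
    show "((\<lambda>u. V (of_real u)) has_vector_derivative ?W (of_real u)) (at u within {p..r})" if "p \<le> u" "u \<le> r" for u
      by (rule has_vector_derivative_real_field[OF V[OF inB]]) (use that in auto)
    show "continuous_on {p..r} (\<lambda>u. ?W (of_real u))"
      by (rule continuous_on_compose2[OF holomorphic_on_imp_continuous_on[OF Wh]]) (use inB in \<open>auto intro!: continuous_intros\<close>)
  qed
  \<comment> \<open>Q and V have the same increments on the real diameter, so the two cases fit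
    together continuously. Analytic pasting across the line and the vanishing below it force D to be
    0.\<close>
  define D where "D w = (if Im w \<le> 0 then 0 else Q w - V w - (Q 0 - V 0))" for w
  have D0: "Q w - V w = Q 0 - V 0" if "w \<in> ?B" "Im w = 0" for w
  proof -
    have w: "w = of_real (Re w)" using that by (simp add: complex_eq_iff)
    have b: "- \<rho> < Re w" "Re w < \<rho>" using that abs_Re_le_cmod[of w] by auto
    show ?thesis
    proof (cases "Re w \<ge> 0")
      case True
      show ?thesis using Qreal[OF True] Vreal[OF True] b \<rho> by (subst (1 2) w) (simp add: algebra_simps)
    next
      case False
      then have "Re w \<le> 0" by simp
      from Qreal[OF this] Vreal[OF this] show ?thesis using b \<rho> by (subst (1 2) w) (simp add: algebra_simps)
    qed
  qed
  have Vc: "continuous_on ?B V" using V by (meson DERIV_isCont continuous_at_imp_continuous_on)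
  have "D holomorphic_on ?B"
  proof (rule holomorphic_on_paste_across_line[of _ \<i> _ 0])
    have "D holomorphic_on (?B \<inter> {z. \<i> \<bullet> z < 0}) \<longleftrightarrow> (\<lambda>_. 0) holomorphic_on (?B \<inter> {z. \<i> \<bullet> z < 0})"
      by (intro holomorphic_cong) (auto simp: D_def)
    then show "D holomorphic_on (?B \<inter> {z. \<i> \<bullet> z < 0})" by simp
    have "(\<lambda>w. Q w - V w - (Q 0 - V 0)) holomorphic_on (?B \<inter> {z. 0 < \<i> \<bullet> z})"
    proof (intro holomorphic_intros)
      show "Q holomorphic_on ?B \<inter> {z. 0 < \<i> \<bullet> z}"
        unfolding holomorphic_on_def field_differentiable_def
        by (intro ballI exI, rule has_field_derivative_at_within[OF Qderiv]) simp
      show "V holomorphic_on ?B \<inter> {z. 0 < \<i> \<bullet> z}"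
        unfolding holomorphic_on_def field_differentiable_def using has_field_derivative_at_within[OF V] by blast
    qed
    then show "D holomorphic_on (?B \<inter> {z. 0 < \<i> \<bullet> z})"
      by (rule holomorphic_transform) (auto simp: D_def)
    show "continuous_on ?B D"
      unfolding D_def
    proof (rule continuous_on_cases_le)
      show "continuous_on {t \<in> ?B. 0 \<le> Im t} (\<lambda>w. Q w - V w - (Q 0 - V 0))"
        by (intro continuous_intros continuous_on_subset[OF Qcont] continuous_on_subset[OF Vc]) auto
    qed (use D0 in \<open>auto intro!: continuous_intros\<close>)
  qed auto
  have D_zero: "D w = 0" if "w \<in> ?B" for w
  proof (rule analytic_continuation_open[of "?B \<inter> {z. Im z < 0}" ?B D "\<lambda>_. 0"])
    show "open (?B \<inter> {z. Im z < 0})" by (intro open_Int open_ball open_halfspace_Im_lt)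
    have "- \<i> * of_real (\<rho> / 2) \<in> ?B \<inter> {z. Im z < 0}" using \<rho> by (simp add: norm_mult)
    then show "?B \<inter> {z. Im z < 0} \<noteq> {}" by blast
  qed (use that \<open>D holomorphic_on ?B\<close> in \<open>auto simp: D_def\<close>)
  have LW: "LT k w = ?W w" if w: "w \<in> ?B" "Im w > 0" for w
  proof -
    have "((\<lambda>w. V w + (Q 0 - V 0)) has_field_derivative ?W w) (at w)"
      using V[OF w(1)] by (auto intro!: derivative_eq_intros)
    then have "(Q has_field_derivative ?W w) (at w)"
    proof (rule has_field_derivative_transform_within_open[where S="?B \<inter> ?H"])
      fix x assume x: "x \<in> ?B \<inter> ?H"
      then show "V x + (Q 0 - V 0) = Q x" using D_zero[of x] by (simp add: D_def algebra_simps)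
    qed (use w oH in auto)
    then show ?thesis using Qderiv[OF w(2)] DERIV_unique by blast
  qed
  \<comment> \<open>The equality of derivatives holds only near 0, and B must not vanish in order to
    read \<open>T\<close> as the quotient. Agreement on this open set determines both sides on the
    half plane.\<close>
  let ?s = "?B \<inter> ?H \<inter> {w. B w \<noteq> 0}"
  show ?thesis
  proof (rule analytic_continuation_open[of ?s ?H A "\<lambda>z. B z * ((1 - \<i> * z) * LT k z)"])
    have "open {w. B w \<noteq> 0}"
      by (rule open_Collect_neq[OF holomorphic_on_imp_continuous_on[OF B_hol] continuous_on_const])
    then show "open ?s" using oH by (intro open_Int open_ball)
    let ?z1 = "\<i> * of_real (\<rho> / 2)"
    have z1: "?z1 \<in> ?B \<inter> ?H" using \<rho> by (simp add: norm_mult)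
    have "\<forall>\<^sub>F w in at ?z1. w \<in> ?B \<inter> ?H" by (rule eventually_at_in_open'[OF open_Int[OF open_ball oH] z1])
    then have "\<forall>\<^sub>F w in at ?z1. w \<in> ?s" using B_eventually_nz[of ?z1] by eventually_elim simp
    then have "\<exists>w. w \<in> ?s" by (rule eventually_happens'[OF at_neq_bot])
    then show "?s \<noteq> {}" by blast
    show "connected ?H" by (rule convex_connected[OF convex_halfspace_Im_gt])
    show "A holomorphic_on ?H" "(\<lambda>z. B z * ((1 - \<i> * z) * LT k z)) holomorphic_on ?H"
      using holomorphic_on_subset[OF A_hol] holomorphic_on_subset[OF B_hol] LT_holomorphic[OF L supp]
      by (auto intro!: holomorphic_intros)
    show "A w = B w * ((1 - \<i> * w) * LT k w)" if "w \<in> ?s" for w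
      using that LW[of w] nz[of w] T_eq[of w] by simp
  qed (use oH z in auto)
qed

end

section \<open>Functions determined by their integrals over intervals\<close>

text \<open>Closed intervals are an intersection-stable generator of the Borel sets, so the integral
  vanishes over every Borel set by induction and f is almost everywhere the density 0. Complements
  require the total integral, a limit over [-n, n].\<close>

lemma AE_zero_if_interval_integrals_zero_real:
  fixes f :: "real \<Rightarrow> real"
  assumes I: "integrable lborel f"
    and zero: "\<And>a b. a \<le> b \<Longrightarrow> (\<integral>x. indicator {a..b} x * f x \<partial>lborel) = 0"
  shows "AE x in lborel. f x = 0"
proof -
  have [measurable]: "f \<in> borel_measurable borel" using borel_measurable_integrable[OF I] by simp
  have total: "(\<integral>x. f x \<partial>lborel) = 0"
  proof -
    have "(\<lambda>n. \<integral>x. indicator {- real n..real n} x * f x \<partial>lborel) \<longlonglongrightarrow> (\<integral>x. f x \<partial>lborel)"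
    proof (rule integral_dominated_convergence[OF _ _ integrable_norm[OF I]])
      show "AE x in lborel. (\<lambda>n. indicator {- real n..real n} x * f x) \<longlonglongrightarrow> f x"
      proof (intro AE_I2 tendsto_eventually)
        fix x :: real
        show "\<forall>\<^sub>F n in sequentially. indicator {- real n..real n} x * f x = f x"
          using eventually_ge_at_top[of "nat \<lceil>\<bar>x\<bar>\<rceil>"]
        proof eventually_elim
          case (elim n)
          then have "\<bar>x\<bar> \<le> real n" by linarith
          then show ?case by (simp add: abs_le_iff)
        qed
      qed
      show "AE x in lborel. norm (indicator {- real n..real n} x * f x) \<le> norm (f x)" for n
        by (intro AE_I2) (auto simp: indicator_def)
    qed measurable
    then show ?thesis using zero by (simp add: LIMSEQ_const_iff)
  qed
  have si: "set_integrable lborel S f" if "S \<in> sets borel" for S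
    unfolding set_integrable_def by (rule integrable_mult_indicator[OF _ I]) (use that in simp)
  have "(\<integral>x\<in>S. f x \<partial>lborel) = 0" if "S \<in> sets borel" for S
  proof -
    let ?G = "range (\<lambda>(a, b). {a..b::real})"
    have "sets borel = sigma_sets UNIV ?G" unfolding borel_eq_atLeastAtMost by simp
    then have S: "S \<in> sigma_sets UNIV ?G" using that by simp
    have stable: "Int_stable ?G"
    proof (rule Int_stableI)
      fix A B assume "A \<in> ?G" "B \<in> ?G"
      then obtain a b c d where "A = {a..b}" "B = {c..d}" by auto
      then have "A \<inter> B = (\<lambda>(a, b). {a..b}) (max a c, min b d)" by auto
      then show "A \<inter> B \<in> ?G" by (simp only: rangeI)
    qed
    show ?thesis
      using stable subset_Pow_Union[of ?G, THEN order_trans, OF Pow_mono[OF subset_UNIV]] S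
    proof (induct rule: sigma_sets_induct_disjoint)
      case (basic S)
      then obtain a b where S: "S = {a..b}" by auto
      show ?case
      proof (cases "a \<le> b")
        case True then show ?thesis using zero[OF True] S by (simp add: set_lebesgue_integral_def)
      next
        case False then show ?thesis using S by (simp add: set_lebesgue_integral_def)
      qed
    next
      case empty
      show ?case by (simp add: set_lebesgue_integral_def)
    next
      case (compl S)
      then have S: "S \<in> sets borel" unfolding borel_eq_atLeastAtMost by simp
      have "(\<integral>x\<in>UNIV - S. f x \<partial>lborel) = (\<integral>x. f x - indicator S x *\<^sub>R f x \<partial>lborel)"
        unfolding set_lebesgue_integral_def by (rule Bochner_Integration.integral_cong) (auto simp: indicator_def)
      also have "\<dots> = (\<integral>x. f x \<partial>lborel) - (\<integral>x\<in>S. f x \<partial>lborel)"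
        unfolding set_lebesgue_integral_def
        by (rule Bochner_Integration.integral_diff[OF I si[OF S, unfolded set_integrable_def]])
      finally show ?case using compl total by simp
    next
      case (union F)
      then have F: "F i \<in> sets borel" for i unfolding borel_eq_atLeastAtMost by auto
      have "(\<integral>x\<in>(\<Union>i. F i). f x \<partial>lborel) = (\<Sum>i. \<integral>x\<in>F i. f x \<partial>lborel)"
        by (rule lebesgue_integral_countable_add) (use F union(1) si in \<open>auto simp: disjoint_family_on_def\<close>)
      then show ?case using union by simp
    qed
  qed
  then have "AE x in lborel. f x = (\<lambda>_. 0) x"
    by (intro density_unique_real[OF I]) (auto simp: set_lebesgue_integral_def)
  then show ?thesis by simp
qed

text \<open>Local integrability suffices after restriction to [-n, n]; this matters because the
  convolution it is applied to is not known to be integrable. Real and imaginary parts are treated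
  separately.\<close>

lemma AE_zero_if_interval_integrals_zero:
  fixes f :: "real \<Rightarrow> complex"
  assumes I: "\<And>a b. integrable lborel (\<lambda>x. indicator {a..b} x * f x)"
    and zero: "\<And>a b. a \<le> b \<Longrightarrow> (\<integral>x. indicator {a..b} x * f x \<partial>lborel) = 0"
  shows "AE x in lborel. f x = 0"
proof -
  have "AE x in lborel. indicator {- real n..real n} x * f x = 0" for n
  proof -
    let ?f = "\<lambda>x. indicator {- real n..real n} x * f x"
    have prod: "(\<integral>x. indicator {a..b} x * ?f x \<partial>lborel) = 0" for a b
    proof -
      have "(\<integral>x. indicator {a..b} x * ?f x \<partial>lborel) = (\<integral>x. indicator {max a (- real n)..min b (real n)} x * f x \<partial>lborel)"
        by (rule Bochner_Integration.integral_cong) (auto simp: indicator_def)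
      also have "\<dots> = 0"
        using zero[of "max a (- real n)" "min b (real n)"]
        by (cases "max a (- real n) \<le> min b (real n)") (simp_all del: max.bounded_iff min.bounded_iff)
      finally show ?thesis .
    qed
    have iab: "integrable lborel (\<lambda>x. indicator {a..b} x * ?f x)" for a b
      by (rule Bochner_Integration.integrable_bound[OF I[of "- real n" "real n"]])
         (use borel_measurable_integrable[OF I[of "- real n" "real n"]] in \<open>auto simp: indicator_def\<close>)
    have ReIm: "(\<integral>x. indicator {a..b} x * Re (?f x) \<partial>lborel) = 0" "(\<integral>x. indicator {a..b} x * Im (?f x) \<partial>lborel) = 0" for a b
    proof -
      have "(\<integral>x. indicator {a..b} x * Re (?f x) \<partial>lborel) = (\<integral>x. Re (indicator {a..b} x * ?f x) \<partial>lborel)"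
        by (rule Bochner_Integration.integral_cong) (auto simp: indicator_def)
      also have "\<dots> = Re (\<integral>x. indicator {a..b} x * ?f x \<partial>lborel)" by (rule integral_Re[OF iab])
      finally show "(\<integral>x. indicator {a..b} x * Re (?f x) \<partial>lborel) = 0" unfolding prod by simp
      have "(\<integral>x. indicator {a..b} x * Im (?f x) \<partial>lborel) = (\<integral>x. Im (indicator {a..b} x * ?f x) \<partial>lborel)"
        by (rule Bochner_Integration.integral_cong) (auto simp: indicator_def)
      also have "\<dots> = Im (\<integral>x. indicator {a..b} x * ?f x \<partial>lborel)" by (rule integral_Im[OF iab])
      finally show "(\<integral>x. indicator {a..b} x * Im (?f x) \<partial>lborel) = 0" unfolding prod by simp
    qed
    have "AE x in lborel. Re (?f x) = 0"
      by (rule AE_zero_if_interval_integrals_zero_real[OF integrable_Re[OF I] ReIm(1)])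
    moreover have "AE x in lborel. Im (?f x) = 0"
      by (rule AE_zero_if_interval_integrals_zero_real[OF integrable_Im[OF I] ReIm(2)])
    ultimately show ?thesis by eventually_elim (simp add: complex_eq_iff)
  qed
  then have "AE x in lborel. \<forall>n. indicator {- real n..real n} x * f x = 0"
    unfolding AE_all_countable ..
  then show ?thesis
  proof eventually_elim
    case (elim x)
    obtain n where "\<bar>x\<bar> \<le> real n" using real_arch_simple by blast
    then show ?case using elim[rule_format, of n] by (simp add: abs_le_iff)
  qed
qed

section \<open>Convolution\<close>

definition conv :: "(real \<Rightarrow> complex) \<Rightarrow> (real \<Rightarrow> complex) \<Rightarrow> real \<Rightarrow> complex" where
  "conv a b t = (\<integral>s. a (t - s) * b s \<partial>lborel)"

lemma conv_measurable [measurable]: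
  assumes [measurable]: "a \<in> borel_measurable borel" "b \<in> borel_measurable borel"
  shows "conv a b \<in> borel_measurable borel"
  unfolding conv_def by measurable

lemma
  assumes a: "integrable lborel a" and b: "integrable lborel b"
  shows conv_integrable: "integrable lborel (conv a b)"
    and conv_integral: "(\<integral>t. conv a b t \<partial>lborel) = (\<integral>t. a t \<partial>lborel) * (\<integral>t. b t \<partial>lborel)"
proof -
  have [measurable]: "a \<in> borel_measurable borel" "b \<in> borel_measurable borel"
    using borel_measurable_integrable[OF a] borel_measurable_integrable[OF b] by auto
  have shift: "(\<integral>t. F (t - s) \<partial>lborel) = (\<integral>t. F t \<partial>lborel)" for F :: "real \<Rightarrow> 'b::{banach, second_countable_topology}" and s
    using lborel_integral_real_affine[of 1 "\<lambda>t. F (t - s)" s] by simp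
  have ishift: "integrable lborel (\<lambda>t. a (t - s))" for s
    using lborel_integrable_real_affine[OF a, of 1 "- s"] by (simp add: add.commute)
  have F: "integrable (lborel \<Otimes>\<^sub>M lborel) (\<lambda>(s, t). a (t - s) * b s)"
  proof (rule lborel_pair.Fubini_integrable)
    have "(\<integral>t. norm (case (s, t) of (s, t) \<Rightarrow> a (t - s) * b s) \<partial>lborel) = (\<integral>t. cmod (a t) \<partial>lborel) * cmod (b s)" for s
      using shift[of "\<lambda>t. cmod (a t)" s] by (simp add: norm_mult)
    then show "integrable lborel (\<lambda>s. \<integral>t. norm (case (s, t) of (s, t) \<Rightarrow> a (t - s) * b s) \<partial>lborel)"
      using b by simp
    show "AE s in lborel. integrable lborel (\<lambda>t. case (s, t) of (s, t) \<Rightarrow> a (t - s) * b s)"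
      using ishift by simp
  qed measurable
  show "integrable lborel (conv a b)"
    unfolding conv_def using lborel_pair.integrable_snd[OF F] by simp
  have "(\<integral>t. conv a b t \<partial>lborel) = (\<integral>s. \<integral>t. a (t - s) * b s \<partial>lborel \<partial>lborel)"
    unfolding conv_def by (rule lborel_pair.Fubini_integral[OF F])
  also have "\<dots> = (\<integral>s. (\<integral>t. a t \<partial>lborel) * b s \<partial>lborel)"
    using shift[of a] by simp
  finally show "(\<integral>t. conv a b t \<partial>lborel) = (\<integral>t. a t \<partial>lborel) * (\<integral>t. b t \<partial>lborel)" by simp
qed

text \<open>An exponential is a character of the additive group and passes through the convolution.
  Facts about integrable functions thus extend to functions integrable after exponential
  damping.\<close>

lemma conv_exp:
  "conv (\<lambda>t. a t * exp (c * of_real t)) (\<lambda>t. b t * exp (c * of_real t)) = (\<lambda>t. conv a b t * exp (c * of_real t))"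
proof
  fix t
  have "a (t - s) * exp (c * of_real (t - s)) * (b s * exp (c * of_real s)) = a (t - s) * b s * exp (c * of_real t)" for s
  proof -
    have "exp (c * of_real (t - s)) * exp (c * of_real s) = exp (c * of_real t)"
      by (simp flip: exp_add add: algebra_simps)
    moreover have "x * p * (y * q) = x * y * (p * q)" for x y p q :: complex by simp
    ultimately show ?thesis by (simp only:)
  qed
  then show "conv (\<lambda>t. a t * exp (c * of_real t)) (\<lambda>t. b t * exp (c * of_real t)) t = conv a b t * exp (c * of_real t)"
    unfolding conv_def integral_mult_left_zero[symmetric] by (simp only:)
qed

lemma
  assumes a: "integrable lborel (\<lambda>t. a t * exp (\<i> * z * of_real t))"
    and b: "integrable lborel (\<lambda>t. b t * exp (\<i> * z * of_real t))"
  shows conv_LT_integrable: "integrable lborel (\<lambda>t. conv a b t * exp (\<i> * z * of_real t))"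
    and conv_LT: "LT (conv a b) z = LT a z * LT b z"
  using conv_integrable[OF a b] conv_integral[OF a b] unfolding conv_exp LT_def by auto

text \<open>Young's inequality \<open>L\<^sup>1 * L\<^sup>2 \<subseteq> L\<^sup>2\<close>, by Cauchy--Schwarz with respect to the measure \<open>|a (t - s)| ds\<close>.\<close>
lemma conv_L2:
  assumes a: "integrable lborel a" and b: "L2 b"
  shows "L2 (conv a b)"
proof -
  have [measurable]: "a \<in> borel_measurable borel" "b \<in> borel_measurable borel"
    using borel_measurable_integrable[OF a] b by (auto simp: L2_def)
  let ?N = "\<integral>t. cmod (a t) \<partial>lborel"
  have N: "(\<integral>\<^sup>+s. ennreal (cmod (a (t - s))) \<partial>lborel) = ennreal ?N" for t
  proof -
    have "(\<integral>\<^sup>+s. ennreal (cmod (a (t - s))) \<partial>lborel) = (\<integral>\<^sup>+s. ennreal (cmod (a s)) \<partial>lborel)"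
      using nn_integral_real_affine[of "\<lambda>s. ennreal (cmod (a s))" "-1" t] by simp
    also have "\<dots> = ennreal ?N" by (rule nn_integral_eq_integral) (use a in auto)
    finally show ?thesis .
  qed
  have N': "(\<integral>\<^sup>+t. ennreal (cmod (a (t - s))) \<partial>lborel) = ennreal ?N" for s
  proof -
    have "(\<integral>\<^sup>+t. ennreal (cmod (a (t - s))) \<partial>lborel) = (\<integral>\<^sup>+t. ennreal (cmod (a t)) \<partial>lborel)"
      using nn_integral_real_affine[of "\<lambda>t. ennreal (cmod (a t))" 1 "- s"] by (simp add: add.commute)
    also have "\<dots> = ennreal ?N" by (rule nn_integral_eq_integral) (use a in auto)
    finally show ?thesis .
  qed
  have pt: "ennreal ((cmod (conv a b t))\<^sup>2) \<le> ennreal ?N * (\<integral>\<^sup>+s. ennreal (cmod (a (t - s))) * ennreal ((cmod (b s))\<^sup>2) \<partial>lborel)" for t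
  proof -
    have "ennreal (cmod (conv a b t)) \<le> (\<integral>\<^sup>+s. ennreal (cmod (a (t - s) * b s)) \<partial>lborel)"
    \<comment> \<open>Where the convolution integral diverges, its value is 0 by convention, so the
      bound still holds.\<close>
    proof (cases "integrable lborel (\<lambda>s. a (t - s) * b s)")
      case True
      then show ?thesis unfolding conv_def by (rule integral_norm_bound_ennreal)
    qed (simp add: conv_def not_integrable_integral_eq)
    also have "\<dots> = (\<integral>\<^sup>+s. ennreal (sqrt (cmod (a (t - s)))) * ennreal (sqrt (cmod (a (t - s))) * cmod (b s)) \<partial>lborel)"
      by (rule nn_integral_cong) (simp add: norm_mult mult.assoc[symmetric] flip: ennreal_mult)
    finally have "(ennreal (cmod (conv a b t)))\<^sup>2 \<le> (\<integral>\<^sup>+s. ennreal (sqrt (cmod (a (t - s)))) * ennreal (sqrt (cmod (a (t - s))) * cmod (b s)) \<partial>lborel)\<^sup>2"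
      by (rule power_mono) simp
    also have "\<dots> \<le> (\<integral>\<^sup>+s. (ennreal (sqrt (cmod (a (t - s)))))\<^sup>2 \<partial>lborel) * (\<integral>\<^sup>+s. (ennreal (sqrt (cmod (a (t - s))) * cmod (b s)))\<^sup>2 \<partial>lborel)"
      by (rule Cauchy_Schwarz_nn_integral) measurable
    also have "\<dots> = ennreal ?N * (\<integral>\<^sup>+s. ennreal (cmod (a (t - s))) * ennreal ((cmod (b s))\<^sup>2) \<partial>lborel)"
      by (simp add: ennreal_power power_mult_distrib N ennreal_mult)
    finally show ?thesis by (simp add: ennreal_power)
  qed
  have "(\<integral>\<^sup>+t. ennreal ((cmod (conv a b t))\<^sup>2) \<partial>lborel)
     \<le> (\<integral>\<^sup>+t. ennreal ?N * (\<integral>\<^sup>+s. ennreal (cmod (a (t - s))) * ennreal ((cmod (b s))\<^sup>2) \<partial>lborel) \<partial>lborel)"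
    by (intro nn_integral_mono pt)
  also have "\<dots> = ennreal ?N * (\<integral>\<^sup>+t. \<integral>\<^sup>+s. ennreal (cmod (a (t - s))) * ennreal ((cmod (b s))\<^sup>2) \<partial>lborel \<partial>lborel)"
    by (rule nn_integral_cmult) measurable
  also have "(\<integral>\<^sup>+t. \<integral>\<^sup>+s. ennreal (cmod (a (t - s))) * ennreal ((cmod (b s))\<^sup>2) \<partial>lborel \<partial>lborel)
     = (\<integral>\<^sup>+s. \<integral>\<^sup>+t. ennreal (cmod (a (t - s))) * ennreal ((cmod (b s))\<^sup>2) \<partial>lborel \<partial>lborel)"
    by (rule lborel_pair.Fubini'[symmetric]) measurable
  also have "\<dots> = (\<integral>\<^sup>+s. ennreal ?N * ennreal ((cmod (b s))\<^sup>2) \<partial>lborel)"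
    by (simp add: nn_integral_multc N')
  also have "\<dots> = ennreal ?N * ennreal (nsq b)"
    by (simp add: nn_integral_cmult nn_nsq[OF b])
  also have "ennreal ?N * \<dots> < \<infinity>" by (simp add: ennreal_mult_less_top)
  finally show ?thesis by (subst L2_iff_nn) measurable
qed

section \<open>Transforms of interval indicators\<close>

text \<open>On a horizontal line this is the conjugate of a transform (\<open>ivl_LT_FT\<close>), as
  an inner product demands, yet with -i z in the exponent it is holomorphic in z. This makes the
  contour shift possible.\<close>

definition ivl_LT :: "real \<Rightarrow> real \<Rightarrow> complex \<Rightarrow> complex" where
  "ivl_LT a b z = (\<integral>t. indicator {a..b} t *\<^sub>R exp (- \<i> * z * of_real t) \<partial>lborel)"

lemma ivl_LT_eq:
  assumes "a \<le> b" "z \<noteq> 0"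
  shows "ivl_LT a b z = (exp (- \<i> * z * of_real b) - exp (- \<i> * z * of_real a)) / (- \<i> * z)"
proof -
  have "ivl_LT a b z = exp (- \<i> * z * of_real b) / (- \<i> * z) - exp (- \<i> * z * of_real a) / (- \<i> * z)"
    unfolding ivl_LT_def
  proof (rule integral_FTC_Icc[OF assms(1)])
    show "((\<lambda>t. exp (- \<i> * z * of_real t) / (- \<i> * z)) has_vector_derivative exp (- \<i> * z * of_real t)) (at t within {a..b})" for t
      using assms(2) by (intro has_vector_derivative_real_field) (auto intro!: derivative_eq_intros)
  qed (intro continuous_intros)
  then show ?thesis by (simp add: diff_divide_distrib)
qed

lemma ivl_LT_holomorphic:
  assumes "a \<le> b" shows "ivl_LT a b holomorphic_on {z. Im z > 0}"
proof -
  have "(\<lambda>z. (exp (- \<i> * z * of_real b) - exp (- \<i> * z * of_real a)) / (- \<i> * z)) holomorphic_on {z. Im z > 0}"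
    by (intro holomorphic_intros) auto
  then show ?thesis
  proof (rule holomorphic_transform)
    fix z assume "z \<in> {z. Im z > 0}"
    then have "z \<noteq> 0" by auto
    then show "(exp (- \<i> * z * of_real b) - exp (- \<i> * z * of_real a)) / (- \<i> * z) = ivl_LT a b z"
      by (rule ivl_LT_eq[OF assms, symmetric])
  qed
qed

text \<open>The length of the interval controls small |z| and the closed form with its division by z
  controls large |z|. Together they decay like 1 / |Re z|, uniformly in the strip, which makes
  vertical sides of contours negligible.\<close>

lemma ivl_LT_bound:
  assumes ab: "a \<le> b" and z: "0 \<le> Im z" "Im z \<le> V"
  shows "cmod (ivl_LT a b z) \<le> ((b - a + 2) * exp (V * (\<bar>a\<bar> + \<bar>b\<bar>))) * (1 / (1 + \<bar>Re z\<bar>))"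
proof -
  let ?E = "exp (V * (\<bar>a\<bar> + \<bar>b\<bar>))"
  have e: "cmod (exp (- \<i> * z * of_real t)) \<le> ?E" if "t \<in> {a..b}" for t
  proof -
    have "Im z * t \<le> Im z * (\<bar>a\<bar> + \<bar>b\<bar>)" using that z by (intro mult_left_mono) auto
    also have "\<dots> \<le> V * (\<bar>a\<bar> + \<bar>b\<bar>)" using z by (intro mult_right_mono) auto
    finally show ?thesis by simp
  qed
  have "cmod (ivl_LT a b z) \<le> (\<integral>t. norm (indicator {a..b} t *\<^sub>R exp (- \<i> * z * of_real t)) \<partial>lborel)"
    unfolding ivl_LT_def by (rule integral_norm_bound)
  also have "\<dots> \<le> (\<integral>t. ?E * indicator {a..b} t \<partial>lborel)"
  proof (rule integral_mono)
    show i: "integrable lborel (\<lambda>t. ?E * indicator {a..b} t)"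
      by (intro integrable_mult_right integrable_real_indicator) (auto simp: ab)
    show le: "norm (indicator {a..b} t *\<^sub>R exp (- \<i> * z * of_real t)) \<le> ?E * indicator {a..b} t" for t
      using e[of t] by (auto simp: indicator_def)
    show "integrable lborel (\<lambda>t. norm (indicator {a..b} t *\<^sub>R exp (- \<i> * z * of_real t)))"
      by (rule Bochner_Integration.integrable_bound[OF i]) (use le in \<open>auto intro!: AE_I2 simp: abs_mult\<close>)
  qed
  also have "\<dots> = (b - a) * ?E" using ab by simp
  finally have 1: "cmod (ivl_LT a b z) \<le> (b - a) * ?E" .
  have 2: "\<bar>Re z\<bar> * cmod (ivl_LT a b z) \<le> 2 * ?E"
  proof (cases "z = 0")
    case False
    have "\<bar>Re z\<bar> * cmod (ivl_LT a b z) \<le> cmod z * cmod (ivl_LT a b z)" by (intro mult_right_mono abs_Re_le_cmod) auto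
    also have "\<dots> = cmod (exp (- \<i> * z * of_real b) - exp (- \<i> * z * of_real a))"
      using False by (simp add: ivl_LT_eq[OF ab False] norm_divide norm_mult)
    also have "\<dots> \<le> cmod (exp (- \<i> * z * of_real b)) + cmod (exp (- \<i> * z * of_real a))" by (rule norm_triangle_ineq4)
    also have "\<dots> \<le> ?E + ?E" by (intro add_mono e) (use ab in auto)
    finally show ?thesis by simp
  qed simp
  have "(1 + \<bar>Re z\<bar>) * cmod (ivl_LT a b z) \<le> (b - a) * ?E + 2 * ?E" using 1 2 by (simp add: distrib_right)
  moreover have "1 + \<bar>Re z\<bar> > 0" by simp
  ultimately show ?thesis by (simp add: pos_le_divide_eq distrib_right mult.commute)
qed

lemma ivl_LT_FT: "ivl_LT a b (of_real u + \<i> * of_real v) = cnj (FT 1 (\<lambda>t. indicator {a..b} t * of_real (exp (v * t))) u)"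
  unfolding ivl_LT_def FT_def
  by (subst Bochner_Integration.integral_cnj[symmetric])
     (auto intro!: Bochner_Integration.integral_cong
       simp: indicator_def cis_cnj cis_conv_exp exp_of_real[symmetric] exp_cnj algebra_simps simp flip: exp_add)

lemma L2_indicator_exp: "L2 (\<lambda>t. indicator {a..b::real} t * of_real (exp (v * t)))"
proof (rule L2_bound[OF L2_indicator_Icc, where C="exp (\<bar>v\<bar> * (\<bar>a\<bar> + \<bar>b\<bar>))"])
  have "v * t \<le> \<bar>v\<bar> * (\<bar>a\<bar> + \<bar>b\<bar>)" if "t \<in> {a..b}" for t
  proof -
    have "v * t \<le> \<bar>v\<bar> * \<bar>t\<bar>" using abs_ge_self[of "v * t"] by (simp add: abs_mult)
    also have "\<dots> \<le> \<bar>v\<bar> * (\<bar>a\<bar> + \<bar>b\<bar>)" using that by (intro mult_left_mono) auto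
    finally show ?thesis .
  qed
  then show "AE t in lborel. cmod (indicator {a..b} t * of_real (exp (v * t))) \<le> exp (\<bar>v\<bar> * (\<bar>a\<bar> + \<bar>b\<bar>)) * cmod (indicator {a..b} t)"
    by (intro AE_I2) (auto simp: indicator_def)
qed measurable

lemma integrable_indicator_exp: "integrable lborel (\<lambda>t. indicator {a..b::real} t * complex_of_real (exp (v * t)))"
proof -
  have "(\<lambda>t. indicator {a..b} t * (indicator {a..b} t * complex_of_real (exp (v * t)))) = (\<lambda>t. indicator {a..b} t * complex_of_real (exp (v * t)))"
    by (auto simp: indicator_def)
  then show ?thesis using L2_prod_integrable[OF L2_indicator_Icc L2_indicator_exp[of a b v], of a b] by simp
qed

lemma LT_FT:
  "LT k (of_real u + \<i> * of_real v) = FT 1 (\<lambda>t. k t * of_real (exp (- (v * t)))) u"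
  unfolding LT_def FT_def
  by (rule Bochner_Integration.integral_cong)
     (auto simp: cis_conv_exp exp_of_real[symmetric] algebra_simps simp flip: exp_add)

section \<open>From an inner function to the convolution formula\<close>

context unimodular_quotient
begin

text \<open>The integral of \<open>T\<close> times \<open>LT f\<close> times the transform of an interval over the line
  \<open>Im z = v\<close> does not depend on \<open>v\<close>. High up, Plancherel identifies it with the integral of
  \<open>conv e f\<close> over the interval, and for \<open>v \<rightarrow> 0\<close> with that of \<open>k\<close>.\<close>
lemma inner_imp_conv:
  assumes inner: "meromorphic_inner \<Theta>"
    and e_meas [measurable]: "e \<in> borel_measurable borel" and e_supp: "\<And>t. t \<le> 0 \<Longrightarrow> e t = 0"
    and v0: "v0 \<ge> 0" and e_int: "\<And>v. v > v0 \<Longrightarrow> integrable lborel (\<lambda>t. cmod (e t) * exp (- (v * t)))"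
    and rep: "\<And>z. Im z > v0 \<Longrightarrow> A z = B z * LT e z"
    and L: "L2 f" and supp: "\<And>t. t \<le> 0 \<Longrightarrow> f t = 0"
    and F: "is_FT 1 f g" and K: "is_FT 1 k (\<lambda>u. T (of_real u) * g u)"
  shows "AE t in lborel. k t = conv e f t"
proof -
  let ?H = "{z. Im z > 0}"
  let ?l = "\<lambda>u v. complex_of_real u + \<i> * complex_of_real v"
  have oH: "open ?H" by (rule open_halfspace_Im_gt)
  have [measurable]: "f \<in> borel_measurable borel" using L by (simp add: L2_def)
  have Tan: "T analytic_on ?H" and "bounded (T ` ?H)"
    using inner unfolding meromorphic_inner_def T_def by auto
  then obtain M where M: "\<And>z. Im z > 0 \<Longrightarrow> cmod (T z) \<le> M" unfolding bounded_iff by auto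
  have M0: "M \<ge> 0" by (rule order_trans[OF norm_ge_zero M[of \<i>]]) simp
  have Th: "T holomorphic_on ?H" by (rule analytic_imp_holomorphic[OF Tan])
  have Tl_meas: "(\<lambda>u. T (?l u v)) \<in> borel_measurable borel" if "v > 0" for v
    by (rule borel_measurable_continuous_onI, rule continuous_on_compose2[OF holomorphic_on_imp_continuous_on[OF Th]])
       (use that in \<open>auto intro!: continuous_intros\<close>)
  define fv where "fv v t = f t * of_real (exp (- (v * t)))" for v t
  have fvL: "L2 (fv v)" if "v \<ge> 0" for v
    unfolding fv_def
  proof (rule L2_bound[OF L, where C=1])
    have "cmod (f t * of_real (exp (- (v * t)))) \<le> 1 * cmod (f t)" for t
      using supp[of t] that by (cases "t > 0") (auto simp: norm_mult mult_left_le)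
    then show "AE t in lborel. cmod (f t * of_real (exp (- (v * t)))) \<le> 1 * cmod (f t)" by simp
  qed measurable
  have fvI: "integrable lborel (fv v)" if "v > 0" for v
    using LT_abs_integrable[OF L supp, of "\<i> * of_real v"] that unfolding fv_def
    by (subst integrable_norm_iff[symmetric]) (auto simp: norm_mult)
  have FV: "is_FT 1 (fv v) (FT 1 (fv v))" if "v > 0" for v
    by (rule is_FT_integrable) (use fvL fvI that in auto)
  have LTl: "LT f (?l u v) = FT 1 (fv v) u" for u v unfolding LT_FT fv_def ..
  have "(\<integral>t. indicator {a..b} t * k t \<partial>lborel) = (\<integral>t. indicator {a..b} t * conv e f t \<partial>lborel)" if ab: "a \<le> b" for a b
  proof -
    \<comment> \<open>Above v0, so that \<open>rep\<close> and \<open>e_int\<close> apply on the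
      line Im z = v1; above 1, so that all heights 1 / (n + 1) used later lie below it.\<close>
    define v1 where "v1 = v0 + 2"
    have v1: "v1 > v0" "v1 > 1" using v0 by (auto simp: v1_def)
    define C where "C = (b - a + 2) * exp (v1 * (\<bar>a\<bar> + \<bar>b\<bar>))"
    have C0: "C \<ge> 0" using ab by (simp add: C_def)
    let ?p = "\<lambda>u. complex_of_real (1 / (1 + \<bar>u\<bar>))"
    have PB: "cmod (ivl_LT a b (?l u v)) \<le> C * cmod (?p u)" if "0 \<le> v" "v \<le> v1" for u v
    proof -
      have "cmod (?p u) = 1 / (1 + \<bar>u\<bar>)" by (simp only: norm_of_real) simp
      then show ?thesis using ivl_LT_bound[OF ab, of "?l u v" v1] that by (simp only: C_def) simp
    qed
    have ivl_LT_meas: "(\<lambda>u. ivl_LT a b (?l u v)) \<in> borel_measurable borel" for v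
      unfolding ivl_LT_FT by measurable
    \<comment> \<open>Conjugated so that the line integral of G is the inner product of the
      transform of the damped f with X (\<open>G_ip\<close>).\<close>
    define X where "X v u = cnj (T (?l u v) * ivl_LT a b (?l u v))" for v u
    have XB: "cmod (X v u) \<le> (M * C) * cmod (?p u)" if "0 < v" "v \<le> v1" for u v
      unfolding X_def complex_mod_cnj norm_mult
      using mult_mono[OF M[of "?l u v"] PB[of v u]] that M0 by (simp add: mult.assoc)
    have Xm: "X v \<in> borel_measurable borel" if "v > 0" for v
      unfolding X_def using Tl_meas[OF that] ivl_LT_meas[of v] by measurable
    have XL: "L2 (X v)" if "0 < v" "v \<le> v1" for v
      by (rule L2_bound[OF L2_inverse_linear]) (use XB[OF that] Xm that in auto)
    define G where "G z = T z * LT f z * ivl_LT a b z" for z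
    have Gh: "G holomorphic_on ?H" unfolding G_def
      by (intro holomorphic_intros Th LT_holomorphic[OF L supp] ivl_LT_holomorphic[OF ab])
    have G_ip: "(\<integral>u. G (?l u v) \<partial>lborel) = ip (FT 1 (fv v)) (X v)" for v
      unfolding ip_def X_def G_def LTl by (simp add: mult_ac)
    have GI: "integrable lborel (\<lambda>u. G (?l u v))" if "0 < v" "v \<le> v1" for v
      using L2_prod_cnj_integrable[OF is_FT_L2(2)[OF FV[OF that(1)]] XL[OF that]]
      unfolding X_def G_def LTl by (simp add: mult_ac)
    \<comment> \<open>A primitive replaces contour integrals: integrals over horizontal segments
      become increments of \<Gamma>, and the vertical sides of the rectangle are increments to be
      estimated.\<close>
    obtain \<Gamma> where \<Gamma>: "\<And>z. z \<in> ?H \<Longrightarrow> (\<Gamma> has_field_derivative G z) (at z)"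
      using holomorphic_convex_primitive'[OF convex_halfspace_Im_gt oH Gh] at_within_open[OF _ oH] by metis
    have GB: "cmod (G (?l x v)) \<le> (M * (sqrt (nsq f) / sqrt (2 * w)) * C) * (1 / (1 + \<bar>x\<bar>))"
      if "0 < w" "w \<le> v" "v \<le> v1" for x v w
    proof -
      have "cmod (LT f (?l x v)) \<le> sqrt (nsq f) / sqrt (2 * v)"
        using LT_bound[OF L supp, of "?l x v"] that by simp
      also have "\<dots> \<le> sqrt (nsq f) / sqrt (2 * w)"
        using that by (intro divide_left_mono) (auto simp: nsq_nonneg)
      finally have 1: "cmod (LT f (?l x v)) \<le> sqrt (nsq f) / sqrt (2 * w)" .
      have "cmod (ivl_LT a b (?l x v)) \<le> C * (1 / (1 + \<bar>x\<bar>))"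
        using ivl_LT_bound[OF ab, of "?l x v" v1] that by (simp add: C_def)
      with 1 have "cmod (G (?l x v)) \<le> M * (sqrt (nsq f) / sqrt (2 * w)) * (C * (1 / (1 + \<bar>x\<bar>)))"
        unfolding G_def norm_mult using M[of "?l x v"] M0 that
        by (intro mult_mono) (auto simp: nsq_nonneg C0)
      then show ?thesis by (simp only: mult.assoc)
    qed
    have seg: "(\<integral>u. indicator {- real n..real n} u *\<^sub>R G (?l u v) \<partial>lborel) = \<Gamma> (?l (real n) v) - \<Gamma> (?l (- real n) v)" if "v > 0" for n v
    proof (rule integral_FTC_Icc)
      show "((\<lambda>u. \<Gamma> (?l u v)) has_vector_derivative G (?l u v)) (at u within {- real n..real n})" for u
      proof -
        have "((\<lambda>z. \<Gamma> (z + \<i> * of_real v)) has_field_derivative G (of_real u + \<i> * of_real v)) (at (of_real u))"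
          using \<Gamma>[of "?l u v"] that DERIV_shift[of \<Gamma> "G (?l u v)" "of_real u" "\<i> * of_real v"] by simp
        then show ?thesis by (rule has_vector_derivative_real_field)
      qed
      show "continuous_on {- real n..real n} (\<lambda>u. G (?l u v))"
        by (rule continuous_on_compose2[OF holomorphic_on_imp_continuous_on[OF Gh]])
           (use that in \<open>auto intro!: continuous_intros\<close>)
    qed simp
    have lim_seg: "(\<lambda>n. \<integral>u. indicator {- real n..real n} u *\<^sub>R G (?l u v) \<partial>lborel) \<longlonglongrightarrow> (\<integral>u. G (?l u v) \<partial>lborel)"
      if "0 < v" "v \<le> v1" for v
    proof (rule integral_dominated_convergence[OF _ _ integrable_norm[OF GI[OF that]]])
      have [measurable]: "(\<lambda>u. G (?l u v)) \<in> borel_measurable borel"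
        using borel_measurable_integrable[OF GI[OF that]] by simp
      show "(\<lambda>u. G (?l u v)) \<in> borel_measurable lborel" by simp
      show "(\<lambda>u. indicator {- real n..real n} u *\<^sub>R G (?l u v)) \<in> borel_measurable lborel" for n by measurable
      show "AE u in lborel. (\<lambda>n. indicator {- real n..real n} u *\<^sub>R G (?l u v)) \<longlonglongrightarrow> G (?l u v)"
      proof (intro AE_I2 tendsto_eventually)
        fix u :: real
        show "\<forall>\<^sub>F n in sequentially. indicator {- real n..real n} u *\<^sub>R G (?l u v) = G (?l u v)"
          using eventually_ge_at_top[of "nat \<lceil>\<bar>u\<bar>\<rceil>"]
        proof eventually_elim
          case (elim n)
          then have "\<bar>u\<bar> \<le> real n" by linarith
          then show ?case by (simp add: abs_le_iff)
        qed
      qed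
      show "AE u in lborel. norm (indicator {- real n..real n} u *\<^sub>R G (?l u v)) \<le> norm (G (?l u v))" for n
        by (intro AE_I2) (auto simp: indicator_def)
    qed
    \<comment> \<open>The bound for \<open>LT\<close> decreases with the height, so its value at the
      lower end v serves the whole vertical segment.\<close>
    have vert: "cmod (\<Gamma> (?l x v1) - \<Gamma> (?l x v)) \<le> (M * (sqrt (nsq f) / sqrt (2 * v)) * C) * (1 / (1 + \<bar>x\<bar>)) * v1" if "0 < v" "v \<le> v1" for x v
    proof -
      let ?S = "closed_segment (?l x v) (?l x v1)"
      have S: "\<exists>y. s = ?l x y \<and> v \<le> y \<and> y \<le> v1" if s: "s \<in> ?S" for s
      proof -
        obtain u where u: "0 \<le> u" "u \<le> 1" "s = (1 - u) *\<^sub>R ?l x v + u *\<^sub>R ?l x v1"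
          using s by (auto simp: in_segment)
        have "s = ?l x ((1 - u) * v + u * v1)" unfolding u(3)
          by (simp add: complex_eq_iff algebra_simps)
        moreover have "v \<le> (1 - u) * v + u * v1" "(1 - u) * v + u * v1 \<le> v1"
        proof -
          have "u * (v1 - v) \<ge> 0" using u \<open>v \<le> v1\<close> by simp
          then show "v \<le> (1 - u) * v + u * v1" by (simp add: algebra_simps)
          have "(1 - u) * (v1 - v) \<ge> 0" using u \<open>v \<le> v1\<close> by simp
          then show "(1 - u) * v + u * v1 \<le> v1" by (simp add: algebra_simps)
        qed
        ultimately show ?thesis by blast
      qed
      have "cmod (\<Gamma> (?l x v1) - \<Gamma> (?l x v)) \<le> (M * (sqrt (nsq f) / sqrt (2 * v)) * C) * (1 / (1 + \<bar>x\<bar>)) * cmod (?l x v1 - ?l x v)"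
      proof (rule field_differentiable_bound[where S="?S" and f'=G])
        show "convex ?S" by (rule convex_closed_segment)
        fix s assume "s \<in> ?S"
        then obtain y where y: "s = ?l x y" "v \<le> y" "y \<le> v1" using S by blast
        show "(\<Gamma> has_field_derivative G s) (at s within ?S)"
          using \<Gamma>[of s] y that by (simp add: has_field_derivative_at_within)
        show "cmod (G s) \<le> (M * (sqrt (nsq f) / sqrt (2 * v)) * C) * (1 / (1 + \<bar>x\<bar>))"
          unfolding y(1) by (rule GB) (use y that in auto)
      qed auto
      moreover have "cmod (?l x v1 - ?l x v) \<le> v1"
      proof -
        have "?l x v1 - ?l x v = \<i> * of_real (v1 - v)" by (simp add: algebra_simps)
        then have "cmod (?l x v1 - ?l x v) = \<bar>v1 - v\<bar>" by (simp only: norm_mult norm_ii norm_of_real mult_1)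
        then show ?thesis using that by simp
      qed
      ultimately show ?thesis
        using M0 C0 that by (elim order_trans) (intro mult_left_mono mult_nonneg_nonneg divide_nonneg_nonneg, auto simp: nsq_nonneg)
    qed
    have indep: "(\<integral>u. G (?l u v) \<partial>lborel) = (\<integral>u. G (?l u v1) \<partial>lborel)" if v: "0 < v" "v \<le> v1" for v
    proof -
      let ?c = "M * (sqrt (nsq f) / sqrt (2 * v)) * C"
      let ?J = "\<lambda>v n. \<integral>u. indicator {- real n..real n} u *\<^sub>R G (?l u v) \<partial>lborel"
      have "(\<lambda>n. ?J v1 n - ?J v n) \<longlonglongrightarrow> (\<integral>u. G (?l u v1) \<partial>lborel) - (\<integral>u. G (?l u v) \<partial>lborel)"
        by (intro tendsto_diff lim_seg) (use v v1 in auto)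
      moreover have "(\<lambda>n. ?J v1 n - ?J v n) \<longlonglongrightarrow> 0"
      proof (rule Lim_null_comparison[OF always_eventually[OF allI]])
        fix n
        have v1p: "v1 > 0" using v1 by simp
        have "?J v1 n - ?J v n = (\<Gamma> (?l (real n) v1) - \<Gamma> (?l (real n) v)) - (\<Gamma> (?l (- real n) v1) - \<Gamma> (?l (- real n) v))"
          unfolding seg[OF v(1)] seg[OF v1p] by simp
        then have "norm (?J v1 n - ?J v n) \<le> norm (\<Gamma> (?l (real n) v1) - \<Gamma> (?l (real n) v)) + norm (\<Gamma> (?l (- real n) v1) - \<Gamma> (?l (- real n) v))"
          by (simp only: norm_triangle_ineq4)
        also have "\<dots> \<le> ?c * (1 / (1 + \<bar>real n\<bar>)) * v1 + ?c * (1 / (1 + \<bar>- real n\<bar>)) * v1"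
          by (intro add_mono vert v)
        finally show "norm (?J v1 n - ?J v n) \<le> (2 * ?c * v1) * inverse (real (Suc n))"
          by (simp add: inverse_eq_divide add.commute mult_ac)
        show "(\<lambda>n. (2 * ?c * v1) * inverse (real (Suc n))) \<longlonglongrightarrow> 0"
          using tendsto_mult[OF tendsto_const LIMSEQ_inverse_real_of_nat, of "2 * ?c * v1"] by simp
      qed
      ultimately have "(\<integral>u. G (?l u v1) \<partial>lborel) - (\<integral>u. G (?l u v) \<partial>lborel) = 0" by (rule LIMSEQ_unique)
      then show ?thesis by simp
    qed
    \<comment> \<open>At this height e and f are damped by e^(-v1 t), and by \<open>conv_exp\<close>
      so is the convolution. The indicator receives the compensating factor e^(v1 t), so the weights
      cancel in the inner product.\<close>
    have top: "(\<integral>u. G (?l u v1) \<partial>lborel) = 2 * pi * (\<integral>t. indicator {a..b} t * conv e f t \<partial>lborel)"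
    proof -
      define c1 where "c1 t = conv e f t * of_real (exp (- (v1 * t)))" for t
      let ?Y = "\<lambda>t. indicator {a..b} t * complex_of_real (exp (v1 * t))"
      have v1p: "v1 > 0" using v1 by simp
      have eI: "integrable lborel (\<lambda>t. e t * of_real (exp (- (v1 * t))))"
        using e_int[OF v1(1)] by (subst integrable_norm_iff[symmetric]) (auto simp: norm_mult)
      have ce: "c1 = conv (\<lambda>t. e t * of_real (exp (- (v1 * t)))) (fv v1)"
        using conv_exp[of e "- of_real v1" f] unfolding c1_def fv_def by (simp add: exp_of_real[symmetric])
      have c1L: "L2 c1" unfolding ce by (rule conv_L2[OF eI fvL]) (use v1p in simp)
      have c1I: "integrable lborel c1" unfolding ce by (rule conv_integrable[OF eI fvI[OF v1p]])
      have TL: "T (?l u v1) = LT e (?l u v1)" for u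
      proof (rule T_eq_on[where U="{z. Im z > v0}"])
        show "LT e holomorphic_on {z. v0 < Im z}" by (rule LT_holomorphic_general[OF e_meas e_supp e_int])
      qed (use rep v1 open_halfspace_Im_gt in auto)
      have "LT e (?l u v1) * LT f (?l u v1) = FT 1 c1 u" for u
      proof -
        have exps: "of_real (exp (- (v1 * t))) * cis (u * t) = exp (\<i> * ?l u v1 * of_real t)" for t
          by (simp add: cis_conv_exp exp_of_real[symmetric] algebra_simps flip: exp_add)
        have i1: "integrable lborel (\<lambda>t. e t * exp (\<i> * ?l u v1 * of_real t))"
          using integrable_mult_cis[OF eI, of "\<lambda>t. u * t"] unfolding mult.assoc exps[unfolded mult.assoc] by simp
        have i2: "integrable lborel (\<lambda>t. f t * exp (\<i> * ?l u v1 * of_real t))"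
          by (rule LT_integrable[OF L supp]) (use v1p in auto)
        have "LT (conv e f) (?l u v1) = LT e (?l u v1) * LT f (?l u v1)" by (rule conv_LT[OF i1 i2])
        then show ?thesis unfolding LT_FT[of "conv e f"] c1_def by simp
      qed
      then have "G (?l u v1) = FT 1 c1 u * cnj (FT 1 ?Y u)" for u unfolding G_def TL ivl_LT_FT by simp
      then have "(\<integral>u. G (?l u v1) \<partial>lborel) = ip (FT 1 c1) (FT 1 ?Y)" by (simp add: ip_def)
      also have "\<dots> = 2 * pi * ip c1 ?Y"
        by (rule is_FT_ip[OF _ is_FT_integrable[OF _ c1L c1I] is_FT_integrable[OF _ L2_indicator_exp integrable_indicator_exp]]) auto
      also have "ip c1 ?Y = (\<integral>t. indicator {a..b} t * conv e f t \<partial>lborel)"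
        unfolding ip_def c1_def
        by (rule Bochner_Integration.integral_cong) (auto simp: indicator_def simp flip: of_real_mult exp_add)
      finally show ?thesis .
    qed
    \<comment> \<open>The heights 1 / (n + 1) tend to 0. Both factors of the inner product converge
      in mean square: the transforms of the damped f by Plancherel, and X by dominated convergence
      with majorant a multiple of 1 / (1 + |u|).\<close>
    have bottom: "(\<integral>u. G (?l u v1) \<partial>lborel) = 2 * pi * (\<integral>t. indicator {a..b} t * k t \<partial>lborel)"
    proof -
      define vn where "vn n = inverse (real (Suc n))" for n
      have vn: "0 < vn n" "vn n \<le> v1" "vn n \<le> 1" for n
        using v1 by (auto simp: vn_def inverse_le_1_iff intro: order_trans[of _ 1])
      have vn0: "vn \<longlonglongrightarrow> 0" unfolding vn_def by (rule LIMSEQ_inverse_real_of_nat)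
      define X0 where "X0 u = cnj (T (of_real u) * ivl_LT a b (of_real u))" for u
      have [measurable]: "(\<lambda>u. ivl_LT a b (of_real u)) \<in> borel_measurable borel"
        using ivl_LT_meas[of 0] by simp
      have X0m: "X0 \<in> borel_measurable borel"
        unfolding X0_def by measurable
      have X0B: "cmod (X0 u) \<le> C * cmod (?p u)" for u
        unfolding X0_def complex_mod_cnj norm_mult T_real(2) using PB[of 0 u] v1 by simp
      have X0L: "L2 X0" by (rule L2_bound[OF L2_inverse_linear]) (use X0B X0m in auto)
      have gL: "L2 g" using F by (auto simp: is_FT_def)
      have PIc: "(\<lambda>n. ivl_LT a b (?l u (vn n))) \<longlonglongrightarrow> ivl_LT a b (of_real u)" if "u \<noteq> 0" for u
      proof -
        have l0: "(\<lambda>n. ?l u (vn n)) \<longlonglongrightarrow> of_real u"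
          using tendsto_add[OF tendsto_const[of "complex_of_real u"] tendsto_mult[OF tendsto_const[of \<i>] tendsto_of_real[OF vn0]]] by simp
        have nz: "?l u (vn n) \<noteq> 0" for n using that by (simp add: complex_eq_iff)
        show ?thesis
          unfolding ivl_LT_eq[OF ab nz] using that ivl_LT_eq[OF ab, of "of_real u"]
          by (simp only: of_real_eq_0_iff not_False_eq_True) (intro tendsto_intros l0, simp)
      qed
      have Tc: "(\<lambda>n. T (?l u (vn n))) \<longlonglongrightarrow> T (of_real u)" for u
      proof (rule isCont_tendsto_compose[OF analytic_at_imp_isCont[OF T_real(1)]])
        show "(\<lambda>n. ?l u (vn n)) \<longlonglongrightarrow> of_real u"
          using tendsto_add[OF tendsto_const[of "complex_of_real u"] tendsto_mult[OF tendsto_const[of \<i>] tendsto_of_real[OF vn0]]] by simp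
      qed
      have Xlim: "(\<lambda>n. nsq (\<lambda>u. X (vn n) u - X0 u)) \<longlonglongrightarrow> (\<integral>u. 0 \<partial>(lborel::real measure))"
        unfolding nsq_def
      proof (rule integral_dominated_convergence)
        show "integrable lborel (\<lambda>u. (M * C + C)\<^sup>2 * (cmod (?p u))\<^sup>2)"
          using L2_integrable[OF L2_inverse_linear] by (rule integrable_mult_right)
        have "AE u in lborel. u \<noteq> (0::real)" by (rule AE_lborel_singleton)
        then show "AE u in lborel. (\<lambda>n. (cmod (X (vn n) u - X0 u))\<^sup>2) \<longlonglongrightarrow> 0"
        proof eventually_elim
          case (elim u)
          have "(\<lambda>n. (cmod (X (vn n) u - X0 u))\<^sup>2) \<longlonglongrightarrow> (cmod (X0 u - X0 u))\<^sup>2"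
            unfolding X_def X0_def by (intro tendsto_intros Tc PIc elim)
          then show ?case by simp
        qed
        show "AE u in lborel. norm ((cmod (X (vn n) u - X0 u))\<^sup>2) \<le> (M * C + C)\<^sup>2 * (cmod (?p u))\<^sup>2" for n
        proof (rule AE_I2)
          fix u
          have "cmod (X (vn n) u - X0 u) \<le> (M * C) * cmod (?p u) + C * cmod (?p u)"
            by (rule order_trans[OF norm_triangle_ineq4 add_mono[OF XB[OF vn(1,2)] X0B]])
          also have "\<dots> = (M * C + C) * cmod (?p u)" by (simp only: distrib_right)
          finally have "(cmod (X (vn n) u - X0 u))\<^sup>2 \<le> ((M * C + C) * cmod (?p u))\<^sup>2" by (rule power_mono) simp
          then show "norm ((cmod (X (vn n) u - X0 u))\<^sup>2) \<le> (M * C + C)\<^sup>2 * (cmod (?p u))\<^sup>2"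
            by (simp only: power_mult_distrib real_norm_def abs_power2 power2_abs)
        qed
        show "(\<lambda>u. (cmod (X (vn n) u - X0 u))\<^sup>2) \<in> borel_measurable lborel" for n
          using Xm[OF vn(1)[of n]] X0m by measurable
      qed simp
      have flim: "(\<lambda>n. nsq (\<lambda>t. f t - fv (vn n) t)) \<longlonglongrightarrow> (\<integral>t. 0 \<partial>(lborel::real measure))"
        unfolding nsq_def
      proof (rule integral_dominated_convergence[OF _ _ L2_integrable[OF L]])
        show "AE t in lborel. (\<lambda>n. (cmod (f t - fv (vn n) t))\<^sup>2) \<longlonglongrightarrow> 0"
        proof (rule AE_I2)
          fix t
          have "(\<lambda>n. (cmod (f t - fv (vn n) t))\<^sup>2) \<longlonglongrightarrow> (cmod (f t - f t * of_real (exp (- (0 * t)))))\<^sup>2"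
            unfolding fv_def by (intro tendsto_intros vn0)
          then show "(\<lambda>n. (cmod (f t - fv (vn n) t))\<^sup>2) \<longlonglongrightarrow> 0" by simp
        qed
        show "AE t in lborel. norm ((cmod (f t - fv (vn n) t))\<^sup>2) \<le> (cmod (f t))\<^sup>2" for n
        proof (rule AE_I2)
          fix t
          have "cmod (f t - fv (vn n) t) \<le> cmod (f t)"
          proof (cases "t > 0")
            case True
            have "f t - fv (vn n) t = f t * of_real (1 - exp (- (vn n * t)))" by (simp add: fv_def algebra_simps)
            moreover have "\<bar>1 - exp (- (vn n * t))\<bar> \<le> 1" using True vn(1)[of n] by (simp add: abs_le_iff add_increasing)
            ultimately show ?thesis by (simp only: norm_mult norm_of_real) (simp add: mult_left_le)
          qed (use supp in \<open>simp add: fv_def\<close>)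
          then show "norm ((cmod (f t - fv (vn n) t))\<^sup>2) \<le> (cmod (f t))\<^sup>2" by (simp add: power_mono)
        qed
      qed (simp_all add: fv_def)
      have glim: "nsq (\<lambda>u. g u - FT 1 (fv (vn n)) u) = 2 * pi * nsq (\<lambda>t. f t - fv (vn n) t)" for n
        by (rule is_FT_nsq[OF _ is_FT_diff[OF _ F FV[OF vn(1)]]]) auto
      have gl: "(\<lambda>n. nsq (\<lambda>u. g u - FT 1 (fv (vn n)) u)) \<longlonglongrightarrow> 0"
        unfolding glim using tendsto_mult[OF tendsto_const[of "2 * pi"] flim] by simp
      have FL: "L2 (FT 1 (fv (vn n)))" for n by (rule is_FT_L2(2)[OF FV[OF vn(1)]])
      have "(\<lambda>n. ip (FT 1 (fv (vn n))) (X (vn n)) - ip g X0) \<longlonglongrightarrow> 0"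
      proof (rule Lim_null_comparison[OF always_eventually[OF allI]])
        fix n
        let ?K = "FT 1 (fv (vn n))"
        have "ip ?K (X (vn n)) - ip g X0 = ip g (\<lambda>u. X (vn n) u - X0 u) - ip (\<lambda>u. g u - ?K u) (X (vn n))"
          using gL FL XL[OF vn(1,2)] X0L by (simp add: ip_diff_left ip_diff_right)
        then have "norm (ip ?K (X (vn n)) - ip g X0) \<le> cmod (ip g (\<lambda>u. X (vn n) u - X0 u)) + cmod (ip (\<lambda>u. g u - ?K u) (X (vn n)))"
          by (simp only: norm_triangle_ineq4)
        also have "\<dots> \<le> sqrt (nsq g) * sqrt (nsq (\<lambda>u. X (vn n) u - X0 u)) + sqrt (nsq (\<lambda>u. g u - ?K u)) * sqrt (nsq (X (vn n)))"
          by (intro add_mono ip_bound L2_diff gL FL XL[OF vn(1,2)] X0L)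
        also have "\<dots> \<le> sqrt (nsq g) * sqrt (nsq (\<lambda>u. X (vn n) u - X0 u)) + sqrt (nsq (\<lambda>u. g u - ?K u)) * sqrt (nsq (\<lambda>u. of_real (M * C) * ?p u))"
        proof (intro add_left_mono mult_left_mono real_sqrt_le_mono nsq_mono L2_cmult L2_inverse_linear)
          have "cmod (X (vn n) u) \<le> cmod (of_real (M * C) * ?p u)" for u
            using XB[OF vn(1,2), of n u] M0 C0 by (simp only: norm_mult norm_of_real abs_of_nonneg mult_nonneg_nonneg)
          then show "AE u in lborel. cmod (X (vn n) u) \<le> cmod (of_real (M * C) * ?p u)" by (intro AE_I2)
        qed (use Xm[OF vn(1)] nsq_nonneg in auto)
        finally show "norm (ip ?K (X (vn n)) - ip g X0) \<le> sqrt (nsq g) * sqrt (nsq (\<lambda>u. X (vn n) u - X0 u))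
            + sqrt (nsq (\<lambda>u. g u - ?K u)) * sqrt (nsq (\<lambda>u. of_real (M * C) * ?p u))" .
        have "(\<lambda>n. sqrt (nsq g) * sqrt (nsq (\<lambda>u. X (vn n) u - X0 u)) + sqrt (nsq (\<lambda>u. g u - FT 1 (fv (vn n)) u)) * sqrt (nsq (\<lambda>u. of_real (M * C) * ?p u)))
           \<longlonglongrightarrow> sqrt (nsq g) * sqrt 0 + sqrt 0 * sqrt (nsq (\<lambda>u. of_real (M * C) * ?p u))"
          using Xlim gl by (intro tendsto_add tendsto_mult tendsto_const tendsto_real_sqrt) simp_all
        then show "(\<lambda>n. sqrt (nsq g) * sqrt (nsq (\<lambda>u. X (vn n) u - X0 u)) + sqrt (nsq (\<lambda>u. g u - FT 1 (fv (vn n)) u)) * sqrt (nsq (\<lambda>u. of_real (M * C) * ?p u))) \<longlonglongrightarrow> 0"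
          by simp
      qed
      moreover have "ip (FT 1 (fv (vn n))) (X (vn n)) = (\<integral>u. G (?l u v1) \<partial>lborel)" for n
        using G_ip[of "vn n"] indep[OF vn(1,2)[of n]] by simp
      ultimately have "(\<integral>u. G (?l u v1) \<partial>lborel) = ip g X0"
        by (simp add: LIMSEQ_const_iff)
      also have "\<dots> = ip (\<lambda>u. T (of_real u) * g u) (FT 1 (indicator {a..b}))"
      proof -
        have "ivl_LT a b (of_real u) = cnj (FT 1 (indicator {a..b}) u)" for u
          using ivl_LT_FT[of a b u 0] by simp
        then show ?thesis unfolding ip_def X0_def by (simp add: mult_ac)
      qed
      also have "\<dots> = 2 * pi * ip k (indicator {a..b})"
        by (rule is_FT_ip[OF _ K is_FT_integrable[OF _ L2_indicator_Icc integrable_complex_indicator_Icc]]) auto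
      also have "ip k (indicator {a..b}) = (\<integral>t. indicator {a..b} t * k t \<partial>lborel)"
        unfolding ip_def by (rule Bochner_Integration.integral_cong) (auto simp: indicator_def)
      finally show ?thesis .
    qed
    show ?thesis using top bottom by simp
  qed
  note eq = this
  have kI: "integrable lborel (\<lambda>t. indicator {a..b} t * k t)" for a b
    by (rule L2_prod_integrable[OF L2_indicator_Icc is_FT_L2(1)[OF K]])
  \<comment> \<open>The damped convolution is integrable by \<open>conv_integrable\<close>; on a
    bounded interval the damping is undone at the cost of a constant.\<close>
  have cI: "integrable lborel (\<lambda>t. indicator {a..b} t * conv e f t)" for a b
  proof -
    let ?v = "v0 + 1"
    have eI: "integrable lborel (\<lambda>t. e t * of_real (exp (- (?v * t))))"
      using e_int[of ?v] by (subst integrable_norm_iff[symmetric]) (auto simp: norm_mult)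
    have "integrable lborel (conv (\<lambda>t. e t * of_real (exp (- (?v * t)))) (fv ?v))"
      by (rule conv_integrable[OF eI fvI]) (use v0 in simp)
    then have c: "integrable lborel (\<lambda>t. conv e f t * of_real (exp (- (?v * t))))"
    proof -
      have ex: "complex_of_real (exp (- (v * t))) = exp (- of_real v * of_real t)" for v t
        by (simp add: exp_of_real[symmetric])
      assume "integrable lborel (conv (\<lambda>t. e t * of_real (exp (- (?v * t)))) (fv ?v))"
      then show ?thesis unfolding fv_def ex conv_exp .
    qed
    have "integrable lborel (\<lambda>t. (exp (?v * \<bar>b\<bar>)) * cmod (conv e f t * of_real (exp (- (?v * t)))))"
      by (intro integrable_mult_right integrable_norm c)
    then show ?thesis
    proof (rule Bochner_Integration.integrable_bound)
      have "cmod (indicator {a..b} t * conv e f t) \<le> exp (?v * \<bar>b\<bar>) * cmod (conv e f t * of_real (exp (- (?v * t))))" for t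
      proof (cases "t \<in> {a..b}")
        case True
        have "?v * t \<le> ?v * \<bar>b\<bar>" using True v0 by (intro mult_left_mono) auto
        then have "1 \<le> exp (?v * \<bar>b\<bar>) * exp (- (?v * t))" by (simp flip: exp_add)
        then have "cmod (conv e f t) * 1 \<le> cmod (conv e f t) * (exp (?v * \<bar>b\<bar>) * exp (- (?v * t)))"
          by (intro mult_left_mono) auto
        then show ?thesis using True by (simp add: norm_mult mult_ac)
      qed simp
      then show "AE t in lborel. norm (indicator {a..b} t * conv e f t) \<le> norm (exp (?v * \<bar>b\<bar>) * cmod (conv e f t * of_real (exp (- (?v * t)))))"
        by (intro AE_I2) (simp add: abs_mult)
    qed measurable
  qed
  have "AE t in lborel. k t - conv e f t = 0"
  proof (rule AE_zero_if_interval_integrals_zero)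
    show "integrable lborel (\<lambda>t. indicator {a..b} t * (k t - conv e f t))" for a b
      unfolding right_diff_distrib by (intro Bochner_Integration.integrable_diff kI cI)
    show "(\<integral>t. indicator {a..b} t * (k t - conv e f t) \<partial>lborel) = 0" if "a \<le> b" for a b
      unfolding right_diff_distrib using eq[OF that] by (simp add: kI cI)
  qed
  then show ?thesis by eventually_elim simp
qed

end

lemma is_FT_AE_cong_left:
  assumes F: "is_FT c f g" and AE: "AE t in lborel. f t = f' t" and [measurable]: "f' \<in> borel_measurable borel"
  shows "is_FT c f' g"
proof -
  have [measurable]: "f \<in> borel_measurable borel" using F by (auto simp: is_FT_def L2_def)
  have "FT c (trunc R f') = FT c (trunc R f)" for R
  proof
    fix u
    show "FT c (trunc R f') u = FT c (trunc R f) u" unfolding FT_def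
    proof (rule integral_cong_AE)
      show "AE t in lborel. trunc R f' t * cis (c * u * t) = trunc R f t * cis (c * u * t)"
        using AE by eventually_elim (simp add: trunc_def)
    qed (unfold trunc_def, measurable)
  qed
  moreover have "L2 f'" by (rule L2_AE_cong[OF is_FT_L2(1)[OF F] AE]) measurable
  ultimately show ?thesis using F by (simp add: is_FT_def)
qed

section \<open>The logarithmic variable and the Mellin transform\<close>

text \<open>Under \<open>x = e\<^sup>t\<close> the space \<open>L\<^sup>2(0,\<infinity>)\<close> becomes \<open>L\<^sup>2(\<real>)\<close>, the shifted Mellin
  transform the Fourier transform, and multiplicative convolution the additive one.\<close>
definition lg :: "(real \<Rightarrow> complex) \<Rightarrow> real \<Rightarrow> complex" where
  "lg f t = f (exp t) * of_real (exp (t / 2))"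

lemma L2_on_UNIV: "L2_on UNIV g \<longleftrightarrow> L2 g"
  by (simp add: L2_on_def L2_def set_borel_measurable_def set_integrable_def)

lemma lg_inverse: "x > 0 \<Longrightarrow> f x = lg f (ln x) * of_real (exp (- ln x / 2))"
  by (simp add: lg_def flip: of_real_mult exp_add)

lemma lg_surj: "lg (\<lambda>x. b (ln x) * of_real (exp (- ln x / 2))) = b"
  by (rule ext) (simp add: lg_def flip: of_real_mult exp_add)

text \<open>\<open>L2_on\<close> asks for measurability on the half line only; this equivalence
  translates it to Borel measurability on the whole line.\<close>

lemma lg_measurable_iff:
  "lg f \<in> borel_measurable borel \<longleftrightarrow> (\<lambda>x. indicator {0<..} x *\<^sub>R f x) \<in> borel_measurable borel"
proof
  assume [measurable]: "lg f \<in> borel_measurable borel"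
  have "(\<lambda>x. indicator {0<..} x *\<^sub>R f x) = (\<lambda>x. indicator {0<..} x *\<^sub>R (lg f (ln x) * of_real (exp (- ln x / 2))))"
  proof
    fix x
    show "indicator {0<..} x *\<^sub>R f x = indicator {0<..} x *\<^sub>R (lg f (ln x) * of_real (exp (- ln x / 2)))"
      using lg_inverse[of x f] by (cases "x > 0") simp_all
  qed
  then show "(\<lambda>x. indicator {0<..} x *\<^sub>R f x) \<in> borel_measurable borel" by simp
next
  assume m: "(\<lambda>x. indicator {0<..} x *\<^sub>R f x) \<in> borel_measurable borel"
  have "(\<lambda>t. indicator {0<..} (exp t) *\<^sub>R f (exp t) * of_real (exp (t / 2))) \<in> borel_measurable borel"
    by (intro borel_measurable_times measurable_compose[OF _ m]) measurable
  then show "lg f \<in> borel_measurable borel" by (simp add: lg_def[abs_def])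
qed

lemma
  assumes m: "lg f \<in> borel_measurable borel"
  shows set_integral_lg: "(\<integral>x\<in>{0<..}. (cmod (f x))\<^sup>2 \<partial>lborel) = nsq (lg f)"
    and set_integrable_lg: "set_integrable lborel {0<..} (\<lambda>x. (cmod (f x))\<^sup>2) \<longleftrightarrow> integrable lborel (\<lambda>t. (cmod (lg f t))\<^sup>2)"
proof -
  let ?F = "\<lambda>x. indicator {0<..} x *\<^sub>R f x"
  have [measurable]: "?F \<in> borel_measurable borel" using m lg_measurable_iff by blast
  have 1: "(\<lambda>x. indicator {0<..} x *\<^sub>R (cmod (f x))\<^sup>2) = (\<lambda>x. indicator {0<..} x *\<^sub>R (cmod (?F x))\<^sup>2)"
    by (auto simp: indicator_def)
  have 2: "exp t *\<^sub>R (cmod (?F (exp t)))\<^sup>2 = (cmod (lg f t))\<^sup>2" for t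
  proof -
    have "(exp (t / 2))\<^sup>2 = exp t" by (simp add: power2_eq_square flip: exp_add)
    then show ?thesis by (simp add: lg_def norm_mult power_mult_distrib)
  qed
  show "(\<integral>x\<in>{0<..}. (cmod (f x))\<^sup>2 \<partial>lborel) = nsq (lg f)"
    unfolding set_lebesgue_integral_def 1 nsq_def
    by (subst integral_exp_subst) (measurable, simp only: 2)
  show "set_integrable lborel {0<..} (\<lambda>x. (cmod (f x))\<^sup>2) \<longleftrightarrow> integrable lborel (\<lambda>t. (cmod (lg f t))\<^sup>2)"
    unfolding set_integrable_def 1
    by (subst integrable_exp_subst) (measurable, simp only: 2)
qed

lemma L2_on_lg: "L2_on {0<..} f \<longleftrightarrow> L2 (lg f)"
proof (cases "lg f \<in> borel_measurable borel")
  case True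
  then have "set_borel_measurable lborel {0<..} f" using lg_measurable_iff by (simp add: set_borel_measurable_def)
  then show ?thesis using True set_integrable_lg[OF True] by (simp add: L2_on_def L2_def)
next
  case False
  then have "\<not> set_borel_measurable lborel {0<..} f" using lg_measurable_iff by (simp add: set_borel_measurable_def)
  then show ?thesis using False by (simp add: L2_on_def L2_def)
qed

lemma exp_powr_complex: "complex_of_real (exp t) powr s = exp (s * of_real t)"
  by (simp add: powr_def Ln_of_real)

lemma mellin_trunc:
  assumes m: "lg f \<in> borel_measurable borel" and R: "R > 0"
  shows "(\<integral>x\<in>{1/R..R}. f x * (of_real x) powr (1/2 + \<i> * of_real u) / of_real x \<partial>lborel) = FT 1 (trunc (ln R) (lg f)) u"
proof -
  let ?F = "\<lambda>x. indicator {0<..} x *\<^sub>R f x"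
  let ?s = "1/2 + \<i> * complex_of_real u"
  let ?I = "\<lambda>x. indicator {1/R..R} x *\<^sub>R (?F x * exp (?s * of_real (ln x)) / of_real x)"
  have [measurable]: "?F \<in> borel_measurable borel" using m lg_measurable_iff by blast
  have "(\<lambda>x. indicator {1/R..R} x *\<^sub>R (f x * (of_real x) powr ?s / of_real x)) = (\<lambda>x. indicator {0<..} x *\<^sub>R ?I x)"
  proof
    fix x
    show "indicator {1/R..R} x *\<^sub>R (f x * (of_real x) powr ?s / of_real x) = indicator {0<..} x *\<^sub>R ?I x"
    proof (cases "x > 0")
      case True
      then show ?thesis using exp_powr_complex[of "ln x" ?s] by simp
    next
      case False
      have "1 / R > 0" using R by simp
      then have "x \<notin> {1/R..R}" using False by (metis atLeastAtMost_iff less_le_trans)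
      then show ?thesis by simp
    qed
  qed
  then have "(\<integral>x\<in>{1/R..R}. f x * (of_real x) powr ?s / of_real x \<partial>lborel) = (\<integral>x. indicator {0<..} x *\<^sub>R ?I x \<partial>lborel)"
    unfolding set_lebesgue_integral_def by simp
  also have "\<dots> = (\<integral>r. exp r *\<^sub>R ?I (exp r) \<partial>lborel)"
    by (rule integral_exp_subst) measurable
  also have "\<dots> = FT 1 (trunc (ln R) (lg f)) u"
    unfolding FT_def
  proof (rule Bochner_Integration.integral_cong[OF refl])
    fix r :: real
    have ind: "indicator {1/R..R} (exp r) = (indicator {- ln R..ln R} r :: real)"
    proof -
      have "exp r \<le> R \<longleftrightarrow> r \<le> ln R" using R by (metis exp_le_cancel_iff exp_ln)
      moreover have "1 / R \<le> exp r \<longleftrightarrow> - ln R \<le> r"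
        using R by (metis exp_le_cancel_iff exp_ln exp_minus inverse_eq_divide)
      ultimately show ?thesis by (simp add: indicator_def)
    qed
    have e: "exp (?s * of_real r) = of_real (exp (r / 2)) * cis (1 * u * r)"
      by (simp add: cis_conv_exp exp_of_real[symmetric] algebra_simps flip: exp_add)
    show "exp r *\<^sub>R ?I (exp r) = trunc (ln R) (lg f) r * cis (1 * u * r)"
      unfolding ind ln_exp e by (simp add: trunc_def lg_def scaleR_conv_of_real mult_ac indicator_def)
  qed
  finally show ?thesis .
qed

lemma tendsto_compose_ln:
  fixes N :: "real \<Rightarrow> real"
  shows "((\<lambda>R. N (ln R)) \<longlongrightarrow> (l::real)) at_top \<longleftrightarrow> (N \<longlongrightarrow> l) at_top"
proof
  assume "((\<lambda>R. N (ln R)) \<longlongrightarrow> l) at_top"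
  from filterlim_compose[OF this exp_at_top] show "(N \<longlongrightarrow> l) at_top" by simp
next
  assume "(N \<longlongrightarrow> l) at_top"
  from filterlim_compose[OF this ln_at_top] show "((\<lambda>R. N (ln R)) \<longlongrightarrow> l) at_top" .
qed

lemma mellin_L2_iff: "mellin_L2 f g \<longleftrightarrow> is_FT 1 (lg f) g"
proof (cases "L2 (lg f)")
  case True
  then have m: "lg f \<in> borel_measurable borel" by (simp add: L2_def)
  let ?J = "\<lambda>R. \<integral>u. (cmod (g u - (\<integral>x\<in>{1/R..R}. f x * (of_real x) powr (1/2 + \<i> * of_real u) / of_real x \<partial>lborel)))\<^sup>2 \<partial>lborel"
  let ?N = "\<lambda>R. nsq (\<lambda>u. g u - FT 1 (trunc R (lg f)) u)"
  have "\<forall>\<^sub>F R in at_top. ?J R = ?N (ln R)"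
    using eventually_gt_at_top[of 0] by eventually_elim (simp add: mellin_trunc[OF m] nsq_def)
  then have "(?J \<longlongrightarrow> 0) at_top \<longleftrightarrow> (?N \<longlongrightarrow> 0) at_top"
    unfolding tendsto_compose_ln[of ?N 0, symmetric] by (rule tendsto_cong)
  then show ?thesis unfolding mellin_L2_def is_FT_def L2_on_lg L2_on_UNIV using True by blast
qed (simp add: mellin_L2_def is_FT_def L2_on_lg)

text \<open>\<open>mellin_inv_L2\<close> puts 1 / (2 pi) on the transform; in \<open>is_FT\<close>
  the constant moves to \<open>lg f\<close>, and the squared norms differ by the fixed factor (2
  pi)^2.\<close>

lemma mellin_inv_L2_iff: "mellin_inv_L2 g f \<longleftrightarrow> is_FT (-1) g (\<lambda>t. of_real (2 * pi) * lg f t)"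
proof (cases "L2 g \<and> L2 (lg f)")
  case True
  then have m [measurable]: "lg f \<in> borel_measurable borel" "g \<in> borel_measurable borel" by (auto simp: L2_def)
  let ?c = "1 / (2 * complex_of_real pi)"
  let ?D = "\<lambda>R x. f x - ?c * (\<integral>u\<in>{-R..R}. g u * (of_real x) powr (- 1/2 - \<i> * of_real u) \<partial>lborel)"
  have lgD: "lg (?D R) = (\<lambda>t. lg f t - ?c * FT (-1) (trunc R g) t)" for R
  proof
    fix t
    have "(\<integral>u\<in>{-R..R}. g u * (of_real (exp t)) powr (- 1/2 - \<i> * of_real u) \<partial>lborel) * of_real (exp (t / 2))
        = FT (-1) (trunc R g) t"
      unfolding FT_def set_lebesgue_integral_def
    proof (subst Bochner_Integration.integral_mult_left_zero[symmetric], rule Bochner_Integration.integral_cong[OF refl])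
      fix u
      have "of_real (exp t) powr (- 1/2 - \<i> * of_real u) * of_real (exp (t / 2)) = cis (- 1 * t * u)"
        unfolding exp_powr_complex unfolding cis_conv_exp exp_of_real[symmetric] by (simp add: algebra_simps flip: exp_add)
      then show "indicator {- R..R} u *\<^sub>R (g u * of_real (exp t) powr (- 1/2 - \<i> * of_real u)) * of_real (exp (t / 2)) = trunc R g u * cis (- 1 * t * u)"
        by (simp only: trunc_def mult.assoc mult_scaleR_left) (simp add: indicator_def)
    qed
    then show "lg (?D R) t = lg f t - ?c * FT (-1) (trunc R g) t" by (simp only: lg_def left_diff_distrib mult.assoc)
  qed
  have mD: "lg (?D R) \<in> borel_measurable borel" for R
    unfolding lgD trunc_def by measurable
  have eq: "nsq (\<lambda>t. of_real (2 * pi) * lg f t - FT (-1) (trunc R g) t) = (2 * pi)\<^sup>2 * (\<integral>x\<in>{0<..}. (cmod (?D R x))\<^sup>2 \<partial>lborel)" for R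
  proof -
    have "(\<lambda>t. of_real (2 * pi) * lg f t - FT (-1) (trunc R g) t) = (\<lambda>t. of_real (2 * pi) * lg (?D R) t)"
      unfolding lgD by (simp add: right_diff_distrib)
    then show ?thesis unfolding set_integral_lg[OF mD] by (simp add: nsq_cmult)
  qed
  have "((\<lambda>R. (2 * pi)\<^sup>2 * (\<integral>x\<in>{0<..}. (cmod (?D R x))\<^sup>2 \<partial>lborel)) \<longlongrightarrow> 0) at_top
      \<longleftrightarrow> ((\<lambda>R. \<integral>x\<in>{0<..}. (cmod (?D R x))\<^sup>2 \<partial>lborel) \<longlongrightarrow> 0) at_top"
    (is "(?a \<longlongrightarrow> 0) at_top \<longleftrightarrow> (?b \<longlongrightarrow> 0) at_top")
    using tendsto_mult_left_iff[of "(2 * pi)\<^sup>2" ?b 0 at_top] by simp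
  moreover have "L2 (\<lambda>t. of_real (2 * pi) * lg f t)" using True by (intro L2_cmult) auto
  ultimately show ?thesis unfolding mellin_inv_L2_def is_FT_def L2_on_lg L2_on_UNIV eq using True by simp
next
  case False
  have "L2 (lg f)" if "L2 (\<lambda>t. of_real (2 * pi) * lg f t)"
    using L2_cmult[OF that, of "1 / of_real (2 * pi)"] by simp
  then show ?thesis using False by (auto simp: mellin_inv_L2_def is_FT_def L2_on_lg L2_on_UNIV)
qed

lemma is_FT_mellin:
  assumes "L2_on {0<..} f" shows "is_FT 1 (lg f) (mellin f)"
proof -
  obtain g where "is_FT 1 (lg f) g" using FT_exists[of 1 "lg f"] assms L2_on_lg by auto
  then have "mellin_L2 f g" by (simp only: mellin_L2_iff)
  then have "mellin_L2 f (mellin f)" unfolding mellin_def by (rule someI[where P="mellin_L2 f"])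
  then show ?thesis by (simp add: mellin_L2_iff)
qed

text \<open>Any transform of g with sign -1, carried back to the half line, shows that the choice
  has a witness. \<open>is_FT_inverse\<close> then turns the relation around.\<close>

lemma is_FT_mellin_inv:
  assumes "L2 g" shows "is_FT 1 (lg (mellin_inv g)) g"
proof -
  obtain b where b: "is_FT (-1) g b" using FT_exists[of "-1" g] assms by auto
  define k where "k x = (of_real (1 / (2 * pi)) * b (ln x)) * of_real (exp (- ln x / 2))" for x
  have "lg k = (\<lambda>t. of_real (1 / (2 * pi)) * b t)"
    unfolding k_def[abs_def] by (rule lg_surj)
  then have "mellin_inv_L2 g k" using b by (simp add: mellin_inv_L2_iff)
  then have "mellin_inv_L2 g (mellin_inv g)" unfolding mellin_inv_def by (rule someI[where P="mellin_inv_L2 g"])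
  then have "is_FT (-1) g (\<lambda>t. of_real (2 * pi) * lg (mellin_inv g) t)" by (simp only: mellin_inv_L2_iff)
  then have "is_FT 1 (\<lambda>t. of_real (2 * pi) * lg (mellin_inv g) t) (\<lambda>t. of_real (2 * pi) * g t)"
    using is_FT_inverse[of "-1"] by simp
  from is_FT_cmult[OF this, of "of_real (1 / (2 * pi))"] show ?thesis by simp
qed

text \<open>The measure dy / y becomes ds, and the weight e^(t/2) of \<open>lg\<close> splits as
  e^((t-s)/2) e^(s/2) between the two factors.\<close>

lemma lg_mconv:
  assumes [measurable]: "h \<in> borel_measurable borel" and m: "lg f \<in> borel_measurable borel"
  shows "lg (mconv h f) = conv (lg (\<lambda>x. of_real (h x))) (lg f)"
proof
  fix t
  let ?F = "\<lambda>x. indicator {0<..} x *\<^sub>R f x"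
  let ?I = "\<lambda>y. of_real (h (exp t / y)) * ?F y / of_real y"
  have [measurable]: "?F \<in> borel_measurable borel" using m lg_measurable_iff by blast
  have "mconv h f (exp t) = (\<integral>y. indicator {0<..} y *\<^sub>R ?I y \<partial>lborel)"
    unfolding mconv_def set_lebesgue_integral_def
    by (rule Bochner_Integration.integral_cong) (auto simp: indicator_def)
  also have "\<dots> = (\<integral>r. exp r *\<^sub>R ?I (exp r) \<partial>lborel)"
    by (rule integral_exp_subst) measurable
  finally have "lg (mconv h f) t = (\<integral>r. exp r *\<^sub>R ?I (exp r) * of_real (exp (t / 2)) \<partial>lborel)"
    unfolding lg_def by (simp only: Bochner_Integration.integral_mult_left_zero)
  also have "\<dots> = conv (lg (\<lambda>x. of_real (h x))) (lg f) t"
    unfolding conv_def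
  proof (rule Bochner_Integration.integral_cong[OF refl])
    fix r
    have "exp (t / 2) = exp ((t - r) / 2) * exp (r / 2)" by (simp add: diff_divide_distrib flip: exp_add)
    then show "exp r *\<^sub>R ?I (exp r) * of_real (exp (t / 2)) = lg (\<lambda>x. of_real (h x)) (t - r) * lg f r"
      by (simp add: lg_def exp_diff scaleR_conv_of_real)
  qed
  finally show "lg (mconv h f) t = conv (lg (\<lambda>x. of_real (h x))) (lg f) t" .
qed

lemma AE_lg_iff:
  assumes [measurable]: "lg p \<in> borel_measurable borel" "lg q \<in> borel_measurable borel"
  shows "(AE x in lborel. 0 < x \<longrightarrow> p x = q x) \<longleftrightarrow> (AE t in lborel. lg p t = lg q t)"
proof -
  have "(AE x in lborel. 0 < x \<longrightarrow> p x = q x) \<longleftrightarrow> (AE x in lborel. 0 < x \<longrightarrow> lg p (ln x) = lg q (ln x))"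
    by (rule AE_cong) (auto simp: lg_def)
  also have "\<dots> \<longleftrightarrow> (AE t in lborel. lg p (ln (exp t)) = lg q (ln (exp t)))"
    by (rule AE_exp_subst) measurable
  finally show ?thesis by simp
qed

lemma lg_supp:
  assumes "\<forall>x\<in>{0<..1}. f x = 0" "t \<le> 0" shows "lg f t = 0"
  using assms by (simp add: lg_def)

section \<open>The xi quotient and the three conditions\<close>

definition test_fun :: "real \<Rightarrow> complex" where
  "test_fun x = (if x > 1 then of_real (x powr (- 3 / 2)) else 0)"

lemma lg_test_fun: "lg test_fun = ehalf"
proof
  fix t :: real
  have "exp t powr (- 3 / 2) * exp (t / 2) = exp (- t)" by (simp add: powr_def flip: exp_add)
  then have "complex_of_real (exp t powr (- 3 / 2)) * of_real (exp (t / 2)) = exp (- of_real t)"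
    by (metis exp_of_real of_real_minus of_real_mult)
  then show "lg test_fun t = ehalf t" by (simp add: lg_def test_fun_def ehalf_def indicator_def)
qed

lemma test_fun_L2: "L2_on {0<..} test_fun"
  by (simp add: L2_on_lg lg_test_fun L2_ehalf)

definition xi_num :: "real \<Rightarrow> complex \<Rightarrow> complex" where
  "xi_num \<omega> z = riemann_xi (1/2 - of_real \<omega> - \<i> * z)"

definition xi_den :: "real \<Rightarrow> complex \<Rightarrow> complex" where
  "xi_den \<omega> z = riemann_xi (1/2 + of_real \<omega> - \<i> * z)"

interpretation xi: unimodular_quotient "xi_num \<omega>" "xi_den \<omega>" "Theta \<omega>" for \<omega>
proof
  have hol: "(\<lambda>z. riemann_xi (c - \<i> * z)) holomorphic_on UNIV" for c
    unfolding riemann_xi_eq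
    by (rule holomorphic_on_compose_gen[OF _ xi_rep_holomorphic, unfolded o_def]) (auto intro!: holomorphic_intros)
  show "xi_num \<omega> holomorphic_on UNIV" "xi_den \<omega> holomorphic_on UNIV"
    using hol by (simp_all add: xi_num_def[abs_def] xi_den_def[abs_def])
  \<comment> \<open>A point where \<open>xi_den\<close> is nonzero: at z = i (3/2 - \<omega>) the
    argument of xi is 2, where the zeta series is positive.\<close>
  have "zeta_real 2 > 0" unfolding zeta_real_def by (rule suminf_pos[OF summable_zeta_real]) auto
  then have "xi_rep (of_real 2) \<noteq> 0" by (subst xi_rep_real) (simp_all del: of_real_numeral)
  moreover have "1/2 + of_real \<omega> - \<i> * (\<i> * of_real (3/2 - \<omega>)) = complex_of_real 2" by (simp add: complex_eq_iff)
  ultimately show "\<exists>z. xi_den \<omega> z \<noteq> 0" unfolding xi_den_def riemann_xi_eq by metis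
  \<comment> \<open>For real u the reflection s -> 1 - s sends the argument of the numerator to the
    conjugate of that of the denominator, so the functional equation and the conjugation symmetry
    give equal moduli.\<close>
  show "cmod (xi_num \<omega> (of_real u)) = cmod (xi_den \<omega> (of_real u))" for u
  proof -
    have "xi_rep (1/2 - of_real \<omega> - \<i> * of_real u) = xi_rep (1 - (1/2 - of_real \<omega> - \<i> * of_real u))"
      by (rule xi_rep_reflect[symmetric])
    also have "1 - (1/2 - of_real \<omega> - \<i> * of_real u) = cnj (1/2 + of_real \<omega> - \<i> * of_real u)"
      by (simp add: complex_eq_iff)
    finally show ?thesis by (simp add: xi_num_def xi_den_def riemann_xi_eq xi_rep_cnj del: complex_cnj_diff complex_cnj_add)
  qed
  show "Theta \<omega> z = xi_num \<omega> z / xi_den \<omega> z" for z by (simp add: Theta_def xi_num_def xi_den_def)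
qed

definition h_log :: "real \<Rightarrow> real \<Rightarrow> complex" where
  "h_log \<omega> = lg (\<lambda>x. of_real (h_fun \<omega> x))"

lemma h_log_measurable [measurable]: "h_log \<omega> \<in> borel_measurable borel"
  unfolding h_log_def lg_def[abs_def] by measurable

lemma h_log_supp: "t \<le> 0 \<Longrightarrow> h_log \<omega> t = 0"
  by (simp add: h_log_def lg_def h_fun_def)

context
  fixes \<omega> :: real
  assumes \<omega>: "\<omega> > 0"
begin

text \<open>With s = 1/2 + v, the range s > 1 + \<omega> of \<open>h_fun_Mellin\<close> is v > 1/2 +
  \<omega>; the 1/2 comes from the weight e^(t/2) in \<open>lg\<close>.\<close>

lemma h_log_integrable:
  assumes "v > 1/2 + \<omega>" shows "integrable lborel (\<lambda>t. cmod (h_log \<omega> t) * exp (- (v * t)))"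
proof -
  have "integrable lborel (\<lambda>t. h_fun \<omega> (exp t) * exp (t * (1 - (1/2 + v))))"
    by (rule h_fun_Mellin(1)[OF \<omega>]) (use assms in simp)
  then have "integrable lborel (\<lambda>t. norm (h_fun \<omega> (exp t) * exp (t * (1 - (1/2 + v)))))" by (rule integrable_norm)
  moreover have "norm (h_fun \<omega> (exp t) * exp (t * (1 - (1/2 + v)))) = cmod (h_log \<omega> t) * exp (- (v * t))" for t
  proof -
    have "exp (t * (1 - (1/2 + v))) = exp (t / 2) * exp (- (v * t))" by (simp add: algebra_simps flip: exp_add)
    then show ?thesis by (simp add: h_log_def lg_def norm_mult abs_mult)
  qed
  ultimately show ?thesis by simp
qed

lemma h_log_LT_integrable:
  assumes "Im z > 1/2 + \<omega>" shows "integrable lborel (\<lambda>t. h_log \<omega> t * exp (\<i> * z * of_real t))"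
  using h_log_integrable[OF assms] by (subst integrable_norm_iff[symmetric]) (auto simp: norm_mult)

text \<open>On the imaginary axis z = i x the variable s = 1/2 + x of xi is real, and
  \<open>xi_ratio_real\<close> applies. The identity theorem extends the relation to the half plane
  where the Laplace integral converges absolutely.\<close>

lemma xi_num_eq_LT:
  assumes "Im z > 1/2 + \<omega>" shows "xi_num \<omega> z = xi_den \<omega> z * LT (h_log \<omega>) z"
proof (rule identity_on_ray[where f="xi_num \<omega>" and g="\<lambda>z. xi_den \<omega> z * LT (h_log \<omega>) z" and
    S="{z. Im z > 1/2 + \<omega>}" and d="\<i>" and a="1/2 + \<omega>"])
  show "xi_num \<omega> holomorphic_on {z. Im z > 1/2 + \<omega>}" using xi.A_hol holomorphic_on_subset by blast
  show "(\<lambda>z. xi_den \<omega> z * LT (h_log \<omega>) z) holomorphic_on {z. Im z > 1/2 + \<omega>}"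
    by (intro holomorphic_on_mult holomorphic_on_subset[OF xi.B_hol]
        LT_holomorphic_general[OF h_log_measurable h_log_supp h_log_integrable]) auto
  fix x :: real assume x: "x > 1/2 + \<omega>"
  have z1: "1/2 - of_real \<omega> - \<i> * (of_real x * \<i>) = complex_of_real ((1/2 + x) - \<omega>)"
    and z2: "1/2 + of_real \<omega> - \<i> * (of_real x * \<i>) = complex_of_real ((1/2 + x) + \<omega>)"
    by (simp_all add: complex_eq_iff)
  have "LT (h_log \<omega>) (of_real x * \<i>) = (\<integral>t. complex_of_real (h_fun \<omega> (exp t) * exp (t * (1 - (1/2 + x)))) \<partial>lborel)"
    unfolding LT_def
  proof (rule Bochner_Integration.integral_cong[OF refl])
    fix t
    have "\<i> * (of_real x * \<i>) * of_real t = complex_of_real (- (x * t))" by (simp add: complex_eq_iff)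
    then have "exp (\<i> * (of_real x * \<i>) * of_real t) = complex_of_real (exp (- (x * t)))" by (simp only: exp_of_real)
    moreover have "exp (t * (1 - (1/2 + x))) = exp (t / 2) * exp (- (x * t))" by (simp add: algebra_simps flip: exp_add)
    ultimately show "h_log \<omega> t * exp (\<i> * (of_real x * \<i>) * of_real t) = of_real (h_fun \<omega> (exp t) * exp (t * (1 - (1/2 + x))))"
      by (simp only: h_log_def lg_def of_real_mult mult.assoc)
  qed
  also have "\<dots> = of_real (\<integral>t. h_fun \<omega> (exp t) * exp (t * (1 - (1/2 + x))) \<partial>lborel)" by (rule integral_complex_of_real)
  finally have L: "LT (h_log \<omega>) (of_real x * \<i>) = of_real (\<integral>t. h_fun \<omega> (exp t) * exp (t * (1 - (1/2 + x))) \<partial>lborel)" .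
  show "of_real x * \<i> \<in> {z. Im z > 1/2 + \<omega>} \<and> xi_num \<omega> (of_real x * \<i>) = xi_den \<omega> (of_real x * \<i>) * LT (h_log \<omega>) (of_real x * \<i>)"
    unfolding L xi_num_def xi_den_def riemann_xi_eq z1 z2 using xi_ratio_real[OF \<omega>, of "1/2 + x"] x by simp
qed (use assms in \<open>auto intro!: open_halfspace_Im_gt convex_connected convex_halfspace_Im_gt\<close>)

text \<open>\<open>Theta\<close> and its continuous version \<open>T\<close> differ on the real line
  at most at the countably many zeros of \<open>xi_den\<close>, so the multiplier may be exchanged
  under \<open>is_FT\<close>.\<close>

lemma is_FT_Theta_hat:
  assumes f: "L2_on {0<..} f"
  shows "is_FT 1 (lg (Theta_hat \<omega> f)) (\<lambda>u. xi.T \<omega> (of_real u) * mellin f u)"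
proof -
  let ?G = "\<lambda>u. Theta \<omega> (of_real u) * mellin f u" and ?H = "\<lambda>u. xi.T \<omega> (of_real u) * mellin f u"
  have gL: "L2 (mellin f)" by (rule is_FT_L2(2)[OF is_FT_mellin[OF f]])
  then have [measurable]: "mellin f \<in> borel_measurable borel" by (simp add: L2_def)
  have hol: "(\<lambda>u. F (complex_of_real u)) \<in> borel_measurable borel" if "F holomorphic_on UNIV" for F
    by (rule borel_measurable_continuous_onI, rule continuous_on_compose2[OF holomorphic_on_imp_continuous_on[OF that]])
       (auto intro!: continuous_intros)
  note [measurable] = hol[OF xi.A_hol[of \<omega>]] hol[OF xi.B_hol[of \<omega>]]
  have Hm: "?H \<in> borel_measurable borel" by measurable
  have HL: "L2 ?H" by (rule L2_bound[OF gL Hm, where C=1]) (simp add: norm_mult xi.T_real)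
  have eq: "AE u in lborel. ?G u = ?H u" using xi.AE_T_eq[of \<omega>] by eventually_elim simp
  have "L2 ?G"
  proof (rule L2_AE_cong[OF HL])
    show "AE u in lborel. ?H u = ?G u" using eq by eventually_elim (simp only:)
    show "?G \<in> borel_measurable borel" unfolding xi.\<Theta>_eq by measurable
  qed
  then have "is_FT 1 (lg (Theta_hat \<omega> f)) ?G" unfolding Theta_hat_def by (rule is_FT_mellin_inv)
  then show ?thesis by (rule is_FT_AE_cong[OF _ eq Hm])
qed

lemma lg_mconv_h: "L2_on {0<..} f \<Longrightarrow> lg (mconv (h_fun \<omega>) f) = conv (h_log \<omega>) (lg f)"
  unfolding h_log_def by (rule lg_mconv) (simp_all add: L2_on_lg L2_def)

lemma lg_mconv_h_measurable: "L2_on {0<..} f \<Longrightarrow> lg (mconv (h_fun \<omega>) f) \<in> borel_measurable borel"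
  unfolding lg_mconv_h by (rule conv_measurable) (simp_all add: L2_on_lg L2_def)

lemma Theta_hat_measurable: "L2_on {0<..} f \<Longrightarrow> lg (Theta_hat \<omega> f) \<in> borel_measurable borel"
  using is_FT_L2(1)[OF is_FT_Theta_hat] by (simp add: L2_def)

lemma Theta_hat_eq_mconv:
  assumes inner: "meromorphic_inner (Theta \<omega>)" and f: "L2_on {0<..} f" and supp: "\<forall>x\<in>{0<..1}. f x = 0"
  shows "AE x in lborel. 0 < x \<longrightarrow> Theta_hat \<omega> f x = mconv (h_fun \<omega>) f x"
  unfolding AE_lg_iff[OF Theta_hat_measurable[OF f] lg_mconv_h_measurable[OF f]] lg_mconv_h[OF f]
proof (rule xi.inner_imp_conv[OF inner h_log_measurable h_log_supp _ h_log_integrable xi_num_eq_LT])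
  show "L2 (lg f)" using f by (simp add: L2_on_lg)
  show "is_FT 1 (lg f) (mellin f)" by (rule is_FT_mellin[OF f])
  show "is_FT 1 (lg (Theta_hat \<omega> f)) (\<lambda>u. xi.T \<omega> (of_real u) * mellin f u)" by (rule is_FT_Theta_hat[OF f])
  show "lg f t = 0" if "t \<le> 0" for t by (rule lg_supp[OF supp that])
qed (use \<omega> in auto)

lemma inner_if_vanishing:
  assumes van: "AE x in lborel. 0 < x \<and> x < 1 \<longrightarrow> Theta_hat \<omega> test_fun x = 0"
  shows "meromorphic_inner (Theta \<omega>)"
proof -
  let ?k = "Theta_hat \<omega> test_fun"
  \<comment> \<open>The hypothesis leaves a null set and x = 1 open, whereas the half plane lemmas
    require vanishing at every t <= 0; q is a representative with that property.\<close>
  define q where "q x = (if x \<le> 1 then 0 else ?k x)" for x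
  have km [measurable]: "lg ?k \<in> borel_measurable borel" by (rule Theta_hat_measurable[OF test_fun_L2])
  have lq: "lg q = (\<lambda>t. if t \<le> 0 then 0 else lg ?k t)" by (rule ext) (simp add: lg_def q_def)
  have qm: "lg q \<in> borel_measurable borel" unfolding lq by measurable
  have "AE x in lborel. x \<noteq> (1::real)" by (rule AE_lborel_singleton)
  with van have "AE x in lborel. 0 < x \<longrightarrow> ?k x = q x"
    by eventually_elim (auto simp: q_def)
  then have kq: "AE t in lborel. lg ?k t = lg q t" using AE_lg_iff[OF km qm] by simp
  have "AE u in lborel. mellin test_fun u = FT 1 ehalf u"
    by (rule is_FT_unique[OF _ is_FT_mellin[OF test_fun_L2, unfolded lg_test_fun]
          is_FT_integrable[OF _ L2_ehalf integrable_ehalf]]) auto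
  then have "AE u in lborel. xi.T \<omega> (of_real u) * mellin test_fun u = xi.T \<omega> (of_real u) / (1 - \<i> * of_real u)"
    by eventually_elim (simp add: FT_ehalf)
  then have "is_FT 1 (lg ?k) (\<lambda>u. xi.T \<omega> (of_real u) / (1 - \<i> * of_real u))"
    by (rule is_FT_AE_cong[OF is_FT_Theta_hat[OF test_fun_L2]]) measurable
  then have F: "is_FT 1 (lg q) (\<lambda>u. xi.T \<omega> (of_real u) / (1 - \<i> * of_real u))"
    by (rule is_FT_AE_cong_left[OF _ kq qm])
  have supp: "lg q t = 0" if "t \<le> 0" for t using that by (simp add: lq)
  show ?thesis
    by (rule xi.inner_if_LT[OF is_FT_L2(1)[OF F] supp xi.analytic_extension_agrees[OF is_FT_L2(1)[OF F] supp F]])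
qed

text \<open>The convolution theorem gives the factorization only for Im z > 1/2 + \<omega>.
  Square-integrability makes the Laplace transform of the convolution holomorphic on the whole upper
  half plane, so the product identity, with entire factors, spreads to all of it.\<close>

lemma inner_if_mconv_L2:
  assumes L: "L2_on {0<..} (mconv (h_fun \<omega>) test_fun)"
  shows "meromorphic_inner (Theta \<omega>)"
proof -
  let ?k = "conv (h_log \<omega>) ehalf"
  have kL: "L2 ?k" using L unfolding L2_on_lg lg_mconv_h[OF test_fun_L2] lg_test_fun .
  have supp: "?k t = 0" if "t \<le> 0" for t
  proof -
    have "h_log \<omega> (t - s) * ehalf s = 0" for s
      using that h_log_supp[of "t - s" \<omega>] by (cases "s > 0") (auto simp: ehalf_def)
    then show ?thesis unfolding conv_def by (simp only:) simp
  qed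
  have far: "xi_num \<omega> z = xi_den \<omega> z * ((1 - \<i> * z) * LT ?k z)" if z: "Im z > 1/2 + \<omega>" for z
  proof -
    have z0: "Im z > 0" using z \<omega> by simp
    have "integrable lborel (\<lambda>t. ehalf t * exp (\<i> * z * of_real t))"
      by (rule LT_integrable[OF L2_ehalf _ z0]) (simp add: ehalf_def)
    then have "LT ?k z = LT (h_log \<omega>) z * (1 / (1 - \<i> * z))"
      using conv_LT[OF h_log_LT_integrable[OF z]] LT_ehalf[of z] z0 by simp
    moreover have "1 - \<i> * z \<noteq> 0" using z0 by (auto simp: complex_eq_iff)
    ultimately show ?thesis using xi_num_eq_LT[OF z] by simp
  qed
  show ?thesis
  proof (rule xi.inner_if_LT[OF kL supp])
    fix z assume z: "Im z > 0"
    let ?g = "\<lambda>z. xi_den \<omega> z * ((1 - \<i> * z) * LT ?k z)"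
    show "xi_num \<omega> z = ?g z"
    proof (rule analytic_continuation_open[where f="xi_num \<omega>" and g="?g" and s="{z. Im z > 1/2 + \<omega>}" and s'="{z. Im z > 0}"])
      show "open {z. Im z > 1/2 + \<omega>}" "open {z. Im z > 0}" by (rule open_halfspace_Im_gt)+
      show "{z. Im z > 1/2 + \<omega>} \<noteq> {}" by (auto intro!: exI[of _ "\<i> * of_real (1 + \<omega>)"])
      show "connected {z. Im z > 0}" by (rule convex_connected[OF convex_halfspace_Im_gt])
      show "xi_num \<omega> holomorphic_on {z. Im z > 0}" using xi.A_hol holomorphic_on_subset by blast
      show "?g holomorphic_on {z. Im z > 0}"
        by (intro holomorphic_intros holomorphic_on_subset[OF xi.B_hol] LT_holomorphic[OF kL supp]) auto
    qed (use z \<omega> far in auto)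
  qed
qed

text \<open>For x < 1 < y the quotient x / y lies below 1, where \<open>h_fun\<close> is 0.\<close>

lemma mconv_h_vanishing:
  assumes supp: "\<forall>x\<in>{0<..1}. f x = 0" and x: "0 < x" "x < 1"
  shows "mconv (h_fun \<omega>) f x = 0"
proof -
  have "indicator {0<..} y *\<^sub>R (of_real (h_fun \<omega> (x / y)) * f y / of_real y) = 0" for y
    using supp x by (cases "y > 1") (auto simp: h_fun_def indicator_def)
  then show ?thesis unfolding mconv_def set_lebesgue_integral_def by (simp only:) simp
qed

end

theorem theorem2p2:
  fixes \<omega> :: real
  assumes "0 < \<omega>"
  shows "(meromorphic_inner (Theta \<omega>) \<longleftrightarrow>
            (\<forall>f. L2_on {0<..} f \<and> (\<forall>x\<in>{0<..1}. f x = 0) \<longrightarrow>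
               (AE x in lborel. 0 < x \<longrightarrow> Theta_hat \<omega> f x = mconv (h_fun \<omega>) f x)))
       \<and> (meromorphic_inner (Theta \<omega>) \<longleftrightarrow>
            (\<forall>f. L2_on {0<..} f \<and> (\<forall>x\<in>{0<..1}. f x = 0) \<longrightarrow>
               (AE x in lborel. 0 < x \<and> x < 1 \<longrightarrow> Theta_hat \<omega> f x = 0)))
       \<and> (meromorphic_inner (Theta \<omega>) \<longleftrightarrow>
            (\<forall>f. L2_on {0<..} f \<and> (\<forall>x\<in>{0<..1}. f x = 0) \<longrightarrow>
               L2_on {0<..} (mconv (h_fun \<omega>) f)))"
    (is "(?inner \<longleftrightarrow> ?P1) \<and> (?inner \<longleftrightarrow> ?P2) \<and> (?inner \<longleftrightarrow> ?P3)")
proof -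
  have test: "L2_on {0<..} test_fun \<and> (\<forall>x\<in>{0<..1}. test_fun x = 0)"
    using test_fun_L2 by (simp add: test_fun_def)
  have "?P1" if "?inner" using Theta_hat_eq_mconv[OF assms that] by blast
  moreover have "?P2" if P1: "?P1"
  proof (intro allI impI)
    fix f assume f: "L2_on {0<..} f \<and> (\<forall>x\<in>{0<..1}. f x = 0)"
    with P1 have "AE x in lborel. 0 < x \<longrightarrow> Theta_hat \<omega> f x = mconv (h_fun \<omega>) f x" by blast
    then show "AE x in lborel. 0 < x \<and> x < 1 \<longrightarrow> Theta_hat \<omega> f x = 0"
    proof eventually_elim
      case (elim x)
      then show ?case using mconv_h_vanishing[OF assms, of f x] f by auto
    qed
  qed
  moreover have "?P3" if P1: "?P1"
  proof (intro allI impI)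
    fix f assume f: "L2_on {0<..} f \<and> (\<forall>x\<in>{0<..1}. f x = 0)"
    then have fL: "L2_on {0<..} f" by blast
    from f P1 have "AE x in lborel. 0 < x \<longrightarrow> Theta_hat \<omega> f x = mconv (h_fun \<omega>) f x" by blast
    then have "AE t in lborel. lg (Theta_hat \<omega> f) t = lg (mconv (h_fun \<omega>) f) t"
      using AE_lg_iff[OF Theta_hat_measurable[OF assms fL] lg_mconv_h_measurable[OF assms fL]] by simp
    then show "L2_on {0<..} (mconv (h_fun \<omega>) f)" unfolding L2_on_lg
      by (rule L2_AE_cong[OF is_FT_L2(1)[OF is_FT_Theta_hat[OF assms fL]] _ lg_mconv_h_measurable[OF assms fL]])
  qed
  moreover have "?inner" if P2: "?P2" using inner_if_vanishing[OF assms] P2 test by blast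
  moreover have "?inner" if P3: "?P3" using inner_if_mconv_L2[OF assms] P3 test by blast
  ultimately show ?thesis by blast
qed

end
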